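(* Let $\Omega \subset \mathbb{R}^n$ be a bounded open set with finite perimeter and let $\Omega^\sharp$ be the ball centered at the origin with $|\Omega^\sharp| = |\Omega|$. Let $u \in \mathrm{BV}_0(\Omega)$ be a non-negative function, and let $u^\star$ be the radial, radially decreasing function in $W^{1,1}(\Omega^\sharp)\cap \mathrm{BV}_0(\Omega^\sharp)\cap L^\infty(\Omega^\sharp)$ satisfying $$\begin{cases} |\nabla u^\star|(x) = |\nabla^a u|_\sharp(x) & \text{for a.e. } x \in \Omega^\sharp,\\[1ex] u^\star(x) = \dfrac{1}{\mathrm{Per}(\Omega^\sharp)}\,|D^s u|(\mathbb{R}^n) & \text{on } \partial\Omega^\sharp. \end{cases}$$ Then $$\|u\|_{L^1(\Omega)} \le \|u^\star\|_{L^1(\Omega^\sharp)}.$$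
   Context: $|E|$ denotes the $n$-dimensional Lebesgue measure of $E$; $\omega_n$ is the measure of the unit ball of $\mathbb{R}^n$; $\mathrm{Per}(E) = |D\chi_E|(\mathbb{R}^n)$ is the perimeter of $E$, and $E$ has finite perimeter if $\chi_E\in \mathrm{BV}(\mathbb{R}^n)$. For a bounded open set $\Omega$ with finite perimeter, $\mathrm{BV}_0(\Omega) := \{u \in \mathrm{BV}(\mathbb{R}^n) : u \equiv 0 \text{ in } \mathbb{R}^n\setminus\Omega\}$. For $u\in \mathrm{BV}(\mathbb{R}^n)$, the distributional derivative decomposes (Lebesgue decomposition) as $Du = \nabla^a u\,\mathcal{L}^n + D^s u$, where $\nabla^a u \in L^1(\mathbb{R}^n;\mathbb{R}^n)$ is the density of the absolutely continuous part and $D^s u \perp \mathcal{L}^n$ is the singular part; $|D^s u|$ is the total variation measure of $D^s u$. (All measures are on the whole of $\mathbb{R}^n$, so $D^s u$ includes any part concentrated on $\partial\Omega$.) Rearrangements: for a measurable $h:\Omega\to\mathbb{R}$, the distribution function is $\mu_h(t) = |\{x\in\Omega : |h(x)|>t\}|$, $t\ge 0$; the decreasing rearrangement is $h^*(s) = \inf\{t>0 : \mu_h(t)\le s\}$, $s \ge 0$; the increasing rearrangement is $h_*(s) = h^*(|\Omega|-s)$, $s\in[0,|\Omega|]$; and the spherically symmetric increasing rearrangement is $h_\sharp(x) = h_*(\omega_n|x|^n)$, $x\in\Omega^\sharp$. The function $|\nabla^a u|_\sharp$ is $h_\sharp$ for $h = |\nabla^a u|$ restricted to $\Omega$. Explicitly,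 for $x \in \Omega^\sharp$, $$u^\star(x) = \frac{|D^s u|(\mathbb{R}^n)}{\mathrm{Per}(\Omega^\sharp)} + \int_{\omega_n|x|^n}^{|\Omega|} \frac{|\nabla^a u|_*(t)}{n\omega_n^{1/n}t^{1-1/n}}\,dt,$$ extended by $0$ outside $\Omega^\sharp$. *)

theory Defs
  imports "HOL-Analysis.Analysis"
begin

section \<open>Distributional derivatives\<close>

text \<open>The space \<open>C\<^sub>c\<^sup>1(U; \<real>\<^sup>n)\<close>, where \<open>\<real>\<^sup>n\<close> is the Euclidean space \<open>'a\<close> and \<open>n = DIM('a)\<close>.\<close>

definition test_fields :: "'a::euclidean_space set \<Rightarrow> ('a \<Rightarrow> 'a) set" where
  "test_fields U = {\<phi>. \<phi> differentiable_on UNIV \<and>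
     (\<forall>v. continuous_on UNIV (\<lambda>x. frechet_derivative \<phi> (at x) v)) \<and>
     compact (closure {x. \<phi> x \<noteq> 0}) \<and> closure {x. \<phi> x \<noteq> 0} \<subseteq> U}"

definition divergence :: "('a::euclidean_space \<Rightarrow> 'a) \<Rightarrow> 'a \<Rightarrow> real" where
  "divergence \<phi> x = (\<Sum>b\<in>Basis. frechet_derivative \<phi> (at x) b \<bullet> b)"

text \<open>The distributional derivative of \<open>u\<close> in \<open>U\<close> is the functional \<open>T\<close> on test fields;
  a derivative that is a vector measure \<open>\<nu>\<close> is given by \<open>T \<phi> = \<integral> \<phi> \<cdot> d\<nu>\<close>.\<close>

definition has_distr_derivative_on ::
    "('a::euclidean_space \<Rightarrow> real) \<Rightarrow> (('a \<Rightarrow> 'a) \<Rightarrow> real) \<Rightarrow> 'a set \<Rightarrow> bool" where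
  "has_distr_derivative_on u T U \<longleftrightarrow>
     (\<forall>\<phi>\<in>test_fields U. (LINT x:U|lebesgue. u x * divergence \<phi> x) = - T \<phi>)"

section \<open>Functions of bounded variation\<close>

text \<open>A finite \<open>\<real>\<^sup>n\<close>-valued Radon measure \<open>\<nu>\<close> is encoded by its polar decomposition
  \<open>\<nu> = \<sigma> M\<close>: the finite positive Borel measure \<open>M\<close> is the total variation
  measure \<open>\<bar>\<nu>\<bar>\<close>, and the Borel density \<open>\<sigma>\<close> has length \<open>1\<close> almost everywhere for \<open>M\<close>.
  This determines \<open>M\<close>, and \<open>\<sigma>\<close> up to \<open>M\<close>-null sets.\<close>

definition polar_pair :: "'a::euclidean_space measure \<Rightarrow> ('a \<Rightarrow> 'a) \<Rightarrow> bool" where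
  "polar_pair M \<sigma> \<longleftrightarrow> sets M = sets borel \<and> finite_measure M \<and>
     \<sigma> \<in> borel_measurable borel \<and> (AE x in M. norm (\<sigma> x) = 1)"

definition has_derivative_measure ::
    "('a::euclidean_space \<Rightarrow> real) \<Rightarrow> 'a measure \<Rightarrow> ('a \<Rightarrow> 'a) \<Rightarrow> bool" where
  "has_derivative_measure u M \<sigma> \<longleftrightarrow> polar_pair M \<sigma> \<and>
     has_distr_derivative_on u (\<lambda>\<phi>. LINT x|M. \<phi> x \<bullet> \<sigma> x) UNIV"

definition BV :: "('a::euclidean_space \<Rightarrow> real) set" where
  "BV = {u. integrable lebesgue u \<and> (\<exists>M \<sigma>. has_derivative_measure u M \<sigma>)}"

text \<open>The total variation measure \<open>\<bar>Du\<bar>\<close>; meaningful for \<open>u \<in> BV\<close>.\<close>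

definition variation_measure :: "('a::euclidean_space \<Rightarrow> real) \<Rightarrow> 'a measure" where
  "variation_measure u = (SOME M. \<exists>\<sigma>. has_derivative_measure u M \<sigma>)"

definition finite_perimeter :: "'a::euclidean_space set \<Rightarrow> bool" where
  "finite_perimeter E \<longleftrightarrow> (indicator E :: 'a \<Rightarrow> real) \<in> BV"

definition Per :: "'a::euclidean_space set \<Rightarrow> real" where
  "Per E = measure (variation_measure (indicator E)) UNIV"

definition BV0 :: "'a::euclidean_space set \<Rightarrow> ('a \<Rightarrow> real) set" where
  "BV0 \<Omega> = {u \<in> BV. AE x in lebesgue. x \<notin> \<Omega> \<longrightarrow> u x = 0}"

text \<open>The Lebesgue decomposition \<open>Du = g \<L>\<^sup>n + \<sigma> S\<close>, where \<open>g = \<nabla>\<^sup>a u\<close> and the singular part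
  \<open>D\<^sup>s u = \<sigma> S\<close> is again given by its polar decomposition, so \<open>S = \<bar>D\<^sup>s u\<bar>\<close>.
  For \<open>u \<in> BV\<close> it exists, \<open>g\<close> is unique almost everywhere and \<open>S\<close> is unique.\<close>

definition has_lebesgue_decomposition ::
    "('a::euclidean_space \<Rightarrow> real) \<Rightarrow> ('a \<Rightarrow> 'a) \<Rightarrow> 'a measure \<Rightarrow> ('a \<Rightarrow> 'a) \<Rightarrow> bool" where
  "has_lebesgue_decomposition u g S \<sigma> \<longleftrightarrow>
     integrable lebesgue g \<and> polar_pair S \<sigma> \<and>
     (\<exists>N\<in>null_sets lborel. emeasure S (- N) = 0) \<and>
     has_distr_derivative_on u
       (\<lambda>\<phi>. (LINT x|lebesgue. \<phi> x \<bullet> g x) + (LINT x|S. \<phi> x \<bullet> \<sigma> x)) UNIV"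

definition derivative_parts ::
    "('a::euclidean_space \<Rightarrow> real) \<Rightarrow> ('a \<Rightarrow> 'a) \<times> 'a measure" where
  "derivative_parts u = (SOME (g, S). \<exists>\<sigma>. has_lebesgue_decomposition u g S \<sigma>)"

text \<open>\<open>\<nabla>\<^sup>a u\<close>\<close>

definition abs_cont_grad :: "('a::euclidean_space \<Rightarrow> real) \<Rightarrow> 'a \<Rightarrow> 'a" where
  "abs_cont_grad u = fst (derivative_parts u)"

text \<open>\<open>\<bar>D\<^sup>s u\<bar>\<close>\<close>

definition sing_variation_measure :: "('a::euclidean_space \<Rightarrow> real) \<Rightarrow> 'a measure" where
  "sing_variation_measure u = snd (derivative_parts u)"

section \<open>Sobolev functions and traces\<close>

definition has_weak_gradient_on ::
    "('a::euclidean_space \<Rightarrow> real) \<Rightarrow> ('a \<Rightarrow> 'a) \<Rightarrow> 'a set \<Rightarrow> bool" where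
  "has_weak_gradient_on v G U \<longleftrightarrow> set_integrable lebesgue U G \<and>
     has_distr_derivative_on v (\<lambda>\<phi>. LINT x:U|lebesgue. \<phi> x \<bullet> G x) U"

definition W11 :: "'a::euclidean_space set \<Rightarrow> ('a \<Rightarrow> real) set" where
  "W11 U = {v. set_integrable lebesgue U v \<and> (\<exists>G. has_weak_gradient_on v G U)}"

text \<open>Determined almost everywhere in \<open>U\<close> if \<open>v \<in> W11 U\<close>.\<close>

definition weak_grad :: "'a::euclidean_space set \<Rightarrow> ('a \<Rightarrow> real) \<Rightarrow> 'a \<Rightarrow> 'a" where
  "weak_grad U v = (SOME G. has_weak_gradient_on v G U)"

definition Linfty :: "'a::euclidean_space set \<Rightarrow> ('a \<Rightarrow> real) set" where
  "Linfty U = {v. set_borel_measurable lebesgue U v \<and>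
     (\<exists>C. AE x in lebesgue. x \<in> U \<longrightarrow> \<bar>v x\<bar> \<le> C)}"

text \<open>The inner boundary trace of \<open>v\<close> at a point \<open>y \<in> \<partial>U\<close> in the usual sense for
  \<open>W\<^sup>1\<^sup>,\<^sup>1\<close> and \<open>BV\<close> functions, as a limit of mean oscillations.\<close>

definition has_trace_at ::
    "'a::euclidean_space set \<Rightarrow> ('a \<Rightarrow> real) \<Rightarrow> 'a \<Rightarrow> real \<Rightarrow> bool" where
  "has_trace_at U v y c \<longleftrightarrow>
     ((\<lambda>r. (LINT x:U \<inter> ball y r|lebesgue. \<bar>v x - c\<bar>) / measure lebesgue (ball y r))
        \<longlongrightarrow> 0) (at_right 0)"

definition radially_decreasing_on :: "'a::euclidean_space set \<Rightarrow> ('a \<Rightarrow> real) \<Rightarrow> bool" where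
  "radially_decreasing_on U v \<longleftrightarrow>
     (\<exists>f. antimono_on (norm ` U) f \<and> (AE x in lebesgue. x \<in> U \<longrightarrow> v x = f (norm x)))"

section \<open>Rearrangements\<close>

definition sharp_ball :: "'a::euclidean_space set \<Rightarrow> 'a set" where
  "sharp_ball \<Omega> =
     ball 0 (root DIM('a) (measure lebesgue \<Omega> / unit_ball_vol (real DIM('a))))"

lemma measure_sharp_ball:
  fixes \<Omega> :: "'a::euclidean_space set"
  shows "measure lebesgue (sharp_ball \<Omega>) = measure lebesgue \<Omega>"
  by (simp add: sharp_ball_def content_ball less_imp_neq[symmetric])

definition distribution_fun ::
    "'a::euclidean_space set \<Rightarrow> ('a \<Rightarrow> real) \<Rightarrow> real \<Rightarrow> real" where
  "distribution_fun \<Omega> h t = measure lebesgue {x \<in> \<Omega>. \<bar>h x\<bar> > t}"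

text \<open>For \<open>\<Omega>\<close> of finite measure the set below is nonempty for every \<open>s > 0\<close>. For \<open>s = 0\<close> and \<open>h\<close>
  essentially unbounded it is empty and the real infimum is not \<open>\<infinity>\<close>; the value at \<open>s = 0\<close>
  enters \<open>sharp_rearr\<close> only on the sphere bounding \<open>sharp_ball \<Omega>\<close>, a null set.\<close>

definition decr_rearr ::
    "'a::euclidean_space set \<Rightarrow> ('a \<Rightarrow> real) \<Rightarrow> real \<Rightarrow> real" where
  "decr_rearr \<Omega> h s = Inf {t. t > 0 \<and> distribution_fun \<Omega> h t \<le> s}"

definition incr_rearr ::
    "'a::euclidean_space set \<Rightarrow> ('a \<Rightarrow> real) \<Rightarrow> real \<Rightarrow> real" where
  "incr_rearr \<Omega> h s = decr_rearr \<Omega> h (measure lebesgue \<Omega> - s)"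

definition sharp_rearr ::
    "'a::euclidean_space set \<Rightarrow> ('a \<Rightarrow> real) \<Rightarrow> 'a \<Rightarrow> real" where
  "sharp_rearr \<Omega> h x =
     incr_rearr \<Omega> h (unit_ball_vol (real DIM('a)) * norm x ^ DIM('a))"

definition L1_norm_on :: "'a::euclidean_space set \<Rightarrow> ('a \<Rightarrow> real) \<Rightarrow> real" where
  "L1_norm_on U v = (LINT x:U|lebesgue. \<bar>v x\<bar>)"

text \<open>The comparison function \<open>u\<^sup>\<star>\<close>, characterised (up to null sets) by the problem it solves.\<close>

definition is_comparison_function ::
    "'a::euclidean_space set \<Rightarrow> ('a \<Rightarrow> real) \<Rightarrow> ('a \<Rightarrow> real) \<Rightarrow> bool" where
  "is_comparison_function \<Omega> u v \<longleftrightarrow>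
     radially_decreasing_on (sharp_ball \<Omega>) v \<and>
     v \<in> W11 (sharp_ball \<Omega>) \<inter> BV0 (sharp_ball \<Omega>) \<inter> Linfty (sharp_ball \<Omega>) \<and>
     (AE x in lebesgue. x \<in> sharp_ball \<Omega> \<longrightarrow>
        norm (weak_grad (sharp_ball \<Omega>) v x) = sharp_rearr \<Omega> (\<lambda>z. norm (abs_cont_grad u z)) x) \<and>
     (\<forall>y\<in>frontier (sharp_ball \<Omega>).
        has_trace_at (sharp_ball \<Omega>) v y
          (measure (sing_variation_measure u) UNIV / Per (sharp_ball \<Omega>)))"

end

theory Submission
  imports Defs
begin

text \<open>Let \<open>r(t)\<close> be the radius of the ball of volume \<open>\<bar>{v > t}\<bar>\<close>. For a smooth, compactly supported \<open>v \<ge> 0\<close>,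
  the Brunn--Minkowski inequality bounds from below the gain in volume when \<open>{v > t}\<close> is enlarged by a small ball;
  integrating over the levels, i.e. comparing \<open>v\<close> with its supremum over small balls, gives
  \<open>n \<integral> (v - \<epsilon>)\<^sup>+ \<le> \<integral>\<^bsub>{v \<ge> \<epsilon>}\<^esub> r(v) \<bar>\<nabla>v\<bar>\<close>, without the coarea formula. Apply this to mollifications of \<open>u\<close> and split
  the gradient into its mollified parts. For the absolutely continuous part, \<open>r(v)\<close> is distributed like \<open>\<bar>x\<bar>\<close> on
  a ball, so the Hardy--Littlewood inequality yields \<open>\<integral> \<bar>x\<bar> \<bar>\<nabla>\<^sup>a u\<bar>\<^sub>\<sharp>\<close> in the limit; for the singular part
  \<open>r(v)\<close> is bounded by the radius \<open>R\<close> of \<open>\<Omega>\<^sup>\<sharp>\<close>, which yields \<open>R \<bar>D\<^sup>s u\<bar>(\<real>\<^sup>n)\<close>.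
  The sum of these two terms is at most \<open>n\<close> times the integral of \<open>u\<^sup>\<star>\<close>, by testing the derivative of \<open>u\<^sup>\<star>\<close>
  with a smooth approximation of the field \<open>x\<close>.\<close>

section \<open>The Brunn--Minkowski inequality\<close>

text \<open>Multiplying the isoperimetric inequality for a level set by its radius turns the surface
  area n \<omega> r^(n-1) of the optimal ball into n \<omega> r^n, which is n times the volume of
  the level set. Integration over the levels then yields n times the integral of the function, and
  the distribution function is never differentiated. Comparing enlarged sets needs volumes only, so
  no surface measure of a level set has to be defined. The weight r(v) is small where v is large.
  The worst case pairs the largest gradients with the largest weights; this is why the increasing
  rearrangement of the gradient appears. On the other side div x = n, so n times the integral of
  \<open>ustar\<close> consists of its boundary value times n |B| and of the integral of |x| |grad
  \<open>ustar\<close>|. Dividing by Per(B) makes the boundary share equal to R times the singular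
  mass. The obstacle is that a mollified u no longer vanishes outside \<Omega>, so its level sets
  can be larger than \<Omega>. Levels below a fixed \<epsilon> are therefore cut away before the
  mollification is refined.\<close>

definition is_box_family :: "'a::euclidean_space set set \<Rightarrow> bool" where
  "is_box_family \<A> \<longleftrightarrow> finite \<A> \<and> \<A> \<noteq> {} \<and> pairwise disjnt \<A> \<and>
     (\<forall>Q\<in>\<A>. Q \<noteq> {} \<and> (\<exists>a b. Q = box a b))"

text \<open>The n-th power form has the homogeneity of volume on both sides, so the contributions of
  disjoint pieces can be added.\<close>

definition brunn_minkowski_ineq :: "'a::euclidean_space set \<Rightarrow> 'a set \<Rightarrow> bool" where
  "brunn_minkowski_ineq A B \<longleftrightarrow>
     (root DIM('a) (measure lborel A) + root DIM('a) (measure lborel B)) ^ DIM('a)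
       \<le> measure lborel (\<Union>x\<in>A. \<Union>y\<in>B. {x + y})"

section \<open>Brunn-Minkowski for finite unions of boxes\<close>

lemma box_Int_halfspace_lt:
  fixes a b :: "'a::euclidean_space"
  assumes "e \<in> Basis"
  shows "box a b \<inter> {x. x \<bullet> e < c} = box a (\<Sum>i\<in>Basis. (if i = e then min (b \<bullet> i) c else b \<bullet> i) *\<^sub>R i)"
  using assms by (auto simp: mem_box inner_sum_left_Basis split: if_splits)

lemma box_Int_halfspace_gt:
  fixes a b :: "'a::euclidean_space"
  assumes "e \<in> Basis"
  shows "box a b \<inter> {x. x \<bullet> e > c} = box (\<Sum>i\<in>Basis. (if i = e then max (a \<bullet> i) c else a \<bullet> i) *\<^sub>R i) b"
  using assms by (auto simp: mem_box inner_sum_left_Basis split: if_splits)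

text \<open>Divide by the root of the right-hand side and apply the inequality of arithmetic and
  geometric means to the numbers x_i / (x_i + y_i) and to the numbers y_i / (x_i + y_i): the two
  arithmetic means add up to 1.\<close>

lemma prod_root_add_le:
  fixes x y :: "'a::euclidean_space \<Rightarrow> real"
  assumes pos: "\<And>i. i \<in> Basis \<Longrightarrow> 0 < x i" "\<And>i. i \<in> Basis \<Longrightarrow> 0 < y i"
  shows "(root DIM('a) (\<Prod>i\<in>Basis. x i) + root DIM('a) (\<Prod>i\<in>Basis. y i)) ^ DIM('a)
           \<le> (\<Prod>i\<in>(Basis::'a set). x i + y i)"
proof -
  let ?n = "DIM('a)" and ?B = "Basis :: 'a set"
  define P where "P = (\<Prod>i\<in>?B. x i + y i)"
  have s0: "0 < x i + y i" if "i \<in> ?B" for i using pos[OF that] by simp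
  have P0: "0 < P" unfolding P_def using s0 by (intro prod_pos) auto
  have amgm: "root ?n (\<Prod>i\<in>?B. z i) / root ?n P \<le> (\<Sum>i\<in>?B. z i / (x i + y i)) / ?n"
    if z: "\<And>i. i \<in> ?B \<Longrightarrow> 0 < z i" for z
  proof -
    have "(\<Prod>i\<in>?B. z i / (x i + y i)) powr (1 / ?n) \<le> (\<Sum>i\<in>?B. (z i / (x i + y i)) / ?n)"
      using z s0 by (intro arith_geom_mean) (auto simp: less_imp_le)
    moreover have "(\<Prod>i\<in>?B. z i / (x i + y i)) powr (1 / ?n) = root ?n (\<Prod>i\<in>?B. z i / (x i + y i))"
      using z s0 by (subst root_powr_inverse) (auto intro!: prod_pos prod_nonneg less_imp_le)
    moreover have "(\<Prod>i\<in>?B. z i / (x i + y i)) = (\<Prod>i\<in>?B. z i) / P"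
      unfolding P_def by (simp add: prod_dividef)
    ultimately show ?thesis by (simp add: real_root_divide sum_divide_distrib)
  qed
  have "(root ?n (\<Prod>i\<in>?B. x i) + root ?n (\<Prod>i\<in>?B. y i)) / root ?n P
      \<le> (\<Sum>i\<in>?B. x i / (x i + y i)) / ?n + (\<Sum>i\<in>?B. y i / (x i + y i)) / ?n"
    unfolding add_divide_distrib using amgm[of x] amgm[of y] pos by (intro add_mono) auto
  also have "\<dots> = (\<Sum>i\<in>?B. 1) / ?n"
  proof -
    have "(\<Sum>i\<in>?B. x i / (x i + y i)) + (\<Sum>i\<in>?B. y i / (x i + y i)) = (\<Sum>i\<in>?B. 1)"
      unfolding sum.distrib[symmetric] using s0
      by (intro sum.cong) (auto simp: add_divide_distrib[symmetric] less_imp_neq[THEN not_sym])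
    then show ?thesis by (simp add: add_divide_distrib[symmetric])
  qed
  also have "\<dots> = 1" by simp
  finally have "root ?n (\<Prod>i\<in>?B. x i) + root ?n (\<Prod>i\<in>?B. y i) \<le> root ?n P"
    using P0 by (simp add: divide_le_eq)
  then have "(root ?n (\<Prod>i\<in>?B. x i) + root ?n (\<Prod>i\<in>?B. y i)) ^ ?n \<le> root ?n P ^ ?n"
    using pos by (intro power_mono add_nonneg_nonneg) (auto intro!: prod_nonneg simp: less_imp_le)
  then show ?thesis using P0 unfolding P_def by simp
qed

lemma brunn_minkowski_box:
  fixes a b a' b' :: "'a::euclidean_space"
  assumes "box a b \<noteq> {}" "box a' b' \<noteq> {}"
  shows "brunn_minkowski_ineq (box a b) (box a' b')"
proof -
  have lt: "a \<bullet> i < b \<bullet> i" "a' \<bullet> i < b' \<bullet> i" if "i \<in> Basis" for i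
    using assms that by (auto simp: box_ne_empty)
  have eq: "(\<Union>x\<in>box a b. \<Union>y\<in>box a' b'. {x + y}) = box (a + a') (b + b')"
  proof (intro equalityI subsetI)
    fix z assume "z \<in> (\<Union>x\<in>box a b. \<Union>y\<in>box a' b'. {x + y})"
    then show "z \<in> box (a + a') (b + b')"
      by (auto simp: mem_box inner_add_left intro!: add_strict_mono)
  next
    fix z assume z: "z \<in> box (a + a') (b + b')"
    \<comment> \<open>\<open>t i\<close> is the relative position of \<open>z\<close> in the summed
      box along the axis \<open>i\<close>. Dividing both boxes at this same ratio produces summands
      \<open>x\<close> and \<open>z - x\<close> in the two open boxes.\<close>
    define t where "t i = ((z - a - a') \<bullet> i) / ((b - a + b' - a') \<bullet> i)" for i
    have t: "0 < t i" "t i < 1" and d: "0 < (b - a + b' - a') \<bullet> i" if "i \<in> Basis" for i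
      using z lt[OF that] that by (auto simp: t_def mem_box inner_simps divide_simps)
    define x where "x = (\<Sum>i\<in>Basis. (a \<bullet> i + t i * ((b - a) \<bullet> i)) *\<^sub>R i)"
    have xi: "x \<bullet> i = a \<bullet> i + t i * ((b - a) \<bullet> i)" if "i \<in> Basis" for i
      unfolding x_def using that by simp
    have ti: "t i * ((b - a) \<bullet> i) + t i * ((b' - a') \<bullet> i) = (z - a - a') \<bullet> i" if "i \<in> Basis" for i
    proof -
      have "t i * ((b - a) \<bullet> i) + t i * ((b' - a') \<bullet> i) = t i * ((b - a + b' - a') \<bullet> i)"
        by (simp add: inner_simps algebra_simps)
      then show ?thesis using d[OF that] by (simp add: t_def)
    qed
    have "x \<in> box a b"
      unfolding mem_box
    proof (intro ballI)
      fix i :: 'a assume i: "i \<in> Basis"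
      have "t i * ((b - a) \<bullet> i) < 1 * ((b - a) \<bullet> i)" "0 < t i * ((b - a) \<bullet> i)"
        using t[OF i] lt[OF i] by (auto simp: inner_simps)
      then show "a \<bullet> i < x \<bullet> i \<and> x \<bullet> i < b \<bullet> i" using xi[OF i] by (simp add: inner_simps)
    qed
    moreover have "z - x \<in> box a' b'"
      unfolding mem_box
    proof (intro ballI)
      fix i :: 'a assume i: "i \<in> Basis"
      have "t i * ((b' - a') \<bullet> i) < 1 * ((b' - a') \<bullet> i)" "0 < t i * ((b' - a') \<bullet> i)"
        using t[OF i] lt[OF i] by (auto simp: inner_simps)
      then show "a' \<bullet> i < (z - x) \<bullet> i \<and> (z - x) \<bullet> i < b' \<bullet> i"
        using xi[OF i] ti[OF i] by (simp add: inner_simps)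
    qed
    ultimately show "z \<in> (\<Union>x\<in>box a b. \<Union>y\<in>box a' b'. {x + y})"
      by (intro UN_I[of x] UN_I[of "z - x"]) auto
  qed
  have "(root DIM('a) (\<Prod>i\<in>Basis. (b - a) \<bullet> i) + root DIM('a) (\<Prod>i\<in>Basis. (b' - a') \<bullet> i)) ^ DIM('a)
           \<le> (\<Prod>i\<in>(Basis::'a set). (b - a) \<bullet> i + (b' - a') \<bullet> i)"
    using lt by (intro prod_root_add_le) (auto simp: inner_simps)
  moreover have "measure lborel (box (a + a') (b + b')) = (\<Prod>i\<in>(Basis::'a set). (b - a) \<bullet> i + (b' - a') \<bullet> i)"
    using add_strict_mono[OF lt] by (subst measure_lborel_box) (auto simp: inner_simps less_imp_le intro!: prod.cong)
  ultimately show ?thesis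
    using lt unfolding brunn_minkowski_ineq_def eq by (simp add: less_imp_le)
qed

lemma brunn_minkowski_ineq_commute: "brunn_minkowski_ineq A B \<longleftrightarrow> brunn_minkowski_ineq B A"
proof -
  have "(\<Union>x\<in>A. \<Union>y\<in>B. {x + y}) = (\<Union>x\<in>B. \<Union>y\<in>A. {x + y})" by (fastforce simp: add.commute)
  then show ?thesis by (simp add: brunn_minkowski_ineq_def add.commute)
qed

lemma is_box_familyD:
  assumes "is_box_family \<A>"
  shows "open (\<Union>\<A>)" "bounded (\<Union>\<A>)" "0 < measure lborel (\<Union>\<A>)" "emeasure lborel (\<Union>\<A>) < \<infinity>"
proof -
  have box: "open Q \<and> bounded Q" if "Q \<in> \<A>" for Q
    using assms that unfolding is_box_family_def by (metis bounded_box open_box)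
  then show op: "open (\<Union>\<A>)" by (intro open_Union) auto
  show bd: "bounded (\<Union>\<A>)" using box assms by (intro bounded_Union) (auto simp: is_box_family_def)
  show fin: "emeasure lborel (\<Union>\<A>) < \<infinity>"
    using bd by (rule emeasure_bounded_finite)
  obtain Q where Q: "Q \<in> \<A>" using assms by (auto simp: is_box_family_def)
  then obtain a b where ab: "Q = box a b" "Q \<noteq> {}" using assms unfolding is_box_family_def by meson
  then have "0 < measure lborel Q"
    by (auto simp: box_ne_empty inner_simps less_imp_le intro!: prod_pos)
  also have "\<dots> \<le> measure lborel (\<Union>\<A>)"
    using Q ab fin op by (intro measure_mono_fmeasurable) (auto simp: fmeasurable_def)
  finally show "0 < measure lborel (\<Union>\<A>)" .
qed

lemma hyperplane_null: 
  fixes e :: "'a::euclidean_space" assumes "e \<in> Basis" shows "{x. x \<bullet> e = c} \<in> null_sets lborel"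
  using negligible_standard_hyperplane[OF assms, of c]
  by (auto simp: negligible_iff_null_sets null_sets_completion_iff)

lemma measure_halfspace_split:
  fixes A :: "'a::euclidean_space set"
  assumes "open A" "bounded A" and e: "e \<in> Basis"
  shows "measure lborel A = measure lborel (A \<inter> {x. x \<bullet> e < c}) + measure lborel (A \<inter> {x. x \<bullet> e > c})"
proof -
  have fin: "emeasure lborel (A \<inter> S) \<noteq> \<infinity>" for S
    using emeasure_bounded_finite[of "A \<inter> S"] assms by (auto simp: bounded_Int)
  have [measurable]: "A \<in> sets borel" using assms by auto
  have [measurable]: "{x. x \<bullet> e < c} \<in> sets borel" "{x. x \<bullet> e > c} \<in> sets borel" by measurable
  have "measure lborel A = measure lborel (A \<inter> {x. x \<bullet> e < c} \<union> A \<inter> {x. x \<bullet> e > c})"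
    using AE_not_in[OF hyperplane_null[OF e, of c]]
    by (intro measure_eq_AE) (auto elim!: eventually_mono)
  also have "\<dots> = measure lborel (A \<inter> {x. x \<bullet> e < c}) + measure lborel (A \<inter> {x. x \<bullet> e > c})"
    using fin by (intro measure_Union) (auto simp: less_top)
  finally show ?thesis .
qed

text \<open>The volume below a moving hyperplane has no jumps, because hyperplanes are null; this
  prepares an application of the intermediate value theorem.\<close>

lemma continuous_measure_halfspace:
  fixes A :: "'a::euclidean_space set"
  assumes "open A" "bounded A" and e: "e \<in> Basis"
  shows "continuous_on UNIV (\<lambda>c. measure lborel (A \<inter> {x. x \<bullet> e < c}))"
proof (rule continuous_at_imp_continuous_on, intro ballI, unfold continuous_at_sequentially, intro allI impI)
  fix c and s :: "nat \<Rightarrow> real" assume s: "s \<longlonglongrightarrow> c"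
  have [measurable]: "A \<in> sets borel" using assms by auto
  have finA: "emeasure lborel A < \<infinity>" using assms emeasure_bounded_finite by blast
  have eq: "measure lborel (A \<inter> {x. x \<bullet> e < d}) = (\<integral>x. indicator (A \<inter> {x. x \<bullet> e < d}) x \<partial>lborel)" for d
    by simp
  have "(\<lambda>k. \<integral>x. indicator (A \<inter> {x. x \<bullet> e < s k}) x \<partial>lborel) \<longlonglongrightarrow>
          (\<integral>x. (indicator (A \<inter> {x. x \<bullet> e < c}) x :: real) \<partial>lborel)"
  proof (rule integral_dominated_convergence[where w = "indicator A"])
    show "integrable lborel (indicator A :: 'a \<Rightarrow> real)" using finA by (auto simp: less_top)
    show "AE x in lborel. (\<lambda>k. indicator (A \<inter> {x. x \<bullet> e < s k}) x) \<longlonglongrightarrow> (indicator (A \<inter> {x. x \<bullet> e < c}) x :: real)"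
      using AE_not_in[OF hyperplane_null[OF e, of c]]
    proof eventually_elim
      fix x assume "x \<notin> {x. x \<bullet> e = c}"
      then consider "x \<bullet> e < c" | "x \<bullet> e > c" by fastforce
      then have "\<forall>\<^sub>F k in sequentially. (x \<bullet> e < s k) = (x \<bullet> e < c)"
      proof cases
        case 1 then show ?thesis using order_tendstoD(1)[OF s 1] by simp
      next
        case 2 show ?thesis using order_tendstoD(2)[OF s 2] by eventually_elim (use 2 in auto)
      qed
      then have "\<forall>\<^sub>F k in sequentially. indicator (A \<inter> {x. x \<bullet> e < c}) x = (indicator (A \<inter> {x. x \<bullet> e < s k}) x :: real)"
        by eventually_elim (auto simp: indicator_def)
      then show "(\<lambda>k. indicator (A \<inter> {x. x \<bullet> e < s k}) x) \<longlonglongrightarrow> (indicator (A \<inter> {x. x \<bullet> e < c}) x :: real)"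
        by (rule Lim_transform_eventually[OF tendsto_const])
    qed
  qed (auto split: split_indicator)
  then show "((\<lambda>c. measure lborel (A \<inter> {x. x \<bullet> e < c})) \<circ> s) \<longlonglongrightarrow> measure lborel (A \<inter> {x. x \<bullet> e < c})"
    unfolding eq comp_def .
qed

lemma ex_halfspace_fraction:
  fixes A :: "'a::euclidean_space set"
  assumes A: "open A" "bounded A" and e: "e \<in> Basis" and l: "0 < l" "l < 1"
  shows "\<exists>c. measure lborel (A \<inter> {x. x \<bullet> e < c}) = l * measure lborel A"
proof -
  obtain M where M: "\<And>x. x \<in> A \<Longrightarrow> norm x \<le> M" "M > 0" using A(2) bounded_pos by blast
  have "\<bar>x \<bullet> e\<bar> \<le> M" if "x \<in> A" for x
    using Basis_le_norm[OF e, of x] M(1)[OF that] by simp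
  \<comment> \<open>The half space is open, so \<open>c = M\<close> could miss points with
    \<open>x \<bullet> e = M\<close>; hence the upper end \<open>M + 1\<close>.\<close>
  then have *: "A \<inter> {x. x \<bullet> e < -M} = {}" "A \<inter> {x. x \<bullet> e < M + 1} = A" by (auto simp: abs_le_iff) (fastforce+)
  have "\<exists>c. -M \<le> c \<and> c \<le> M + 1 \<and> measure lborel (A \<inter> {x. x \<bullet> e < c}) = l * measure lborel A"
    using l M(2) by (intro IVT' continuous_on_subset[OF continuous_measure_halfspace[OF A e]])
       (auto simp: * intro: mult_left_le_one_le)
  then show ?thesis by blast
qed

text \<open>\<open>H\<close> will be an open coordinate half space. Disjoint boxes stay disjoint
  after the cut, and empty pieces are discarded so that the number of boxes drops as soon as one of
  them misses \<open>H\<close>; this strict drop drives the induction.\<close>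

lemma is_box_family_cut:
  fixes H :: "'a::euclidean_space set"
  assumes fam: "is_box_family \<A>"
    and H: "\<And>a b. \<exists>c d. box a b \<inter> H = box c d" and ne: "\<Union>\<A> \<inter> H \<noteq> {}"
  shows "is_box_family ((\<lambda>Q. Q \<inter> H) ` \<A> - {{}})" "\<Union>((\<lambda>Q. Q \<inter> H) ` \<A> - {{}}) = \<Union>\<A> \<inter> H"
    "card ((\<lambda>Q. Q \<inter> H) ` \<A> - {{}}) \<le> card \<A>"
    "Q \<in> \<A> \<Longrightarrow> Q \<inter> H = {} \<Longrightarrow> card ((\<lambda>Q. Q \<inter> H) ` \<A> - {{}}) < card \<A>"
proof -
  have fin: "finite \<A>" using fam by (simp add: is_box_family_def)
  show "is_box_family ((\<lambda>Q. Q \<inter> H) ` \<A> - {{}})"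
    unfolding is_box_family_def
  proof (intro conjI)
    show "finite ((\<lambda>Q. Q \<inter> H) ` \<A> - {{}})" using fin by auto
    show "(\<lambda>Q. Q \<inter> H) ` \<A> - {{}} \<noteq> {}" using ne by auto
    show "pairwise disjnt ((\<lambda>Q. Q \<inter> H) ` \<A> - {{}})"
      using fam unfolding is_box_family_def pairwise_def disjnt_def by blast
    show "\<forall>Q\<in>(\<lambda>Q. Q \<inter> H) ` \<A> - {{}}. Q \<noteq> {} \<and> (\<exists>a b. Q = box a b)"
      using fam H unfolding is_box_family_def by auto
  qed
  show "\<Union>((\<lambda>Q. Q \<inter> H) ` \<A> - {{}}) = \<Union>\<A> \<inter> H" by auto
  show "card ((\<lambda>Q. Q \<inter> H) ` \<A> - {{}}) \<le> card \<A>"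
    by (meson card_image_le card_mono Diff_subset fin finite_imageI le_trans)
  assume Q: "Q \<in> \<A>" "Q \<inter> H = {}"
  have "(\<lambda>Q. Q \<inter> H) ` \<A> - {{}} \<subseteq> (\<lambda>Q. Q \<inter> H) ` (\<A> - {Q})" using Q by auto
  then have "card ((\<lambda>Q. Q \<inter> H) ` \<A> - {{}}) \<le> card (\<A> - {Q})"
    using fin by (meson card_image_le card_mono finite_Diff finite_imageI le_trans)
  also have "\<dots> < card \<A>" using fin Q by (intro psubset_card_mono) auto
  finally show "card ((\<lambda>Q. Q \<inter> H) ` \<A> - {{}}) < card \<A>" .
qed

text \<open>Disjoint nonempty boxes have disjoint projections onto some axis. \<open>Q1\<close> and
  \<open>Q2\<close> lie on opposite sides of the hyperplane, so each of the two half spaces loses a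
  box of the family.\<close>

lemma separating_coordinate:
  assumes "is_box_family \<A>" "Q \<in> \<A>" "Q' \<in> \<A>" "Q \<noteq> Q'"
  obtains e c Q1 Q2 where "e \<in> Basis" "Q1 \<in> \<A>" "Q2 \<in> \<A>" "Q1 \<inter> {x. x \<bullet> e > c} = {}" "Q2 \<inter> {x. x \<bullet> e < c} = {}"
    "Q1 \<subseteq> {x. x \<bullet> e < c}" "Q2 \<subseteq> {x. x \<bullet> e > c}" "Q1 \<noteq> {}" "Q2 \<noteq> {}"
proof -
  obtain a b a' b' where ab: "Q = box a b" "Q' = box a' b'" "Q \<noteq> {}" "Q' \<noteq> {}" 
    using assms unfolding is_box_family_def by metis
  have "Q \<inter> Q' = {}" using assms unfolding is_box_family_def pairwise_def disjnt_def by blast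
  then obtain i where i: "i \<in> Basis" "b \<bullet> i \<le> a' \<bullet> i \<or> b' \<bullet> i \<le> a \<bullet> i"
    using ab(3,4) unfolding ab(1,2) disjoint_interval box_ne_empty by (meson not_le)
  from i(2) show thesis
  proof
    assume "b \<bullet> i \<le> a' \<bullet> i"
    then show thesis using assms ab i(1) by (intro that[of i Q Q' "b \<bullet> i"]) (auto simp: mem_box dest!: bspec[where x = i])
  next
    assume "b' \<bullet> i \<le> a \<bullet> i"
    then show thesis using assms ab i(1) by (intro that[of i Q' Q "b' \<bullet> i"]) (auto simp: mem_box dest!: bspec[where x = i])
  qed
qed

text \<open>The Hadwiger-Ohmann induction step. The first family is cut by a hyperplane separating
  two of its boxes, the second by a parallel hyperplane that divides its volume in the same ratio
  \<open>l\<close>. Both parts of the first family have fewer boxes, so the hypothesis applies to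
  left with left and to right with right.\<close>

lemma brunn_minkowski_step:
  fixes \<A> \<B> :: "'a::euclidean_space set set"
  assumes A: "is_box_family \<A>" and B: "is_box_family \<B>" and two: "Q \<in> \<A>" "Q' \<in> \<A>" "Q \<noteq> Q'"
    and IH: "\<And>\<A>' \<B>' :: 'a set set. is_box_family \<A>' \<Longrightarrow> is_box_family \<B>' \<Longrightarrow> card \<A>' < card \<A> \<Longrightarrow> card \<B>' \<le> card \<B>
               \<Longrightarrow> brunn_minkowski_ineq (\<Union>\<A>') (\<Union>\<B>')"
  shows "brunn_minkowski_ineq (\<Union>\<A>) (\<Union>\<B> :: 'a set)"
proof -
  obtain e c Q1 Q2 where e: "e \<in> Basis" and Q: "Q1 \<in> \<A>" "Q2 \<in> \<A>" "Q1 \<inter> {x. x \<bullet> e > c} = {}" "Q2 \<inter> {x. x \<bullet> e < c} = {}"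
    "Q1 \<subseteq> {x. x \<bullet> e < c}" "Q2 \<subseteq> {x. x \<bullet> e > c}" "Q1 \<noteq> {}" "Q2 \<noteq> {}"
    using separating_coordinate[OF A two] by metis
  let ?n = "DIM('a)"
  define L where "L c = {x::'a. x \<bullet> e < c}" for c
  define G where "G c = {x::'a. x \<bullet> e > c}" for c
  define cut where "cut \<A> H = (\<lambda>Q. Q \<inter> H) ` \<A> - {{}}" for \<A> and H :: "'a set"
  let ?A = "\<Union>\<A>" and ?B = "\<Union>\<B>"
  have H: "\<exists>c' d'. box a b \<inter> L d = box c' d'" "\<exists>c' d'. box a b \<inter> G d = box c' d'" for a b d
    using box_Int_halfspace_lt[OF e] box_Int_halfspace_gt[OF e] unfolding L_def G_def by blast+
  have neA: "?A \<inter> L c \<noteq> {}" "?A \<inter> G c \<noteq> {}" using Q unfolding L_def G_def by blast+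
  note cutA1 = is_box_family_cut[OF A H(1) neA(1), folded cut_def]
  note cutA2 = is_box_family_cut[OF A H(2) neA(2), folded cut_def]
  note Ad = is_box_familyD[OF A] and Bd = is_box_familyD[OF B]
  define m where "m = measure (lborel :: 'a measure)"
  have sA: "m ?A = m (?A \<inter> L c) + m (?A \<inter> G c)"
    unfolding m_def L_def G_def using Ad e by (intro measure_halfspace_split) auto
  have pA: "0 < m (?A \<inter> L c)" "0 < m (?A \<inter> G c)"
    using is_box_familyD(3)[OF cutA1(1)] is_box_familyD(3)[OF cutA2(1)] cutA1(2) cutA2(2) by (auto simp: m_def)
  define l where "l = m (?A \<inter> L c) / m ?A"
  have l: "0 < l" "l < 1" "m (?A \<inter> L c) = l * m ?A" "m (?A \<inter> G c) = (1 - l) * m ?A"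
    using pA sA by (auto simp: l_def field_simps)
  obtain d where d: "m (?B \<inter> L d) = l * m ?B"
    using ex_halfspace_fraction[OF Bd(1,2) e l(1,2)] unfolding L_def m_def by blast
  have sB: "m ?B = m (?B \<inter> L d) + m (?B \<inter> G d)"
    unfolding m_def L_def G_def using Bd e by (intro measure_halfspace_split) auto
  then have d2: "m (?B \<inter> G d) = (1 - l) * m ?B" using d by (simp add: algebra_simps)
  have "0 < m ?B" using Bd by (simp add: m_def)
  then have "0 < m (?B \<inter> L d)" "0 < m (?B \<inter> G d)" using d d2 l by auto
  then have neB: "?B \<inter> L d \<noteq> {}" "?B \<inter> G d \<noteq> {}" by (auto simp: m_def)
  note cutB1 = is_box_family_cut[OF B H(1) neB(1), folded cut_def]
  note cutB2 = is_box_family_cut[OF B H(2) neB(2), folded cut_def]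
  have bm1: "brunn_minkowski_ineq (?A \<inter> L c) (?B \<inter> L d)"
    using IH[OF cutA1(1) cutB1(1) cutA1(4)[OF Q(2) Q(4)[folded L_def]] cutB1(3)] cutA1(2) cutB1(2) by simp
  have bm2: "brunn_minkowski_ineq (?A \<inter> G c) (?B \<inter> G d)"
    using IH[OF cutA2(1) cutB2(1) cutA2(4)[OF Q(1) Q(3)[folded G_def]] cutB2(3)] cutA2(2) cutB2(2) by simp
  define S where "S A B = (\<Union>x\<in>A. \<Union>y\<in>B. {x + y})" for A B :: "'a set"
  have opS: "open (S A B)" if "open A" for A B unfolding S_def using that by (intro open_sums) auto
  have "bounded (S ?A ?B)" unfolding S_def using bounded_plus[OF Ad(2) Bd(2)]
    by (rule bounded_subset) auto
  then have finS: "emeasure lborel (S ?A ?B) < \<infinity>" by (rule emeasure_bounded_finite)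
  have opA: "open (?A \<inter> L c)" "open (?A \<inter> G c)"
    unfolding L_def G_def using Ad by (auto intro!: open_Int open_Collect_less continuous_intros)
  have sub: "S (?A \<inter> L c) (?B \<inter> L d) \<union> S (?A \<inter> G c) (?B \<inter> G d) \<subseteq> S ?A ?B" by (auto simp: S_def)
  \<comment> \<open>The hyperplane at height \<open>c + d\<close> separates the sum of the lower
    parts from the sum of the upper parts, so their volumes add.\<close>
  have disj: "S (?A \<inter> L c) (?B \<inter> L d) \<inter> S (?A \<inter> G c) (?B \<inter> G d) = {}"
  proof -
    have "z \<bullet> e < c + d" if "z \<in> S (?A \<inter> L c) (?B \<inter> L d)" for z
      using that by (auto simp: S_def L_def inner_add_left)
    moreover have "z \<bullet> e > c + d" if "z \<in> S (?A \<inter> G c) (?B \<inter> G d)" for z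
      using that by (auto simp: S_def G_def inner_add_left)
    ultimately show ?thesis by fastforce
  qed
  let ?r = "root ?n (m ?A) + root ?n (m ?B)"
  \<comment> \<open>This is where the equal ratios matter: if both volumes are multiplied by
    \<open>k\<close>, so is the n-th power of the sum of the roots.\<close>
  have part: "(root ?n (k * m ?A) + root ?n (k * m ?B)) ^ ?n = k * ?r ^ ?n" if "0 < k" for k
    using that by (simp add: real_root_mult flip: distrib_left) (simp add: power_mult_distrib)
  have "?r ^ ?n = l * ?r ^ ?n + (1 - l) * ?r ^ ?n" by (simp add: algebra_simps)
  also have "\<dots> \<le> m (S (?A \<inter> L c) (?B \<inter> L d)) + m (S (?A \<inter> G c) (?B \<inter> G d))"
    using bm1 bm2 part[of l] part[of "1 - l"] l(1,2)
    unfolding brunn_minkowski_ineq_def m_def[symmetric] l(3,4) d d2 S_def[symmetric] by simp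
  also have "\<dots> = m (S (?A \<inter> L c) (?B \<inter> L d) \<union> S (?A \<inter> G c) (?B \<inter> G d))"
    unfolding m_def using disj opS opA le_less_trans[OF emeasure_mono[of _ "S ?A ?B" lborel] finS] sub opS[OF Ad(1)]
    by (intro measure_Union[symmetric]) (auto simp: less_top)
  also have "\<dots> \<le> m (S ?A ?B)"
    unfolding m_def using sub opS opA opS[OF Ad(1)] finS by (intro measure_mono_fmeasurable) (auto simp: fmeasurable_def)
  finally show ?thesis unfolding brunn_minkowski_ineq_def m_def S_def .
qed

text \<open>Induction on the total number of boxes: whichever family contains two boxes is split,
  and the base case is a pair of single boxes.\<close>

lemma brunn_minkowski_boxes:
  fixes \<A> \<B> :: "'a::euclidean_space set set"
  assumes "is_box_family \<A>" "is_box_family \<B>"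
  shows "brunn_minkowski_ineq (\<Union>\<A>) (\<Union>\<B>)"
  using assms
proof (induction "card \<A> + card \<B>" arbitrary: \<A> \<B> rule: less_induct)
  case less
  have "(\<exists>Q. \<C> = {Q}) \<or> (\<exists>Q\<in>\<C>. \<exists>Q'\<in>\<C>. Q \<noteq> Q')" if "is_box_family \<C>" for \<C> :: "'a set set"
    using that unfolding is_box_family_def by blast
  then consider (a) Q Q' where "Q \<in> \<A>" "Q' \<in> \<A>" "Q \<noteq> Q'" | (b) Q Q' where "Q \<in> \<B>" "Q' \<in> \<B>" "Q \<noteq> Q'"
    | (c) Q Q' where "\<A> = {Q}" "\<B> = {Q'}"
    using less.prems by metis
  then show ?case
  proof cases
    case a
    show ?thesis by (rule brunn_minkowski_step[OF less.prems a]) (rule less.hyps, auto)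
  next
    case b
    show ?thesis unfolding brunn_minkowski_ineq_commute[of "\<Union>\<A>"]
      by (rule brunn_minkowski_step[OF less.prems(2,1) b]) (rule less.hyps, auto)
  next
    case c
    then obtain a b a' b' where "Q = box a b" "Q' = box a' b'" "Q \<noteq> {}" "Q' \<noteq> {}"
      using less.prems unfolding is_box_family_def by auto
    then show ?thesis using c brunn_minkowski_box[of a b a' b'] by simp
  qed
qed

section \<open>From box families to bounded open sets\<close>

lemma ex_box_family_inside:
  fixes A :: "'a::euclidean_space set"
  assumes A: "open A" "bounded A" "A \<noteq> {}" and "0 < \<epsilon>"
  shows "\<exists>\<A>. is_box_family \<A> \<and> \<Union>\<A> \<subseteq> A \<and> measure lborel A - \<epsilon> < measure lborel (\<Union>\<A>)"
proof -
  obtain a where a: "A \<subseteq> box (-a) a" using bounded_subset_box_symmetric[OF A(2)] .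
  then have ne: "box (-a) a \<noteq> {}" and sub: "A \<subseteq> cbox (-a) a" using A(3) box_subset_cbox by blast+
  \<comment> \<open>The gauge assigns the whole set \<open>A\<close> to each of its points. Every
    box of the covering is tagged by a point of \<open>A\<close> and must therefore lie inside
    \<open>A\<close>.\<close>
  have g: "gauge (\<lambda>x. if x \<in> A then A else UNIV)" using A(1) by (auto simp: gauge_def)
  obtain \<D> where D: "countable \<D>" "\<And>K. K \<in> \<D> \<Longrightarrow> interior K \<noteq> {} \<and> (\<exists>c d. K = cbox c d)"
    "pairwise (\<lambda>A B. interior A \<inter> interior B = {}) \<D>"
    "\<And>K. K \<in> \<D> \<Longrightarrow> \<exists>x \<in> A \<inter> K. K \<subseteq> (if x \<in> A then A else UNIV)" "A \<subseteq> \<Union>\<D>"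
    using covering_lemma[OF sub ne g] by metis
  let ?I = "interior ` \<D>"
  \<comment> \<open>If the family is finite, the enumeration repeats its members; only images of
    initial segments are used, and for these repetitions are harmless.\<close>
  define F where "F = from_nat_into ?I"
  have ne': "?I \<noteq> {}" using D(5) A(3) by auto
  then have ran: "range F = ?I" using D(1) unfolding F_def by (intro range_from_nat_into) auto
  have KA: "K \<subseteq> A" if "K \<in> \<D>" for K using D(4)[OF that] by auto
  have box: "Q \<noteq> {} \<and> (\<exists>c d. Q = box c d)" if Q: "Q \<in> ?I" for Q
  proof -
    obtain K where "K \<in> \<D>" "Q = interior K" using Q by auto
    then show ?thesis using D(2)[of K] interior_cbox by metis
  qed
  have disj: "pairwise disjnt ?I"
  proof (rule pairwiseI)
    fix P Q assume "P \<in> ?I" "Q \<in> ?I" "P \<noteq> Q"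
    then obtain K L where "K \<in> \<D>" "P = interior K" "L \<in> \<D>" "Q = interior L" "K \<noteq> L" by blast
    then show "disjnt P Q" using pairwiseD[OF D(3), of K L] by (simp add: disjnt_def)
  qed
  define U where "U k = \<Union>(F ` {..k})" for k :: nat
  have fam: "is_box_family (F ` {..k})" for k
  proof -
    have sub: "F ` {..k} \<subseteq> ?I" using ran by blast
    then have "\<forall>Q\<in>F ` {..k}. Q \<noteq> {} \<and> (\<exists>a b. Q = box a b)" using box by blast
    then show ?thesis using pairwise_subset[OF disj sub] unfolding is_box_family_def by auto
  qed
  have UA: "U k \<subseteq> A" for k
  proof -
    have "\<Union>?I \<subseteq> A" using KA interior_subset by fastforce
    then show ?thesis unfolding U_def ran[symmetric] by blast
  qed
  have UU: "(\<Union>k. U k) = \<Union>?I" unfolding ran[symmetric] U_def by auto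
  have finA: "emeasure lborel A < \<infinity>" using A(2) by (rule emeasure_bounded_finite)
  have opI: "open (\<Union>?I)" by auto
  \<comment> \<open>Replacing the closed boxes by their interiors, which are truly disjoint, removes
    only countably many box boundaries.\<close>
  have null: "(\<Union>K\<in>\<D>. K - interior K) \<in> null_sets lborel"
  proof (intro null_sets_UN' D(1))
    fix K assume "K \<in> \<D>"
    then obtain c d where K: "K = cbox c d" using D(2) by blast
    show "K - interior K \<in> null_sets lborel"
      unfolding K interior_cbox
      by (intro null_setsI) (auto simp: emeasure_Diff emeasure_lborel_box_eq emeasure_lborel_cbox_eq box_subset_cbox)
  qed
  have "measure lborel A = measure lborel (\<Union>?I)"
  proof (rule measure_eq_AE)
    show "AE x in lborel. (x \<in> A) = (x \<in> \<Union>?I)"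
      using AE_not_in[OF null]
    proof eventually_elim
      case (elim x)
      have "\<Union>?I \<subseteq> A" using KA interior_subset by fastforce
      moreover have "x \<in> \<Union>?I" if x: "x \<in> A"
      proof -
        obtain K where "K \<in> \<D>" "x \<in> K" using D(5) x by auto
        then show ?thesis using elim by auto
      qed
      ultimately show ?case by auto
    qed
  qed (use A opI in auto)
  moreover have "(\<lambda>k. measure lborel (U k)) \<longlonglongrightarrow> measure lborel (\<Union>k. U k)"
  proof (rule Lim_measure_incseq)
    show "range U \<subseteq> sets lborel" using is_box_familyD(1)[OF fam] unfolding U_def by auto
    show "incseq U" unfolding U_def incseq_def by (auto intro: order_trans)
    show "emeasure lborel (\<Union>k. U k) \<noteq> \<infinity>"
    proof -
      have "(\<Union>k. U k) \<subseteq> A" using UA by (intro UN_least)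
      then show ?thesis using le_less_trans[OF emeasure_mono[of "\<Union>k. U k" A lborel] finA] A(1) by auto
    qed
  qed
  ultimately have "(\<lambda>k. measure lborel (U k)) \<longlonglongrightarrow> measure lborel A" by (simp add: UU)
  then have "\<forall>\<^sub>F k in sequentially. measure lborel A - \<epsilon> < measure lborel (U k)"
    using assms(4) by (intro order_tendstoD(1)) auto
  then obtain k where "measure lborel A - \<epsilon> < measure lborel (U k)"
    by (auto simp: eventually_sequentially)
  then show ?thesis using fam[of k] UA[of k] unfolding U_def by blast
qed

text \<open>Both sets are exhausted from inside. Sums of subsets stay inside the sum, so only the
  left-hand side has to converge and nothing about limits of Minkowski sums is required.\<close>

theorem brunn_minkowski_open:
  fixes A B :: "'a::euclidean_space set"
  assumes A: "open A" "bounded A" "A \<noteq> {}" and B: "open B" "bounded B" "B \<noteq> {}"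
  shows "(root DIM('a) (measure lborel A) + root DIM('a) (measure lborel B)) ^ DIM('a)
       \<le> measure lborel (\<Union>x\<in>A. \<Union>y\<in>B. {x + y})"
proof -
  let ?m = "measure lborel :: 'a set \<Rightarrow> real"
  let ?S = "\<Union>x\<in>A. \<Union>y\<in>B. {x + y}"
  have "\<exists>\<A>. is_box_family \<A> \<and> \<Union>\<A> \<subseteq> A \<and> ?m A - 1 / Suc k < ?m (\<Union>\<A>)" for k
    using A by (intro ex_box_family_inside) auto
  then obtain \<A> where \<A>: "\<And>k. is_box_family (\<A> k)" "\<And>k. \<Union>(\<A> k) \<subseteq> A" "\<And>k. ?m A - 1 / Suc k < ?m (\<Union>(\<A> k))"
    by metis
  have "\<exists>\<B>. is_box_family \<B> \<and> \<Union>\<B> \<subseteq> B \<and> ?m B - 1 / Suc k < ?m (\<Union>\<B>)" for k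
    using B by (intro ex_box_family_inside) auto
  then obtain \<B> where \<B>: "\<And>k. is_box_family (\<B> k)" "\<And>k. \<Union>(\<B> k) \<subseteq> B" "\<And>k. ?m B - 1 / Suc k < ?m (\<Union>(\<B> k))"
    by metis
  have bd: "bounded ?S" using bounded_plus[OF A(2) B(2)] by (rule bounded_subset) auto
  have opS: "open ?S" using A by (intro open_sums) auto
  have mono: "?m (\<Union>\<C>) \<le> ?m C" if "is_box_family \<C>" "\<Union>\<C> \<subseteq> C" "open C" "bounded C" for \<C> C
    using that is_box_familyD[OF that(1)] emeasure_bounded_finite[OF that(4)]
    by (intro measure_mono_fmeasurable) (auto simp: fmeasurable_def)
  have lim: "(\<lambda>k. ?m (\<Union>(\<C> k))) \<longlonglongrightarrow> ?m C"
    if "\<And>k. is_box_family (\<C> k)" "\<And>k. \<Union>(\<C> k) \<subseteq> C" "\<And>k. ?m C - 1 / Suc k < ?m (\<Union>(\<C> k))" "open C" "bounded C" for \<C> C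
  proof (rule real_tendsto_sandwich)
    show "\<forall>\<^sub>F k in sequentially. ?m C - 1 / real (Suc k) \<le> ?m (\<Union>(\<C> k))" using less_imp_le[OF that(3)] by simp
    show "\<forall>\<^sub>F k in sequentially. ?m (\<Union>(\<C> k)) \<le> ?m C" using mono that by auto
    show "(\<lambda>k. ?m C - 1 / real (Suc k)) \<longlonglongrightarrow> ?m C"
      using tendsto_diff[OF tendsto_const LIMSEQ_inverse_real_of_nat, of "?m C"] by (simp add: inverse_eq_divide)
  qed simp
  show ?thesis
  proof (rule LIMSEQ_le_const2)
    show "(\<lambda>k. (root DIM('a) (?m (\<Union>(\<A> k))) + root DIM('a) (?m (\<Union>(\<B> k)))) ^ DIM('a)) \<longlonglongrightarrow>
       (root DIM('a) (?m A) + root DIM('a) (?m B)) ^ DIM('a)"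
      using \<A> \<B> A B by (intro tendsto_intros lim) auto
    show "\<exists>N. \<forall>k\<ge>N. (root DIM('a) (?m (\<Union>(\<A> k))) + root DIM('a) (?m (\<Union>(\<B> k)))) ^ DIM('a) \<le> ?m ?S"
    proof (intro exI allI impI)
      fix k
      have "(root DIM('a) (?m (\<Union>(\<A> k))) + root DIM('a) (?m (\<Union>(\<B> k)))) ^ DIM('a)
          \<le> ?m (\<Union>x\<in>\<Union>(\<A> k). \<Union>y\<in>\<Union>(\<B> k). {x + y})"
        using brunn_minkowski_boxes[OF \<A>(1) \<B>(1)] unfolding brunn_minkowski_ineq_def .
      also have "\<dots> \<le> ?m ?S"
      proof (intro measure_mono_fmeasurable)
        show "(\<Union>x\<in>\<Union>(\<A> k). \<Union>y\<in>\<Union>(\<B> k). {x + y}) \<subseteq> ?S" using \<A>(2)[of k] \<B>(2)[of k] by blast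
        have "open (\<Union>x\<in>\<Union>(\<A> k). \<Union>y\<in>\<Union>(\<B> k). {x + y})"
          using is_box_familyD(1)[OF \<A>(1)[of k]] by (intro open_sums) auto
        then show "(\<Union>x\<in>\<Union>(\<A> k). \<Union>y\<in>\<Union>(\<B> k). {x + y}) \<in> sets lborel" by simp
        show "?S \<in> fmeasurable lborel" using opS emeasure_bounded_finite[OF bd] by (auto simp: fmeasurable_def)
      qed
      finally show "(root DIM('a) (?m (\<Union>(\<A> k))) + root DIM('a) (?m (\<Union>(\<B> k)))) ^ DIM('a) \<le> ?m ?S" .
    qed
  qed
qed

section \<open>The level set inequality\<close>

text \<open>The dummy type argument fixes the dimension, which the real argument and the real value
  do not determine.\<close>

definition ball_radius :: "'a::euclidean_space itself \<Rightarrow> real \<Rightarrow> real" where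
  "ball_radius _ m = root DIM('a) (m / unit_ball_vol (real DIM('a)))"

lemma ball_radius_power:
  "0 \<le> m \<Longrightarrow> unit_ball_vol (real DIM('a)) * ball_radius TYPE('a::euclidean_space) m ^ DIM('a) = m"
  by (simp add: ball_radius_def less_imp_neq[THEN not_sym])

lemma measure_ball_lborel: "0 \<le> r \<Longrightarrow> measure lborel (ball (c::'a::euclidean_space) r) = unit_ball_vol (real DIM('a)) * r ^ DIM('a)"
  by (rule content_ball)

text \<open>Brunn-Minkowski with a ball as second summand: among sets of given volume the ball gains
  least when it is enlarged by \<open>r\<close>. This is the isoperimetric inequality before
  division by \<open>r\<close>, expressed in volumes alone.\<close>

lemma measure_enlarge_ge:
  fixes A :: "'a::euclidean_space set"
  assumes A: "open A" "bounded A" "A \<noteq> {}" and r: "0 < r"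
  shows "unit_ball_vol (real DIM('a)) * (ball_radius TYPE('a) (measure lborel A) + r) ^ DIM('a)
      \<le> measure lborel (\<Union>x\<in>A. ball x r)"
proof -
  let ?w = "unit_ball_vol (real DIM('a))" and ?n = "DIM('a)"
  have w: "0 < ?w" by simp
  have eq: "(\<Union>x\<in>A. \<Union>y\<in>ball 0 r. {x + y}) = (\<Union>x\<in>A. ball x r)"
  proof (intro equalityI subsetI)
    fix z assume "z \<in> (\<Union>x\<in>A. ball x r)"
    then obtain x where x: "x \<in> A" "dist x z < r" by auto
    then show "z \<in> (\<Union>x\<in>A. \<Union>y\<in>ball 0 r. {x + y})"
      by (intro UN_I[of x] UN_I[of "z - x"]) (auto simp: dist_norm norm_minus_commute)
  next
    fix z assume "z \<in> (\<Union>x\<in>A. \<Union>y\<in>ball 0 r. {x + y})"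
    then obtain x y where "x \<in> A" "norm y < r" "z = x + y" by auto
    then show "z \<in> (\<Union>x\<in>A. ball x r)" by (intro UN_I[of x]) (auto simp: dist_norm)
  qed
  have rw: "root ?n (measure lborel (ball (0::'a) r)) = root ?n ?w * r"
    using r by (simp add: measure_ball_lborel real_root_mult real_root_power_cancel)
  have rA: "root ?n (measure lborel A) = root ?n ?w * ball_radius TYPE('a) (measure lborel A)"
    using w by (simp add: ball_radius_def less_imp_neq[OF w, THEN not_sym] del: unit_ball_vol_pos flip: real_root_mult)
  have "(root ?n (measure lborel A) + root ?n (measure lborel (ball (0::'a) r))) ^ ?n
     = ?w * (ball_radius TYPE('a) (measure lborel A) + r) ^ ?n"
    unfolding rA rw using w by (simp flip: distrib_left add: power_mult_distrib)
  then show ?thesis using brunn_minkowski_open[OF A, of "ball 0 r"] r unfolding eq by simp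
qed

text \<open>The weight \<open>w\<close> is carried along so that a product can be sliced in one of
  its factors. Only levels \<open>t \<ge> 0\<close> occur, because \<open>ennreal\<close> turns
  negative values of \<open>f\<close> into 0.\<close>

lemma nn_integral_layer_cake:
  fixes f :: "'a \<Rightarrow> real"
  assumes "sigma_finite_measure M" and [measurable]: "f \<in> borel_measurable M" "w \<in> borel_measurable M"
  shows "(\<integral>\<^sup>+x. w x * ennreal (f x) \<partial>M)
      = (\<integral>\<^sup>+t. indicator {0..} t * (\<integral>\<^sup>+x. w x * indicator {x. t < f x} x \<partial>M) \<partial>lborel)"
proof -
  interpret sigma_finite_measure M by fact
  interpret pair_sigma_finite "lborel :: real measure" M ..
  have eq: "ennreal y = (\<integral>\<^sup>+t. indicator {0..<y} t \<partial>lborel)" for y :: real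
    by (cases "0 \<le> y") (auto simp: ennreal_neg)
  have "(\<integral>\<^sup>+x. w x * ennreal (f x) \<partial>M) = (\<integral>\<^sup>+x. (\<integral>\<^sup>+t. w x * indicator {0..<f x} t \<partial>lborel) \<partial>M)"
    by (simp add: eq nn_integral_cmult)
  also have "\<dots> = (\<integral>\<^sup>+x. (\<integral>\<^sup>+t. indicator {0..} t * (w x * indicator {x. t < f x} x) \<partial>lborel) \<partial>M)"
    by (intro nn_integral_cong) (auto split: split_indicator)
  also have "\<dots> = (\<integral>\<^sup>+t. (\<integral>\<^sup>+x. indicator {0..} t * (w x * indicator {x. t < f x} x) \<partial>M) \<partial>lborel)"
    by (intro Fubini') (simp add: indicator_def[abs_def])
  also have "\<dots> = (\<integral>\<^sup>+t. indicator {0..} t * (\<integral>\<^sup>+x. w x * indicator {x. t < f x} x \<partial>M) \<partial>lborel)"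
    by (intro nn_integral_cong nn_integral_cmult) simp
  finally show ?thesis .
qed

lemma LIMSEQ_divide_real_of_nat_Suc: "(\<lambda>k. (c::real) / real (Suc k)) \<longlonglongrightarrow> 0"
  using tendsto_mult[OF tendsto_const LIMSEQ_inverse_real_of_nat, of c] by (simp add: divide_inverse)

lemma power_add_ge_linear:
  fixes p r :: real
  assumes "0 \<le> p" "0 \<le> r"
  shows "p ^ n + n * p ^ (n - 1) * r \<le> (p + r) ^ n"
proof (induction n)
  case (Suc n)
  have "p ^ Suc n + Suc n * p ^ (Suc n - 1) * r \<le> (p ^ n + n * p ^ (n - 1) * r) * (p + r)"
    using assms by (cases n) (auto simp: algebra_simps)
  also have "\<dots> \<le> (p + r) ^ n * (p + r)"
    using Suc assms by (intro mult_right_mono) auto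
  finally show ?case by (simp add: mult.commute)
qed simp

text \<open>Rounding \<open>s\<close> down to the grid of width \<tau>. The steps are counted from
  the level \<tau> on and not from 0, which puts the staircase below \<open>s\<close>, with an error
  of at most one step.\<close>

lemma staircase_lower:
  fixes s \<tau> :: real
  assumes "0 < \<tau>" "s \<le> N * \<tau>"
  shows "s - \<tau> \<le> (\<Sum>j<N. \<tau> * of_bool ((Suc j) * \<tau> < s))"
  using assms(2)
proof (induction N)
  case (Suc N)
  show ?case
  proof (cases "s \<le> N * \<tau>")
    case True
    then show ?thesis using Suc assms(1) by (auto intro: order_trans)
  next
    case False
    have "Suc j * \<tau> < s" if "j < N" for j
    proof -
      have "Suc j * \<tau> \<le> N * \<tau>" using that assms(1) by (intro mult_right_mono) auto
      then show ?thesis using False by linarith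
    qed
    then have "(\<Sum>j<N. \<tau> * of_bool (Suc j * \<tau> < s)) = N * \<tau>" by simp
    then show ?thesis using Suc.prems assms(1) by (auto simp: algebra_simps)
  qed
qed (use assms in auto)

section \<open>Slicing a compactly supported function with Lipschitz gradient\<close>

lemma ball_radius_mono:
  "m \<le> m' \<Longrightarrow> ball_radius TYPE('a::euclidean_space) m \<le> ball_radius TYPE('a) m'"
  unfolding ball_radius_def by (intro real_root_le_mono divide_right_mono) auto

lemma ball_radius_nonneg [simp]: "0 \<le> m \<Longrightarrow> 0 \<le> ball_radius TYPE('a::euclidean_space) m"
  by (simp add: ball_radius_def)

text \<open>Differentiability is encoded as a quadratic Taylor bound with constants independent of
  \<open>x\<close>, because the supremum of \<open>v\<close> over a ball of radius \<open>r\<close>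
  has to be expanded to first order at all points at once. The Lipschitz constant \<open>L\<close>
  tells which points can reach a given level within distance \<open>r\<close>.\<close>

locale compact_C11 =
  fixes v :: "'a::euclidean_space \<Rightarrow> real" and V :: "'a \<Rightarrow> 'a" and C \<delta> L Q :: real
  assumes v_nonneg: "\<And>x. 0 \<le> v x"
    and v_supp: "\<And>x. norm x > Q \<Longrightarrow> v x = 0"
    and quad: "\<And>x h. norm h \<le> \<delta> \<Longrightarrow> \<bar>v (x + h) - v x - V x \<bullet> h\<bar> \<le> C * (norm h)\<^sup>2"
    and lip: "\<And>x y. \<bar>v x - v y\<bar> \<le> L * norm (x - y)"
    and contV: "continuous_on UNIV V"
    and pos: "0 < \<delta>" "0 \<le> C" "0 \<le> L"
begin

text \<open>Restricting to the ball of radius \<open>Q\<close>, which contains all points where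
  \<open>v\<close> is positive, keeps the value finite for negative levels too; hence
  \<open>m\<close> is antitone and Borel on the whole line.\<close>

definition m :: "real \<Rightarrow> real" where
  "m t = measure lborel {x. t < v x \<and> norm x \<le> Q}"

lemma cont_v: "continuous_on UNIV v"
proof (rule continuous_onI)
  fix x and e :: real assume e: "0 < e"
  have "dist (v x') (v x) \<le> e" if "dist x' x < e / (L + 1)" for x'
  proof -
    have "dist (v x') (v x) \<le> L * dist x' x" using lip[of x' x] by (simp add: dist_norm)
    also have "\<dots> \<le> (L + 1) * dist x' x" by (intro mult_right_mono) auto
    also have "\<dots> \<le> e" using that pos(3) by (simp add: field_simps)
    finally show ?thesis .
  qed
  then show "\<exists>d>0. \<forall>x'\<in>UNIV. dist x' x < d \<longrightarrow> dist (v x') (v x) \<le> e"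
    using e pos(3) by (intro exI[of _ "e / (L + 1)"]) auto
qed

lemma v_meas [measurable]: "v \<in> borel_measurable borel"
  using cont_v by (rule borel_measurable_continuous_onI)

lemma V_meas [measurable]: "V \<in> borel_measurable borel"
  using contV by (rule borel_measurable_continuous_onI)

lemma superlevel: "0 \<le> t \<Longrightarrow> {x. t < v x \<and> norm x \<le> Q} = {x. t < v x}"
  using v_supp by (auto simp: not_le[symmetric]) (metis less_le_not_le not_le)

lemma m_eq: "0 \<le> t \<Longrightarrow> m t = measure lborel {x. t < v x}"
  unfolding m_def by (simp add: superlevel)

lemma finite_part: "emeasure lborel {x. P x \<and> norm x \<le> Q} < \<infinity>"
  by (rule emeasure_bounded_finite) (rule bounded_subset[OF bounded_cball[of 0 Q]], auto)

lemma m_emeasure: "0 \<le> t \<Longrightarrow> emeasure lborel {x. t < v x} = ennreal (m t)"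
  unfolding m_eq using finite_part[of "\<lambda>x. t < v x"] superlevel[of t] by (simp add: emeasure_eq_ennreal_measure)

lemma m_antimono: "s \<le> t \<Longrightarrow> m t \<le> m s"
  unfolding m_def using finite_part[of "\<lambda>x. s < v x"]
  by (intro measure_mono_fmeasurable) (auto simp: fmeasurable_def)

lemma m_nonneg [simp]: "0 \<le> m t" by (simp add: m_def)

lemma m_meas [measurable]: "m \<in> borel_measurable borel"
proof -
  have "(\<lambda>t. - m t) \<in> borel_measurable borel"
    by (intro borel_measurable_mono monoI) (simp add: m_antimono)
  then show ?thesis by simp
qed

lemma rad_meas [measurable]: "(\<lambda>x. ball_radius TYPE('a) (m (v x))) \<in> borel_measurable borel"
  unfolding ball_radius_def by measurable

context
  fixes a b :: real
  assumes ab: "0 < a" "a < b"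
begin

text \<open>\<open>w\<close> is the slice of \<open>v\<close> between the levels \<open>a\<close>
  and \<open>b\<close>. Superlevel sets of \<open>W r\<close> are the
  \<open>r\<close>-neighbourhoods of those of \<open>w\<close>, so a volume bound for neighbourhoods
  becomes a bound for the integral of \<open>W r - w\<close>.\<close>

definition w :: "'a \<Rightarrow> real" where "w x = min (max (v x) a) b - a"
definition W :: "real \<Rightarrow> 'a \<Rightarrow> real" where "W r x = (SUP z\<in>ball x r. w z)"

lemma w_bounds: "0 \<le> w x" "w x \<le> b - a" using ab by (auto simp: w_def)

lemma w_meas [measurable]: "w \<in> borel_measurable borel" unfolding w_def[abs_def] by measurable

lemma less_W: "0 < r \<Longrightarrow> t < W r x \<longleftrightarrow> (\<exists>z\<in>ball x r. t < w z)"
  unfolding W_def using w_bounds(2) by (intro less_cSUP_iff) (auto intro!: bdd_aboveI2[where M = "b - a"])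

lemma W_superlevel: "0 < r \<Longrightarrow> {x. t < W r x} = (\<Union>z\<in>{z. t < w z}. ball z r)"
  by (auto simp: less_W dist_commute)

lemma W_meas [measurable]: "0 < r \<Longrightarrow> W r \<in> borel_measurable borel"
  by (rule borel_measurableI_greater) (simp add: W_superlevel open_UN borel_open)

text \<open>The Taylor bound gives the gain to first order. It is localised to the slice: from a
  point with \<open>v x < a - L * r\<close> the level \<open>a\<close> is out of reach within
  distance \<open>r\<close>, and where \<open>v x \<ge> b\<close> the slice is already full.\<close>

lemma W_le:
  assumes r: "0 < r" "r \<le> \<delta>"
  shows "W r x \<le> w x + r * (norm (V x) + C * r) * indicator {x. a - L * r \<le> v x \<and> v x < b} x"
  unfolding W_def
proof (rule cSUP_least)
  fix z assume z: "z \<in> ball x r"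
  have nz: "norm (z - x) \<le> r" using z by (simp add: dist_norm norm_minus_commute)
  have nn: "0 \<le> r * (norm (V x) + C * r)" using r pos by simp
  have "\<bar>v (x + (z - x)) - v x - V x \<bullet> (z - x)\<bar> \<le> C * (norm (z - x))\<^sup>2"
    using nz r by (intro quad) auto
  moreover have "C * (norm (z - x))\<^sup>2 \<le> C * r\<^sup>2" using nz pos by (intro mult_left_mono power_mono) auto
  moreover have "V x \<bullet> (z - x) \<le> norm (V x) * r"
    using norm_cauchy_schwarz[of "V x" "z - x"] mult_left_mono[OF nz, of "norm (V x)"] by simp
  ultimately have "v z - v x \<le> r * (norm (V x) + C * r)" by (simp add: algebra_simps power2_eq_square)
  then have le: "w z \<le> w x + r * (norm (V x) + C * r)" using nn by (auto simp: w_def)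
  have "\<bar>v z - v x\<bar> \<le> L * r" using lip[of z x] mult_left_mono[OF nz pos(3)] by simp
  then have "w z \<le> w x" if "\<not> (a - L * r \<le> v x \<and> v x < b)" using that by (auto simp: w_def)
  then show "w z \<le> w x + r * (norm (V x) + C * r) * indicator {x. a - L * r \<le> v x \<and> v x < b} x"
    using le by (auto split: split_indicator)
qed (use r in auto)

text \<open>Layer cake. Every superlevel set in the slice has volume at least \<open>m b\<close>, so
  enlarging it gains at least the linear term of what the ball of volume \<open>m b\<close> gains;
  there are levels of total length \<open>b - a\<close>.\<close>

lemma W_integral_ge:
  assumes r: "0 < r" and mb: "0 < m b"
  shows "(\<integral>\<^sup>+x. ennreal (w x) \<partial>lborel)
       + ennreal (DIM('a) * unit_ball_vol (real DIM('a)) * ball_radius TYPE('a) (m b) ^ (DIM('a) - 1) * r * (b - a))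
       \<le> (\<integral>\<^sup>+x. ennreal (W r x) \<partial>lborel)"
proof -
  define c where "c = DIM('a) * unit_ball_vol (real DIM('a)) * ball_radius TYPE('a) (m b) ^ (DIM('a) - 1) * r"
  have c0: "0 \<le> c" using r by (simp add: c_def)
  have lc: "(\<integral>\<^sup>+x. ennreal (f x) \<partial>lborel) = (\<integral>\<^sup>+t. indicator {0..} t * emeasure lborel {x. t < f x} \<partial>lborel)"
    if [measurable]: "f \<in> borel_measurable borel" for f :: "'a \<Rightarrow> real"
    using nn_integral_layer_cake[of lborel f "\<lambda>_. 1"] lborel.sigma_finite_measure_axioms
    by (simp add: Collect_mem_eq)
  have ineq: "emeasure lborel {x. t < w x} + ennreal c \<le> emeasure lborel {x. t < W r x}" if t: "0 \<le> t" "t < b - a" for t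
  proof -
    let ?A = "{x. a + t < v x}"
    have eqA: "{x. t < w x} = ?A" using t ab by (auto simp: w_def)
    have opA: "open ?A" using cont_v by (intro open_Collect_less) auto
    have bdA: "bounded ?A"
      using superlevel[of "a + t"] t ab by (intro bounded_subset[OF bounded_cball[of 0 Q]]) auto
    have mA: "measure lborel ?A = m (a + t)" using t ab by (simp add: m_eq)
    have mAb: "m b \<le> m (a + t)" using t by (intro m_antimono) auto
    \<comment> \<open>Brunn-Minkowski is false for an empty summand; \<open>0 < m b\<close> excludes
      this at every level of the slice.\<close>
    then have neA: "?A \<noteq> {}" using mb mA by (metis measure_empty not_le)
    let ?p = "ball_radius TYPE('a) (m (a + t))" and ?w = "unit_ball_vol (real DIM('a))"
    have "m (a + t) + c \<le> ?w * (?p ^ DIM('a) + DIM('a) * ?p ^ (DIM('a) - 1) * r)"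
      unfolding distrib_left ball_radius_power[OF m_nonneg] c_def using r mAb
      by (simp add: mult_ac) (intro mult_left_mono power_mono ball_radius_mono, auto)
    also have "\<dots> \<le> ?w * (?p + r) ^ DIM('a)"
      using r by (intro mult_left_mono power_add_ge_linear) auto
    also have "\<dots> \<le> measure lborel (\<Union>x\<in>?A. ball x r)"
      using measure_enlarge_ge[OF opA bdA neA r] by (simp add: mA)
    finally have *: "m (a + t) + c \<le> measure lborel (\<Union>x\<in>?A. ball x r)" .
    have "emeasure lborel {x. t < w x} + ennreal c = ennreal (m (a + t) + c)"
      unfolding eqA using t ab c0 by (simp add: m_emeasure)
    also have "\<dots> \<le> ennreal (measure lborel (\<Union>x\<in>?A. ball x r))" using * by (rule ennreal_leI)
    also have "\<dots> \<le> emeasure lborel {x. t < W r x}"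
      unfolding W_superlevel[OF r] eqA measure_def using ennreal_enn2real_if by (auto simp: ennreal_enn2real_if)
    finally show ?thesis .
  qed
  have "(\<integral>\<^sup>+x. ennreal (w x) \<partial>lborel) + ennreal (c * (b - a))
      = (\<integral>\<^sup>+t. indicator {0..} t * emeasure lborel {x. t < w x} + ennreal c * indicator {0..<b - a} t \<partial>lborel)"
    using ab c0 by (subst nn_integral_add) (auto simp: lc nn_integral_cmult ennreal_mult)
  also have "\<dots> \<le> (\<integral>\<^sup>+t. indicator {0..} t * emeasure lborel {x. t < W r x} \<partial>lborel)"
  proof (intro nn_integral_mono)
    fix t :: real
    consider "t < 0" | "0 \<le> t" "t < b - a" | "b - a \<le> t" by linarith
    then show "indicator {0..} t * emeasure lborel {x. t < w x} + ennreal c * indicator {0..<b - a} t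
        \<le> indicator {0..} t * emeasure lborel {x. t < W r x}"
    proof cases
      case 3
      then have "{x. t < w x} = {}" using w_bounds(2) by (auto simp: not_less intro: order_trans)
      then show ?thesis using 3 by auto
    qed (use ineq in auto)
  qed
  also have "\<dots> = (\<integral>\<^sup>+x. ennreal (W r x) \<partial>lborel)" using r by (simp add: lc)
  finally show ?thesis unfolding c_def .
qed

lemma slice_ineq_r:
  assumes r: "0 < r" "r \<le> \<delta>" and mb: "0 < m b"
  shows "ennreal (DIM('a) * unit_ball_vol (real DIM('a)) * ball_radius TYPE('a) (m b) ^ (DIM('a) - 1) * (b - a))
     \<le> (\<integral>\<^sup>+x. ennreal ((norm (V x) + C * r) * indicator {x. a - L * r \<le> v x \<and> v x < b} x) \<partial>lborel)" (is "ennreal ?c \<le> ?I")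
proof -
  have c0: "0 \<le> ?c" using ab by simp
  \<comment> \<open>Finiteness is what permits cancelling this integral from both sides
    below.\<close>
  have fin: "(\<integral>\<^sup>+x. ennreal (w x) \<partial>lborel) < \<infinity>"
  proof -
    have "(\<integral>\<^sup>+x. ennreal (w x) \<partial>lborel) \<le> (\<integral>\<^sup>+x. ennreal (b - a) * indicator (cball (0::'a) Q) x \<partial>lborel)"
    proof (intro nn_integral_mono)
      fix x
      show "ennreal (w x) \<le> ennreal (b - a) * indicator (cball 0 Q) x"
        using w_bounds[of x] v_supp[of x] ab by (cases "norm x \<le> Q") (auto simp: w_def ennreal_leI)
    qed
    also have "\<dots> < \<infinity>"
      using emeasure_bounded_finite[OF bounded_cball[of "0::'a" Q]] by (subst nn_integral_cmult_indicator) (auto simp: ennreal_mult_less_top)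
    finally show ?thesis .
  qed
  have "(\<integral>\<^sup>+x. ennreal (w x) \<partial>lborel) + ennreal (?c * r) \<le> (\<integral>\<^sup>+x. ennreal (W r x) \<partial>lborel)"
    using W_integral_ge[OF r(1) mb] by (simp add: mult_ac)
  also have "\<dots> \<le> (\<integral>\<^sup>+x. ennreal (w x) + ennreal r * ennreal ((norm (V x) + C * r) * indicator {x. a - L * r \<le> v x \<and> v x < b} x) \<partial>lborel)"
    using W_le[OF r] w_bounds r pos
    by (intro nn_integral_mono) (simp add: ennreal_leI mult_ac flip: ennreal_mult ennreal_plus)
  also have "\<dots> = (\<integral>\<^sup>+x. ennreal (w x) \<partial>lborel) + ennreal r * ?I"
    by (subst nn_integral_add) (auto simp: nn_integral_cmult)
  finally have "ennreal (?c * r) \<le> ennreal r * ?I"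
    using fin by (auto simp: ennreal_add_left_cancel_le)
  then have "ennreal r * ennreal ?c \<le> ennreal r * ?I"
    using r c0 by (simp add: ennreal_mult mult.commute)
  then show ?thesis using r by (subst (asm) ennreal_mult_le_mult_iff) auto
qed

text \<open>Let \<open>r\<close> tend to 0 in the preceding bound and multiply by the radius of the
  ball of volume \<open>m b\<close>: its surface area becomes n times its volume. Inside the slice
  \<open>v x < b\<close>, so the constant radius is at most the radius belonging to the level
  \<open>v x\<close>.\<close>

lemma slice_ineq:
  "ennreal (DIM('a) * (b - a) * m b)
     \<le> (\<integral>\<^sup>+x. ennreal (ball_radius TYPE('a) (m (v x)) * norm (V x)) * indicator {x. a \<le> v x \<and> v x < b} x \<partial>lborel)"
proof (cases "0 < m b")
  case False
  then have "m b = 0" using m_nonneg[of b] by linarith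
  then show ?thesis by simp
next
  case mb: True
  define c where "c = DIM('a) * unit_ball_vol (real DIM('a)) * ball_radius TYPE('a) (m b) ^ (DIM('a) - 1) * (b - a)"
  \<comment> \<open>Three constraints: \<open>\<delta>\<close> for the Taylor bound, 1 for a
    majorant independent of \<open>k\<close>, and \<open>a / (2 * (L + 1))\<close> to keep
    \<open>a - L * r k\<close> positive, so that the integrands vanish outside the ball of radius
    \<open>Q\<close>.\<close>
  define r where "r k = min \<delta> (min 1 (a / (2 * (L + 1)))) / real (Suc k)" for k
  have r0: "0 < r k" for k using pos ab by (simp add: r_def)
  have r1: "r k \<le> min \<delta> (min 1 (a / (2 * (L + 1))))" for k
  proof -
    define q where "q = min \<delta> (min 1 (a / (2 * (L + 1))))"
    have "0 < q" using pos ab by (simp add: q_def)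
    then have "q / real (Suc k) \<le> q / 1" by (intro divide_left_mono) auto
    then show ?thesis unfolding r_def q_def[symmetric] by simp
  qed
  have rlim: "r \<longlonglongrightarrow> 0" unfolding r_def by (intro LIMSEQ_divide_real_of_nat_Suc)
  have Lr: "L * r k \<le> a / 2" for k
  proof -
    have "L * r k \<le> (L + 1) * (a / (2 * (L + 1)))" using r1[of k] r0[of k] pos by (intro mult_mono) auto
    also have "\<dots> = a / 2"
    proof -
      have "L + 1 \<noteq> 0" using pos(3) by linarith
      then show ?thesis by (simp only: mult_divide_mult_cancel_left_if times_divide_eq_right mult.commute[of 2]) simp
    qed
    finally show ?thesis .
  qed
  have "compact (V ` cball 0 Q)" using contV by (intro compact_continuous_image continuous_on_subset[OF contV]) auto
  then have "bounded (V ` cball 0 Q)" by (rule compact_imp_bounded)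
  then obtain B where "\<forall>y\<in>V ` cball 0 Q. norm y \<le> B" unfolding bounded_iff by blast
  then have B: "norm (V x) \<le> B" if "norm x \<le> Q" for x using that by auto
  let ?f = "\<lambda>k x. ennreal ((norm (V x) + C * r k) * indicator {x. a - L * r k \<le> v x \<and> v x < b} x)"
  have "(\<lambda>k. \<integral>\<^sup>+x. ?f k x \<partial>lborel) \<longlonglongrightarrow> (\<integral>\<^sup>+x. ennreal (norm (V x) * indicator {x. a \<le> v x \<and> v x < b} x) \<partial>lborel)"
  proof (rule nn_integral_dominated_convergence[where w = "\<lambda>x. ennreal (B + C) * indicator (cball (0::'a) Q) x"])
    show "AE x in lborel. ?f k x \<le> ennreal (B + C) * indicator (cball 0 Q) x" for k
    proof (intro AE_I2)
      fix x :: 'a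
      show "?f k x \<le> ennreal (B + C) * indicator (cball 0 Q) x"
      proof (cases "norm x \<le> Q")
        case True
        have "C * r k \<le> C * 1" using r1[of k] pos by (intro mult_left_mono) auto
        then show ?thesis using True B[OF True] by (auto split: split_indicator intro!: ennreal_leI)
      next
        case False
        then have "v x = 0" by (simp add: v_supp)
        then show ?thesis using Lr[of k] ab by simp
      qed
    qed
    show "(\<integral>\<^sup>+x. ennreal (B + C) * indicator (cball (0::'a) Q) x \<partial>lborel) < \<infinity>"
      using emeasure_bounded_finite[OF bounded_cball[of "0::'a" Q]] by (subst nn_integral_cmult_indicator) (auto simp: ennreal_mult_less_top)
    show "AE x in lborel. (\<lambda>k. ?f k x) \<longlonglongrightarrow> ennreal (norm (V x) * indicator {x. a \<le> v x \<and> v x < b} x)"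
    proof (intro AE_I2 tendsto_ennrealI tendsto_mult)
      fix x
      show "(\<lambda>k. norm (V x) + C * r k) \<longlonglongrightarrow> norm (V x)"
        using tendsto_add[OF tendsto_const tendsto_mult[OF tendsto_const rlim], of "norm (V x)" C] by simp
      have "(\<lambda>k. a - L * r k) \<longlonglongrightarrow> a - L * 0" by (intro tendsto_intros rlim)
      then have lim: "(\<lambda>k. a - L * r k) \<longlonglongrightarrow> a" by simp
      \<comment> \<open>The thresholds approach \<open>a\<close> from below. Points with
        \<open>v x = a\<close> therefore belong to all the sets, and the limit set has the closed
        lower bound.\<close>
      have "\<forall>\<^sub>F k in sequentially. indicator {x. a \<le> v x \<and> v x < b} x = (indicator {x. a - L * r k \<le> v x \<and> v x < b} x :: real)"
      proof (cases "a \<le> v x")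
        case True
        have "a - L * r k \<le> v x" for k using True r0[of k] pos(3) by (smt (verit) mult_nonneg_nonneg)
        then show ?thesis using True by (intro always_eventually allI) (simp add: indicator_def)
      next
        case False
        then have "\<forall>\<^sub>F k in sequentially. v x < a - L * r k" using order_tendstoD(1)[OF lim, of "v x"] by simp
        then show ?thesis by eventually_elim (use False in auto)
      qed
      then show "(\<lambda>k. indicator {x. a - L * r k \<le> v x \<and> v x < b} x) \<longlonglongrightarrow> (indicator {x. a \<le> v x \<and> v x < b} x :: real)"
        by (rule Lim_transform_eventually[OF tendsto_const])
    qed
    have [measurable]: "cball (0::'a) Q \<in> sets borel" by (intro borel_closed closed_cball)
    show "(\<lambda>x. ennreal (B + C) * indicator (cball (0::'a) Q) x) \<in> borel_measurable lborel" by measurable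
  qed simp_all
  moreover have "ennreal c \<le> (\<integral>\<^sup>+x. ?f k x \<partial>lborel)" for k
    unfolding c_def using r1[of k] by (intro slice_ineq_r[OF r0 _ mb]) simp
  ultimately have *: "ennreal c \<le> (\<integral>\<^sup>+x. ennreal (norm (V x) * indicator {x. a \<le> v x \<and> v x < b} x) \<partial>lborel)"
    by (intro LIMSEQ_le_const) auto
  let ?R = "ball_radius TYPE('a) (m b)"
  have "DIM('a) * (b - a) * m b = ?R * c"
  proof -
    have "m b = unit_ball_vol (real DIM('a)) * (?R * ?R ^ (DIM('a) - 1))"
      using ball_radius_power[OF m_nonneg, where 'a='a] DIM_positive[where 'a='a] by (simp flip: power_Suc)
    then show ?thesis unfolding c_def by (metis mult.assoc mult.commute)
  qed
  also have "ennreal (?R * c) = ennreal ?R * ennreal c" by (intro ennreal_mult') simp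
  also have "\<dots> \<le> ennreal ?R * (\<integral>\<^sup>+x. ennreal (norm (V x) * indicator {x. a \<le> v x \<and> v x < b} x) \<partial>lborel)"
    using * by (intro mult_left_mono) auto
  also have "\<dots> = (\<integral>\<^sup>+x. ennreal ?R * ennreal (norm (V x) * indicator {x. a \<le> v x \<and> v x < b} x) \<partial>lborel)"
    by (intro nn_integral_cmult[symmetric]) simp
  also have "\<dots> \<le> (\<integral>\<^sup>+x. ennreal (ball_radius TYPE('a) (m (v x)) * norm (V x)) * indicator {x. a \<le> v x \<and> v x < b} x \<partial>lborel)"
  proof (intro nn_integral_mono)
    fix x
    show "ennreal ?R * ennreal (norm (V x) * indicator {x. a \<le> v x \<and> v x < b} x)
      \<le> ennreal (ball_radius TYPE('a) (m (v x)) * norm (V x)) * indicator {x. a \<le> v x \<and> v x < b} x"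
      by (auto split: split_indicator simp flip: ennreal_mult
          intro!: ennreal_leI mult_right_mono ball_radius_mono m_antimono)
  qed
  finally show ?thesis .
qed

end

lemma v_bounded: "\<exists>B. \<forall>x. v x \<le> B"
proof -
  have "compact (v ` cball 0 Q)" using cont_v by (intro compact_continuous_image continuous_on_subset[OF cont_v]) auto
  then have "bounded (v ` cball 0 Q)" by (rule compact_imp_bounded)
  then obtain B where "\<forall>y\<in>v ` cball 0 Q. norm y \<le> B" unfolding bounded_iff by blast
  then have B: "v x \<le> B" if "norm x \<le> Q" for x using that by (auto dest: bspec[where x = x])
  have "v x \<le> max B 0" for x using B[of x] v_supp[of x] by (cases "norm x \<le> Q") auto
  then show ?thesis by blast
qed

text \<open>Slices of height \<tau> = \<epsilon>' - \<epsilon> are stacked from the level \<epsilon>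
  upwards. The staircase of their upper levels falls short of \<open>v - \<epsilon>\<close> by at
  most \<tau>, which is the gap between the two thresholds; finitely many slices suffice and no
  limit is taken.\<close>

theorem level_set_inequality:
  assumes "0 < \<epsilon>" "\<epsilon> < \<epsilon>'"
  shows "ennreal DIM('a) * (\<integral>\<^sup>+x. ennreal (v x - \<epsilon>') \<partial>lborel)
     \<le> (\<integral>\<^sup>+x. ennreal (ball_radius TYPE('a) (m (v x)) * norm (V x)) * indicator {x. \<epsilon> \<le> v x} x \<partial>lborel)"
proof -
  define \<tau> where "\<tau> = \<epsilon>' - \<epsilon>"
  have \<tau>: "0 < \<tau>" using assms by (simp add: \<tau>_def)
  obtain B where B: "\<And>x. v x \<le> B" using v_bounded by blast
  obtain N :: nat where N: "B / \<tau> \<le> N" using real_arch_simple by blast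
  define a where "a j = \<epsilon> + real j * \<tau>" for j :: nat
  let ?g = "\<lambda>x. ennreal (ball_radius TYPE('a) (m (v x)) * norm (V x))"
  have a0: "0 < a j" and aS: "a j < a (Suc j)" for j using assms \<tau> by (auto simp: a_def add_pos_nonneg)
  have *: "ennreal (v x - \<epsilon>') \<le> (\<Sum>j<N. ennreal \<tau> * indicator {x. a (Suc j) < v x} x)" for x
  proof -
    have "v x - \<epsilon> \<le> N * \<tau>" using B[of x] N \<tau> assms by (simp add: field_simps)
    then have "(v x - \<epsilon>) - \<tau> \<le> (\<Sum>j<N. \<tau> * of_bool (Suc j * \<tau> < v x - \<epsilon>))" using \<tau> by (intro staircase_lower)
    also have "\<dots> = (\<Sum>j<N. \<tau> * indicator {x. a (Suc j) < v x} x)"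
      by (intro sum.cong) (auto simp: a_def indicator_def)
    finally have "ennreal (v x - \<epsilon>') \<le> ennreal (\<Sum>j<N. \<tau> * indicator {x. a (Suc j) < v x} x)"
      by (intro ennreal_leI) (simp add: \<tau>_def)
    also have "\<dots> = (\<Sum>j<N. ennreal (\<tau> * indicator {x. a (Suc j) < v x} x))" using \<tau> by (simp add: sum_ennreal)
    also have "\<dots> = (\<Sum>j<N. ennreal \<tau> * indicator {x. a (Suc j) < v x} x)"
      by (intro sum.cong) (auto split: split_indicator)
    finally show ?thesis .
  qed
  have "ennreal DIM('a) * (\<integral>\<^sup>+x. ennreal (v x - \<epsilon>') \<partial>lborel)
     \<le> ennreal DIM('a) * (\<integral>\<^sup>+x. (\<Sum>j<N. ennreal \<tau> * indicator {x. a (Suc j) < v x} x) \<partial>lborel)"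
    by (intro mult_left_mono nn_integral_mono *) auto
  also have "\<dots> = ennreal DIM('a) * (\<Sum>j<N. ennreal \<tau> * ennreal (m (a (Suc j))))"
    using less_imp_le[OF a0] by (subst nn_integral_sum) (auto simp: nn_integral_cmult m_emeasure)
  also have "\<dots> = (\<Sum>j<N. ennreal (DIM('a) * (a (Suc j) - a j) * m (a (Suc j))))"
    unfolding sum_distrib_left using \<tau> by (intro sum.cong) (auto simp: a_def algebra_simps simp flip: ennreal_mult)
  also have "\<dots> \<le> (\<Sum>j<N. \<integral>\<^sup>+x. ?g x * indicator {x. a j \<le> v x \<and> v x < a (Suc j)} x \<partial>lborel)"
    by (intro sum_mono slice_ineq a0 aS)
  also have "\<dots> = (\<integral>\<^sup>+x. (\<Sum>j<N. ?g x * indicator {x. a j \<le> v x \<and> v x < a (Suc j)} x) \<partial>lborel)"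
    by (intro nn_integral_sum[symmetric]) auto
  also have "\<dots> = (\<integral>\<^sup>+x. ?g x * indicator {x. a 0 \<le> v x \<and> v x < a N} x \<partial>lborel)"
  proof (intro nn_integral_cong)
    fix x
    have mono: "a 0 \<le> a k" for k using \<tau> by (simp add: a_def)
    have "(\<Sum>j<M. indicator {x. a j \<le> v x \<and> v x < a (Suc j)} x) = (indicator {x. a 0 \<le> v x \<and> v x < a M} x :: ennreal)" for M
    proof (induction M)
      case (Suc M)
      then show ?case using mono[of M] aS[of M] by (auto split: split_indicator)
    qed simp
    then show "(\<Sum>j<N. ?g x * indicator {x. a j \<le> v x \<and> v x < a (Suc j)} x) = ?g x * indicator {x. a 0 \<le> v x \<and> v x < a N} x"
      unfolding sum_distrib_left[symmetric] by simp
  qed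
  also have "\<dots> \<le> (\<integral>\<^sup>+x. ?g x * indicator {x. \<epsilon> \<le> v x} x \<partial>lborel)"
    by (intro nn_integral_mono) (auto simp: a_def split: split_indicator)
  finally show ?thesis .
qed

end

section \<open>Test fields and mollification\<close>

lemma test_fieldsI:
  fixes \<phi> :: "'a::euclidean_space \<Rightarrow> 'a"
  assumes d: "\<And>x. (\<phi> has_derivative \<phi>' x) (at x)" and c: "\<And>v. continuous_on UNIV (\<lambda>x. \<phi>' x v)"
    and K: "compact K" "K \<subseteq> U" "\<And>x. x \<notin> K \<Longrightarrow> \<phi> x = 0"
  shows "\<phi> \<in> test_fields U"
proof -
  have fd: "frechet_derivative \<phi> (at x) = \<phi>' x" for x using frechet_derivative_at[OF d] by simp
  have "closure {x. \<phi> x \<noteq> 0} \<subseteq> K" using K compact_imp_closed by (intro closure_minimal) auto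
  moreover from this have "compact (closure {x. \<phi> x \<noteq> 0})"
    using K(1) by (metis closed_closure compact_Int_closed inf.absorb_iff2)
  ultimately show ?thesis
    using K(2) d c unfolding test_fields_def differentiable_on_def differentiable_def
    by (auto simp: fd intro: has_derivative_at_withinI)
qed

lemma test_fieldsD:
  fixes \<phi> :: "'a::euclidean_space \<Rightarrow> 'a"
  assumes "\<phi> \<in> test_fields U"
  shows "(\<phi> has_derivative frechet_derivative \<phi> (at x)) (at x)"
    and "continuous_on UNIV (\<lambda>x. frechet_derivative \<phi> (at x) v)"
    and "compact (closure {x. \<phi> x \<noteq> 0})" "closure {x. \<phi> x \<noteq> 0} \<subseteq> U"
    and "x \<notin> closure {x. \<phi> x \<noteq> 0} \<Longrightarrow> \<phi> x = 0"
    and "x \<notin> closure {x. \<phi> x \<noteq> 0} \<Longrightarrow> frechet_derivative \<phi> (at x) v = 0"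
proof -
  let ?K = "closure {x. \<phi> x \<noteq> 0}" and ?d = "\<lambda>x. frechet_derivative \<phi> (at x)"
  show d: "(\<phi> has_derivative ?d x) (at x)" for x
    using assms unfolding test_fields_def differentiable_on_def
    by (auto simp: frechet_derivative_works[symmetric])
  show "continuous_on UNIV (\<lambda>x. ?d x v)" "compact ?K" "?K \<subseteq> U" using assms by (simp_all add: test_fields_def)
  show z: "x \<notin> ?K \<Longrightarrow> \<phi> x = 0" for x using closure_subset[of "{x. \<phi> x \<noteq> 0}"] by auto
  assume x: "x \<notin> ?K"
  have "((\<lambda>_. 0) has_derivative ?d x) (at x)"
  proof (rule has_derivative_transform_within_open[OF d])
    show "open (- ?K)" by (rule open_Compl) simp
    show "x \<in> - ?K" using x by simp
    show "\<phi> y = 0" if "y \<in> - ?K" for y using that z[of y] by simp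
  qed
  then have "?d x = (\<lambda>_. 0)" using has_derivative_unique[OF _ has_derivative_const] by blast
  then show "?d x v = 0" by simp
qed

lemma test_field_regular:
  fixes \<phi> :: "'a::euclidean_space \<Rightarrow> 'a"
  assumes \<phi>: "\<phi> \<in> test_fields U"
  shows test_field_continuous: "continuous_on UNIV \<phi>"
    and divergence_continuous: "continuous_on UNIV (divergence \<phi>)"
    and test_field_bounded: "\<exists>B>0. \<forall>x. norm (\<phi> x) \<le> B"
    and divergence_bounded: "\<exists>B>0. \<forall>x. \<bar>divergence \<phi> x\<bar> \<le> B"
    and test_field_support: "\<exists>K. compact K \<and> K \<subseteq> U \<and> (\<forall>x. x \<notin> K \<longrightarrow> \<phi> x = 0 \<and> divergence \<phi> x = 0)"
    and test_field_lipschitz: "\<exists>L>0. \<forall>x y. norm (\<phi> x - \<phi> y) \<le> L * norm (x - y)"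
proof -
  let ?K = "closure {x. \<phi> x \<noteq> 0}" and ?d = "\<lambda>x. frechet_derivative \<phi> (at x)"
  note d = test_fieldsD(1,2)[OF \<phi>] and K = test_fieldsD(3,4,5,6)[OF \<phi>]
  have div: "divergence \<phi> x = (\<Sum>b\<in>Basis. ?d x b \<bullet> b)" for x unfolding divergence_def ..
  show c1: "continuous_on UNIV \<phi>"
    by (intro continuous_at_imp_continuous_on ballI has_derivative_continuous[OF d(1)])
  have "divergence \<phi> = (\<lambda>x. \<Sum>b\<in>Basis. ?d x b \<bullet> b)" using div by auto
  then show c2: "continuous_on UNIV (divergence \<phi>)" using d(2) by (auto intro!: continuous_intros)
  have bd: "\<exists>B>0. \<forall>x. norm (f x) \<le> B" if f: "continuous_on UNIV f" "\<And>x. x \<notin> ?K \<Longrightarrow> f x = 0" for f :: "'a \<Rightarrow> 'b::real_normed_vector"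
  proof -
    have "compact (f ` ?K)" using f(1) K(1) continuous_on_subset by (intro compact_continuous_image) auto
    then have "bounded (f ` ?K)" by (rule compact_imp_bounded)
    then obtain B where B: "0 < B" "\<forall>y\<in>f ` ?K. norm y \<le> B" unfolding bounded_pos by blast
    have "norm (f x) \<le> B" for x using B f(2)[of x] by (cases "x \<in> ?K") auto
    then show ?thesis using B by blast
  qed
  show "\<exists>B>0. \<forall>x. norm (\<phi> x) \<le> B" using bd[OF c1] K(3) by blast
  show "\<exists>B>0. \<forall>x. \<bar>divergence \<phi> x\<bar> \<le> B" using bd[OF c2] K(4) by (auto simp: div)
  show "\<exists>K. compact K \<and> K \<subseteq> U \<and> (\<forall>x. x \<notin> K \<longrightarrow> \<phi> x = 0 \<and> divergence \<phi> x = 0)"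
    by (intro exI[of _ ?K] conjI allI impI K(1,2)) (erule K(3), simp add: div K(4))
  have "\<forall>b. \<exists>B>0. \<forall>x. norm (?d x b) \<le> B" using bd[OF d(2)] K(4) by blast
  then obtain B where B: "\<And>b. 0 < B b" "\<And>b x. norm (?d x b) \<le> B b" by metis
  define L where "L = (\<Sum>b\<in>(Basis::'a set). B b)"
  have L: "0 < L" unfolding L_def using B(1) by (intro sum_pos) auto
  \<comment> \<open>Bounds on the partial derivatives add up to a bound on the operator norm, by
    expanding the increment along the basis.\<close>
  have on: "onorm (?d x) \<le> L" for x
  proof (rule onorm_le)
    fix h
    have bl: "bounded_linear (?d x)" using d(1) has_derivative_bounded_linear by blast
    have "?d x h = ?d x (\<Sum>b\<in>Basis. (h \<bullet> b) *\<^sub>R b)" by (simp add: euclidean_representation)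
    also have "\<dots> = (\<Sum>b\<in>Basis. (h \<bullet> b) *\<^sub>R ?d x b)"
      using bl by (simp add: linear_sum bounded_linear.linear linear_scale)
    also have "norm \<dots> \<le> (\<Sum>b\<in>Basis. norm h * B b)"
      by (intro sum_norm_le) (auto intro!: mult_mono B simp: Basis_le_norm)
    finally show "norm (?d x h) \<le> L * norm h" by (simp add: L_def sum_distrib_left mult.commute)
  qed
  have "norm (\<phi> x - \<phi> y) \<le> L * norm (x - y)" for x y
    by (rule differentiable_bound[of UNIV \<phi> ?d, OF _ _ on]) (auto intro: has_derivative_at_withinI[OF d(1)])
  then show "\<exists>L>0. \<forall>x y. norm (\<phi> x - \<phi> y) \<le> L * norm (x - y)" using L by blast
qed

lemma test_field_measurable [measurable_dest]:
  "\<phi> \<in> test_fields U \<Longrightarrow> \<phi> \<in> borel_measurable borel"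
  using test_field_continuous borel_measurable_continuous_onI by blast

lemma divergence_measurable:
  "\<phi> \<in> test_fields U \<Longrightarrow> divergence \<phi> \<in> borel_measurable borel"
  using divergence_continuous borel_measurable_continuous_onI by blast

lemma test_fields_mono: "U \<subseteq> U' \<Longrightarrow> test_fields U \<subseteq> test_fields U'"
  by (auto simp: test_fields_def)

lemma test_fields_zero: "(\<lambda>_. 0) \<in> test_fields U"
  by (rule test_fieldsI[where \<phi>' = "\<lambda>_ _. 0" and K = "{}"]) auto

lemma test_fields_add:
  fixes \<phi> \<psi> :: "'a::euclidean_space \<Rightarrow> 'a"
  assumes "\<phi> \<in> test_fields U" "\<psi> \<in> test_fields U"
  shows "(\<lambda>x. \<phi> x + \<psi> x) \<in> test_fields U"
proof -
  note 1 = test_fieldsD[OF assms(1)]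
  note 2 = test_fieldsD[OF assms(2)]
  show ?thesis
  proof (rule test_fieldsI)
    show "((\<lambda>x. \<phi> x + \<psi> x) has_derivative (\<lambda>h. frechet_derivative \<phi> (at x) h + frechet_derivative \<psi> (at x) h)) (at x)" for x
      by (rule has_derivative_add[OF 1(1) 2(1)])
    show "continuous_on UNIV (\<lambda>x. frechet_derivative \<phi> (at x) v + frechet_derivative \<psi> (at x) v)" for v
      by (rule continuous_on_add[OF 1(2) 2(2)])
    show "compact (closure {x. \<phi> x \<noteq> 0} \<union> closure {x. \<psi> x \<noteq> 0})" by (rule compact_Un[OF 1(3) 2(3)])
    show "closure {x. \<phi> x \<noteq> 0} \<union> closure {x. \<psi> x \<noteq> 0} \<subseteq> U" by (rule Un_least[OF 1(4) 2(4)])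
    show "\<phi> x + \<psi> x = 0" if x: "x \<notin> closure {x. \<phi> x \<noteq> 0} \<union> closure {x. \<psi> x \<noteq> 0}" for x
    proof -
      have "\<phi> x = 0" by (rule 1(5)) (use x in blast)
      moreover have "\<psi> x = 0" by (rule 2(5)) (use x in blast)
      ultimately show ?thesis by simp
    qed
  qed
qed

lemma test_fields_mult:
  fixes \<phi> :: "'a::euclidean_space \<Rightarrow> 'a" and s :: "'a \<Rightarrow> real"
  assumes "\<phi> \<in> test_fields U" and s: "\<And>x. (s has_derivative s' x) (at x)" "\<And>v. continuous_on UNIV (\<lambda>x. s' x v)"
  shows "(\<lambda>x. s x *\<^sub>R \<phi> x) \<in> test_fields U"
proof -
  note 1 = test_fieldsD[OF assms(1)]
  have cs: "continuous_on UNIV s"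
    by (intro continuous_at_imp_continuous_on ballI has_derivative_continuous[OF s(1)])
  show ?thesis
  proof (rule test_fieldsI[OF _ _ 1(3,4)])
    show "((\<lambda>x. s x *\<^sub>R \<phi> x) has_derivative (\<lambda>h. s x *\<^sub>R frechet_derivative \<phi> (at x) h + s' x h *\<^sub>R \<phi> x)) (at x)" for x
      by (rule has_derivative_scaleR[OF s(1) 1(1)])
    show "continuous_on UNIV (\<lambda>x. s x *\<^sub>R frechet_derivative \<phi> (at x) v + s' x v *\<^sub>R \<phi> x)" for v
      by (intro continuous_on_add continuous_on_scaleR cs s(2) 1(2)
          test_field_continuous[OF assms(1)])
    show "s x *\<^sub>R \<phi> x = 0" if x: "x \<notin> closure {x. \<phi> x \<noteq> 0}" for x
      using 1(5)[OF x] by simp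
  qed
qed

text \<open>The divergence of a field of constant direction is one directional derivative of its
  scalar factor; testing with such fields extracts a single component of a distributional
  gradient.\<close>

lemma test_fields_scalar:
  fixes \<theta> :: "'a::euclidean_space \<Rightarrow> real"
  assumes s: "\<And>x. (\<theta> has_derivative (\<lambda>h. G x \<bullet> h)) (at x)" "continuous_on UNIV G"
    and K: "compact K" "K \<subseteq> U" "\<And>x. x \<notin> K \<Longrightarrow> \<theta> x = 0"
  shows "(\<lambda>x. \<theta> x *\<^sub>R c) \<in> test_fields U" "divergence (\<lambda>x. \<theta> x *\<^sub>R c) x = G x \<bullet> c"
proof -
  have d: "((\<lambda>x. \<theta> x *\<^sub>R c) has_derivative (\<lambda>h. (G x \<bullet> h) *\<^sub>R c)) (at x)" for x
    using s(1) by (intro has_derivative_scaleR_left)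
  then show "(\<lambda>x. \<theta> x *\<^sub>R c) \<in> test_fields U"
    by (rule test_fieldsI[OF _ _ K(1,2)]) (use s K in \<open>auto intro!: continuous_intros\<close>)
  show "divergence (\<lambda>x. \<theta> x *\<^sub>R c) x = G x \<bullet> c"
    unfolding divergence_def frechet_derivative_at[OF d, symmetric]
    by (subst euclidean_inner) (simp add: mult_ac)
qed

section \<open>The mollifier\<close>

lemma has_derivative_quadI:
  fixes f :: "'a::real_normed_vector \<Rightarrow> 'b::real_normed_vector"
  assumes "bounded_linear D" "0 < \<delta>" and q: "\<And>h. norm h \<le> \<delta> \<Longrightarrow> norm (f (x + h) - f x - D h) \<le> C * (norm h)\<^sup>2"
  shows "(f has_derivative D) (at x)"
  unfolding has_derivative_at
proof (intro conjI assms(1))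
  show "(\<lambda>h. norm (f (x + h) - f x - D h) / norm h) \<midarrow>0\<rightarrow> 0"
  proof (rule tendsto_sandwich)
    show "\<forall>\<^sub>F h in at 0. 0 \<le> norm (f (x + h) - f x - D h) / norm h" by simp
    show "\<forall>\<^sub>F h in at 0. norm (f (x + h) - f x - D h) / norm h \<le> C * norm h"
      unfolding eventually_at
    proof (intro exI[of _ \<delta>] conjI ballI impI assms(2))
      fix h :: 'a assume h: "h \<noteq> 0 \<and> dist h 0 < \<delta>"
      then have "norm (f (x + h) - f x - D h) \<le> C * norm h * norm h"
        using q[of h] by (simp add: power2_eq_square mult.assoc)
      then show "norm (f (x + h) - f x - D h) / norm h \<le> C * norm h" using h by (simp add: divide_le_eq)
    qed
    show "((\<lambda>h. C * norm h) \<longlongrightarrow> 0) (at 0)" by (auto intro!: tendsto_eq_intros)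
  qed simp
qed

text \<open>A truncated polynomial is smooth enough: squaring the truncation makes it continuously
  differentiable with a quadratic Taylor remainder, as test fields and \<open>compact_C11\<close>
  demand.\<close>

definition bump :: "real \<Rightarrow> 'a::euclidean_space \<Rightarrow> real" where
  "bump \<delta> x = (max 0 (\<delta>\<^sup>2 - (norm x)\<^sup>2))\<^sup>2"

definition mollifier :: "real \<Rightarrow> 'a::euclidean_space \<Rightarrow> real" where
  "mollifier \<delta> x = bump \<delta> x / (\<integral>y. bump \<delta> (y::'a) \<partial>lborel)"

definition mollifier_grad :: "real \<Rightarrow> 'a::euclidean_space \<Rightarrow> 'a" where
  "mollifier_grad \<delta> x = (- 4 * max 0 (\<delta>\<^sup>2 - (norm x)\<^sup>2) / (\<integral>y. bump \<delta> (y::'a) \<partial>lborel)) *\<^sub>R x"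

lemma bump_continuous: "continuous_on A (bump \<delta>)"
  unfolding bump_def[abs_def] by (intro continuous_intros)

lemma bump_outside: "0 < \<delta> \<Longrightarrow> \<delta> \<le> norm x \<Longrightarrow> bump \<delta> x = 0"
  unfolding bump_def by (simp add: max_def power_mono)

lemma bump_integrable:
  assumes "0 < \<delta>" shows "integrable lborel (bump \<delta> :: 'a::euclidean_space \<Rightarrow> real)"
proof -
  have "integrable lborel (\<lambda>x::'a. indicator (cball 0 \<delta>) x *\<^sub>R bump \<delta> x)"
    by (rule borel_integrable_compact) (auto intro: bump_continuous)
  moreover have "(\<lambda>x::'a. indicator (cball 0 \<delta>) x *\<^sub>R bump \<delta> x) = bump \<delta>"
    using assms by (auto simp: fun_eq_iff bump_outside split: split_indicator)
  ultimately show ?thesis by simp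
qed

lemma bump_integral_pos:
  assumes "0 < \<delta>" shows "0 < (\<integral>y. bump \<delta> (y::'a::euclidean_space) \<partial>lborel)"
proof -
  \<comment> \<open>On the ball of radius \<open>\<delta> / 2\<close> the difference of the squares
    is at least three quarters of \<open>\<delta>\<^sup>2\<close>.\<close>
  let ?c = "(3 / 4 * \<delta>\<^sup>2)\<^sup>2"
  have "0 < ?c * measure lborel (ball (0::'a) (\<delta> / 2))" using assms by simp
  also have "\<dots> = (\<integral>y. ?c * indicator (ball (0::'a) (\<delta> / 2)) y \<partial>lborel)" by simp
  also have "\<dots> \<le> (\<integral>y. bump \<delta> (y::'a) \<partial>lborel)"
  proof (rule integral_mono)
    show "integrable lborel (\<lambda>y. ?c * indicator (ball (0::'a) (\<delta> / 2)) y)"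
      by (intro integrable_mult_right integrable_real_indicator) (simp, rule emeasure_bounded_finite[OF bounded_ball])
    fix y :: 'a
    have "?c \<le> bump \<delta> y" if "norm y < \<delta> / 2"
    proof -
      have "(norm y)\<^sup>2 \<le> (\<delta> / 2)\<^sup>2" using that by (intro power_mono) auto
      then show ?thesis unfolding bump_def by (intro power_mono) (auto simp: power2_eq_square le_max_iff_disj)
    qed
    then show "?c * indicator (ball 0 (\<delta> / 2)) y \<le> bump \<delta> y"
      by (auto simp: bump_def split: split_indicator)
  qed (use bump_integrable[OF assms] in auto)
  finally show ?thesis .
qed

context
  fixes \<delta> :: real assumes \<delta>: "0 < \<delta>"
begin

lemma mollifier_nonneg: "0 \<le> mollifier \<delta> (x::'a::euclidean_space)"
  unfolding mollifier_def using less_imp_le[OF bump_integral_pos[OF \<delta>]] by (auto simp: bump_def)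

lemma mollifier_continuous: "continuous_on A (mollifier \<delta> :: 'a::euclidean_space \<Rightarrow> real)"
  unfolding mollifier_def[abs_def] using bump_integral_pos[OF \<delta>, where 'a='a] bump_continuous[of A \<delta>]
  by (intro continuous_on_divide) auto

lemma mollifier_grad_continuous: "continuous_on A (mollifier_grad \<delta> :: 'a::euclidean_space \<Rightarrow> 'a)"
  unfolding mollifier_grad_def[abs_def] using bump_integral_pos[OF \<delta>, where 'a='a]
  by (intro continuous_intros) auto

lemma mollifier_measurable [measurable]: "(mollifier \<delta> :: 'a::euclidean_space \<Rightarrow> real) \<in> borel_measurable borel"
  using mollifier_continuous by (rule borel_measurable_continuous_onI)

lemma mollifier_grad_measurable [measurable]: "(mollifier_grad \<delta> :: 'a::euclidean_space \<Rightarrow> 'a) \<in> borel_measurable borel"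
  using mollifier_grad_continuous by (rule borel_measurable_continuous_onI)

lemma mollifier_outside: "\<delta> \<le> norm x \<Longrightarrow> mollifier \<delta> x = 0"
  using \<delta> by (simp add: mollifier_def bump_outside)

lemma mollifier_grad_outside: "\<delta> \<le> norm x \<Longrightarrow> mollifier_grad \<delta> x = 0"
  using \<delta> by (simp add: mollifier_grad_def max_def power_mono)

lemma mollifier_integrable: "integrable lborel (mollifier \<delta> :: 'a::euclidean_space \<Rightarrow> real)"
  unfolding mollifier_def[abs_def] divide_inverse by (intro integrable_mult_left bump_integrable \<delta>)

lemma mollifier_integral: "(\<integral>x. mollifier \<delta> (x::'a::euclidean_space) \<partial>lborel) = 1"
  unfolding mollifier_def[abs_def] using bump_integral_pos[OF \<delta>, where 'a='a] by simp

lemma mollifier_bounded: "\<exists>B. \<forall>x::'a::euclidean_space. mollifier \<delta> x \<le> B"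
proof (intro exI allI)
  fix x :: 'a
  have "bump \<delta> x \<le> (\<delta>\<^sup>2)\<^sup>2" unfolding bump_def by (intro power_mono) auto
  then show "mollifier \<delta> x \<le> (\<delta>\<^sup>2)\<^sup>2 / (\<integral>y. bump \<delta> (y::'a) \<partial>lborel)"
    unfolding mollifier_def using bump_integral_pos[OF \<delta>, where 'a='a] by (intro divide_right_mono) auto
qed

lemma mollifier_grad_bounded: "\<exists>B. \<forall>x::'a::euclidean_space. norm (mollifier_grad \<delta> x) \<le> B"
proof -
  have "compact (mollifier_grad \<delta> ` cball (0::'a) \<delta>)"
    by (intro compact_continuous_image mollifier_grad_continuous) auto
  then have "bounded (mollifier_grad \<delta> ` cball (0::'a) \<delta>)" by (rule compact_imp_bounded)
  then obtain B where B: "\<forall>y\<in>mollifier_grad \<delta> ` cball (0::'a) \<delta>. norm y \<le> B" unfolding bounded_iff by blast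
  have "norm (mollifier_grad \<delta> x) \<le> max B 0" for x :: 'a
    using B mollifier_grad_outside[of x] by (cases "norm x \<le> \<delta>") (auto simp: le_max_iff_disj)
  then show ?thesis by blast
qed

text \<open>The function (max 0 s)^2 has derivative 2 max 0 s, which is Lipschitz with constant 2;
  half of this constant bounds the second-order remainder.\<close>

lemma max_square_remainder:
  fixes s d :: real
  shows "\<bar>(max 0 (s + d))\<^sup>2 - (max 0 s)\<^sup>2 - 2 * max 0 s * d\<bar> \<le> d\<^sup>2"
proof -
  consider "0 \<le> s" "0 \<le> s + d" | "0 \<le> s" "s + d < 0" | "s < 0" "0 \<le> s + d" | "s < 0" "s + d < 0" by linarith
  then show ?thesis
  proof cases
    case 1 then show ?thesis by (simp add: power2_eq_square algebra_simps)
  next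
    case 2
    then have "s * s \<le> (-d) * (-d)" by (intro mult_mono) auto
    moreover have "0 \<le> - s * (s + 2 * d)" using 2 by (intro mult_nonpos_nonpos) auto
    moreover have "0 \<le> (s + d) * (s + d)" by simp
    ultimately show ?thesis using 2 by (simp add: power2_eq_square algebra_simps abs_le_iff)
  next
    case 3
    then have "(s + d) * (s + d) \<le> d * d" by (intro mult_mono) auto
    then show ?thesis using 3 by (simp add: power2_eq_square)
  qed simp
qed

lemma mollifier_quad:
  "\<exists>C\<ge>0. \<forall>(x::'a::euclidean_space) h. norm h \<le> \<delta> \<longrightarrow>
     \<bar>mollifier \<delta> (x + h) - mollifier \<delta> x - mollifier_grad \<delta> x \<bullet> h\<bar> \<le> C * (norm h)\<^sup>2"
proof -
  define Z where "Z = (\<integral>y. bump \<delta> (y::'a) \<partial>lborel)"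
  have Z: "0 < Z" unfolding Z_def by (rule bump_integral_pos[OF \<delta>])
  \<comment> \<open>27 = 25 + 2: the increment \<open>d\<close> of the difference of squares is at
    most \<open>5 * \<delta> * norm h\<close>, and its part quadratic in \<open>h\<close>,
    multiplied by the derivative, contributes
    \<open>2 * \<delta>\<^sup>2 * (norm h)\<^sup>2\<close>.\<close>
  have main: "\<bar>mollifier \<delta> (x + h) - mollifier \<delta> x - mollifier_grad \<delta> x \<bullet> h\<bar> \<le> (27 * \<delta>\<^sup>2 / Z) * (norm h)\<^sup>2"
    if h: "norm h \<le> \<delta>" for x h :: 'a
  \<comment> \<open>Beyond distance \<open>2 * \<delta>\<close> both \<open>x\<close> and
    \<open>x + h\<close> lie outside the support; within it, \<open>x \<bullet> h\<close> is at most
    \<open>2 * \<delta> * norm h\<close>.\<close>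
  proof (cases "norm x \<le> 2 * \<delta>")
    case False
    then have "\<delta> \<le> norm (x + h)" using h norm_diff_ineq[of x h] by linarith
    then show ?thesis using False \<delta> Z by (simp add: mollifier_outside mollifier_grad_outside)
  next
    case True
    define s where "s = \<delta>\<^sup>2 - (norm x)\<^sup>2"
    define d where "d = - 2 * (x \<bullet> h) - (norm h)\<^sup>2"
    have sd: "\<delta>\<^sup>2 - (norm (x + h))\<^sup>2 = s + d"
      unfolding s_def d_def power2_norm_eq_inner by (simp add: inner_add_left inner_add_right inner_commute)
    have "Z * (mollifier \<delta> (x + h) - mollifier \<delta> x - mollifier_grad \<delta> x \<bullet> h)
        = (max 0 (s + d))\<^sup>2 - (max 0 s)\<^sup>2 + 4 * max 0 s * (x \<bullet> h)"
      using Z unfolding mollifier_def mollifier_grad_def bump_def sd Z_def[symmetric] s_def[symmetric]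
      by (simp add: right_diff_distrib distrib_left)
    also have "\<dots> = ((max 0 (s + d))\<^sup>2 - (max 0 s)\<^sup>2 - 2 * max 0 s * d) - 2 * max 0 s * (norm h)\<^sup>2"
      unfolding d_def by (simp add: algebra_simps)
    also have "\<bar>\<dots>\<bar> \<le> d\<^sup>2 + 2 * \<delta>\<^sup>2 * (norm h)\<^sup>2"
    proof -
      have "\<bar>2 * max 0 s * (norm h)\<^sup>2\<bar> \<le> 2 * \<delta>\<^sup>2 * (norm h)\<^sup>2"
        unfolding abs_mult by (intro mult_mono) (auto simp: s_def)
      then show ?thesis using max_square_remainder[of s d] by linarith
    qed
    also have "d\<^sup>2 \<le> (5 * \<delta> * norm h)\<^sup>2"
    proof -
      have "\<bar>x \<bullet> h\<bar> \<le> 2 * \<delta> * norm h"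
        using Cauchy_Schwarz_ineq2[of x h] mult_right_mono[OF True, of "norm h"] by simp
      moreover have "(norm h)\<^sup>2 \<le> \<delta> * norm h" unfolding power2_eq_square using h by (intro mult_right_mono) auto
      moreover have "0 \<le> (norm h)\<^sup>2" by simp
      ultimately have "\<bar>d\<bar> \<le> 5 * \<delta> * norm h" unfolding d_def by linarith
      then show ?thesis using power_mono[of "\<bar>d\<bar>" "5 * \<delta> * norm h" 2] by simp
    qed
    finally have "\<bar>Z * (mollifier \<delta> (x + h) - mollifier \<delta> x - mollifier_grad \<delta> x \<bullet> h)\<bar> \<le> 27 * \<delta>\<^sup>2 * (norm h)\<^sup>2"
      by (simp add: power_mult_distrib)
    then have "\<bar>mollifier \<delta> (x + h) - mollifier \<delta> x - mollifier_grad \<delta> x \<bullet> h\<bar> * Z \<le> 27 * \<delta>\<^sup>2 * (norm h)\<^sup>2"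
      unfolding abs_mult using Z by (simp add: mult.commute)
    then show ?thesis using Z by (simp only: pos_le_divide_eq[symmetric] times_divide_eq_left)
  qed
  then show ?thesis using Z by (intro exI[of _ "27 * \<delta>\<^sup>2 / Z"]) auto
qed

lemma mollifier_has_derivative:
  "(mollifier \<delta> has_derivative (\<lambda>h. mollifier_grad \<delta> x \<bullet> h)) (at (x::'a::euclidean_space))"
proof -
  obtain C where "\<forall>(x::'a) h. norm h \<le> \<delta> \<longrightarrow>
     \<bar>mollifier \<delta> (x + h) - mollifier \<delta> x - mollifier_grad \<delta> x \<bullet> h\<bar> \<le> C * (norm h)\<^sup>2"
    using mollifier_quad by blast
  then show ?thesis
    by (intro has_derivative_quadI[OF bounded_linear_inner_right \<delta>, where C = C]) auto
qed

lemma mollifier_lipschitz: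
  "\<exists>L\<ge>0. \<forall>x y::'a::euclidean_space. \<bar>mollifier \<delta> x - mollifier \<delta> y\<bar> \<le> L * norm (x - y)"
proof -
  obtain B where B: "\<And>x::'a. norm (mollifier_grad \<delta> x) \<le> B" using mollifier_grad_bounded by blast
  then have B0: "0 \<le> B" using norm_ge_zero order_trans by blast
  have "norm (mollifier \<delta> x - mollifier \<delta> y) \<le> B * norm (x - y)" for x y :: 'a
  proof (rule differentiable_bound[of UNIV])
    fix z :: 'a
    show "(mollifier \<delta> has_derivative (\<lambda>h. mollifier_grad \<delta> z \<bullet> h)) (at z within UNIV)"
      by (simp add: mollifier_has_derivative)
    show "onorm (\<lambda>h. mollifier_grad \<delta> z \<bullet> h) \<le> B"
    proof (rule onorm_le)
      fix h
      show "norm (mollifier_grad \<delta> z \<bullet> h) \<le> B * norm h"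
        using Cauchy_Schwarz_ineq2[of "mollifier_grad \<delta> z" h] mult_right_mono[OF B[of z], of "norm h"] by simp
    qed
  qed auto
  then show ?thesis using B0 by auto
qed

end

section \<open>Mollification of functions and of vector measures\<close>

lemma nn_integral_lborel_shift:
  fixes a :: "'a::euclidean_space"
  assumes [measurable]: "f \<in> borel_measurable borel"
  shows "(\<integral>\<^sup>+x. f (x - a) \<partial>lborel) = (\<integral>\<^sup>+x. f x \<partial>lborel)"
proof -
  have "(\<integral>\<^sup>+x. f x \<partial>lborel) = (\<integral>\<^sup>+x. f x \<partial>distr lborel borel ((+) (- a)))" by (simp add: lborel_distr_plus)
  also have "\<dots> = (\<integral>\<^sup>+x. f (x - a) \<partial>lborel)" by (subst nn_integral_distr) (auto simp: algebra_simps)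
  finally show ?thesis by simp
qed

lemma integral_lborel_reflect:
  fixes a :: "'a::euclidean_space" and f :: "'a \<Rightarrow> real"
  assumes [measurable]: "f \<in> borel_measurable borel"
  shows "(\<integral>x. f (a - x) \<partial>lborel) = (\<integral>x. f x \<partial>lborel)"
proof -
  have "(lborel :: 'a measure) = density (distr lborel borel (\<lambda>x. a + (-1) *\<^sub>R x)) (\<lambda>_. \<bar>-1::real\<bar> ^ DIM('a))"
    by (rule lborel_affine) simp
  then have *: "(lborel :: 'a measure) = distr lborel borel (\<lambda>x. a - x)" by (simp add: density_1)
  have "(\<integral>x. f x \<partial>lborel) = (\<integral>x. f x \<partial>distr lborel borel (\<lambda>x. a - x))" by (subst *) simp
  also have "\<dots> = (\<integral>x. f (a - x) \<partial>lborel)" by (rule integral_distr) auto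
  finally show ?thesis by simp
qed

text \<open>The base measure is a parameter: over \<open>lborel\<close> this mollifies a function,
  over a singular measure with its polar density it mollifies a vector measure.\<close>

definition mollify :: "real \<Rightarrow> 'a::euclidean_space measure \<Rightarrow> ('a \<Rightarrow> 'b::euclidean_space) \<Rightarrow> 'a \<Rightarrow> 'b" where
  "mollify \<delta> M f x = (\<integral>y. mollifier \<delta> (x - y) *\<^sub>R f y \<partial>M)"

definition mollify_grad :: "real \<Rightarrow> 'a::euclidean_space measure \<Rightarrow> ('a \<Rightarrow> real) \<Rightarrow> 'a \<Rightarrow> 'a" where
  "mollify_grad \<delta> M f x = (\<integral>y. f y *\<^sub>R mollifier_grad \<delta> (x - y) \<partial>M)"

lemma integrable_mollify:
  fixes f :: "'a::euclidean_space \<Rightarrow> 'b::euclidean_space"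
  assumes d: "0 < \<delta>" and M[measurable_cong]: "sets M = sets borel" and f: "integrable M f"
  shows "integrable M (\<lambda>y. mollifier \<delta> (x - y) *\<^sub>R f y)"
proof -
  note [measurable] = mollifier_measurable[OF d] borel_measurable_integrable[OF f]
  obtain B where B: "\<And>z::'a. mollifier \<delta> z \<le> B" using mollifier_bounded[OF d] by blast
  show ?thesis
  proof (rule Bochner_Integration.integrable_bound)
    show "integrable M (\<lambda>y. B *\<^sub>R f y)" using f by simp
    have "norm (mollifier \<delta> (x - y) *\<^sub>R f y) \<le> norm (B *\<^sub>R f y)" for y
      unfolding norm_scaleR using B[of "x - y"] mollifier_nonneg[OF d, of "x - y"] by (intro mult_right_mono) auto
    then show "AE y in M. norm (mollifier \<delta> (x - y) *\<^sub>R f y) \<le> norm (B *\<^sub>R f y)" by simp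
  qed measurable
qed

lemma integrable_mollify_grad:
  fixes f :: "'a::euclidean_space \<Rightarrow> real"
  assumes d: "0 < \<delta>" and M[measurable_cong]: "sets M = sets borel" and f: "integrable M f"
  shows "integrable M (\<lambda>y. f y *\<^sub>R mollifier_grad \<delta> (x - y))"
proof -
  note [measurable] = mollifier_grad_measurable[OF d] borel_measurable_integrable[OF f]
  obtain B where B: "\<And>z::'a. norm (mollifier_grad \<delta> z) \<le> B" using mollifier_grad_bounded[OF d] by blast
  show ?thesis
  proof (rule Bochner_Integration.integrable_bound)
    show "integrable M (\<lambda>y. B * f y)" using f by simp
    have "norm (f y *\<^sub>R mollifier_grad \<delta> (x - y)) \<le> norm (B * f y)" for y
      using mult_left_mono[OF order_trans[OF B[of "x - y"] abs_ge_self], of "\<bar>f y\<bar>"] by (simp add: abs_mult mult.commute)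
    then show "AE y in M. norm (f y *\<^sub>R mollifier_grad \<delta> (x - y)) \<le> norm (B * f y)" by simp
  qed measurable
qed

lemma mollify_measurable:
  fixes f :: "'a::euclidean_space \<Rightarrow> 'b::euclidean_space"
  assumes d: "0 < \<delta>" and M[measurable_cong]: "sets M = sets borel" and "sigma_finite_measure M" and f[measurable]: "f \<in> borel_measurable M"
  shows "mollify \<delta> M f \<in> borel_measurable borel"
proof -
  interpret sigma_finite_measure M by fact
  note [measurable] = mollifier_measurable[OF d]
  show ?thesis unfolding mollify_def[abs_def] by measurable
qed

text \<open>Fubini and the unit mass of the kernel. For the singular part this bounds the L^1 norm
  of the mollification by the total variation, uniformly in \<open>\<delta>\<close>.\<close>

lemma nn_integral_mollify_le:
  fixes f :: "'a::euclidean_space \<Rightarrow> 'b::euclidean_space"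
  assumes d: "0 < \<delta>" and M[measurable_cong]: "sets M = sets borel" and sf: "sigma_finite_measure M" and f: "integrable M f"
  shows "(\<integral>\<^sup>+x. norm (mollify \<delta> M f x) \<partial>lborel) \<le> (\<integral>\<^sup>+x. norm (f x) \<partial>M)"
proof -
  interpret sigma_finite_measure M by fact
  interpret pair_sigma_finite "lborel :: 'a measure" M ..
  note [measurable] = mollifier_measurable[OF d] borel_measurable_integrable[OF f]
  have "(\<integral>\<^sup>+x. norm (mollify \<delta> M f x) \<partial>lborel) \<le> (\<integral>\<^sup>+x. (\<integral>\<^sup>+y. ennreal (mollifier \<delta> (x - y)) * norm (f y) \<partial>M) \<partial>lborel)"
  proof (intro nn_integral_mono)
    fix x
    have "ennreal (norm (mollify \<delta> M f x)) \<le> (\<integral>\<^sup>+y. norm (mollifier \<delta> (x - y) *\<^sub>R f y) \<partial>M)"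
      unfolding mollify_def by (rule integral_norm_bound_ennreal[OF integrable_mollify[OF d M f]])
    also have "\<dots> = (\<integral>\<^sup>+y. ennreal (mollifier \<delta> (x - y)) * norm (f y) \<partial>M)"
      by (intro nn_integral_cong) (simp add: abs_of_nonneg[OF mollifier_nonneg[OF d]] ennreal_mult'[OF mollifier_nonneg[OF d]])
    finally show "ennreal (norm (mollify \<delta> M f x)) \<le> (\<integral>\<^sup>+y. ennreal (mollifier \<delta> (x - y)) * norm (f y) \<partial>M)" .
  qed
  also have "\<dots> = (\<integral>\<^sup>+y. (\<integral>\<^sup>+x. ennreal (mollifier \<delta> (x - y)) * norm (f y) \<partial>lborel) \<partial>M)"
    by (intro Fubini'[symmetric]) measurable
  also have "\<dots> = (\<integral>\<^sup>+y. norm (f y) \<partial>M)"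
  proof (intro nn_integral_cong)
    fix y :: 'a
    have "(\<integral>\<^sup>+x. ennreal (mollifier \<delta> (x - y)) \<partial>lborel) = (\<integral>\<^sup>+x. ennreal (mollifier \<delta> (x::'a)) \<partial>lborel)"
      by (rule nn_integral_lborel_shift[where f = "\<lambda>x. ennreal (mollifier \<delta> x)"]) measurable
    also have "\<dots> = 1"
      using mollifier_nonneg[OF d] mollifier_integral[OF d, where 'a='a]
      by (subst nn_integral_eq_integral[OF mollifier_integrable[OF d]]) auto
    finally show "(\<integral>\<^sup>+x. ennreal (mollifier \<delta> (x - y)) * norm (f y) \<partial>lborel) = norm (f y)"
      by (subst nn_integral_multc) auto
  qed
  finally show ?thesis .
qed

lemma mollify_outside:
  fixes f :: "'a::euclidean_space \<Rightarrow> 'b::euclidean_space"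
  assumes d: "0 < \<delta>" and f: "\<And>y. norm y > Q \<Longrightarrow> f y = 0" and x: "norm x > Q + \<delta>"
  shows "mollify \<delta> M f x = 0"
proof -
  have "mollifier \<delta> (x - y) *\<^sub>R f y = 0" for y
  proof (cases "norm y > Q")
    case False
    then have "\<delta> \<le> norm (x - y)" using x norm_triangle_ineq2[of x y] by linarith
    then show ?thesis by (simp add: mollifier_outside[OF d])
  qed (simp add: f)
  then show ?thesis unfolding mollify_def by (intro integral_eq_zero_AE AE_I2)
qed

text \<open>The Taylor bound of the kernel is uniform in its argument and so survives integration:
  the L^1 norm of \<open>f\<close> alone supplies the constant.\<close>

lemma mollify_quad:
  fixes f :: "'a::euclidean_space \<Rightarrow> real"
  assumes d: "0 < \<delta>" and M[measurable_cong]: "sets M = sets borel" and f: "integrable M f"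
  shows "\<exists>C\<ge>0. \<forall>x h. norm h \<le> \<delta> \<longrightarrow>
     \<bar>mollify \<delta> M f (x + h) - mollify \<delta> M f x - mollify_grad \<delta> M f x \<bullet> h\<bar> \<le> C * (norm h)\<^sup>2"
proof -
  obtain C where C: "0 \<le> C" "\<And>(x::'a) h. norm h \<le> \<delta> \<Longrightarrow>
     \<bar>mollifier \<delta> (x + h) - mollifier \<delta> x - mollifier_grad \<delta> x \<bullet> h\<bar> \<le> C * (norm h)\<^sup>2"
    using mollifier_quad[OF d] by blast
  have "\<bar>mollify \<delta> M f (x + h) - mollify \<delta> M f x - mollify_grad \<delta> M f x \<bullet> h\<bar> \<le> (C * (\<integral>y. \<bar>f y\<bar> \<partial>M)) * (norm h)\<^sup>2"
    if h: "norm h \<le> \<delta>" for x h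
  proof -
    note i = integrable_mollify[OF d M f, of "x + h", unfolded real_scaleR_def]
      integrable_mollify[OF d M f, of x, unfolded real_scaleR_def] integrable_mollify_grad[OF d M f, of x]
    have ig: "integrable M (\<lambda>y. (f y *\<^sub>R mollifier_grad \<delta> (x - y)) \<bullet> h)" using i(3) by (rule integrable_inner_left)
    let ?g = "\<lambda>y. mollifier \<delta> (x + h - y) * f y - mollifier \<delta> (x - y) * f y - (f y *\<^sub>R mollifier_grad \<delta> (x - y)) \<bullet> h"
    have "mollify \<delta> M f (x + h) - mollify \<delta> M f x - mollify_grad \<delta> M f x \<bullet> h = (\<integral>y. ?g y \<partial>M)"
      unfolding mollify_def mollify_grad_def real_scaleR_def integral_inner_left[OF i(3), symmetric]
      using i ig by simp
    also have "\<bar>\<dots>\<bar> \<le> (\<integral>y. C * (norm h)\<^sup>2 * \<bar>f y\<bar> \<partial>M)"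
    proof (rule order_trans[OF integral_abs_bound integral_mono])
      show "integrable M (\<lambda>y. \<bar>?g y\<bar>)" using i ig by (intro integrable_abs Bochner_Integration.integrable_diff)
      show "integrable M (\<lambda>y. C * (norm h)\<^sup>2 * \<bar>f y\<bar>)" using f by simp
      fix y
      have "?g y = (mollifier \<delta> ((x - y) + h) - mollifier \<delta> (x - y) - mollifier_grad \<delta> (x - y) \<bullet> h) * f y"
        by (simp add: algebra_simps)
      then show "\<bar>?g y\<bar> \<le> C * (norm h)\<^sup>2 * \<bar>f y\<bar>"
        using C(2)[OF h, of "x - y"] by (simp add: abs_mult mult_right_mono)
    qed
    finally show ?thesis by (simp add: mult_ac)
  qed
  then show ?thesis using C(1) by (intro exI[of _ "C * (\<integral>y. \<bar>f y\<bar> \<partial>M)"]) auto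
qed

lemma mollify_has_derivative:
  fixes f :: "'a::euclidean_space \<Rightarrow> real"
  assumes d: "0 < \<delta>" and M: "sets M = sets borel" and f: "integrable M f"
  shows "(mollify \<delta> M f has_derivative (\<lambda>h. mollify_grad \<delta> M f x \<bullet> h)) (at x)"
proof -
  obtain C where "\<forall>x h. norm h \<le> \<delta> \<longrightarrow>
     \<bar>mollify \<delta> M f (x + h) - mollify \<delta> M f x - mollify_grad \<delta> M f x \<bullet> h\<bar> \<le> C * (norm h)\<^sup>2"
    using mollify_quad[OF assms] by blast
  then show ?thesis
    by (intro has_derivative_quadI[OF bounded_linear_inner_right d, where C = C]) auto
qed

lemma mollify_grad_continuous:
  fixes f :: "'a::euclidean_space \<Rightarrow> real"
  assumes d: "0 < \<delta>" and M[measurable_cong]: "sets M = sets borel" and f: "integrable M f"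
  shows "continuous_on UNIV (mollify_grad \<delta> M f)"
proof (rule continuous_at_imp_continuous_on, intro ballI, unfold continuous_at_sequentially, intro allI impI)
  fix x and s :: "nat \<Rightarrow> 'a" assume s: "s \<longlonglongrightarrow> x"
  note [measurable] = mollifier_grad_measurable[OF d] borel_measurable_integrable[OF f]
  obtain B where B: "\<And>z::'a. norm (mollifier_grad \<delta> z) \<le> B" using mollifier_grad_bounded[OF d] by blast
  have "(\<lambda>k. \<integral>y. f y *\<^sub>R mollifier_grad \<delta> (s k - y) \<partial>M) \<longlonglongrightarrow> (\<integral>y. f y *\<^sub>R mollifier_grad \<delta> (x - y) \<partial>M)"
  proof (rule integral_dominated_convergence[where w = "\<lambda>y. B * \<bar>f y\<bar>"])
    show "integrable M (\<lambda>y. B * \<bar>f y\<bar>)" using f by simp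
    show "AE y in M. (\<lambda>k. f y *\<^sub>R mollifier_grad \<delta> (s k - y)) \<longlonglongrightarrow> f y *\<^sub>R mollifier_grad \<delta> (x - y)"
    proof (intro AE_I2 tendsto_scaleR tendsto_const)
      fix y
      have "continuous (at (x - y)) (mollifier_grad \<delta>)"
        using mollifier_grad_continuous[OF d, of "UNIV :: 'a set"] by (simp add: continuous_on_eq_continuous_at)
      then show "(\<lambda>k. mollifier_grad \<delta> (s k - y)) \<longlonglongrightarrow> mollifier_grad \<delta> (x - y)"
        by (rule isCont_tendsto_compose) (intro tendsto_diff s tendsto_const)
    qed
    show "AE y in M. norm (f y *\<^sub>R mollifier_grad \<delta> (s k - y)) \<le> B * \<bar>f y\<bar>" for k
      using mult_left_mono[OF B, of "\<bar>f _\<bar>"] by (intro AE_I2) (simp add: mult.commute[of B])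
  qed measurable
  then show "(mollify_grad \<delta> M f \<circ> s) \<longlonglongrightarrow> mollify_grad \<delta> M f x"
    unfolding mollify_grad_def comp_def .
qed

lemma mollify_lipschitz:
  fixes f :: "'a::euclidean_space \<Rightarrow> real"
  assumes d: "0 < \<delta>" and M[measurable_cong]: "sets M = sets borel" and f: "integrable M f"
  shows "\<exists>L\<ge>0. \<forall>x y. \<bar>mollify \<delta> M f x - mollify \<delta> M f y\<bar> \<le> L * norm (x - y)"
proof -
  obtain L where L: "0 \<le> L" "\<And>x y::'a. \<bar>mollifier \<delta> x - mollifier \<delta> y\<bar> \<le> L * norm (x - y)"
    using mollifier_lipschitz[OF d] by blast
  have "\<bar>mollify \<delta> M f x - mollify \<delta> M f y\<bar> \<le> (L * (\<integral>z. \<bar>f z\<bar> \<partial>M)) * norm (x - y)" for x y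
  proof -
    note i = integrable_mollify[OF d M f, unfolded real_scaleR_def]
    have "mollify \<delta> M f x - mollify \<delta> M f y = (\<integral>z. mollifier \<delta> (x - z) * f z - mollifier \<delta> (y - z) * f z \<partial>M)"
      unfolding mollify_def real_scaleR_def using i by simp
    also have "\<bar>\<dots>\<bar> \<le> (\<integral>z. L * norm (x - y) * \<bar>f z\<bar> \<partial>M)"
    proof (rule order_trans[OF integral_abs_bound integral_mono])
      show "integrable M (\<lambda>z. \<bar>mollifier \<delta> (x - z) * f z - mollifier \<delta> (y - z) * f z\<bar>)"
        using i by (intro integrable_abs Bochner_Integration.integrable_diff)
      show "integrable M (\<lambda>z. L * norm (x - y) * \<bar>f z\<bar>)" using f by simp
      fix z
      show "\<bar>mollifier \<delta> (x - z) * f z - mollifier \<delta> (y - z) * f z\<bar> \<le> L * norm (x - y) * \<bar>f z\<bar>"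
        using L(2)[of "x - z" "y - z"] by (simp add: abs_mult mult_right_mono flip: left_diff_distrib)
    qed
    finally show ?thesis by (simp add: mult_ac)
  qed
  then show ?thesis using L(1) by (intro exI[of _ "L * (\<integral>z. \<bar>f z\<bar> \<partial>M)"]) auto
qed

lemma mollifier_integral_reflect:
  assumes "0 < \<delta>"
  shows "integrable lborel (\<lambda>y. mollifier \<delta> (x - y))" "(\<integral>y. mollifier \<delta> (x - y) \<partial>lborel) = 1"
proof -
  note [measurable] = mollifier_measurable[OF assms]
  show *: "(\<integral>y. mollifier \<delta> (x - y) \<partial>lborel) = 1"
    by (subst integral_lborel_reflect) (auto simp: mollifier_integral[OF assms])
  \<comment> \<open>A function that is not integrable has integral 0, so the value 1 already proves
    integrability.\<close>
  show "integrable lborel (\<lambda>y. mollifier \<delta> (x - y))"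
    using * not_integrable_integral_eq by fastforce
qed

section \<open>Density of test fields\<close>

text \<open>The indicator of the neighbourhood of \<open>K\<close> of radius \<open>2 * d j\<close>,
  mollified at scale \<open>d j\<close>, is 1 on \<open>K\<close> and 0 beyond distance
  \<open>3 * d j\<close>. A direction \<open>c\<close> is attached because test fields are vector
  valued.\<close>

lemma cutoff_sequence:
  fixes K :: "'a::euclidean_space set"
  assumes K: "compact K" "K \<subseteq> U" and U: "open U"
  obtains \<theta> :: "nat \<Rightarrow> 'a \<Rightarrow> real"
  where "\<And>j c. (\<lambda>x. \<theta> j x *\<^sub>R c) \<in> test_fields U" "\<And>j x. 0 \<le> \<theta> j x" "\<And>j x. \<theta> j x \<le> 1"
    "\<And>x. (\<lambda>j. \<theta> j x) \<longlonglongrightarrow> indicator K x"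
proof (cases "K = {}")
  case True
  then show thesis by (intro that[of "\<lambda>_ _. 0"]) (auto simp: test_fields_zero)
next
  case False
  obtain e where e: "0 < e" "{x. infdist x K \<le> e} \<subseteq> U"
    using compact_in_open_separated[OF False K(1) U K(2)] .
  \<comment> \<open>A third of the margin \<open>e\<close>: two parts are spent on the neighbourhood
    and one on the kernel.\<close>
  define d where "d j = (e / 3) / real (Suc j)" for j
  have d0: "0 < d j" for j using e by (simp add: d_def)
  have dlim: "d \<longlonglongrightarrow> 0" unfolding d_def by (rule LIMSEQ_divide_real_of_nat_Suc)
  have de: "3 * d j \<le> e" for j
  proof -
    have "e / real (Suc j) \<le> e / 1" using e by (intro divide_left_mono) auto
    moreover have "3 * d j = e / real (Suc j)" by (simp only: d_def)
    ultimately show ?thesis by simp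
  qed
  define G where "G j = (\<Union>x\<in>K. ball x (2 * d j))" for j
  define \<theta> where "\<theta> j = mollify (d j) lborel (indicator (G j) :: 'a \<Rightarrow> real)" for j
  have [measurable]: "G j \<in> sets borel" for j unfolding G_def by (intro borel_open open_UN) auto
  have "bounded (G j)" for j
  proof -
    obtain B where "\<forall>x\<in>K. norm x \<le> B" using compact_imp_bounded[OF K(1)] bounded_iff by blast
    then have "norm y \<le> B + 2 * d j" if "y \<in> G j" for y
      using that unfolding G_def dist_norm mem_ball UN_iff
      by (smt (verit) norm_minus_commute norm_triangle_sub)
    then show ?thesis unfolding bounded_iff by blast
  qed
  then have fin: "integrable lborel (indicator (G j) :: 'a \<Rightarrow> real)" for j
    using emeasure_bounded_finite by (intro integrable_real_indicator) auto
  have one: "\<theta> j x = 1" if x: "x \<in> K" for j x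
  proof -
    have "mollifier (d j) (x - y) * indicator (G j) y = mollifier (d j) (x - y)" for y
    proof (cases "norm (x - y) < d j")
      case True
      then have "y \<in> G j" using x d0[of j] unfolding G_def by (intro UN_I[of x]) (auto simp: dist_norm)
      then show ?thesis by simp
    qed (simp add: mollifier_outside[OF d0])
    then have "(\<integral>y. mollifier (d j) (x - y) * indicator (G j) y \<partial>lborel) = (\<integral>y. mollifier (d j) (x - y) \<partial>lborel)"
      by (intro Bochner_Integration.integral_cong refl)
    then show ?thesis by (simp add: \<theta>_def mollify_def mollifier_integral_reflect[OF d0])
  qed
  have zero: "\<theta> j x = 0" if x: "3 * d j < infdist x K" for j x
  proof -
    have "mollifier (d j) (x - y) * indicator (G j) y = 0" for y
    proof (cases "norm (x - y) < d j \<and> y \<in> G j")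
      case True
      then obtain k where k: "k \<in> K" "dist k y < 2 * d j" by (auto simp: G_def)
      have "infdist x K \<le> dist x k" using k by (intro infdist_le)
      also have "\<dots> \<le> dist x y + dist k y" by (rule dist_triangle2)
      also have "\<dots> < 3 * d j" using True k by (simp add: dist_norm)
      finally show ?thesis using x by simp
    next
      case False
      then show ?thesis by (cases "norm (x - y) < d j") (auto simp: mollifier_outside[OF d0])
    qed
    then show ?thesis unfolding \<theta>_def mollify_def real_scaleR_def by (intro integral_eq_zero_AE AE_I2)
  qed
  show thesis
  proof (rule that)
    fix j x
    show "0 \<le> \<theta> j x" unfolding \<theta>_def mollify_def
      by (intro integral_nonneg_AE AE_I2) (auto simp: mollifier_nonneg[OF d0])
    have "\<theta> j x \<le> (\<integral>y. mollifier (d j) (x - y) \<partial>lborel)"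
      unfolding \<theta>_def mollify_def
      by (intro integral_mono integrable_mollify d0 fin mollifier_integral_reflect)
         (auto simp: mollifier_nonneg[OF d0] split: split_indicator)
    then show "\<theta> j x \<le> 1" by (simp add: mollifier_integral_reflect[OF d0])
    show "(\<lambda>j. \<theta> j x) \<longlonglongrightarrow> indicator K x"
    proof (cases "x \<in> K")
      case True then show ?thesis by (simp add: one)
    next
      case x: False
      have "infdist x K \<noteq> 0" using x in_closed_iff_infdist_zero[OF compact_imp_closed[OF K(1)] False] by blast
      then have "0 < infdist x K" using infdist_nonneg[of x K] by linarith
      moreover have "(\<lambda>j. 3 * d j) \<longlonglongrightarrow> 3 * 0" by (intro tendsto_intros dlim)
      ultimately have "\<forall>\<^sub>F j in sequentially. 3 * d j < infdist x K" by (intro order_tendstoD(2)) auto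
      then have "\<forall>\<^sub>F j in sequentially. \<theta> j x = 0" by eventually_elim (rule zero)
      then show ?thesis using x by (simp add: tendsto_eventually)
    qed
  next
    fix j c
    show "(\<lambda>x. \<theta> j x *\<^sub>R c) \<in> test_fields U"
      unfolding \<theta>_def
    proof (rule test_fields_scalar)
      show "(mollify (d j) lborel (indicator (G j)) has_derivative
         (\<lambda>h. mollify_grad (d j) lborel (indicator (G j)) x \<bullet> h)) (at x)" for x
        by (rule mollify_has_derivative[OF d0 _ fin]) simp
      show "continuous_on UNIV (mollify_grad (d j) lborel (indicator (G j)))"
        by (rule mollify_grad_continuous[OF d0 _ fin]) simp
      show "compact {x. infdist x K \<le> 3 * d j}" using d0 by (intro compact_infdist_le False K) auto
      show "{x. infdist x K \<le> 3 * d j} \<subseteq> U" using e(2) de[of j] by auto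
      show "mollify (d j) lborel (indicator (G j)) x = (0::real)" if "x \<notin> {x. infdist x K \<le> 3 * d j}" for x
        using zero[of j x] that by (simp add: \<theta>_def)
    qed
  qed
qed

text \<open>Induction over integrable functions. Indicators are approximated by compact sets through
  inner regularity and then by cutoffs. The error is measured on \<open>U\<close> only, because the
  fields vanish outside \<open>U\<close>.\<close>

lemma test_fields_dense:
  fixes f :: "'a::euclidean_space \<Rightarrow> 'a"
  assumes M: "finite_measure M" and sets[measurable_cong]: "sets M = sets borel" and U: "open U" and f: "integrable M f" and "0 < \<epsilon>"
  shows "\<exists>\<phi>\<in>test_fields U. (\<integral>\<^sup>+x. indicator U x * ennreal (norm (f x - \<phi> x)) \<partial>M) < ennreal \<epsilon>"
  using f \<open>0 < \<epsilon>\<close>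
proof (induction arbitrary: \<epsilon>)
  case (base A c)
  interpret finite_measure M by fact
  have space: "space M = UNIV" using sets_eq_imp_space_eq[OF sets] by simp
  have [measurable]: "A \<in> sets M" "U \<in> sets M" using base U by (auto simp: sets)
  \<comment> \<open>Two errors of size \<eta> occur, each multiplied by \<open>norm c\<close>; the
    summand 1 covers \<open>c = 0\<close>.\<close>
  define \<eta> where "\<eta> = \<epsilon> / (2 * (norm c + 1))"
  have \<eta>: "0 < \<eta>" using base(3) by (simp add: \<eta>_def add_nonneg_pos)
  have reg: "emeasure M (A \<inter> U) = (SUP K\<in>{K. K \<subseteq> A \<inter> U \<and> compact K}. emeasure M K)"
    using sets by (intro inner_regular) auto
  have "\<exists>K. K \<subseteq> A \<inter> U \<and> compact K \<and> measure M (A \<inter> U) < measure M K + \<eta>"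
  \<comment> \<open>Without mass, \<open>ennreal\<close> would truncate the negative number used
    below to 0, and the strict inequality with the supremum would fail.\<close>
  proof (cases "emeasure M (A \<inter> U) = 0")
    case True
    then show ?thesis using \<eta> by (intro exI[of _ "{}"]) (auto simp: measure_def)
  next
    case False
    then have "measure M (A \<inter> U) - \<eta> < measure M (A \<inter> U)" and pos: "0 < measure M (A \<inter> U)" using \<eta>
      by (auto simp: emeasure_eq_measure zero_less_measure_iff)
    then have "ennreal (measure M (A \<inter> U) - \<eta>) < emeasure M (A \<inter> U)"
      unfolding emeasure_eq_measure by (intro ennreal_lessI)
    then have "ennreal (measure M (A \<inter> U) - \<eta>) < (SUP K\<in>{K. K \<subseteq> A \<inter> U \<and> compact K}. emeasure M K)"
      using reg by simp
    then obtain K where K: "K \<subseteq> A \<inter> U" "compact K" "ennreal (measure M (A \<inter> U) - \<eta>) < emeasure M K"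
      by (auto simp: less_SUP_iff)
    have "measure M (A \<inter> U) < measure M K + \<eta>"
    proof (rule ccontr)
      assume "\<not> ?thesis"
      then have "ennreal (measure M K) \<le> ennreal (measure M (A \<inter> U) - \<eta>)" by (intro ennreal_leI) simp
      then show False using K(3) unfolding emeasure_eq_measure by simp
    qed
    then show ?thesis using K by blast
  qed
  then obtain K where K: "K \<subseteq> A \<inter> U" "compact K" "measure M (A \<inter> U) < measure M K + \<eta>" by blast
  have [measurable]: "K \<in> sets M" unfolding sets by (intro borel_closed compact_imp_closed K(2))
  obtain \<theta> :: "nat \<Rightarrow> 'a \<Rightarrow> real" where \<theta>: "\<And>j c. (\<lambda>x. \<theta> j x *\<^sub>R c) \<in> test_fields U" "\<And>j x. 0 \<le> \<theta> j x" "\<And>j x. \<theta> j x \<le> 1"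
    "\<And>x. (\<lambda>j. \<theta> j x) \<longlonglongrightarrow> indicator K x"
    using cutoff_sequence[OF K(2) _ U] K(1) by (metis le_inf_iff)
  have \<theta>m: "\<theta> j \<in> borel_measurable M" for j
  proof -
    obtain b :: 'a where b: "b \<in> Basis" using nonempty_Basis by blast
    have "(\<lambda>x. (\<theta> j x *\<^sub>R b) \<bullet> b) \<in> borel_measurable borel"
      using test_field_measurable[OF \<theta>(1)[of j b]] by measurable
    then have "\<theta> j \<in> borel_measurable borel" using b by simp
    then show ?thesis by (simp add: measurable_cong_sets[OF sets refl])
  qed
  note [measurable] = this
  have "(\<lambda>j. \<integral>\<^sup>+x. ennreal \<bar>\<theta> j x - indicator K x\<bar> \<partial>M) \<longlonglongrightarrow> (\<integral>\<^sup>+x. 0 \<partial>M)"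
  proof (rule nn_integral_dominated_convergence[where w = "\<lambda>_. 1"])
    show "AE x in M. (\<lambda>j. ennreal \<bar>\<theta> j x - indicator K x\<bar>) \<longlonglongrightarrow> 0"
    proof (intro AE_I2)
      fix x
      have "(\<lambda>j. \<bar>\<theta> j x - indicator K x\<bar>) \<longlonglongrightarrow> \<bar>indicator K x - indicator K x :: real\<bar>"
        by (intro tendsto_intros \<theta>(4))
      then show "(\<lambda>j. ennreal \<bar>\<theta> j x - indicator K x\<bar>) \<longlonglongrightarrow> 0" by (auto dest: tendsto_ennrealI)
    qed
    show "AE x in M. ennreal \<bar>\<theta> j x - indicator K x\<bar> \<le> 1" for j
    proof (intro AE_I2)
      fix x
      have "\<bar>\<theta> j x - indicator K x\<bar> \<le> 1" using \<theta>(2,3)[of j x] by (auto split: split_indicator)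
      then show "ennreal \<bar>\<theta> j x - indicator K x\<bar> \<le> 1" by (simp add: ennreal_le_1)
    qed
  qed (auto simp: less_top[symmetric])
  then have "\<forall>\<^sub>F j in sequentially. (\<integral>\<^sup>+x. ennreal \<bar>\<theta> j x - indicator K x\<bar> \<partial>M) < ennreal \<eta>"
    using \<eta> by (intro order_tendstoD(2)) auto
  then obtain j where j: "(\<integral>\<^sup>+x. ennreal \<bar>\<theta> j x - indicator K x\<bar> \<partial>M) < ennreal \<eta>"
    by (auto simp: eventually_sequentially)
  have AK: "emeasure M (A \<inter> U - K) < ennreal \<eta>"
    unfolding emeasure_eq_measure using K \<eta> by (intro ennreal_lessI) (auto simp: finite_measure_Diff)
  have "(\<integral>\<^sup>+x. indicator U x * ennreal (norm (indicator A x *\<^sub>R c - \<theta> j x *\<^sub>R c)) \<partial>M)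
      \<le> (\<integral>\<^sup>+x. ennreal (norm c) * (indicator (A \<inter> U - K) x + ennreal \<bar>\<theta> j x - indicator K x\<bar>) \<partial>M)"
  proof (intro nn_integral_mono)
    fix x
    have "norm (indicator A x *\<^sub>R c - \<theta> j x *\<^sub>R c) = norm c * \<bar>indicator A x - \<theta> j x\<bar>"
      by (simp add: mult.commute flip: scaleR_diff_left)
    moreover have "indicator U x * \<bar>indicator A x - \<theta> j x\<bar> \<le> indicator (A \<inter> U - K) x + \<bar>\<theta> j x - indicator K x\<bar>"
      using K(1) \<theta>(2,3)[of j x] by (auto split: split_indicator)
    ultimately have "indicator U x * norm (indicator A x *\<^sub>R c - \<theta> j x *\<^sub>R c)
        \<le> norm c * (indicator (A \<inter> U - K) x + \<bar>\<theta> j x - indicator K x\<bar>)"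
      by (metis mult.left_commute mult_left_mono norm_ge_zero)
    then have "ennreal (indicator U x * norm (indicator A x *\<^sub>R c - \<theta> j x *\<^sub>R c))
        \<le> ennreal (norm c * (indicator (A \<inter> U - K) x + \<bar>\<theta> j x - indicator K x\<bar>))" by (rule ennreal_leI)
    then show "indicator U x * ennreal (norm (indicator A x *\<^sub>R c - \<theta> j x *\<^sub>R c))
        \<le> ennreal (norm c) * (indicator (A \<inter> U - K) x + ennreal \<bar>\<theta> j x - indicator K x\<bar>)"
      by (simp add: ennreal_mult ennreal_indicator)
  qed
  also have "\<dots> = ennreal (norm c) * (emeasure M (A \<inter> U - K) + (\<integral>\<^sup>+x. ennreal \<bar>\<theta> j x - indicator K x\<bar> \<partial>M))"
    by (subst nn_integral_cmult) (auto simp: nn_integral_add)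
  also have "\<dots> \<le> ennreal (norm c) * (ennreal \<eta> + ennreal \<eta>)"
    using AK j by (intro mult_left_mono add_mono) auto
  also have "\<dots> = ennreal (norm c * (2 * \<eta>))"
    using \<eta> by (simp add: ennreal_mult flip: ennreal_plus)
  also have "\<dots> < ennreal \<epsilon>"
  proof (rule ennreal_lessI[OF base(3)])
    have "0 < 2 * (norm c + 1)" by (intro mult_pos_pos add_nonneg_pos) auto
    then have "2 * (norm c + 1) \<noteq> 0" by (rule less_imp_neq[THEN not_sym])
    then have "\<eta> * (2 * (norm c + 1)) = \<epsilon>" unfolding \<eta>_def by (rule nonzero_eq_divide_eq[THEN iffD1, OF _ refl])
    then show "norm c * (2 * \<eta>) < \<epsilon>" using \<eta> by (simp add: algebra_simps)
  qed
  finally show ?case using \<theta>(1)[of j c] by (intro bexI[of _ "\<lambda>x. \<theta> j x *\<^sub>R c"])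
next
  case (add f g)
  obtain \<phi> \<psi> where \<phi>: "\<phi> \<in> test_fields U" "(\<integral>\<^sup>+x. indicator U x * ennreal (norm (f x - \<phi> x)) \<partial>M) < ennreal (\<epsilon> / 2)"
    and \<psi>: "\<psi> \<in> test_fields U" "(\<integral>\<^sup>+x. indicator U x * ennreal (norm (g x - \<psi> x)) \<partial>M) < ennreal (\<epsilon> / 2)"
    using add.IH(1)[of "\<epsilon> / 2"] add.IH(2)[of "\<epsilon> / 2"] add.prems by auto
  note [measurable] = borel_measurable_integrable[OF add.hyps(1)] borel_measurable_integrable[OF add.hyps(2)]
    test_field_measurable[OF \<phi>(1)] test_field_measurable[OF \<psi>(1)] borel_open[OF U]
  have "(\<integral>\<^sup>+x. indicator U x * ennreal (norm (f x + g x - (\<phi> x + \<psi> x))) \<partial>M)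
     \<le> (\<integral>\<^sup>+x. indicator U x * ennreal (norm (f x - \<phi> x)) + indicator U x * ennreal (norm (g x - \<psi> x)) \<partial>M)"
  proof (intro nn_integral_mono)
    fix x
    have "norm (f x + g x - (\<phi> x + \<psi> x)) \<le> norm (f x - \<phi> x) + norm (g x - \<psi> x)"
      by (rule norm_diff_triangle_ineq)
    then show "indicator U x * ennreal (norm (f x + g x - (\<phi> x + \<psi> x)))
      \<le> indicator U x * ennreal (norm (f x - \<phi> x)) + indicator U x * ennreal (norm (g x - \<psi> x))"
      by (auto split: split_indicator intro: ennreal_leI simp flip: ennreal_plus)
  qed
  also have "\<dots> = (\<integral>\<^sup>+x. indicator U x * ennreal (norm (f x - \<phi> x)) \<partial>M) + (\<integral>\<^sup>+x. indicator U x * ennreal (norm (g x - \<psi> x)) \<partial>M)"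
    by (rule nn_integral_add) measurable
  also have "\<dots> < ennreal (\<epsilon> / 2) + ennreal (\<epsilon> / 2)" using \<phi>(2) \<psi>(2) by (rule add_strict_mono)
  also have "\<dots> = ennreal \<epsilon>" using add.prems by (simp flip: ennreal_plus)
  finally show ?case by (rule bexI[OF _ test_fields_add[OF \<phi>(1) \<psi>(1)]])
next
  case (lim f s)
  note [measurable] = borel_measurable_integrable[OF lim.hyps(4)] borel_measurable_integrable[OF lim.hyps(1)] borel_open[OF U]
  have "(\<lambda>j. \<integral>\<^sup>+x. ennreal (norm (f x - s j x)) \<partial>M) \<longlonglongrightarrow> (\<integral>\<^sup>+x. 0 \<partial>M)"
  \<comment> \<open>The approximating sequence is bounded by twice the norm of \<open>f\<close>,
    hence its distance to \<open>f\<close> by three times that norm.\<close>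
  proof (rule nn_integral_dominated_convergence[where w = "\<lambda>x. ennreal (3 * norm (f x))"])
    show "AE x in M. (\<lambda>j. ennreal (norm (f x - s j x))) \<longlonglongrightarrow> 0"
    proof (intro AE_I2)
      fix x assume "x \<in> space M"
      then have "(\<lambda>j. norm (f x - s j x)) \<longlonglongrightarrow> norm (f x - f x)" by (intro tendsto_intros lim.hyps(2))
      then show "(\<lambda>j. ennreal (norm (f x - s j x))) \<longlonglongrightarrow> 0" by (auto dest: tendsto_ennrealI)
    qed
    show "AE x in M. ennreal (norm (f x - s j x)) \<le> ennreal (3 * norm (f x))" for j
    proof (intro AE_I2 ennreal_leI)
      fix x assume "x \<in> space M"
      then show "norm (f x - s j x) \<le> 3 * norm (f x)"
        using lim.hyps(3)[of x j] norm_triangle_ineq4[of "f x" "s j x"] by linarith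
    qed
    have "(\<integral>\<^sup>+x. ennreal (3 * norm (f x)) \<partial>M) = 3 * (\<integral>\<^sup>+x. ennreal (norm (f x)) \<partial>M)"
      by (simp add: ennreal_mult nn_integral_cmult)
    then show "(\<integral>\<^sup>+x. ennreal (3 * norm (f x)) \<partial>M) < \<infinity>"
      using lim.hyps(4) by (simp add: integrable_iff_bounded ennreal_mult_less_top)
  qed auto
  then have "\<forall>\<^sub>F j in sequentially. (\<integral>\<^sup>+x. ennreal (norm (f x - s j x)) \<partial>M) < ennreal (\<epsilon> / 2)"
    using lim.prems by (intro order_tendstoD(2)) auto
  then obtain j where j: "(\<integral>\<^sup>+x. ennreal (norm (f x - s j x)) \<partial>M) < ennreal (\<epsilon> / 2)"
    by (auto simp: eventually_sequentially)
  obtain \<phi> where \<phi>: "\<phi> \<in> test_fields U" "(\<integral>\<^sup>+x. indicator U x * ennreal (norm (s j x - \<phi> x)) \<partial>M) < ennreal (\<epsilon> / 2)"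
    using lim.IH[of "\<epsilon> / 2" j] lim.prems by auto
  note [measurable] = test_field_measurable[OF \<phi>(1)]
  have "(\<integral>\<^sup>+x. indicator U x * ennreal (norm (f x - \<phi> x)) \<partial>M)
     \<le> (\<integral>\<^sup>+x. ennreal (norm (f x - s j x)) + indicator U x * ennreal (norm (s j x - \<phi> x)) \<partial>M)"
  proof (intro nn_integral_mono)
    fix x
    have "norm (f x - \<phi> x) \<le> norm (f x - s j x) + norm (s j x - \<phi> x)"
      using norm_triangle_ineq[of "f x - s j x" "s j x - \<phi> x"] by simp
    then show "indicator U x * ennreal (norm (f x - \<phi> x))
      \<le> ennreal (norm (f x - s j x)) + indicator U x * ennreal (norm (s j x - \<phi> x))"
      by (auto split: split_indicator intro: ennreal_leI simp flip: ennreal_plus)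
  qed
  also have "\<dots> = (\<integral>\<^sup>+x. ennreal (norm (f x - s j x)) \<partial>M) + (\<integral>\<^sup>+x. indicator U x * ennreal (norm (s j x - \<phi> x)) \<partial>M)"
    by (rule nn_integral_add) measurable
  also have "\<dots> < ennreal (\<epsilon> / 2) + ennreal (\<epsilon> / 2)" using j \<phi>(2) by (rule add_strict_mono)
  also have "\<dots> = ennreal \<epsilon>" using lim.prems by (simp flip: ennreal_plus)
  finally show ?case by (rule bexI[OF _ \<phi>(1)])
qed

section \<open>Convergence of mollifications in L^1\<close>

lemma mollify_test_field_close:
  assumes d: "0 < \<delta>" and \<phi>: "\<phi> \<in> test_fields U" and L: "\<And>x y. norm (\<phi> x - \<phi> y) \<le> L * norm (x - y)"
  shows "norm (mollify \<delta> lborel \<phi> x - \<phi> x) \<le> L * \<delta>"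
proof -
  note [measurable] = mollifier_measurable[OF d] test_field_measurable[OF \<phi>]
  obtain B where B: "\<And>x. norm (\<phi> x) \<le> B" using test_field_bounded[OF \<phi>] by blast
  note m = mollifier_integral_reflect[OF d, of x]
  have i: "integrable lborel (\<lambda>y. mollifier \<delta> (x - y) *\<^sub>R \<phi> y)"
  proof (rule Bochner_Integration.integrable_bound)
    show "integrable lborel (\<lambda>y. B * mollifier \<delta> (x - y))" using m(1) by simp
    show "AE y in lborel. norm (mollifier \<delta> (x - y) *\<^sub>R \<phi> y) \<le> norm (B * mollifier \<delta> (x - y))"
    proof (intro AE_I2)
      fix y
      have "norm (\<phi> y) \<le> \<bar>B\<bar>" using B[of y] by linarith
      then show "norm (mollifier \<delta> (x - y) *\<^sub>R \<phi> y) \<le> norm (B * mollifier \<delta> (x - y))"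
        unfolding norm_scaleR real_norm_def abs_mult by (subst mult.commute) (intro mult_right_mono, auto)
    qed
  qed measurable
  have "mollify \<delta> lborel \<phi> x - \<phi> x = (\<integral>y. mollifier \<delta> (x - y) *\<^sub>R \<phi> y - mollifier \<delta> (x - y) *\<^sub>R \<phi> x \<partial>lborel)"
    unfolding mollify_def using i m by (subst Bochner_Integration.integral_diff) auto
  also have "norm \<dots> \<le> (\<integral>y. L * \<delta> * mollifier \<delta> (x - y) \<partial>lborel)"
  proof (rule order_trans[OF integral_norm_bound integral_mono])
    show "integrable lborel (\<lambda>y. norm (mollifier \<delta> (x - y) *\<^sub>R \<phi> y - mollifier \<delta> (x - y) *\<^sub>R \<phi> x))"
      using i m(1) by (intro integrable_norm Bochner_Integration.integrable_diff integrable_scaleR_left)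
    show "integrable lborel (\<lambda>y. L * \<delta> * mollifier \<delta> (x - y))" using m(1) by simp
    fix y
    show "norm (mollifier \<delta> (x - y) *\<^sub>R \<phi> y - mollifier \<delta> (x - y) *\<^sub>R \<phi> x) \<le> L * \<delta> * mollifier \<delta> (x - y)"
    proof (cases "norm (x - y) < \<delta>")
      case True
      have "norm (\<phi> y - \<phi> x) \<le> L * norm (y - x)" by (rule L)
      moreover have "0 \<le> L"
      proof (rule ccontr)
        assume "\<not> 0 \<le> L"
        obtain b :: 'a where b: "b \<in> Basis" using nonempty_Basis by blast
        have "0 \<le> norm (\<phi> b - \<phi> 0)" by simp
        also have "\<dots> \<le> L * norm (b - 0)" by (rule L)
        finally show False using b \<open>\<not> 0 \<le> L\<close> by simp
      qed
      then have "L * norm (y - x) \<le> L * \<delta>" using True by (intro mult_left_mono) (auto simp: norm_minus_commute)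
      ultimately have "norm (\<phi> y - \<phi> x) \<le> L * \<delta>" by linarith
      then have "mollifier \<delta> (x - y) * norm (\<phi> y - \<phi> x) \<le> mollifier \<delta> (x - y) * (L * \<delta>)"
        by (intro mult_left_mono) (auto simp: mollifier_nonneg[OF d])
      then show ?thesis unfolding scaleR_diff_right[symmetric] norm_scaleR
        by (simp add: abs_of_nonneg[OF mollifier_nonneg[OF d]] mult_ac)
    qed (simp add: mollifier_outside[OF d])
  qed
  also have "\<dots> = L * \<delta>" using m by simp
  finally show ?thesis .
qed

text \<open>The density theorem is for finite measures, so Lebesgue measure is restricted to a large
  ball. Outside it the integral of the norm of \<open>f\<close> is small and the approximating field
  vanishes.\<close>

lemma L1_approx_test_field:
  fixes f :: "'a::euclidean_space \<Rightarrow> 'a"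
  assumes f: "integrable lborel f" and e: "0 < \<epsilon>"
  shows "\<exists>\<phi>\<in>test_fields UNIV. (\<integral>\<^sup>+x. ennreal (norm (f x - \<phi> x)) \<partial>lborel) < ennreal \<epsilon>"
proof -
  note [measurable] = borel_measurable_integrable[OF f]
  have "(\<lambda>k. \<integral>\<^sup>+x. ennreal (norm (f x) * indicator (- ball 0 (real k)) x) \<partial>lborel) \<longlonglongrightarrow> integral\<^sup>N lborel (\<lambda>x::'a. 0)"
  proof (rule nn_integral_dominated_convergence[where w = "\<lambda>x. ennreal (norm (f x))"])
    show "AE x in lborel. (\<lambda>k. ennreal (norm (f x) * indicator (- ball 0 (real k)) x)) \<longlonglongrightarrow> 0"
    proof (intro AE_I2)
      fix x :: 'a
      obtain N :: nat where N: "norm x < N" using reals_Archimedean2 by blast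
      have "\<forall>\<^sub>F k in sequentially. ennreal (norm (f x) * indicator (- ball 0 (real k)) x) = 0"
        using eventually_ge_at_top[of N] by eventually_elim (use N in auto)
      then show "(\<lambda>k. ennreal (norm (f x) * indicator (- ball 0 (real k)) x)) \<longlonglongrightarrow> 0" by (rule tendsto_eventually)
    qed
    show "(\<integral>\<^sup>+x. ennreal (norm (f x)) \<partial>lborel) < \<infinity>" using f by (simp add: integrable_iff_bounded)
  qed (auto split: split_indicator)
  then have "\<forall>\<^sub>F k in sequentially. (\<integral>\<^sup>+x. ennreal (norm (f x) * indicator (- ball 0 (real k)) x) \<partial>lborel) < ennreal (\<epsilon> / 2)"
    using e by (intro order_tendstoD(2)) auto
  then obtain k where k: "(\<integral>\<^sup>+x. ennreal (norm (f x) * indicator (- ball 0 (real k)) x) \<partial>lborel) < ennreal (\<epsilon> / 2)"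
    by (auto simp: eventually_sequentially)
  define M where "M = density lborel (\<lambda>x. ennreal (indicator (ball (0::'a) (real k)) x))"
  have [measurable]: "ball (0::'a) (real k) \<in> sets borel" by simp
  have fin: "finite_measure M"
  proof (rule finite_measureI)
    have "emeasure M (space M) = emeasure lborel (ball (0::'a) (real k))"
      unfolding M_def by (subst emeasure_density) (auto simp: ennreal_indicator)
    then show "emeasure M (space M) \<noteq> \<infinity>"
      using emeasure_bounded_finite[OF bounded_ball[of "0::'a" "real k"]] by simp
  qed
  have "integrable M f"
    unfolding M_def using integrable_mult_indicator[OF _ f, of "ball 0 (real k)"] by (subst integrable_density) auto
  then obtain \<phi> where \<phi>: "\<phi> \<in> test_fields (ball 0 (real k))"
    "(\<integral>\<^sup>+x. indicator (ball 0 (real k)) x * ennreal (norm (f x - \<phi> x)) \<partial>M) < ennreal (\<epsilon> / 2)"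
    using test_fields_dense[OF fin _ open_ball, of f "\<epsilon> / 2"] e unfolding M_def by auto
  note [measurable] = test_field_measurable[OF \<phi>(1)]
  have z: "\<phi> x = 0" if "x \<notin> ball 0 (real k)" for x using test_field_support[OF \<phi>(1)] that by blast
  have "(\<integral>\<^sup>+x. ennreal (norm (f x - \<phi> x)) \<partial>lborel)
     = (\<integral>\<^sup>+x. ennreal (norm (f x) * indicator (- ball 0 (real k)) x) + indicator (ball 0 (real k)) x * (indicator (ball 0 (real k)) x * ennreal (norm (f x - \<phi> x))) \<partial>lborel)"
    using z by (intro nn_integral_cong) (auto split: split_indicator)
  also have "\<dots> = (\<integral>\<^sup>+x. ennreal (norm (f x) * indicator (- ball 0 (real k)) x) \<partial>lborel)
      + (\<integral>\<^sup>+x. indicator (ball 0 (real k)) x * ennreal (norm (f x - \<phi> x)) \<partial>M)"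
    unfolding M_def by (subst nn_integral_add) (auto simp: nn_integral_density ennreal_indicator)
  also have "\<dots> < ennreal (\<epsilon> / 2) + ennreal (\<epsilon> / 2)" using k \<phi>(2) by (rule add_strict_mono)
  also have "\<dots> = ennreal \<epsilon>" using e by (simp flip: ennreal_plus)
  finally show ?thesis using \<phi>(1) test_fields_mono[of "ball 0 (real k)" UNIV] by blast
qed

text \<open>Mollification does not increase the L^1 distance between \<open>f\<close> and a test
  field \<open>\<phi>\<close>, and \<open>\<phi>\<close> converges uniformly within a fixed ball
  because it is Lipschitz.\<close>

lemma mollify_L1_convergence:
  fixes f :: "'a::euclidean_space \<Rightarrow> 'a"
  assumes f: "integrable lborel f" and d: "\<And>k. 0 < d k" "d \<longlonglongrightarrow> 0"
  shows "(\<lambda>k. \<integral>\<^sup>+x. ennreal (norm (mollify (d k) lborel f x - f x)) \<partial>lborel) \<longlonglongrightarrow> 0"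
proof (rule order_tendstoI)
  fix a :: ennreal assume "0 < a"
  then obtain \<epsilon>' where "0 < \<epsilon>'" "\<epsilon>' < a" using dense by blast
  then obtain \<epsilon> where \<epsilon>: "0 < \<epsilon>" "ennreal \<epsilon> < a" by (cases \<epsilon>') auto
  obtain \<phi> where \<phi>: "\<phi> \<in> test_fields UNIV" "(\<integral>\<^sup>+x. ennreal (norm (f x - \<phi> x)) \<partial>lborel) < ennreal (\<epsilon> / 3)"
    using L1_approx_test_field[OF f, of "\<epsilon> / 3"] \<epsilon> by auto
  note [measurable] = borel_measurable_integrable[OF f] test_field_measurable[OF \<phi>(1)]
  obtain L where L: "0 < L" "\<And>x y. norm (\<phi> x - \<phi> y) \<le> L * norm (x - y)" using test_field_lipschitz[OF \<phi>(1)] by blast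
  obtain K where K: "compact K" "\<And>x. x \<notin> K \<Longrightarrow> \<phi> x = 0" using test_field_support[OF \<phi>(1)] by blast
  then obtain Q where Q: "\<And>x. x \<in> K \<Longrightarrow> norm x \<le> Q" using compact_imp_bounded bounded_iff by metis
  have \<phi>Q: "\<phi> x = 0" if "norm x > Q" for x using K(2) Q[of x] that by fastforce
  have i\<phi>: "integrable lborel \<phi>"
  proof -
    have "integrable lborel (\<lambda>x. indicator (cball 0 Q) x *\<^sub>R \<phi> x)"
      by (rule borel_integrable_compact) (auto intro: continuous_on_subset[OF test_field_continuous[OF \<phi>(1)]])
    moreover have "(\<lambda>x. indicator (cball 0 Q) x *\<^sub>R \<phi> x) = \<phi>"
      using \<phi>Q by (auto simp: fun_eq_iff split: split_indicator)
    ultimately show ?thesis by simp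
  qed
  define m where "m = measure lborel (cball (0::'a) (Q + 1))"
  have em: "emeasure lborel (cball (0::'a) (Q + 1)) = ennreal m"
    unfolding m_def using emeasure_bounded_finite[OF bounded_cball[of "0::'a" "Q + 1"]]
    by (intro emeasure_eq_ennreal_measure) auto
  have m0: "0 \<le> m" by (simp add: m_def)
  \<comment> \<open>The bound 1 keeps the mollified field supported within radius
    \<open>Q + 1\<close>. The other bound makes the uniform error \<open>L * d k\<close>, times the
    volume \<open>m\<close>, at most \<epsilon> / 3; the added 1 guards against a vanishing
    denominator.\<close>
  have "\<forall>\<^sub>F k in sequentially. d k < min 1 (\<epsilon> / (3 * (L * m + 1)))"
    using \<epsilon> L m0 by (intro order_tendstoD(2)[OF d(2)]) (auto simp: add_nonneg_pos)
  then show "\<forall>\<^sub>F k in sequentially. (\<integral>\<^sup>+x. ennreal (norm (mollify (d k) lborel f x - f x)) \<partial>lborel) < a"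
  proof eventually_elim
    case (elim k)
    note dk = d(1)[of k]
    have [measurable]: "mollify (d k) lborel f \<in> borel_measurable borel" "mollify (d k) lborel \<phi> \<in> borel_measurable borel"
      "mollify (d k) lborel (\<lambda>x. f x - \<phi> x) \<in> borel_measurable borel"
      by (auto intro!: mollify_measurable dk lborel.sigma_finite_measure_axioms)
    have split: "mollify (d k) lborel f x - f x = mollify (d k) lborel (\<lambda>x. f x - \<phi> x) x + (mollify (d k) lborel \<phi> x - \<phi> x) + (\<phi> x - f x)" for x
      unfolding mollify_def scaleR_diff_right
      by (subst Bochner_Integration.integral_diff) (auto intro!: integrable_mollify dk f i\<phi>)
    have A: "(\<integral>\<^sup>+x. ennreal (norm (mollify (d k) lborel (\<lambda>x. f x - \<phi> x) x)) \<partial>lborel) \<le> (\<integral>\<^sup>+x. ennreal (norm (f x - \<phi> x)) \<partial>lborel)"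
      by (intro nn_integral_mollify_le dk lborel.sigma_finite_measure_axioms) (auto intro: f i\<phi>)
    have B: "(\<integral>\<^sup>+x. ennreal (norm (mollify (d k) lborel \<phi> x - \<phi> x)) \<partial>lborel) \<le> ennreal (L * d k * m)"
    proof -
      have "(\<integral>\<^sup>+x. ennreal (norm (mollify (d k) lborel \<phi> x - \<phi> x)) \<partial>lborel)
        \<le> (\<integral>\<^sup>+x. ennreal (L * d k) * indicator (cball (0::'a) (Q + 1)) x \<partial>lborel)"
      proof (intro nn_integral_mono)
        fix x :: 'a
        show "ennreal (norm (mollify (d k) lborel \<phi> x - \<phi> x)) \<le> ennreal (L * d k) * indicator (cball (0::'a) (Q + 1)) x"
        proof (cases "norm x \<le> Q + 1")
          case True
          then show ?thesis using mollify_test_field_close[OF dk \<phi>(1) L(2), of x] by (simp add: ennreal_leI)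
        next
          case False
          have "mollify (d k) lborel \<phi> x = 0"
            using False elim by (intro mollify_outside[where Q = Q] dk \<phi>Q) auto
          then show ?thesis using \<phi>Q[of x] False by simp
        qed
      qed
      also have "\<dots> = ennreal (L * d k) * ennreal m" by (simp add: nn_integral_cmult_indicator em)
      also have "\<dots> = ennreal (L * d k * m)" using L dk m0 by (simp add: ennreal_mult)
      finally show ?thesis .
    qed
    have "L * d k * m \<le> \<epsilon> / 3"
    proof -
      have p: "0 < 3 * (L * m + 1)" using L m0 by (simp add: add_nonneg_pos)
      have "d k * (3 * (L * m + 1)) \<le> \<epsilon>" using elim p by (simp add: pos_less_divide_eq)
      then show ?thesis using dk by (simp add: algebra_simps)
    qed
    then have B': "(\<integral>\<^sup>+x. ennreal (norm (mollify (d k) lborel \<phi> x - \<phi> x)) \<partial>lborel) \<le> ennreal (\<epsilon> / 3)"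
      using B by (meson ennreal_leI order_trans)
    have "(\<integral>\<^sup>+x. ennreal (norm (mollify (d k) lborel f x - f x)) \<partial>lborel)
       \<le> (\<integral>\<^sup>+x. ennreal (norm (mollify (d k) lborel (\<lambda>x. f x - \<phi> x) x)) + (ennreal (norm (mollify (d k) lborel \<phi> x - \<phi> x)) + ennreal (norm (f x - \<phi> x))) \<partial>lborel)"
    proof (intro nn_integral_mono)
      fix x
      have "norm (mollify (d k) lborel f x - f x) \<le> norm (mollify (d k) lborel (\<lambda>x. f x - \<phi> x) x) + (norm (mollify (d k) lborel \<phi> x - \<phi> x) + norm (f x - \<phi> x))"
        unfolding split
        by (smt (verit) norm_triangle_ineq norm_minus_commute)
      then show "ennreal (norm (mollify (d k) lborel f x - f x)) \<le> ennreal (norm (mollify (d k) lborel (\<lambda>x. f x - \<phi> x) x)) + (ennreal (norm (mollify (d k) lborel \<phi> x - \<phi> x)) + ennreal (norm (f x - \<phi> x)))"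
        by (simp add: ennreal_leI flip: ennreal_plus)
    qed
    also have "\<dots> = (\<integral>\<^sup>+x. ennreal (norm (mollify (d k) lborel (\<lambda>x. f x - \<phi> x) x)) \<partial>lborel) + ((\<integral>\<^sup>+x. ennreal (norm (mollify (d k) lborel \<phi> x - \<phi> x)) \<partial>lborel) + (\<integral>\<^sup>+x. ennreal (norm (f x - \<phi> x)) \<partial>lborel))"
      by (subst nn_integral_add; (subst nn_integral_add)?) auto
    also have "\<dots> \<le> ennreal (\<epsilon> / 3) + (ennreal (\<epsilon> / 3) + ennreal (\<epsilon> / 3))"
      using A B' \<phi>(2) by (intro add_mono) auto
    also have "\<dots> = ennreal \<epsilon>" using \<epsilon> by (simp flip: ennreal_plus)
    finally show ?case using \<epsilon>(2) by (rule le_less_trans)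
  qed
qed simp

text \<open>The scalar case is read off from the vector case for \<open>f x *\<^sub>R b\<close> with
  a unit vector \<open>b\<close>.\<close>

lemma mollify_L1_convergence_real:
  fixes f :: "'a::euclidean_space \<Rightarrow> real"
  assumes f: "integrable lborel f" and d: "\<And>k. 0 < d k" "d \<longlonglongrightarrow> 0"
  shows "(\<lambda>k. \<integral>\<^sup>+x. ennreal \<bar>mollify (d k) lborel f x - f x\<bar> \<partial>lborel) \<longlonglongrightarrow> 0"
proof -
  obtain b :: 'a where b: "b \<in> Basis" using nonempty_Basis by blast
  have "mollify (d k) lborel (\<lambda>x. f x *\<^sub>R b) x - f x *\<^sub>R b = (mollify (d k) lborel f x - f x) *\<^sub>R b" for k x
    unfolding mollify_def scaleR_diff_left using integrable_mollify[OF d(1) _ f] b by (simp add: integral_scaleR_left)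
  then have "norm (mollify (d k) lborel (\<lambda>x. f x *\<^sub>R b) x - f x *\<^sub>R b) = \<bar>mollify (d k) lborel f x - f x\<bar>" for k x
    using b by simp
  then show ?thesis
    using mollify_L1_convergence[OF integrable_scaleR_left[OF f] d, of b] by simp
qed

section \<open>Total variation by duality with test fields\<close>

lemma clamp_lipschitz:
  fixes a b :: "'a::real_inner"
  shows "norm (a /\<^sub>R sqrt (1 + (norm a)\<^sup>2) - b /\<^sub>R sqrt (1 + (norm b)\<^sup>2)) \<le> 2 * norm (a - b)"
proof -
  let ?s = "\<lambda>a::'a. sqrt (1 + (norm a)\<^sup>2)"
  have s: "1 \<le> ?s a" "norm a \<le> ?s a" for a :: 'a by (auto intro: real_le_rsqrt)
  \<comment> \<open>\<open>?s a\<close> is the norm of the pair \<open>(1, a)\<close> and hence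
    1-Lipschitz. In the difference of the quotients, numerator and denominator then contribute one
    \<open>norm (a - b)\<close> each.\<close>
  have "\<bar>norm (1::real, a) - norm (1::real, b)\<bar> \<le> norm ((1::real, a) - (1, b))" by (rule norm_triangle_ineq3)
  then have sd: "\<bar>?s a - ?s b\<bar> \<le> norm (a - b)" by (simp add: norm_Pair)
  have eq: "a /\<^sub>R ?s a - b /\<^sub>R ?s b = (a - b) /\<^sub>R ?s a + ((?s b - ?s a) / (?s a * ?s b)) *\<^sub>R b"
  proof -
    have "inverse p - inverse q = (q - p) / (p * q)" if "p \<noteq> 0" "q \<noteq> 0" for p q :: real
      using that by (simp add: field_simps)
    moreover have "?s a \<noteq> 0" "?s b \<noteq> 0" using s(1)[of a] s(1)[of b] by linarith+
    ultimately have "inverse (?s a) - inverse (?s b) = (?s b - ?s a) / (?s a * ?s b)" by blast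
    then show ?thesis by (simp add: algebra_simps flip: scaleR_diff_left)
  qed
  have "norm ((a - b) /\<^sub>R ?s a) \<le> norm (a - b)"
  proof -
    have "norm (a - b) / ?s a \<le> norm (a - b) / 1" using s(1)[of a] by (intro divide_left_mono) (auto simp: add_pos_nonneg)
    moreover have "norm ((a - b) /\<^sub>R ?s a) = norm (a - b) / ?s a"
      using s(1)[of a] unfolding norm_scaleR by (subst abs_of_nonneg) (auto simp: divide_inverse mult.commute)
    ultimately show ?thesis by simp
  qed
  moreover have "norm (((?s b - ?s a) / (?s a * ?s b)) *\<^sub>R b) \<le> norm (a - b)"
  proof -
    have "norm (((?s b - ?s a) / (?s a * ?s b)) *\<^sub>R b) = \<bar>?s a - ?s b\<bar> * (norm b / ?s b) / ?s a"
      using s(1)[of a] s(1)[of b] by (simp add: abs_mult abs_minus_commute)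
    also have "\<dots> \<le> norm (a - b) * 1 / 1"
    proof -
      have "0 < ?s b" using s(1)[of b] by linarith
      then have "norm b / ?s b \<le> 1" using s(2)[of b] by (subst pos_divide_le_eq) auto
      moreover have "0 \<le> norm b / ?s b" using \<open>0 < ?s b\<close> by simp
      ultimately show ?thesis using s(1)[of a] sd by (intro divide_mono mult_mono) auto
    qed
    finally show ?thesis by simp
  qed
  ultimately show ?thesis unfolding eq using norm_triangle_ineq[of "(a - b) /\<^sub>R ?s a"] by (smt (verit))
qed

text \<open>Unlike the radial projection onto the unit ball, this map is smooth, so the composed
  field remains a test field.\<close>

lemma test_fields_clamp:
  fixes \<phi> :: "'a::euclidean_space \<Rightarrow> 'a"
  assumes \<phi>: "\<phi> \<in> test_fields U"
  shows "(\<lambda>x. \<phi> x /\<^sub>R sqrt (1 + (norm (\<phi> x))\<^sup>2)) \<in> test_fields U"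
proof -
  note D = test_fieldsD(1,2)[OF \<phi>]
  let ?d = "\<lambda>x. frechet_derivative \<phi> (at x)"
  have pos: "0 < 1 + (norm (\<phi> x))\<^sup>2" for x by (simp add: add_pos_nonneg)
  show ?thesis
  proof (rule test_fields_mult[OF \<phi>])
    fix x
    have "((\<lambda>x. inverse (sqrt (1 + \<phi> x \<bullet> \<phi> x))) has_derivative
        (\<lambda>h. - ((\<phi> x \<bullet> ?d x h) * inverse (sqrt (1 + \<phi> x \<bullet> \<phi> x)) ^ 3))) (at x)"
      using pos[of x] unfolding power2_norm_eq_inner
      by (auto intro!: derivative_eq_intros D(1) simp: inner_commute divide_simps power3_eq_cube)
    then show "((\<lambda>x. inverse (sqrt (1 + (norm (\<phi> x))\<^sup>2))) has_derivative
        (\<lambda>h. - ((\<phi> x \<bullet> ?d x h) * inverse (sqrt (1 + \<phi> x \<bullet> \<phi> x)) ^ 3))) (at x)"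
      by (simp add: power2_norm_eq_inner)
  next
    fix v
    show "continuous_on UNIV (\<lambda>x. - ((\<phi> x \<bullet> ?d x v) * inverse (sqrt (1 + \<phi> x \<bullet> \<phi> x)) ^ 3))"
      using pos unfolding power2_norm_eq_inner
      by (intro continuous_intros D(2) test_field_continuous[OF \<phi>]) (auto simp: less_imp_neq[THEN not_sym])
  qed
qed

text \<open>The fields \<open>\<phi>\<close> approximate \<open>t \<psi> / \<bar>\<psi>\<bar>\<close>; composing with \<open>y / sqrt (1 + \<bar>y\<bar>\<^sup>2)\<close> restores the
  constraint \<open>\<bar>\<phi>\<bar> \<le> 1\<close> and costs a factor \<open>t / sqrt (1 + t\<^sup>2)\<close>, which tends to \<open>1\<close>.\<close>

lemma total_variation_le:
  fixes \<psi> :: "'a::euclidean_space \<Rightarrow> 'a"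
  assumes M: "finite_measure M" and sets[measurable_cong]: "sets M = sets borel" and U: "open U" and \<psi>: "integrable M \<psi>"
    and C: "\<And>\<phi>. \<phi> \<in> test_fields U \<Longrightarrow> (\<And>x. norm (\<phi> x) \<le> 1) \<Longrightarrow> (\<integral>x. \<phi> x \<bullet> \<psi> x \<partial>M) \<le> C"
  shows "(\<integral>x. indicator U x * norm (\<psi> x) \<partial>M) \<le> C"
proof -
  interpret finite_measure M by fact
  note [measurable] = borel_measurable_integrable[OF \<psi>]
  have [measurable]: "U \<in> sets M" using U by (simp add: sets)
  define I where "I = (\<integral>x. indicator U x * norm (\<psi> x) \<partial>M)"
  have iU: "integrable M (\<lambda>x. indicator U x * norm (\<psi> x))"
    using integrable_mult_indicator[OF \<open>U \<in> sets M\<close> integrable_norm[OF \<psi>]] by simp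
  \<comment> \<open>Density in the measure |\<psi>| M controls the error weighted by |\<psi>|, which
    is the error of the pairing with \<psi>; points where \<psi> vanishes carry no mass.\<close>
  define N where "N = density M (\<lambda>x. ennreal (norm (\<psi> x)))"
  have N: "finite_measure N" "sets N = sets borel"
  proof -
    have "emeasure N (space N) = (\<integral>\<^sup>+x. ennreal (norm (\<psi> x)) \<partial>M)"
      by (auto simp: N_def emeasure_density intro!: nn_integral_cong)
    also have "\<dots> < \<infinity>" using \<psi> by (simp add: integrable_iff_bounded)
    finally show "finite_measure N" by (intro finite_measureI) simp
    show "sets N = sets borel" by (simp add: N_def sets)
  qed
  have key: "t / sqrt (1 + t\<^sup>2) * I - 2 * \<epsilon> \<le> C" if t: "0 < t" and e: "0 < \<epsilon>" for t \<epsilon>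
  proof -
    have "integrable N (\<lambda>x. t *\<^sub>R sgn (\<psi> x))"
    proof (rule finite_measure.integrable_const_bound[OF N(1)])
      show "AE x in N. norm (t *\<^sub>R sgn (\<psi> x)) \<le> t" using t by (auto simp: norm_sgn)
      show "(\<lambda>x. t *\<^sub>R sgn (\<psi> x)) \<in> borel_measurable N" unfolding sgn_div_norm N_def by simp
    qed
    then obtain \<phi> where \<phi>: "\<phi> \<in> test_fields U"
      "(\<integral>\<^sup>+x. indicator U x * ennreal (norm (t *\<^sub>R sgn (\<psi> x) - \<phi> x)) \<partial>N) < ennreal \<epsilon>"
      using test_fields_dense[OF N U _ e] by blast
    define P where "P y = y /\<^sub>R sqrt (1 + (norm y)\<^sup>2)" for y :: 'a
    have P\<phi>: "(\<lambda>x. P (\<phi> x)) \<in> test_fields U" unfolding P_def by (rule test_fields_clamp[OF \<phi>(1)])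
    note [measurable] = test_field_measurable[OF \<phi>(1)] test_field_measurable[OF P\<phi>]
    have P1: "norm (P y) \<le> 1" for y
    proof -
      have "0 < sqrt (1 + (norm y)\<^sup>2)" by (simp add: add_pos_nonneg)
      moreover have "norm y \<le> sqrt (1 + (norm y)\<^sup>2)" by (auto intro: real_le_rsqrt)
      ultimately show ?thesis by (simp add: P_def divide_inverse[symmetric] mult.commute[of "inverse _"] divide_le_eq)
    qed
    have Pz: "P (\<phi> x) = 0" if "x \<notin> U" for x using test_field_support[OF P\<phi>] that by blast
    have iP: "integrable M (\<lambda>x. P (\<phi> x) \<bullet> \<psi> x)"
    proof (rule Bochner_Integration.integrable_bound[OF integrable_norm[OF \<psi>]])
      show "AE x in M. norm (P (\<phi> x) \<bullet> \<psi> x) \<le> norm (norm (\<psi> x))"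
      proof (intro AE_I2)
        fix x
        have "norm (P (\<phi> x)) * norm (\<psi> x) \<le> 1 * norm (\<psi> x)" by (intro mult_right_mono P1) auto
        then show "norm (P (\<phi> x) \<bullet> \<psi> x) \<le> norm (norm (\<psi> x))"
          using Cauchy_Schwarz_ineq2[of "P (\<phi> x)" "\<psi> x"] by simp
      qed
    qed measurable
    define E where "E x = indicator U x * norm (t *\<^sub>R sgn (\<psi> x) - \<phi> x) * norm (\<psi> x)" for x
    have E0: "0 \<le> E x" for x by (simp add: E_def)
    have [measurable]: "E \<in> borel_measurable M" unfolding E_def[abs_def] sgn_div_norm by measurable
    have nE: "(\<integral>\<^sup>+x. ennreal (E x) \<partial>M) < ennreal \<epsilon>"
    proof -
      have "(\<integral>\<^sup>+x. indicator U x * ennreal (norm (t *\<^sub>R sgn (\<psi> x) - \<phi> x)) \<partial>N) = (\<integral>\<^sup>+x. ennreal (E x) \<partial>M)"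
        unfolding N_def sgn_div_norm
        by (subst nn_integral_density)
           (auto intro!: nn_integral_cong simp: E_def sgn_div_norm ennreal_mult mult.commute split: split_indicator)
      then show ?thesis using \<phi>(2) by simp
    qed
    have iE: "integrable M E" using nE E0 by (auto simp: integrable_iff_bounded intro: less_trans)
    have E_le: "(\<integral>x. E x \<partial>M) \<le> \<epsilon>"
      using nE E0 e by (subst (asm) nn_integral_eq_integral[OF iE]) (auto simp: ennreal_less_iff integral_nonneg_AE)
    have "t / sqrt (1 + t\<^sup>2) * I - 2 * (\<integral>x. E x \<partial>M) = (\<integral>x. t / sqrt (1 + t\<^sup>2) * (indicator U x * norm (\<psi> x)) - 2 * E x \<partial>M)"
      unfolding I_def using iE iU by simp
    also have "\<dots> \<le> (\<integral>x. P (\<phi> x) \<bullet> \<psi> x \<partial>M)"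
    proof (rule integral_mono)
      show "integrable M (\<lambda>x. t / sqrt (1 + t\<^sup>2) * (indicator U x * norm (\<psi> x)) - 2 * E x)"
        using iE iU by (intro Bochner_Integration.integrable_diff integrable_mult_right)
      fix x
      show "t / sqrt (1 + t\<^sup>2) * (indicator U x * norm (\<psi> x)) - 2 * E x \<le> P (\<phi> x) \<bullet> \<psi> x"
      proof (cases "x \<in> U \<and> \<psi> x \<noteq> 0")
        case True
        have "P (t *\<^sub>R sgn (\<psi> x)) \<bullet> \<psi> x = t / sqrt (1 + t\<^sup>2) * norm (\<psi> x)"
          using True t by (simp add: P_def norm_sgn power_mult_distrib sgn_div_norm divide_inverse dot_square_norm power2_eq_square)
        \<comment> \<open>The factor 2 is the Lipschitz constant of the clamp.\<close>
        moreover have "(P (t *\<^sub>R sgn (\<psi> x)) - P (\<phi> x)) \<bullet> \<psi> x \<le> 2 * norm (t *\<^sub>R sgn (\<psi> x) - \<phi> x) * norm (\<psi> x)"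
          using norm_cauchy_schwarz[of "P (t *\<^sub>R sgn (\<psi> x)) - P (\<phi> x)" "\<psi> x"]
            mult_right_mono[OF clamp_lipschitz[of "t *\<^sub>R sgn (\<psi> x)" "\<phi> x"], of "norm (\<psi> x)"]
          unfolding P_def by simp
        ultimately show ?thesis using True by (simp add: E_def inner_diff_left)
      next
        case False
        then show ?thesis using Pz[of x] by (auto simp: E_def)
      qed
    qed (rule iP)
    also have "\<dots> \<le> C" by (rule C[OF P\<phi> P1])
    finally show ?thesis using E_le by linarith
  qed
  have I0: "0 \<le> I" unfolding I_def by (intro integral_nonneg_AE) auto
  \<comment> \<open>Take \<open>t = k + 1\<close> and accuracy \<open>1 / t\<close>. From
    \<open>sqrt (1 + t\<^sup>2) \<le> 1 + t\<close> the factor is at least \<open>1 - 1 / t\<close>,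
    and the losses add up to \<open>(I + 2) / t\<close>.\<close>
  have "I - (I + 2) / real (Suc k) \<le> C" for k
  proof -
    define t where "t = real (Suc k)"
    have t: "0 < t" by (simp add: t_def)
    have s: "0 < sqrt (1 + t\<^sup>2)" by (simp add: add_pos_nonneg)
    have "sqrt (1 + t\<^sup>2) \<le> 1 + t" using t by (intro real_le_lsqrt) (auto simp: power2_sum)
    then have "t / (1 + t) \<le> t / sqrt (1 + t\<^sup>2)" using t s by (intro divide_left_mono) auto
    moreover have "1 - 1 / t \<le> t / (1 + t)" using t by (simp add: field_simps)
    ultimately have "1 - 1 / t \<le> t / sqrt (1 + t\<^sup>2)" by linarith
    then have "(1 - 1 / t) * I \<le> t / sqrt (1 + t\<^sup>2) * I" using I0 by (intro mult_right_mono)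
    moreover have "t / sqrt (1 + t\<^sup>2) * I - 2 * (1 / t) \<le> C" using t by (intro key) auto
    moreover have "(1 - 1 / t) * I - 2 * (1 / t) = I - (I + 2) / t" using t by (simp add: field_simps)
    ultimately show ?thesis unfolding t_def by linarith
  qed
  moreover have "(\<lambda>k. I - (I + 2) / real (Suc k)) \<longlonglongrightarrow> I - 0"
    by (intro tendsto_diff tendsto_const LIMSEQ_divide_real_of_nat_Suc)
  ultimately have "I - 0 \<le> C" by (intro LIMSEQ_le_const2) auto
  then show ?thesis by (simp add: I_def)
qed

section \<open>The divergence theorem on balls\<close>

lemma integral_lborel_translate:
  fixes a :: "'a::euclidean_space" and f :: "'a \<Rightarrow> 'b::euclidean_space"
  assumes [measurable]: "f \<in> borel_measurable borel"
  shows "(\<integral>x. f (x + a) \<partial>lborel) = (\<integral>x. f x \<partial>lborel)"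
proof -
  have "(\<integral>x. f x \<partial>lborel) = (\<integral>x. f x \<partial>distr lborel borel ((+) a))" by (simp add: lborel_distr_plus)
  also have "\<dots> = (\<integral>x. f (x + a) \<partial>lborel)" by (subst integral_distr) (auto simp: add.commute)
  finally show ?thesis by simp
qed

lemma integral_lborel_scale:
  fixes f :: "'a::euclidean_space \<Rightarrow> real"
  assumes [measurable]: "f \<in> borel_measurable borel" and s: "0 < s"
  shows "(\<integral>x. f x \<partial>lborel) = s ^ DIM('a) * (\<integral>x. f (s *\<^sub>R x) \<partial>lborel)"
proof -
  have *: "(lborel :: 'a measure) = density (distr lborel borel (\<lambda>x. 0 + s *\<^sub>R x)) (\<lambda>_. \<bar>s\<bar> ^ DIM('a))"
    using s by (intro lborel_affine) auto
  have "(\<integral>x. f x \<partial>lborel) = (\<integral>x. f x \<partial>density (distr lborel borel (\<lambda>x. 0 + s *\<^sub>R x)) (\<lambda>_. ennreal (\<bar>s\<bar> ^ DIM('a))))"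
    by (subst *) simp
  also have "\<dots> = (\<integral>x. \<bar>s\<bar> ^ DIM('a) *\<^sub>R f x \<partial>distr lborel borel (\<lambda>x. 0 + s *\<^sub>R x))"
    by (rule integral_density) auto
  also have "\<dots> = (\<integral>x. \<bar>s\<bar> ^ DIM('a) *\<^sub>R f (0 + s *\<^sub>R x) \<partial>lborel)"
    by (rule integral_distr) auto
  finally show ?thesis using s by simp
qed

lemma integrable_continuous_compact_support:
  fixes f :: "'a::euclidean_space \<Rightarrow> 'b::euclidean_space"
  assumes "continuous_on UNIV f" "compact K" "\<And>x. x \<notin> K \<Longrightarrow> f x = 0"
  shows "integrable lborel f"
proof -
  have "integrable lborel (\<lambda>x. indicator K x *\<^sub>R f x)"
    by (rule borel_integrable_compact) (auto intro: assms continuous_on_subset[OF assms(1)])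
  moreover have "(\<lambda>x. indicator K x *\<^sub>R f x) = f"
    using assms(3) by (auto simp: fun_eq_iff split: split_indicator)
  ultimately show ?thesis by simp
qed

lemma test_field_integrable:
  assumes \<phi>: "\<phi> \<in> test_fields U"
  shows "integrable lborel \<phi>" "integrable lborel (divergence \<phi>)"
proof -
  obtain K where K: "compact K" "\<And>x. x \<notin> K \<Longrightarrow> \<phi> x = 0" "\<And>x. x \<notin> K \<Longrightarrow> divergence \<phi> x = 0"
    using test_field_support[OF \<phi>] by blast
  show "integrable lborel \<phi>" "integrable lborel (divergence \<phi>)"
    by (rule integrable_continuous_compact_support[OF _ K(1)];
        use K test_field_continuous[OF \<phi>] divergence_continuous[OF \<phi>] in blast)+
qed

lemma difference_quotient_limit:
  fixes f :: "real \<Rightarrow> real" and t :: "nat \<Rightarrow> real"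
  assumes "(f has_real_derivative d) (at 0)" "t \<longlonglongrightarrow> 0" "\<And>k. t k \<noteq> 0"
  shows "(\<lambda>k. (f (t k) - f 0) / t k) \<longlonglongrightarrow> d"
proof -
  have "((\<lambda>h. (f (0 + h) - f 0) / h) \<longlongrightarrow> d) (at 0)" using assms(1) by (simp add: DERIV_def)
  moreover have "filterlim t (at 0) sequentially" using assms(2,3) by (simp add: filterlim_at)
  ultimately show ?thesis using filterlim_compose by fastforce
qed

text \<open>Integration by parts against the cone \<open>max 0 (\<rho> - norm x)\<close>, whose
  gradient inside the ball is \<open>- sgn x\<close>. Difference quotients are moved from the field
  to the cone by translation invariance. The cone is Lipschitz, and differentiable off the origin
  and the sphere, so dominated convergence works on both sides.\<close>

lemma integral_cone_divergence:
  fixes \<phi> :: "'a::euclidean_space \<Rightarrow> 'a"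
  assumes \<phi>: "\<phi> \<in> test_fields UNIV"
  shows "(\<integral>x. max 0 (\<rho> - norm x) * divergence \<phi> x \<partial>lborel) = (\<integral>x. indicator (ball 0 \<rho>) x * (\<phi> x \<bullet> sgn x) \<partial>lborel)"
proof -
  define \<eta> where "\<eta> x = max 0 (\<rho> - norm x)" for x :: 'a
  define d where "d x = frechet_derivative \<phi> (at x)" for x
  note D = test_fieldsD(1,2)[OF \<phi>, folded d_def]
  define t where "t k = 1 / real (Suc k)" for k
  have t: "0 < t k" "t k \<noteq> 0" for k by (simp_all add: t_def)
  have tlim: "t \<longlonglongrightarrow> 0" unfolding t_def by (rule LIMSEQ_divide_real_of_nat_Suc)
  obtain L where L: "0 < L" "\<And>x y. norm (\<phi> x - \<phi> y) \<le> L * norm (x - y)" using test_field_lipschitz[OF \<phi>] by blast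
  have c\<eta>: "continuous_on UNIV \<eta>" unfolding \<eta>_def[abs_def] by (intro continuous_intros)
  have i\<eta>: "integrable lborel \<eta>"
    by (rule integrable_continuous_compact_support[OF c\<eta>, of "cball 0 \<rho>"]) (auto simp: \<eta>_def)
  note i\<phi> = test_field_integrable(1)[OF \<phi>]
  note [measurable] = borel_measurable_continuous_onI[OF c\<eta>] test_field_measurable[OF \<phi>]
  have [measurable]: "ball (0::'a) \<rho> \<in> sets borel" by simp
  have [measurable]: "(sgn :: 'a \<Rightarrow> 'a) \<in> borel_measurable borel" unfolding sgn_div_norm by measurable
  have \<eta>lip: "\<bar>\<eta> x - \<eta> y\<bar> \<le> norm (x - y)" for x y
    using norm_triangle_ineq3[of x y] by (auto simp: \<eta>_def)
  have dir: "(\<integral>x. \<eta> x * (d x b \<bullet> b) \<partial>lborel) = (\<integral>x. indicator (ball 0 \<rho>) x * (sgn x \<bullet> b) * (\<phi> x \<bullet> b) \<partial>lborel)"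
    if b: "b \<in> Basis" for b :: 'a
  proof -
    have [measurable]: "(\<lambda>x. d x b) \<in> borel_measurable borel" by (rule borel_measurable_continuous_onI[OF D(2)])
    have A: "(\<lambda>k. \<integral>x. \<eta> x * ((\<phi> (x + t k *\<^sub>R b) \<bullet> b - \<phi> x \<bullet> b) / t k) \<partial>lborel) \<longlonglongrightarrow> (\<integral>x. \<eta> x * (d x b \<bullet> b) \<partial>lborel)"
    proof (rule integral_dominated_convergence[where w = "\<lambda>x. \<eta> x * L"])
      show "integrable lborel (\<lambda>x. \<eta> x * L)" using i\<eta> by simp
      show "AE x in lborel. (\<lambda>k. \<eta> x * ((\<phi> (x + t k *\<^sub>R b) \<bullet> b - \<phi> x \<bullet> b) / t k)) \<longlonglongrightarrow> \<eta> x * (d x b \<bullet> b)"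
      proof (intro AE_I2 tendsto_mult tendsto_const)
        fix x
        have "((\<lambda>s. \<phi> (x + s *\<^sub>R b) \<bullet> b) has_derivative (\<lambda>s. d x (s *\<^sub>R b) \<bullet> b)) (at 0)"
          by (rule has_derivative_inner_left, rule has_derivative_compose[where g = \<phi>])
             (auto intro!: derivative_eq_intros D(1))
        moreover have "d x (s *\<^sub>R b) \<bullet> b = (d x b \<bullet> b) * s" for s
          using has_derivative_bounded_linear[OF D(1)[of x]] by (simp add: linear_scale bounded_linear.linear)
        ultimately have "((\<lambda>s. \<phi> (x + s *\<^sub>R b) \<bullet> b) has_real_derivative (d x b \<bullet> b)) (at 0)"
          by (simp add: has_field_derivative_def)
        from difference_quotient_limit[OF this tlim t(2)]
        show "(\<lambda>k. (\<phi> (x + t k *\<^sub>R b) \<bullet> b - \<phi> x \<bullet> b) / t k) \<longlonglongrightarrow> d x b \<bullet> b" by simp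
      qed
      show "AE x in lborel. norm (\<eta> x * ((\<phi> (x + t k *\<^sub>R b) \<bullet> b - \<phi> x \<bullet> b) / t k)) \<le> \<eta> x * L" for k
      proof (intro AE_I2)
        fix x
        have "\<bar>\<phi> (x + t k *\<^sub>R b) \<bullet> b - \<phi> x \<bullet> b\<bar> \<le> norm (\<phi> (x + t k *\<^sub>R b) - \<phi> x)"
          unfolding inner_diff_left[symmetric] by (rule Basis_le_norm[OF b])
        also have "\<dots> \<le> L * t k" using L(2)[of "x + t k *\<^sub>R b" x] t(1)[of k] b by simp
        finally have "\<bar>\<phi> (x + t k *\<^sub>R b) \<bullet> b - \<phi> x \<bullet> b\<bar> / t k \<le> L" using t(1)[of k] by (simp add: pos_divide_le_eq)
        then have "\<eta> x * (\<bar>\<phi> (x + t k *\<^sub>R b) \<bullet> b - \<phi> x \<bullet> b\<bar> / t k) \<le> \<eta> x * L"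
          by (intro mult_left_mono) (auto simp: \<eta>_def)
        moreover have "0 \<le> \<eta> x" by (simp add: \<eta>_def)
        ultimately show "norm (\<eta> x * ((\<phi> (x + t k *\<^sub>R b) \<bullet> b - \<phi> x \<bullet> b) / t k)) \<le> \<eta> x * L"
          using t(1)[of k] by (simp add: abs_mult)
      qed
    qed measurable
    have B: "(\<lambda>k. \<integral>x. ((\<eta> (x - t k *\<^sub>R b) - \<eta> x) / t k) * (\<phi> x \<bullet> b) \<partial>lborel) \<longlonglongrightarrow>
       (\<integral>x. indicator (ball 0 \<rho>) x * (sgn x \<bullet> b) * (\<phi> x \<bullet> b) \<partial>lborel)"
    proof (rule integral_dominated_convergence[where w = "\<lambda>x. norm (\<phi> x)"])
      show "integrable lborel (\<lambda>x. norm (\<phi> x))" using i\<phi> by simp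
      have "negligible (sphere (0::'a) \<rho>)" by (rule negligible_sphere)
      then have null: "AE x::'a in lborel. x \<notin> sphere 0 \<rho>" 
        by (intro AE_not_in) (auto simp: negligible_iff_null_sets null_sets_completion_iff)
      show "AE x in lborel. (\<lambda>k. ((\<eta> (x - t k *\<^sub>R b) - \<eta> x) / t k) * (\<phi> x \<bullet> b)) \<longlonglongrightarrow>
          indicator (ball 0 \<rho>) x * (sgn x \<bullet> b) * (\<phi> x \<bullet> b)"
        using null AE_lborel_singleton[of 0]
      proof eventually_elim
        fix x :: 'a assume x: "x \<notin> sphere 0 \<rho>" "x \<noteq> 0"
        have nd: "((\<lambda>s. norm (x - s *\<^sub>R b)) has_real_derivative - (sgn x \<bullet> b)) (at 0)"
        proof -
          have "((\<lambda>s. norm (x - s *\<^sub>R b)) has_derivative (\<lambda>s. sgn (x - 0 *\<^sub>R b) \<bullet> (0 - s *\<^sub>R b))) (at 0)"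
          proof (rule has_derivative_compose[where g = norm])
            show "((\<lambda>s. x - s *\<^sub>R b) has_derivative (\<lambda>s. 0 - s *\<^sub>R b)) (at 0)"
              by (auto intro!: derivative_eq_intros)
            show "(norm has_derivative (\<lambda>h. sgn (x - 0 *\<^sub>R b) \<bullet> h)) (at (x - 0 *\<^sub>R b))"
              using x(2) has_derivative_norm[of x] by (simp add: inner_commute)
          qed
          moreover have "(\<lambda>s. sgn (x - 0 *\<^sub>R b) \<bullet> (0 - s *\<^sub>R b)) = (\<lambda>s. - (sgn x \<bullet> b) * s)"
            by (auto simp: fun_eq_iff)
          ultimately show ?thesis unfolding has_field_derivative_def by (simp only: )
        qed
        have lim: "(\<lambda>s. norm (x - s *\<^sub>R b)) \<midarrow>0\<rightarrow> norm x" by (auto intro!: tendsto_eq_intros)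
        have "((\<lambda>s. \<eta> (x - s *\<^sub>R b)) has_real_derivative indicator (ball 0 \<rho>) x * (sgn x \<bullet> b)) (at 0)"
        proof (cases "norm x < \<rho>")
          case True
          have ev: "\<forall>\<^sub>F s in at 0. \<eta> (x - s *\<^sub>R b) = \<rho> - norm (x - s *\<^sub>R b)"
            using order_tendstoD(2)[OF lim True] by eventually_elim (simp add: \<eta>_def)
          have "((\<lambda>s. \<rho> - norm (x - s *\<^sub>R b)) has_real_derivative 0 - - (sgn x \<bullet> b)) (at 0)"
            by (intro DERIV_diff DERIV_const nd)
          then show ?thesis
            using ev True by (subst DERIV_cong_ev[OF refl _ refl, of _ "\<lambda>s. \<rho> - norm (x - s *\<^sub>R b)"])
              (auto simp: eventually_nhds_conv_at \<eta>_def)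
        next
          case False
          then have gt: "\<rho> < norm x" using x(1) by simp
          have ev: "\<forall>\<^sub>F s in at 0. \<eta> (x - s *\<^sub>R b) = 0"
            using order_tendstoD(1)[OF lim gt] by eventually_elim (simp add: \<eta>_def)
          have "((\<lambda>s::real. 0::real) has_real_derivative 0) (at 0)" by simp
          then show ?thesis
            using ev gt by (subst DERIV_cong_ev[OF refl _ refl, of _ "\<lambda>s. 0"])
              (auto simp: eventually_nhds_conv_at \<eta>_def)
        qed
        from difference_quotient_limit[OF this tlim t(2)]
        show "(\<lambda>k. ((\<eta> (x - t k *\<^sub>R b) - \<eta> x) / t k) * (\<phi> x \<bullet> b)) \<longlonglongrightarrow>
          indicator (ball 0 \<rho>) x * (sgn x \<bullet> b) * (\<phi> x \<bullet> b)" by (intro tendsto_mult tendsto_const) simp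
      qed
      show "AE x in lborel. norm (((\<eta> (x - t k *\<^sub>R b) - \<eta> x) / t k) * (\<phi> x \<bullet> b)) \<le> norm (\<phi> x)" for k
      proof (intro AE_I2)
        fix x
        have "\<bar>\<eta> (x - t k *\<^sub>R b) - \<eta> x\<bar> \<le> t k" using \<eta>lip[of "x - t k *\<^sub>R b" x] t(1)[of k] b by simp
        then have "\<bar>\<eta> (x - t k *\<^sub>R b) - \<eta> x\<bar> / t k \<le> 1" using t(1)[of k] by (simp add: pos_divide_le_eq)
        then have "(\<bar>\<eta> (x - t k *\<^sub>R b) - \<eta> x\<bar> / t k) * \<bar>\<phi> x \<bullet> b\<bar> \<le> 1 * norm (\<phi> x)"
          using t(1)[of k] by (intro mult_mono Basis_le_norm[OF b]) auto
        then show "norm (((\<eta> (x - t k *\<^sub>R b) - \<eta> x) / t k) * (\<phi> x \<bullet> b)) \<le> norm (\<phi> x)"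
          using t(1)[of k] by (simp add: abs_mult)
      qed
    qed measurable
    \<comment> \<open>Discrete integration by parts: the product containing the shifted field is
      translated by \<open>t k *\<^sub>R b\<close>.\<close>
    have eq: "(\<integral>x. \<eta> x * ((\<phi> (x + t k *\<^sub>R b) \<bullet> b - \<phi> x \<bullet> b) / t k) \<partial>lborel)
        = (\<integral>x. ((\<eta> (x - t k *\<^sub>R b) - \<eta> x) / t k) * (\<phi> x \<bullet> b) \<partial>lborel)" for k
    proof -
      have cont: "continuous_on UNIV (\<lambda>x. \<eta> (x + u) * (\<phi> (x + v) \<bullet> b))" for u v
        by (intro continuous_intros continuous_on_compose2[OF c\<eta>] continuous_on_compose2[OF test_field_continuous[OF \<phi>]]) auto
      have int: "integrable lborel (\<lambda>x. \<eta> (x + u) * (\<phi> (x + v) \<bullet> b))" for u v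
      proof (rule integrable_continuous_compact_support[OF cont])
        show "compact (cball (-u) \<rho>)" by simp
        show "\<eta> (x + u) * (\<phi> (x + v) \<bullet> b) = 0" if "x \<notin> cball (-u) \<rho>" for x
          using that by (simp add: \<eta>_def dist_norm norm_minus_commute add.commute)
      qed
      have "(\<integral>x. \<eta> x * ((\<phi> (x + t k *\<^sub>R b) \<bullet> b - \<phi> x \<bullet> b) / t k) \<partial>lborel)
        = ((\<integral>x. \<eta> x * (\<phi> (x + t k *\<^sub>R b) \<bullet> b) \<partial>lborel) - (\<integral>x. \<eta> x * (\<phi> x \<bullet> b) \<partial>lborel)) / t k"
        using int[of 0 "t k *\<^sub>R b"] int[of 0 0] by (simp add: right_diff_distrib diff_divide_distrib)
      also have "(\<integral>x. \<eta> x * (\<phi> (x + t k *\<^sub>R b) \<bullet> b) \<partial>lborel) = (\<integral>x. \<eta> (x - t k *\<^sub>R b) * (\<phi> x \<bullet> b) \<partial>lborel)"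
        using integral_lborel_translate[of "\<lambda>x. \<eta> (x - t k *\<^sub>R b) * (\<phi> x \<bullet> b)" "t k *\<^sub>R b"] by simp
      also have "(\<dots> - (\<integral>x. \<eta> x * (\<phi> x \<bullet> b) \<partial>lborel)) / t k
         = (\<integral>x. ((\<eta> (x - t k *\<^sub>R b) - \<eta> x) / t k) * (\<phi> x \<bullet> b) \<partial>lborel)"
        using int[of "- t k *\<^sub>R b" 0] int[of 0 0] by (simp add: left_diff_distrib diff_divide_distrib)
      finally show ?thesis .
    qed
    show ?thesis using LIMSEQ_unique[OF A] B unfolding eq by simp
  qed
  have i1: "integrable lborel (\<lambda>x. \<eta> x * (d x b \<bullet> b))" for b
    by (rule integrable_continuous_compact_support[of _ "cball 0 \<rho>"])
       (auto intro!: continuous_intros c\<eta> D(2) simp: \<eta>_def)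
  have i2: "integrable lborel (\<lambda>x. indicator (ball 0 \<rho>) x * (sgn x \<bullet> b) * (\<phi> x \<bullet> b))" if b: "b \<in> Basis" for b
  proof (rule Bochner_Integration.integrable_bound[OF integrable_norm[OF i\<phi>]])
    show "(\<lambda>x. indicator (ball 0 \<rho>) x * (sgn x \<bullet> b) * (\<phi> x \<bullet> b)) \<in> borel_measurable lborel"
      unfolding sgn_div_norm by measurable
    show "AE x in lborel. norm (indicator (ball 0 \<rho>) x * (sgn x \<bullet> b) * (\<phi> x \<bullet> b)) \<le> norm (norm (\<phi> x))"
    proof (intro AE_I2)
      fix x :: 'a
      have "\<bar>sgn x \<bullet> b\<bar> \<le> 1" using Basis_le_norm[OF b, of "sgn x"] by (auto simp: norm_sgn split: if_splits)
      then have "\<bar>sgn x \<bullet> b\<bar> * \<bar>\<phi> x \<bullet> b\<bar> \<le> 1 * norm (\<phi> x)" by (intro mult_mono Basis_le_norm[OF b]) auto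
      then show "norm (indicator (ball 0 \<rho>) x * (sgn x \<bullet> b) * (\<phi> x \<bullet> b)) \<le> norm (norm (\<phi> x))"
        by (auto simp: abs_mult split: split_indicator)
    qed
  qed
  have "(\<integral>x. \<eta> x * divergence \<phi> x \<partial>lborel) = (\<integral>x. (\<Sum>b\<in>Basis. \<eta> x * (d x b \<bullet> b)) \<partial>lborel)"
    by (simp add: divergence_def d_def sum_distrib_left)
  also have "\<dots> = (\<Sum>b\<in>Basis. \<integral>x. \<eta> x * (d x b \<bullet> b) \<partial>lborel)"
    by (rule Bochner_Integration.integral_sum) (rule i1)
  also have "\<dots> = (\<Sum>b\<in>Basis. \<integral>x. indicator (ball 0 \<rho>) x * (sgn x \<bullet> b) * (\<phi> x \<bullet> b) \<partial>lborel)"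
    by (intro sum.cong refl dir)
  also have "\<dots> = (\<integral>x. (\<Sum>b\<in>Basis. indicator (ball 0 \<rho>) x * (sgn x \<bullet> b) * (\<phi> x \<bullet> b)) \<partial>lborel)"
    by (rule Bochner_Integration.integral_sum[symmetric]) (rule i2)
  also have "\<dots> = (\<integral>x. indicator (ball 0 \<rho>) x * (\<phi> x \<bullet> sgn x) \<partial>lborel)"
    by (intro Bochner_Integration.integral_cong refl, subst euclidean_inner) (simp add: sum_distrib_left mult_ac)
  finally show ?thesis unfolding \<eta>_def .
qed

lemma test_field_radial_bound:
  fixes \<phi> :: "'a::euclidean_space \<Rightarrow> 'a"
  assumes \<phi>: "\<phi> \<in> test_fields UNIV"
  shows "\<exists>B>0. \<forall>x. \<bar>\<phi> (\<rho> *\<^sub>R sgn x) \<bullet> sgn x\<bar> \<le> B"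
proof -
  obtain B where B: "0 < B" "\<And>x. norm (\<phi> x) \<le> B" using test_field_bounded[OF \<phi>] by blast
  have "\<bar>\<phi> y \<bullet> sgn x\<bar> \<le> B" for x y
  proof -
    have "\<bar>\<phi> y \<bullet> sgn x\<bar> \<le> norm (\<phi> y) * norm (sgn x)" by (rule Cauchy_Schwarz_ineq2)
    also have "\<dots> \<le> B * 1" using B by (intro mult_mono) (auto simp: norm_sgn less_imp_le)
    finally show ?thesis by simp
  qed
  then show ?thesis using B(1) by blast
qed

lemma ball_indicator_integrable:
  fixes f :: "'a::euclidean_space \<Rightarrow> real"
  assumes [measurable]: "f \<in> borel_measurable borel" and B: "\<And>x. \<bar>f x\<bar> \<le> B"
  shows "integrable lborel (\<lambda>x. indicator (ball a r) x * f x)"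
proof (rule Bochner_Integration.integrable_bound)
  have [measurable]: "ball a r \<in> sets borel" by simp
  have "integrable lborel (indicator (ball a r) :: 'a \<Rightarrow> real)"
    using emeasure_bounded_finite[OF bounded_ball[of a r]] by (intro integrable_real_indicator) auto
  then show "integrable lborel (\<lambda>x. B * indicator (ball a r) x)" by (intro integrable_mult_right)
  show "AE x in lborel. norm (indicator (ball a r) x * f x) \<le> norm (B * indicator (ball a r) x)"
    by (intro AE_I2) (auto split: split_indicator intro: order_trans[OF B])
  show "(\<lambda>x. indicator (ball a r) x * f x) \<in> borel_measurable lborel" by measurable
qed

text \<open>The flux through the sphere appears as a volume integral of the field read at the radial
  projection, and n / \<rho> is the ratio of surface area to volume. The identity is the derivative
  of \<open>integral_cone_divergence\<close> with respect to \<rho>.\<close>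

theorem divergence_theorem_ball:
  fixes \<phi> :: "'a::euclidean_space \<Rightarrow> 'a"
  assumes \<phi>: "\<phi> \<in> test_fields UNIV" and \<rho>: "0 < \<rho>"
  shows "(\<integral>x. indicator (ball 0 \<rho>) x * divergence \<phi> x \<partial>lborel)
     = real DIM('a) / \<rho> * (\<integral>x. indicator (ball 0 \<rho>) x * (\<phi> (\<rho> *\<^sub>R sgn x) \<bullet> sgn x) \<partial>lborel)"
proof -
  let ?n = "DIM('a)" and ?w = "unit_ball_vol (real DIM('a))"
  define \<epsilon> where "\<epsilon> k = (\<rho> / 2) / real (Suc k)" for k
  have e: "0 < \<epsilon> k" "\<epsilon> k \<noteq> 0" for k using \<rho> by (simp_all add: \<epsilon>_def)
  have elim: "\<epsilon> \<longlonglongrightarrow> 0" unfolding \<epsilon>_def by (rule LIMSEQ_divide_real_of_nat_Suc)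
  have er: "\<epsilon> k < \<rho>" for k
  proof -
    have "(\<rho> / 2) / real (Suc k) \<le> (\<rho> / 2) / 1" using \<rho> by (intro divide_left_mono) auto
    then show ?thesis using \<rho> unfolding \<epsilon>_def by linarith
  qed
  \<comment> \<open>\<open>F\<close> is constant along rays, so its integral over centred balls
    scales like their volume.\<close>
  define F where "F x = \<phi> (\<rho> *\<^sub>R sgn x) \<bullet> sgn x" for x
  obtain B where B: "0 < B" "\<And>x. \<bar>F x\<bar> \<le> B" using test_field_radial_bound[OF \<phi>, of \<rho>] unfolding F_def by blast
  obtain B' where B': "0 < B'" "\<And>x. \<bar>divergence \<phi> x\<bar> \<le> B'" using divergence_bounded[OF \<phi>] by blast
  obtain B'' where B'': "0 < B''" "\<And>x. norm (\<phi> x) \<le> B''" using test_field_bounded[OF \<phi>] by blast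
  obtain L where L: "0 < L" "\<And>x y. norm (\<phi> x - \<phi> y) \<le> L * norm (x - y)" using test_field_lipschitz[OF \<phi>] by blast
  have dm [measurable]: "divergence \<phi> \<in> borel_measurable borel" by (rule divergence_measurable[OF \<phi>])
  have [measurable]: "\<phi> \<in> borel_measurable borel" by (rule test_field_measurable[OF \<phi>])
  have [measurable]: "F \<in> borel_measurable borel" unfolding F_def[abs_def] by measurable
  have [measurable]: "ball (0::'a) r \<in> sets borel" for r by simp
  have b: "\<bar>\<phi> x \<bullet> sgn x\<bar> \<le> B''" for x
  proof -
    have "\<bar>\<phi> x \<bullet> sgn x\<bar> \<le> norm (\<phi> x) * norm (sgn x)" by (rule Cauchy_Schwarz_ineq2)
    also have "\<dots> \<le> B'' * 1" using B'' by (intro mult_mono) (auto simp: norm_sgn less_imp_le)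
    finally show ?thesis by simp
  qed
  have iF: "integrable lborel (\<lambda>x. indicator (ball 0 r) x * F x)" for r
    by (rule ball_indicator_integrable[OF _ B(2)]) measurable
  have i\<phi>: "integrable lborel (\<lambda>x. indicator (ball 0 r) x * (\<phi> x \<bullet> sgn x))" for r
    by (rule ball_indicator_integrable[OF _ b]) measurable
  have i1: "integrable lborel (indicator (ball (0::'a) r) :: 'a \<Rightarrow> real)" for r
    using emeasure_bounded_finite[OF bounded_ball[of "0::'a" r]] by (intro integrable_real_indicator) auto
  have ieta: "integrable lborel (\<lambda>x. max 0 (r - norm x) * divergence \<phi> x)" for r
    by (rule integrable_continuous_compact_support[of _ "cball 0 r"])
       (auto intro!: continuous_intros divergence_continuous[OF \<phi>])
  define J where "J = (\<integral>x. indicator (ball 0 \<rho>) x * F x \<partial>lborel)"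
  have scale: "(\<integral>x. indicator (ball 0 (s * \<rho>)) x * F x \<partial>lborel) = s ^ ?n * J" if s: "0 < s" for s
  proof -
    have "(\<integral>x. indicator (ball 0 (s * \<rho>)) x * F x \<partial>lborel)
       = s ^ ?n * (\<integral>x. indicator (ball 0 (s * \<rho>)) (s *\<^sub>R x) * F (s *\<^sub>R x) \<partial>lborel)"
      by (rule integral_lborel_scale[OF _ s]) measurable
    also have "(\<integral>x. indicator (ball 0 (s * \<rho>)) (s *\<^sub>R x) * F (s *\<^sub>R x) \<partial>lborel) = J"
      unfolding J_def F_def using s
      by (intro Bochner_Integration.integral_cong refl) (auto simp: sgn_scaleR split: split_indicator)
    finally show ?thesis .
  qed
  define v where "v k = measure lborel (ball (0::'a) \<rho>) - measure lborel (ball (0::'a) (\<rho> - \<epsilon> k))" for k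
  define c where "c k = (1 - ((\<rho> - \<epsilon> k) / \<rho>) ^ ?n) / \<epsilon> k" for k
  \<comment> \<open>The difference of two cones divided by \<open>\<epsilon> k\<close> is 1 on the
    inner ball and falls to 0 across a shell of width \<open>\<epsilon> k\<close>. In the limit it
    is the indicator of the ball, while \<open>integral_cone_divergence\<close> rewrites
    \<open>Q k\<close> as an average over the shell.\<close>
  define Q where "Q k = (\<integral>x. ((max 0 (\<rho> - norm x) - max 0 (\<rho> - \<epsilon> k - norm x)) / \<epsilon> k) * divergence \<phi> x \<partial>lborel)" for k
  have Qlim: "Q \<longlonglongrightarrow> (\<integral>x. indicator (ball 0 \<rho>) x * divergence \<phi> x \<partial>lborel)"
    unfolding Q_def
  proof (rule integral_dominated_convergence[where w = "\<lambda>x. \<bar>divergence \<phi> x\<bar>"])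
    show "integrable lborel (\<lambda>x. \<bar>divergence \<phi> x\<bar>)" using test_field_integrable(2)[OF \<phi>] by simp
    show "AE x in lborel. (\<lambda>k. (max 0 (\<rho> - norm x) - max 0 (\<rho> - \<epsilon> k - norm x)) / \<epsilon> k * divergence \<phi> x) \<longlonglongrightarrow> indicator (ball 0 \<rho>) x * divergence \<phi> x"
    proof (intro AE_I2 tendsto_mult tendsto_const)
      fix x :: 'a
      have "\<forall>\<^sub>F k in sequentially. (max 0 (\<rho> - norm x) - max 0 (\<rho> - \<epsilon> k - norm x)) / \<epsilon> k = indicator (ball 0 \<rho>) x"
      proof (cases "norm x < \<rho>")
        case True
        then have "\<forall>\<^sub>F k in sequentially. \<epsilon> k < \<rho> - norm x" by (intro order_tendstoD(2)[OF elim]) simp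
        then show ?thesis
        proof eventually_elim
          case (elim k)
          then have "max 0 (\<rho> - norm x) - max 0 (\<rho> - \<epsilon> k - norm x) = \<epsilon> k"
            using e(1)[of k] by (auto simp: max_def)
          then show ?case using True e(2)[of k] by simp
        qed
      next
        case False
        then have "max 0 (\<rho> - norm x) - max 0 (\<rho> - \<epsilon> k - norm x) = 0" for k using e(1)[of k] by auto
        then show ?thesis using False by simp
      qed
      then show "(\<lambda>k. (max 0 (\<rho> - norm x) - max 0 (\<rho> - \<epsilon> k - norm x)) / \<epsilon> k) \<longlonglongrightarrow> indicator (ball 0 \<rho>) x"
        by (rule tendsto_eventually)
    qed
    show "AE x in lborel. norm ((max 0 (\<rho> - norm x) - max 0 (\<rho> - \<epsilon> k - norm x)) / \<epsilon> k * divergence \<phi> x) \<le> \<bar>divergence \<phi> x\<bar>" for k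
    proof (intro AE_I2)
      fix x :: 'a
      have "\<bar>max 0 (\<rho> - norm x) - max 0 (\<rho> - \<epsilon> k - norm x)\<bar> \<le> \<epsilon> k" using e(1)[of k] by auto
      then have "\<bar>max 0 (\<rho> - norm x) - max 0 (\<rho> - \<epsilon> k - norm x)\<bar> / \<epsilon> k \<le> 1" using e(1)[of k] by (simp add: pos_divide_le_eq)
      then have "(\<bar>max 0 (\<rho> - norm x) - max 0 (\<rho> - \<epsilon> k - norm x)\<bar> / \<epsilon> k) * \<bar>divergence \<phi> x\<bar> \<le> 1 * \<bar>divergence \<phi> x\<bar>"
        by (intro mult_right_mono) auto
      then show "norm ((max 0 (\<rho> - norm x) - max 0 (\<rho> - \<epsilon> k - norm x)) / \<epsilon> k * divergence \<phi> x) \<le> \<bar>divergence \<phi> x\<bar>"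
        using e(1)[of k] by (simp add: abs_mult)
    qed
  qed measurable
  have Qeq: "Q k = (\<integral>x. (indicator (ball 0 \<rho>) x - indicator (ball 0 (\<rho> - \<epsilon> k)) x) * (\<phi> x \<bullet> sgn x) \<partial>lborel) / \<epsilon> k" for k
  proof -
    have "Q k = ((\<integral>x. max 0 (\<rho> - norm x) * divergence \<phi> x \<partial>lborel) - (\<integral>x. max 0 (\<rho> - \<epsilon> k - norm x) * divergence \<phi> x \<partial>lborel)) / \<epsilon> k"
      unfolding Q_def using ieta[of \<rho>] ieta[of "\<rho> - \<epsilon> k"] by (simp add: left_diff_distrib diff_divide_distrib)
    also have "\<dots> = (\<integral>x. (indicator (ball 0 \<rho>) x - indicator (ball 0 (\<rho> - \<epsilon> k)) x) * (\<phi> x \<bullet> sgn x) \<partial>lborel) / \<epsilon> k"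
      unfolding integral_cone_divergence[OF \<phi>] using i\<phi> by (simp add: left_diff_distrib)
    finally show ?thesis .
  qed
  have ann: "(\<integral>x. (indicator (ball 0 \<rho>) x - indicator (ball 0 (\<rho> - \<epsilon> k)) x) * F x \<partial>lborel) / \<epsilon> k = c k * J" for k
  proof -
    have "(\<integral>x. (indicator (ball 0 \<rho>) x - indicator (ball 0 (\<rho> - \<epsilon> k)) x) * F x \<partial>lborel)
      = J - (\<integral>x. indicator (ball 0 (\<rho> - \<epsilon> k)) x * F x \<partial>lborel)"
      unfolding J_def using iF by (simp add: left_diff_distrib)
    also have "\<dots> = J - ((\<rho> - \<epsilon> k) / \<rho>) ^ ?n * J"
      using scale[of "(\<rho> - \<epsilon> k) / \<rho>"] er[of k] \<rho> by simp
    finally show ?thesis unfolding c_def by (simp add: left_diff_distrib)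
  qed
  \<comment> \<open>A point of the shell has distance at most \<open>\<epsilon> k\<close> to its
    projection on the sphere. Replacing the field by \<open>F\<close> costs
    \<open>L * \<epsilon> k\<close> pointwise, hence \<open>L\<close> times the volume of the shell
    after division by \<open>\<epsilon> k\<close>.\<close>
  have close: "\<bar>Q k - c k * J\<bar> \<le> L * v k" for k
  proof -
    let ?i = "\<lambda>x::'a. indicator (ball 0 \<rho>) x - indicator (ball 0 (\<rho> - \<epsilon> k)) x :: real"
    have int: "integrable lborel (\<lambda>x. ?i x * (\<phi> x \<bullet> sgn x))" "integrable lborel (\<lambda>x. ?i x * F x)" "integrable lborel ?i"
      using i\<phi> iF i1 unfolding left_diff_distrib by (auto intro!: Bochner_Integration.integrable_diff)
    have "Q k - c k * J = ((\<integral>x. ?i x * (\<phi> x \<bullet> sgn x) \<partial>lborel) - (\<integral>x. ?i x * F x \<partial>lborel)) / \<epsilon> k"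
      unfolding Qeq ann[symmetric] by (simp add: diff_divide_distrib)
    also have "\<dots> = (\<integral>x. ?i x * (\<phi> x \<bullet> sgn x) - ?i x * F x \<partial>lborel) / \<epsilon> k"
      using int by (subst Bochner_Integration.integral_diff) auto
    also have "\<bar>\<dots>\<bar> \<le> (\<integral>x. L * \<epsilon> k * ?i x \<partial>lborel) / \<epsilon> k"
      unfolding abs_divide
    proof (intro divide_mono order_trans[OF integral_abs_bound integral_mono])
      show "integrable lborel (\<lambda>x. \<bar>?i x * (\<phi> x \<bullet> sgn x) - ?i x * F x\<bar>)" "integrable lborel (\<lambda>x. L * \<epsilon> k * ?i x)"
        using int by (auto intro!: integrable_abs Bochner_Integration.integrable_diff)
      fix x :: 'a
      show "\<bar>?i x * (\<phi> x \<bullet> sgn x) - ?i x * F x\<bar> \<le> L * \<epsilon> k * ?i x"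
      proof (cases "norm x < \<rho> \<and> \<rho> - \<epsilon> k \<le> norm x")
        case True
        then have x0: "x \<noteq> 0" using er[of k] by auto
        have "norm (x - \<rho> *\<^sub>R sgn x) = \<bar>norm x - \<rho>\<bar>"
        proof -
          have "x - \<rho> *\<^sub>R sgn x = (norm x - \<rho>) *\<^sub>R sgn x"
          proof -
            have "norm x *\<^sub>R sgn x = x" using x0 by (simp add: sgn_div_norm)
            then show ?thesis by (simp add: scaleR_left_diff_distrib)
          qed
          then show ?thesis using x0 by (simp add: norm_sgn)
        qed
        then have "norm (\<phi> x - \<phi> (\<rho> *\<^sub>R sgn x)) \<le> L * \<epsilon> k"
          using True L(1) by (intro order_trans[OF L(2)] mult_left_mono) auto
        moreover have "\<bar>\<phi> x \<bullet> sgn x - F x\<bar> \<le> norm (\<phi> x - \<phi> (\<rho> *\<^sub>R sgn x))"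
          unfolding F_def inner_diff_left[symmetric]
          using Cauchy_Schwarz_ineq2[of "\<phi> x - \<phi> (\<rho> *\<^sub>R sgn x)" "sgn x"] x0 by (simp add: norm_sgn)
        ultimately show ?thesis using True by simp
      next
        case False
        then have "?i x = 0" using e(1)[of k] by (auto split: split_indicator)
        then show ?thesis by simp
      qed
    qed (use e(1)[of k] L(1) in \<open>auto intro!: integral_nonneg_AE split: split_indicator\<close>)
    also have "\<dots> = L * v k"
      unfolding v_def using i1 e(2)[of k] by simp
    finally show ?thesis .
  qed
  have vlim: "v \<longlonglongrightarrow> 0"
  proof -
    have "v = (\<lambda>k. ?w * \<rho> ^ ?n - ?w * (\<rho> - \<epsilon> k) ^ ?n)"
    proof
      show "v k = ?w * \<rho> ^ ?n - ?w * (\<rho> - \<epsilon> k) ^ ?n" for k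
        unfolding v_def using \<rho> er[of k] by (simp add: measure_ball_lborel)
    qed
    moreover have "(\<lambda>k. ?w * \<rho> ^ ?n - ?w * (\<rho> - \<epsilon> k) ^ ?n) \<longlonglongrightarrow> ?w * \<rho> ^ ?n - ?w * (\<rho> - 0) ^ ?n"
      by (intro tendsto_intros elim)
    ultimately show ?thesis by simp
  qed
  have clim: "c \<longlonglongrightarrow> ?n / \<rho>"
  proof -
    have "((\<lambda>t. - (((\<rho> - t) / \<rho>) ^ ?n)) has_real_derivative ?n / \<rho>) (at 0)"
      using \<rho> by (auto intro!: derivative_eq_intros)
    from difference_quotient_limit[OF this elim e(2)] show ?thesis
      using \<rho> unfolding c_def[abs_def] by simp
  qed
  have "(\<lambda>k. Q k - c k * J) \<longlonglongrightarrow> 0"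
  proof (rule Lim_null_comparison)
    show "\<forall>\<^sub>F k in sequentially. norm (Q k - c k * J) \<le> L * v k" using close by simp
    show "(\<lambda>k. L * v k) \<longlonglongrightarrow> 0" using tendsto_mult[OF tendsto_const vlim, of L] by simp
  qed
  moreover have "(\<lambda>k. c k * J) \<longlonglongrightarrow> ?n / \<rho> * J" by (intro tendsto_mult clim tendsto_const)
  ultimately have "(\<lambda>k. (Q k - c k * J) + c k * J) \<longlonglongrightarrow> 0 + ?n / \<rho> * J" by (rule tendsto_add)
  then have "Q \<longlonglongrightarrow> ?n / \<rho> * J" by simp
  then show ?thesis using LIMSEQ_unique[OF Qlim] unfolding J_def F_def by simp
qed

section \<open>The perimeter of a ball\<close>

lemma integral_lebesgue_divergence:
  fixes u :: "'a::euclidean_space \<Rightarrow> real"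
  assumes \<phi>: "\<phi> \<in> test_fields U" and [measurable]: "u \<in> borel_measurable borel"
  shows "(LINT x:UNIV|lebesgue. u x * divergence \<phi> x) = (\<integral>x. u x * divergence \<phi> x \<partial>lborel)"
proof -
  have [measurable]: "divergence \<phi> \<in> borel_measurable borel" by (rule divergence_measurable[OF \<phi>])
  show ?thesis unfolding set_lebesgue_integral_def by (simp, subst integral_completion) auto
qed

lemma ball_integral_le:
  fixes f :: "'a::euclidean_space \<Rightarrow> real"
  assumes "f \<in> borel_measurable borel" "\<And>x. \<bar>f x\<bar> \<le> B"
  shows "(\<integral>x. indicator (ball a r) x * f x \<partial>lborel) \<le> B * measure lborel (ball a r)"
proof -
  have "integrable lborel (indicator (ball a r) :: 'a \<Rightarrow> real)"
    using emeasure_bounded_finite[OF bounded_ball[of a r]] by (intro integrable_real_indicator) auto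
  then have i: "integrable lborel (\<lambda>x. B * indicator (ball a r) x)" by (intro integrable_mult_right)
  have "(\<integral>x. indicator (ball a r) x * f x \<partial>lborel) \<le> (\<integral>x. B * indicator (ball a r) x \<partial>lborel)"
    using assms(2) by (intro integral_mono ball_indicator_integrable[OF assms] i) (auto split: split_indicator simp: abs_le_iff)
  then show ?thesis by simp
qed

lemma radial_field_measurable:
  "\<phi> \<in> test_fields U \<Longrightarrow> (\<lambda>x. \<phi> (\<rho> *\<^sub>R sgn x) \<bullet> sgn x) \<in> borel_measurable borel"
proof -
  assume "\<phi> \<in> test_fields U"
  then have [measurable]: "\<phi> \<in> borel_measurable borel" by (rule test_field_measurable)
  show ?thesis by measurable
qed

text \<open>Only the values on the sphere enter. A field bounded by |x| therefore has the bound
  \<open>\<rho>\<close> there, which will cancel the denominator.\<close>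

lemma divergence_ball_le:
  fixes \<phi> :: "'a::euclidean_space \<Rightarrow> 'a"
  assumes \<phi>: "\<phi> \<in> test_fields UNIV" and \<rho>: "0 < \<rho>" and B: "\<And>x. norm x = \<rho> \<Longrightarrow> norm (\<phi> x) \<le> B" "0 \<le> B"
  shows "(\<integral>x. indicator (ball 0 \<rho>) x * divergence \<phi> x \<partial>lborel) \<le> real DIM('a) / \<rho> * (B * measure lborel (ball (0::'a) \<rho>))"
  unfolding divergence_theorem_ball[OF \<phi> \<rho>]
proof (intro mult_left_mono ball_integral_le radial_field_measurable[OF \<phi>])
  fix x :: 'a
  show "\<bar>\<phi> (\<rho> *\<^sub>R sgn x) \<bullet> sgn x\<bar> \<le> B"
  proof (cases "x = 0")
    case False
    have "\<bar>\<phi> (\<rho> *\<^sub>R sgn x) \<bullet> sgn x\<bar> \<le> norm (\<phi> (\<rho> *\<^sub>R sgn x)) * norm (sgn x)" by (rule Cauchy_Schwarz_ineq2)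
    also have "\<dots> \<le> B" using False \<rho> B(1)[of "\<rho> *\<^sub>R sgn x"] by (simp add: norm_sgn)
    finally show ?thesis .
  qed (simp add: B)
qed (use \<rho> in auto)

text \<open>\<open>Per\<close> refers to some chosen derivative measure, so the bound is proved for
  every one of them, by duality and the divergence theorem.\<close>

lemma total_variation_ball_le:
  assumes hd: "has_derivative_measure (indicator (ball (0::'a::euclidean_space) \<rho>)) M \<sigma>" and \<rho>: "0 < \<rho>"
  shows "measure M UNIV \<le> real DIM('a) / \<rho> * measure lborel (ball (0::'a) \<rho>)"
proof -
  have M: "sets M = sets borel" "finite_measure M" and \<sigma>: "\<sigma> \<in> borel_measurable borel" "AE x in M. norm (\<sigma> x) = 1"
    and D: "\<And>\<phi>. \<phi> \<in> test_fields UNIV \<Longrightarrow> (LINT x:UNIV|lebesgue. indicator (ball (0::'a) \<rho>) x * divergence \<phi> x) = - (LINT x|M. \<phi> x \<bullet> \<sigma> x)"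
    using hd unfolding has_derivative_measure_def polar_pair_def has_distr_derivative_on_def by auto
  interpret finite_measure M by fact
  have \<sigma>M: "\<sigma> \<in> borel_measurable M" using \<sigma>(1) by (simp add: measurable_cong_sets[OF M(1) refl])
  have i: "integrable M \<sigma>"
    using \<sigma>(2) by (intro integrable_const_bound[where B = 1] \<sigma>M) (auto elim: eventually_mono)
  have "(\<integral>x. indicator UNIV x * norm (\<sigma> x) \<partial>M) \<le> real DIM('a) / \<rho> * measure lborel (ball (0::'a) \<rho>)"
  proof (rule total_variation_le[OF M(2,1) open_UNIV i])
    fix \<phi> :: "'a \<Rightarrow> 'a" assume \<phi>: "\<phi> \<in> test_fields UNIV" and n: "\<And>x. norm (\<phi> x) \<le> 1"
    \<comment> \<open>The distributional derivative is defined with a minus sign; reversing the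
      field compensates for it.\<close>
    have \<phi>': "(\<lambda>x. (-1) *\<^sub>R \<phi> x) \<in> test_fields UNIV"
      by (rule test_fields_mult[OF \<phi>, where s' = "\<lambda>_ _. 0"]) auto
    have "(\<integral>x. \<phi> x \<bullet> \<sigma> x \<partial>M) = - (\<integral>x. ((-1) *\<^sub>R \<phi> x) \<bullet> \<sigma> x \<partial>M)" by simp
    also have "\<dots> = (LINT x:UNIV|lebesgue. indicator (ball (0::'a) \<rho>) x * divergence (\<lambda>x. (-1) *\<^sub>R \<phi> x) x)"
      by (simp only: D[OF \<phi>'])
    also have "\<dots> = (\<integral>x. indicator (ball 0 \<rho>) x * divergence (\<lambda>x. (-1) *\<^sub>R \<phi> x) x \<partial>lborel)"
      by (rule integral_lebesgue_divergence[OF \<phi>']) (auto intro: borel_measurable_indicator)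
    also have "\<dots> \<le> real DIM('a) / \<rho> * (1 * measure lborel (ball (0::'a) \<rho>))"
      using n by (intro divergence_ball_le[OF \<phi>' \<rho>]) auto
    finally show "(\<integral>x. \<phi> x \<bullet> \<sigma> x \<partial>M) \<le> real DIM('a) / \<rho> * measure lborel (ball (0::'a) \<rho>)" by simp
  qed
  moreover have "(\<integral>x. indicator UNIV x * norm (\<sigma> x) \<partial>M) = (\<integral>x. 1 \<partial>M)"
    using \<sigma>(2) \<sigma>M by (intro integral_cong_AE) auto
  moreover have "space M = UNIV" using sets_eq_imp_space_eq[OF M(1)] by simp
  ultimately show ?thesis by simp
qed

text \<open>Existence gives the choice in \<open>variation_measure\<close> its meaning. The surface
  measure of the sphere is built as the image of \<open>c\<close> times Lebesgue measure on the ball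
  under radial projection, so that the derivative formula becomes the divergence theorem above;
  \<open>\<sigma>\<close> is the inner normal.\<close>

lemma ball_has_derivative_measure:
  assumes \<rho>: "0 < \<rho>"
  shows "\<exists>M \<sigma>. has_derivative_measure (indicator (ball (0::'a::euclidean_space) \<rho>)) M \<sigma>"
proof -
  define c where "c = real DIM('a) / \<rho>"
  have c: "0 < c" using \<rho> by (simp add: c_def)
  have [measurable]: "ball (0::'a) \<rho> \<in> sets borel" by simp
  define N where "N = density lborel (\<lambda>x. ennreal (c * indicator (ball (0::'a) \<rho>) x))"
  define M where "M = distr N borel (\<lambda>x. \<rho> *\<^sub>R sgn x)"
  define \<sigma> where "\<sigma> y = - sgn y" for y :: 'a
  have sg: "sgn (\<rho> *\<^sub>R sgn x) = sgn x" for x :: 'a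
    using \<rho> by (cases "x = 0") (simp_all add: sgn_scaleR sgn_div_norm[of "sgn x"] norm_sgn)
  have NS: "sets N = sets borel" by (simp add: N_def)
  have Nm: "(\<lambda>x. \<rho> *\<^sub>R sgn x) \<in> N \<rightarrow>\<^sub>M borel" unfolding N_def by measurable
  have fin: "finite_measure N"
  proof (rule finite_measureI)
    have "emeasure N (space N) = (\<integral>\<^sup>+x. ennreal c * indicator (ball (0::'a) \<rho>) x \<partial>lborel)"
      unfolding N_def using c by (subst emeasure_density) (auto intro!: nn_integral_cong split: split_indicator)
    also have "\<dots> = ennreal c * emeasure lborel (ball (0::'a) \<rho>)" by (rule nn_integral_cmult_indicator) simp
    also have "\<dots> < \<infinity>" using emeasure_bounded_finite[OF bounded_ball[of "0::'a" \<rho>]] by (simp add: ennreal_mult_less_top)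
    finally show "emeasure N (space N) \<noteq> \<infinity>" by simp
  qed
  have pol: "polar_pair M \<sigma>"
    unfolding polar_pair_def
  proof (intro conjI)
    show "sets M = sets borel" by (simp add: M_def)
    show "finite_measure M" unfolding M_def by (rule finite_measure.finite_measure_distr[OF fin Nm])
    show "\<sigma> \<in> borel_measurable borel" unfolding \<sigma>_def[abs_def] by measurable
    \<comment> \<open>At the origin \<open>sgn\<close> is 0 and the projection misses the sphere; a
      single point has no mass.\<close>
    have "AE x in N. x \<noteq> 0"
      unfolding N_def by (subst AE_density) (use AE_lborel_singleton[of "0::'a"] in \<open>auto elim: eventually_mono\<close>)
    then have "AE x in N. norm (\<sigma> (\<rho> *\<^sub>R sgn x)) = 1"
      by eventually_elim (simp add: \<sigma>_def sg norm_sgn)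
    then show "AE x in M. norm (\<sigma> x) = 1"
      unfolding M_def by (subst AE_distr_iff[OF Nm]) (auto simp: \<sigma>_def[abs_def])
  qed
  have "has_distr_derivative_on (indicator (ball (0::'a) \<rho>)) (\<lambda>\<phi>. LINT x|M. \<phi> x \<bullet> \<sigma> x) UNIV"
    unfolding has_distr_derivative_on_def
  proof
    fix \<phi> :: "'a \<Rightarrow> 'a" assume \<phi>: "\<phi> \<in> test_fields UNIV"
    have [measurable]: "\<phi> \<in> borel_measurable borel" by (rule test_field_measurable[OF \<phi>])
    have [measurable]: "\<sigma> \<in> borel_measurable borel" unfolding \<sigma>_def[abs_def] by measurable
    have "(\<integral>x. \<phi> x \<bullet> \<sigma> x \<partial>M) = (\<integral>x. \<phi> (\<rho> *\<^sub>R sgn x) \<bullet> \<sigma> (\<rho> *\<^sub>R sgn x) \<partial>N)"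
      unfolding M_def by (rule integral_distr[OF Nm]) measurable
    also have "\<dots> = (\<integral>x. (c * indicator (ball (0::'a) \<rho>) x) *\<^sub>R (\<phi> (\<rho> *\<^sub>R sgn x) \<bullet> \<sigma> (\<rho> *\<^sub>R sgn x)) \<partial>lborel)"
      unfolding N_def using c by (intro integral_density) auto
    also have "\<dots> = - (c * (\<integral>x. indicator (ball (0::'a) \<rho>) x * (\<phi> (\<rho> *\<^sub>R sgn x) \<bullet> sgn x) \<partial>lborel))"
      unfolding \<sigma>_def sg by (simp add: mult.assoc)
    also have "\<dots> = - (\<integral>x. indicator (ball 0 \<rho>) x * divergence \<phi> x \<partial>lborel)"
      unfolding divergence_theorem_ball[OF \<phi> \<rho>] c_def ..
    also have "(\<integral>x. indicator (ball 0 \<rho>) x * divergence \<phi> x \<partial>lborel) = (LINT x:UNIV|lebesgue. indicator (ball (0::'a) \<rho>) x * divergence \<phi> x)"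
      by (rule integral_lebesgue_divergence[OF \<phi>, symmetric]) simp
    finally show "(LINT x:UNIV|lebesgue. indicator (ball (0::'a) \<rho>) x * divergence \<phi> x) = - (LINT x|M. \<phi> x \<bullet> \<sigma> x)" by simp
  qed
  then show ?thesis using pol unfolding has_derivative_measure_def by blast
qed

text \<open>The upper bound points in the direction required where the perimeter occurs as a
  denominator, and positivity makes that division legitimate.\<close>

lemma perimeter_ball:
  fixes \<rho> :: real assumes \<rho>: "0 < \<rho>"
  shows "Per (ball (0::'a::euclidean_space) \<rho>) \<le> real DIM('a) / \<rho> * measure lborel (ball (0::'a) \<rho>)"
    and "0 < Per (ball (0::'a) \<rho>)"
proof -
  let ?I = "indicator (ball (0::'a) \<rho>) :: 'a \<Rightarrow> real"
  define M where "M = variation_measure ?I"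
  have "\<exists>\<sigma>. has_derivative_measure ?I M \<sigma>"
    unfolding M_def variation_measure_def by (rule someI_ex) (rule ball_has_derivative_measure[OF \<rho>])
  then obtain \<sigma> where hd: "has_derivative_measure ?I M \<sigma>" by blast
  show "Per (ball (0::'a) \<rho>) \<le> real DIM('a) / \<rho> * measure lborel (ball (0::'a) \<rho>)"
    unfolding Per_def M_def[symmetric] by (rule total_variation_ball_le[OF hd \<rho>])
  have M: "sets M = sets borel" "finite_measure M"
    and D: "\<And>\<phi>. \<phi> \<in> test_fields UNIV \<Longrightarrow> (LINT x:UNIV|lebesgue. ?I x * divergence \<phi> x) = - (LINT x|M. \<phi> x \<bullet> \<sigma> x)"
    using hd unfolding has_derivative_measure_def polar_pair_def has_distr_derivative_on_def by auto
  interpret finite_measure M by fact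
  have sp: "space M = UNIV" using sets_eq_imp_space_eq[OF M(1)] by simp
  show "0 < Per (ball (0::'a) \<rho>)"
    unfolding Per_def M_def[symmetric]
  proof (rule ccontr)
    assume "\<not> 0 < measure M UNIV"
    then have "emeasure M (space M) = 0" by (simp add: sp emeasure_eq_measure zero_less_measure_iff)
    then have ae: "AE x in M. P x" for P by (intro AE_I[of _ _ "space M"]) auto
    have d2: "0 < 2 * \<rho>" using \<rho> by simp
    \<comment> \<open>A radial field pointing outwards. The kernel of radius
      \<open>2 * \<rho>\<close> is positive at distance \<open>\<rho>\<close>, so the flux through
      the sphere is positive, whereas a derivative measure without mass would force it to be
      0.\<close>
    define \<phi> where "\<phi> x = mollifier (2 * \<rho>) x *\<^sub>R x" for x :: 'a
    have \<phi>: "\<phi> \<in> test_fields UNIV"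
      unfolding \<phi>_def[abs_def]
    proof (rule test_fieldsI)
      show "((\<lambda>x. mollifier (2 * \<rho>) x *\<^sub>R x) has_derivative
        (\<lambda>h. mollifier (2 * \<rho>) x *\<^sub>R h + (mollifier_grad (2 * \<rho>) x \<bullet> h) *\<^sub>R x)) (at x)" for x :: 'a
        by (rule has_derivative_scaleR[OF mollifier_has_derivative[OF d2] has_derivative_ident])
      show "continuous_on UNIV (\<lambda>x::'a. mollifier (2 * \<rho>) x *\<^sub>R v + (mollifier_grad (2 * \<rho>) x \<bullet> v) *\<^sub>R x)" for v
        by (intro continuous_intros mollifier_continuous mollifier_grad_continuous d2)
      show "mollifier (2 * \<rho>) x *\<^sub>R x = 0" if "x \<notin> cball 0 (2 * \<rho>)" for x :: 'a
        using that by (simp add: mollifier_outside[OF d2])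
    qed auto
    have "(\<integral>x. \<phi> x \<bullet> \<sigma> x \<partial>M) = 0" by (rule integral_eq_zero_AE[OF ae])
    then have z: "(\<integral>x. indicator (ball 0 \<rho>) x * divergence \<phi> x \<partial>lborel) = 0"
      using D[OF \<phi>] integral_lebesgue_divergence[OF \<phi>, of ?I] by (simp add: borel_measurable_indicator)
    obtain b :: 'a where b: "b \<in> Basis" using nonempty_Basis by blast
    define m where "m = mollifier (2 * \<rho>) (\<rho> *\<^sub>R b)"
    have m_eq: "mollifier (2 * \<rho>) (\<rho> *\<^sub>R sgn x) = m" if "x \<noteq> 0" for x :: 'a
      unfolding m_def mollifier_def bump_def using b that \<rho> by (simp add: norm_sgn)
    have m: "0 < m"
    proof -
      have "0 < bump (2 * \<rho>) (\<rho> *\<^sub>R b)" using b \<rho> by (simp add: bump_def power_mult_distrib)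
      then show ?thesis unfolding m_def mollifier_def by (rule divide_pos_pos[OF _ bump_integral_pos[OF d2]])
    qed
    have "(\<integral>x. indicator (ball 0 \<rho>) x * (\<phi> (\<rho> *\<^sub>R sgn x) \<bullet> sgn x) \<partial>lborel) = (\<integral>x. m * \<rho> * indicator (ball (0::'a) \<rho>) x \<partial>lborel)"
    proof (rule integral_cong_AE)
      show "AE x in lborel. indicator (ball 0 \<rho>) x * (\<phi> (\<rho> *\<^sub>R sgn x) \<bullet> sgn x) = m * \<rho> * indicator (ball (0::'a) \<rho>) x"
        using AE_lborel_singleton[of "0::'a"]
      proof eventually_elim
        case (elim x)
        then have "sgn x \<bullet> sgn x = 1" by (simp add: norm_sgn flip: power2_norm_eq_inner)
        then show ?case using m_eq[OF elim] by (simp add: \<phi>_def)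
      qed
      have [measurable]: "ball (0::'a) \<rho> \<in> sets borel" by simp
      have [measurable]: "\<phi> \<in> borel_measurable borel" by (rule test_field_measurable[OF \<phi>])
      show "(\<lambda>x. indicator (ball 0 \<rho>) x * (\<phi> (\<rho> *\<^sub>R sgn x) \<bullet> sgn x)) \<in> borel_measurable lborel" by measurable
      show "(\<lambda>x. m * \<rho> * indicator (ball (0::'a) \<rho>) x) \<in> borel_measurable lborel" by measurable
    qed
    also have "\<dots> = m * \<rho> * measure lborel (ball (0::'a) \<rho>)" by simp
    finally have "0 < (\<integral>x. indicator (ball 0 \<rho>) x * (\<phi> (\<rho> *\<^sub>R sgn x) \<bullet> sgn x) \<partial>lborel)"
      using m \<rho> by simp
    then have "0 < (\<integral>x. indicator (ball 0 \<rho>) x * divergence \<phi> x \<partial>lborel)"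
      unfolding divergence_theorem_ball[OF \<phi> \<rho>] using \<rho> by (intro mult_pos_pos) auto
    then show False using z by simp
  qed
qed

section \<open>The Hardy--Littlewood inequality\<close>

text \<open>\<open>m - \<omega> \<rho>^n\<close> is the volume of {|x| > \<rho>} in the ball of
  volume \<open>m\<close>. The level sets of \<open>K\<close> in \<open>S\<close> thus have volume
  at most the minimum of \<open>s\<close> and this number, and on the outer shell of volume
  \<open>s\<close> the function |x| attains this minimum at every level up to the radius of the
  ball.\<close>

lemma bathtub:
  fixes K :: "'a::euclidean_space \<Rightarrow> real"
  assumes [measurable]: "K \<in> borel_measurable borel" "S \<in> sets borel"
    and S: "emeasure lborel S = ennreal s" "0 \<le> s" "s \<le> m"
    and K: "\<And>\<rho>. 0 \<le> \<rho> \<Longrightarrow> emeasure lborel {x \<in> S. \<rho> < K x} \<le> ennreal (m - unit_ball_vol (real DIM('a)) * \<rho> ^ DIM('a))"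
  shows "(\<integral>\<^sup>+x. indicator S x * ennreal (K x) \<partial>lborel)
    \<le> (\<integral>\<^sup>+x. indicator {x \<in> ball (0::'a) (ball_radius TYPE('a) m). m - s < unit_ball_vol (real DIM('a)) * norm x ^ DIM('a)} x * ennreal (norm x) \<partial>lborel)"
proof -
  let ?w = "unit_ball_vol (real DIM('a))" and ?n = "DIM('a)"
  let ?R = "ball_radius TYPE('a) m" and ?r = "ball_radius TYPE('a) (m - s)"
  define T where "T = {x \<in> ball (0::'a) ?R. m - s < ?w * norm x ^ ?n}"
  have wpos: "0 < ?w" by simp
  have mono: "?w * a ^ ?n < ?w * b ^ ?n \<longleftrightarrow> a < b" if "0 \<le> a" "0 \<le> b" for a b
    using that wpos by (simp add: power_mono_iff not_le[symmetric])
  have rad: "m - s < ?w * norm x ^ ?n \<longleftrightarrow> ?r < norm x" for x :: 'a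
    using S mono[of ?r "norm x"] ball_radius_power[of "m - s", where 'a='a] by simp
  have Tb: "T \<in> sets borel" unfolding T_def by measurable
  have rR: "?r \<le> ?R" using S by (intro ball_radius_mono) auto
  have Tm: "emeasure lborel {x \<in> T. \<rho> < norm x} = ennreal (m - max (?w * \<rho> ^ ?n) (m - s))" if \<rho>: "0 \<le> \<rho>" "\<rho> \<le> ?R" for \<rho>
  proof -
    let ?q = "max \<rho> ?r"
    have q: "0 \<le> ?q" "?q \<le> ?R" using \<rho> rR by auto
    have "{x \<in> T. \<rho> < norm x} = ball 0 ?R - cball 0 ?q" unfolding T_def rad by auto
    then have "emeasure lborel {x \<in> T. \<rho> < norm x} = emeasure lborel (ball (0::'a) ?R - cball 0 ?q)" by simp
    also have "\<dots> = emeasure lborel (ball (0::'a) ?R - ball 0 ?q)"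
    proof (rule emeasure_eq_AE)
      have "negligible (sphere (0::'a) ?q)" by (rule negligible_sphere)
      then have null: "AE x::'a in lborel. x \<notin> sphere 0 ?q"
        by (intro AE_not_in) (auto simp: negligible_iff_null_sets null_sets_completion_iff)
      then show "AE x in lborel. (x \<in> ball (0::'a) ?R - cball 0 ?q) = (x \<in> ball (0::'a) ?R - ball 0 ?q)"
        by eventually_elim auto
    qed auto
    also have "\<dots> = emeasure lborel (ball (0::'a) ?R) - emeasure lborel (ball (0::'a) ?q)"
      using q emeasure_bounded_finite[OF bounded_ball[of "0::'a" ?q]] by (intro emeasure_Diff) auto
    also have "\<dots> = ennreal (?w * ?R ^ ?n - ?w * ?q ^ ?n)"
      using q S by (simp add: emeasure_ball ennreal_minus)
    also have "?w * ?R ^ ?n = m" using S by (intro ball_radius_power) auto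
    also have "?w * ?q ^ ?n = max (?w * \<rho> ^ ?n) (m - s)"
    proof (cases "\<rho> \<le> ?r")
      case True
      then have "?w * \<rho> ^ ?n \<le> ?w * ?r ^ ?n" using \<rho> by (intro mult_left_mono power_mono) auto
      then show ?thesis using True S ball_radius_power[of "m - s", where 'a='a] by (simp add: max_def)
    next
      case False
      then have "?w * ?r ^ ?n \<le> ?w * \<rho> ^ ?n" using S by (intro mult_left_mono power_mono) auto
      then show ?thesis using False S ball_radius_power[of "m - s", where 'a='a] by (simp add: max_def)
    qed
    finally show ?thesis .
  qed
  have lc: "(\<integral>\<^sup>+x. indicator A x * ennreal (f x) \<partial>lborel) = (\<integral>\<^sup>+t. indicator {0..} t * emeasure lborel {x \<in> A. t < f x} \<partial>lborel)"
    if [measurable]: "A \<in> sets borel" "f \<in> borel_measurable borel" for A and f :: "'a \<Rightarrow> real"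
  proof -
    have "(\<integral>\<^sup>+x. indicator A x * indicator {x. t < f x} x \<partial>lborel) = emeasure lborel {x \<in> A. t < f x}" for t
    proof -
      have "(\<integral>\<^sup>+x. indicator A x * indicator {x. t < f x} x \<partial>lborel) = (\<integral>\<^sup>+x. indicator {x \<in> A. t < f x} x \<partial>lborel)"
        by (intro nn_integral_cong) (auto split: split_indicator)
      also have "\<dots> = emeasure lborel {x \<in> A. t < f x}" by (rule nn_integral_indicator) simp
      finally show ?thesis .
    qed
    then show ?thesis
      using nn_integral_layer_cake[of lborel f "indicator A"] lborel.sigma_finite_measure_axioms by simp
  qed
  have "emeasure lborel {x \<in> S. \<rho> < K x} \<le> emeasure lborel {x \<in> T. \<rho> < norm x}" if \<rho>: "0 \<le> \<rho>" for \<rho>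
  proof (cases "\<rho> \<le> ?R")
    case True
    have "emeasure lborel {x \<in> S. \<rho> < K x} \<le> emeasure lborel S" by (intro emeasure_mono) auto
    then have "emeasure lborel {x \<in> S. \<rho> < K x} \<le> ennreal s" using S by simp
    then show ?thesis using K[OF \<rho>] unfolding Tm[OF \<rho> True] by (auto simp: max_def)
  next
    case False
    have "m = ?w * ?R ^ ?n" using S by (intro ball_radius_power[symmetric]) auto
    also have "\<dots> \<le> ?w * \<rho> ^ ?n" using False S by (intro mult_left_mono power_mono) auto
    finally have "emeasure lborel {x \<in> S. \<rho> < K x} = 0" using K[OF \<rho>] by (simp add: ennreal_neg)
    then show ?thesis by simp
  qed
  then have "(\<integral>\<^sup>+t. indicator {0..} t * emeasure lborel {x \<in> S. t < K x} \<partial>lborel)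
     \<le> (\<integral>\<^sup>+t. indicator {0..} t * emeasure lborel {x \<in> T. t < norm x} \<partial>lborel)"
    by (intro nn_integral_mono) (auto split: split_indicator)
  moreover have nm: "(\<lambda>x::'a. norm x) \<in> borel_measurable borel" by measurable
  ultimately have "(\<integral>\<^sup>+x. indicator S x * ennreal (K x) \<partial>lborel) \<le> (\<integral>\<^sup>+x. indicator T x * ennreal (norm x) \<partial>lborel)"
    unfolding lc[OF assms(2,1)] lc[OF Tb nm] by simp
  then show ?thesis unfolding T_def .
qed

section \<open>Distribution functions and the increasing rearrangement\<close>

lemma distribution_fun_antimono:
  assumes [measurable]: "\<Omega> \<in> sets lebesgue" "h \<in> borel_measurable lebesgue" and fin: "emeasure lebesgue \<Omega> < \<infinity>" and st: "s \<le> t"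
  shows "distribution_fun \<Omega> h t \<le> distribution_fun \<Omega> h s"
  unfolding distribution_fun_def
proof (rule measure_mono_fmeasurable)
  have m: "{x \<in> \<Omega>. r < \<bar>h x\<bar>} \<in> sets lebesgue" for r
  proof -
    have "{x \<in> space lebesgue. x \<in> \<Omega> \<and> r < \<bar>h x\<bar>} \<in> sets lebesgue" by measurable
    then show ?thesis by simp
  qed
  then show "{x \<in> \<Omega>. t < \<bar>h x\<bar>} \<in> sets lebesgue" .
  have "emeasure lebesgue {x \<in> \<Omega>. s < \<bar>h x\<bar>} \<le> emeasure lebesgue \<Omega>" by (intro emeasure_mono) auto
  then show "{x \<in> \<Omega>. s < \<bar>h x\<bar>} \<in> fmeasurable lebesgue" using m fin by (auto simp: fmeasurable_def)
qed (use st in auto)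

text \<open>The last hypothesis keeps the real infimum meaningful; for \<open>0 < s\<close> it is
  supplied by \<open>distribution_fun_vanishes\<close>.\<close>

lemma decr_rearr_ge:
  assumes "\<Omega> \<in> sets lebesgue" "h \<in> borel_measurable lebesgue" "emeasure lebesgue \<Omega> < \<infinity>"
    and "0 \<le> s" "s < distribution_fun \<Omega> h t" and ne: "\<exists>t>0. distribution_fun \<Omega> h t \<le> s"
  shows "t \<le> decr_rearr \<Omega> h s"
  unfolding decr_rearr_def
proof (rule cInf_greatest)
  show "{t. 0 < t \<and> distribution_fun \<Omega> h t \<le> s} \<noteq> {}" using ne by auto
  fix t' assume t': "t' \<in> {t. 0 < t \<and> distribution_fun \<Omega> h t \<le> s}"
  show "t \<le> t'"
  proof (rule ccontr)
    assume "\<not> t \<le> t'"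
    then have "distribution_fun \<Omega> h t \<le> distribution_fun \<Omega> h t'"
      using assms(1-3) by (intro distribution_fun_antimono) auto
    then show False using t' assms(5) by auto
  qed
qed

lemma distribution_fun_vanishes:
  assumes [measurable]: "\<Omega> \<in> sets lebesgue" "h \<in> borel_measurable lebesgue" and fin: "emeasure lebesgue \<Omega> < \<infinity>" and s: "0 < s"
  shows "\<exists>t>0. distribution_fun \<Omega> h t \<le> s"
proof -
  define A where "A k = {x \<in> \<Omega>. real (Suc k) < \<bar>h x\<bar>}" for k
  have m: "A k \<in> sets lebesgue" for k
  proof -
    have "{x \<in> space lebesgue. x \<in> \<Omega> \<and> real (Suc k) < \<bar>h x\<bar>} \<in> sets lebesgue" by measurable
    then show ?thesis by (simp add: A_def)
  qed
  have "(\<lambda>k. measure lebesgue (A k)) \<longlonglongrightarrow> measure lebesgue (\<Inter>k. A k)"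
  proof (rule Lim_measure_decseq)
    show "range A \<subseteq> sets lebesgue" using m by auto
    show "decseq A" unfolding A_def decseq_def by auto
    have "emeasure lebesgue (A k) \<le> emeasure lebesgue \<Omega>" for k by (intro emeasure_mono) (auto simp: A_def)
    then show "emeasure lebesgue (A k) \<noteq> \<infinity>" for k using fin by (metis infinity_ennreal_def linorder_not_le order_less_le)
  qed
  moreover have "(\<Inter>k. A k) = {}"
  proof -
    have "x \<notin> (\<Inter>k. A k)" for x
    proof -
      obtain k :: nat where "\<bar>h x\<bar> \<le> k" using real_arch_simple by blast
      then have "x \<notin> A k" by (auto simp: A_def)
      then show ?thesis by blast
    qed
    then show ?thesis by blast
  qed
  ultimately have "(\<lambda>k. measure lebesgue (A k)) \<longlonglongrightarrow> 0" by simp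
  then have "\<forall>\<^sub>F k in sequentially. measure lebesgue (A k) < s" using s by (intro order_tendstoD(2))
  then obtain k where "measure lebesgue (A k) < s" by (auto simp: eventually_sequentially)
  then show ?thesis unfolding A_def distribution_fun_def by (intro exI[of _ "real (Suc k)"]) auto
qed

text \<open>The hypothesis on \<open>K\<close> says that it is distributed at most like |x| on
  \<open>sharp_ball \<Omega>\<close>. Slicing \<open>h\<close> into its superlevel sets reduces the
  claim to \<open>bathtub\<close> at each level, and Fubini reassembles the shells.\<close>

theorem hardy_littlewood_sharp:
  fixes K h :: "'a::euclidean_space \<Rightarrow> real"
  assumes \<Omega>[measurable]: "\<Omega> \<in> sets borel" and fin: "emeasure lborel \<Omega> < \<infinity>"
    and h[measurable]: "h \<in> borel_measurable borel" and h0: "\<And>x. 0 \<le> h x"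
    and K[measurable]: "K \<in> borel_measurable borel"
    and Kd: "\<And>\<rho>. 0 \<le> \<rho> \<Longrightarrow> emeasure lborel {x \<in> \<Omega>. \<rho> < K x} \<le> ennreal (measure lborel \<Omega> - unit_ball_vol (real DIM('a)) * \<rho> ^ DIM('a))"
  shows "(\<integral>\<^sup>+x. indicator \<Omega> x * ennreal (K x) * ennreal (h x) \<partial>lborel)
    \<le> (\<integral>\<^sup>+x. indicator (sharp_ball \<Omega>) x * ennreal (norm x) * ennreal (sharp_rearr \<Omega> h x) \<partial>lebesgue)"
proof -
  let ?w = "unit_ball_vol (real DIM('a))" and ?n = "DIM('a)"
  define m where "m = measure lborel \<Omega>"
  have m0: "0 \<le> m" by (simp add: m_def)
  have em: "emeasure lborel \<Omega> = ennreal m" unfolding m_def using fin by (intro emeasure_eq_ennreal_measure) auto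
  have L: "\<Omega> \<in> sets lebesgue" "h \<in> borel_measurable lebesgue" "emeasure lebesgue \<Omega> < \<infinity>" "measure lebesgue \<Omega> = m"
    using fin by (auto simp: m_def measure_completion measurable_completion)
  define \<mu> where "\<mu> t = distribution_fun \<Omega> h t" for t
  have \<mu>_eq: "\<mu> t = measure lborel {x \<in> \<Omega>. t < h x}" for t
    unfolding \<mu>_def distribution_fun_def using h0 by (simp add: measure_completion)
  have emS: "emeasure lborel {x \<in> \<Omega>. t < h x} = ennreal (\<mu> t)" for t
  proof -
    have "emeasure lborel {x \<in> \<Omega>. t < h x} \<le> emeasure lborel \<Omega>" by (intro emeasure_mono) auto
    then show ?thesis unfolding \<mu>_eq using fin by (intro emeasure_eq_ennreal_measure) (auto simp: top_unique)
  qed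
  have \<mu>m: "0 \<le> \<mu> t" "\<mu> t \<le> m" for t
  proof -
    show "0 \<le> \<mu> t" by (simp add: \<mu>_eq)
    show "\<mu> t \<le> m" unfolding \<mu>_eq m_def using fin by (intro measure_mono_fmeasurable) (auto simp: fmeasurable_def)
  qed
  have [measurable]: "\<mu> \<in> borel_measurable borel"
  proof -
    have "(\<lambda>t. - \<mu> t) \<in> borel_measurable borel"
      unfolding \<mu>_def by (intro borel_measurable_mono monoI) (auto intro: distribution_fun_antimono[OF L(1-3)])
    then show ?thesis by simp
  qed
  have B: "sharp_ball \<Omega> = ball 0 (ball_radius TYPE('a) m)"
    unfolding sharp_ball_def ball_radius_def L(4) ..
  have [measurable]: "ball (0::'a) r \<in> sets borel" for r by simp
  let ?B = "ball (0::'a) (ball_radius TYPE('a) m)"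
  let ?T = "\<lambda>t. {x \<in> ?B. m - \<mu> t < ?w * norm x ^ ?n}"
  have "(\<integral>\<^sup>+x. indicator \<Omega> x * ennreal (K x) * ennreal (h x) \<partial>lborel)
     = (\<integral>\<^sup>+t. indicator {0..} t * (\<integral>\<^sup>+x. indicator \<Omega> x * ennreal (K x) * indicator {x. t < h x} x \<partial>lborel) \<partial>lborel)"
    by (rule nn_integral_layer_cake) (auto intro: lborel.sigma_finite_measure_axioms)
  also have "\<dots> \<le> (\<integral>\<^sup>+t. indicator {0..} t * (\<integral>\<^sup>+x. indicator (?T t) x * ennreal (norm x) \<partial>lborel) \<partial>lborel)"
  proof (rule nn_integral_mono, rule mult_left_mono)
    fix t
    let ?S = "{x \<in> \<Omega>. t < h x}"
    have "(\<integral>\<^sup>+x. indicator \<Omega> x * ennreal (K x) * indicator {x. t < h x} x \<partial>lborel) = (\<integral>\<^sup>+x. indicator ?S x * ennreal (K x) \<partial>lborel)"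
      by (intro nn_integral_cong) (auto split: split_indicator)
    also have "\<dots> \<le> (\<integral>\<^sup>+x. indicator (?T t) x * ennreal (norm x) \<partial>lborel)"
    proof (rule bathtub)
      fix \<rho> :: real assume \<rho>: "0 \<le> \<rho>"
      have "emeasure lborel {x \<in> ?S. \<rho> < K x} \<le> emeasure lborel {x \<in> \<Omega>. \<rho> < K x}" by (intro emeasure_mono) auto
      then show "emeasure lborel {x \<in> ?S. \<rho> < K x} \<le> ennreal (m - ?w * \<rho> ^ ?n)"
        using Kd[OF \<rho>] unfolding m_def by (rule order_trans)
    qed (use emS \<mu>m in auto)
    finally show "(\<integral>\<^sup>+x. indicator \<Omega> x * ennreal (K x) * indicator {x. t < h x} x \<partial>lborel)
       \<le> (\<integral>\<^sup>+x. indicator (?T t) x * ennreal (norm x) \<partial>lborel)" .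
  qed simp
  also have "\<dots> = (\<integral>\<^sup>+t. (\<integral>\<^sup>+x. indicator {0..} t * (indicator (?T t) x * ennreal (norm x)) \<partial>lborel) \<partial>lborel)"
    by (intro nn_integral_cong nn_integral_cmult[symmetric]) simp
  also have "\<dots> = (\<integral>\<^sup>+x. (\<integral>\<^sup>+t. indicator {0..} t * (indicator (?T t) x * ennreal (norm x)) \<partial>lborel) \<partial>lborel)"
    by (rule lborel_pair.Fubini'[symmetric]) (simp add: indicator_def[abs_def])
  also have "\<dots> \<le> (\<integral>\<^sup>+x. indicator ?B x * ennreal (norm x) * ennreal (sharp_rearr \<Omega> h x) \<partial>lebesgue)"
    unfolding nn_integral_completion
  proof (intro nn_integral_mono)
    fix x :: 'a
    show "(\<integral>\<^sup>+t. indicator {0..} t * (indicator (?T t) x * ennreal (norm x)) \<partial>lborel)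
      \<le> indicator ?B x * ennreal (norm x) * ennreal (sharp_rearr \<Omega> h x)"
    proof (cases "x \<in> ?B")
      case True
      define s where "s = m - ?w * norm x ^ ?n"
      have "?w * norm x ^ ?n < ?w * ball_radius TYPE('a) m ^ ?n"
        using True by (intro mult_strict_left_mono power_strict_mono) auto
      \<comment> \<open>A point of the open ball gives \<open>0 < s\<close>, so the degenerate value
        of the rearrangement at 0 is never met.\<close>
      then have s: "0 < s" unfolding s_def ball_radius_power[OF m0] by simp
      have sr: "sharp_rearr \<Omega> h x = decr_rearr \<Omega> h s"
        unfolding sharp_rearr_def incr_rearr_def L(4) s_def ..
      \<comment> \<open>Lying in the shell of level \<open>t\<close> means
        \<open>s < \<mu> t\<close>, and then \<open>t\<close> bounds the infimum that defines the
        rearrangement at \<open>s\<close> from below. This one-sided relation bounds the length of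
        the set of levels whose shell contains \<open>x\<close>.\<close>
      have sub: "t \<le> sharp_rearr \<Omega> h x" if "m - \<mu> t < ?w * norm x ^ ?n" for t
        unfolding sr using that s by (intro decr_rearr_ge L distribution_fun_vanishes) (auto simp: s_def \<mu>_def)
      have "(\<integral>\<^sup>+t. indicator {0..} t * (indicator (?T t) x * ennreal (norm x)) \<partial>lborel)
         \<le> (\<integral>\<^sup>+t. ennreal (norm x) * indicator {0..sharp_rearr \<Omega> h x} t \<partial>lborel)"
        using sub by (intro nn_integral_mono) (auto split: split_indicator)
      also have "\<dots> = ennreal (norm x) * emeasure lborel {0..sharp_rearr \<Omega> h x}" by (rule nn_integral_cmult_indicator) simp
      also have "\<dots> = ennreal (norm x) * ennreal (sharp_rearr \<Omega> h x)"
        by (cases "0 \<le> sharp_rearr \<Omega> h x") (auto simp: ennreal_neg)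
      finally show ?thesis using True by simp
    qed simp
  qed
  finally show ?thesis unfolding B .
qed

section \<open>A lower bound for the comparison function\<close>

text \<open>Functions in \<open>BV\<close> and their gradients are only Lebesgue measurable, whereas
  the analysis above is carried out for Borel functions over \<open>lborel\<close>. The
  representative is chosen component by component.\<close>

lemma integrable_lebesgue_borel_version:
  fixes f :: "'a::euclidean_space \<Rightarrow> 'b::euclidean_space"
  assumes f: "integrable lebesgue f"
  obtains f' where "f' \<in> borel_measurable borel" "integrable lborel f'" "AE x in lebesgue. f x = f' x"
proof -
  have "\<forall>b. \<exists>g. g \<in> borel_measurable lborel \<and> (AE x in lborel. f x \<bullet> b = g x)"
  proof
    fix b
    have "(\<lambda>x. f x \<bullet> b) \<in> borel_measurable lebesgue" using borel_measurable_integrable[OF f] by measurable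
    then show "\<exists>g. g \<in> borel_measurable lborel \<and> (AE x in lborel. f x \<bullet> b = g x)"
      using completion_ex_borel_measurable_real[of "\<lambda>x. f x \<bullet> b" lborel] by blast
  qed
  then obtain g where g: "\<And>b. g b \<in> borel_measurable lborel" "\<And>b. AE x in lborel. f x \<bullet> b = g b x" by metis
  define f' where "f' x = (\<Sum>b\<in>Basis. g b x *\<^sub>R b)" for x
  have m: "f' \<in> borel_measurable borel" unfolding f'_def[abs_def] using g(1) by measurable
  have "AE x in lborel. \<forall>b\<in>Basis. f x \<bullet> b = g b x" using g(2) by (intro AE_finite_allI) auto
  then have "AE x in lborel. f x = f' x"
  proof eventually_elim
    case (elim x)
    then show ?case unfolding f'_def by (subst euclidean_representation[of "f x", symmetric]) simp
  qed
  then have ae: "AE x in lebesgue. f x = f' x" by (rule AE_completion)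
  have "integrable lebesgue f'"
    using f ae m by (subst integrable_cong_AE[of _ _ f]) (auto intro: measurable_completion)
  then have "integrable lborel f'" using m by (subst (asm) integrable_completion) auto
  then show thesis using m ae by (intro that)
qed

lemma staircase_upper:
  fixes s \<tau> :: real
  assumes "0 < \<tau>" "0 \<le> s"
  shows "(\<Sum>j<N. \<tau> * of_bool (Suc j * \<tau> < s)) \<le> s"
proof (cases "N * \<tau> < s")
  case True
  have "(\<Sum>j<N. \<tau> * of_bool (Suc j * \<tau> < s)) \<le> (\<Sum>j<N. \<tau>)" using assms(1) by (intro sum_mono) auto
  also have "\<dots> = N * \<tau>" by simp
  finally show ?thesis using True by simp
next
  case False
  then show ?thesis
  proof (induction N)
    case 0 then show ?case using assms by simp
  next
    case (Suc N)
    show ?case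
    proof (cases "N * \<tau> < s")
      case True
      have "(\<Sum>j<N. \<tau> * of_bool (Suc j * \<tau> < s)) \<le> (\<Sum>j<N. \<tau>)" using assms(1) by (intro sum_mono) auto
      also have "\<dots> = N * \<tau>" by simp
      finally show ?thesis using True Suc.prems by simp
    next
      case False
      then show ?thesis using Suc by simp
    qed
  qed
qed

lemma divergence_ball_compact_support:
  fixes \<phi> :: "'a::euclidean_space \<Rightarrow> 'a"
  assumes \<phi>: "\<phi> \<in> test_fields (ball 0 R)" and R: "0 < R"
  shows "(\<integral>x. indicator (ball 0 R) x * divergence \<phi> x \<partial>lborel) = 0"
proof -
  have \<phi>': "\<phi> \<in> test_fields UNIV" using \<phi> test_fields_mono[of "ball 0 R" UNIV] by blast
  have "\<phi> (R *\<^sub>R sgn x) \<bullet> sgn x = 0" for x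
  proof (cases "x = 0")
    case False
    then have "R *\<^sub>R sgn x \<notin> ball 0 R" using R by (simp add: norm_sgn)
    then have "\<phi> (R *\<^sub>R sgn x) = 0" using test_field_support[OF \<phi>] by blast
    then show ?thesis by simp
  qed simp
  then show ?thesis unfolding divergence_theorem_ball[OF \<phi>' R] by simp
qed

text \<open>A radially decreasing function is a superposition of indicators of centred balls, so the
  divergence theorem on balls bounds its weighted variation without using polar coordinates.\<close>

lemma radial_divergence_le:
  fixes g :: "real \<Rightarrow> real" and \<phi> :: "'a::euclidean_space \<Rightarrow> 'a"
  assumes g: "antimono g" "\<And>s. R \<le> s \<Longrightarrow> g s = 0" "\<And>s. 0 \<le> g s"
    and \<phi>: "\<phi> \<in> test_fields UNIV" and n: "\<And>x. norm (\<phi> x) \<le> norm x"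
  shows "(\<integral>x. g (norm x) * divergence \<phi> x \<partial>lborel) \<le> real DIM('a) * (\<integral>x. g (norm (x::'a)) \<partial>lborel)"
proof -
  have gm [measurable]: "g \<in> borel_measurable borel"
  proof -
    have "(\<lambda>t. - g t) \<in> borel_measurable borel"
      using g(1) by (intro borel_measurable_mono monoI) (simp add: antimonoD)
    then show ?thesis by simp
  qed
  note [measurable] = divergence_measurable[OF \<phi>]
  have supp: "norm x < R" if "0 < g (norm x)" for x :: 'a using g(2)[of "norm x"] that by fastforce
  have gb: "g (norm x) \<le> g 0" for x :: 'a using antimonoD[OF g(1), of 0 "norm x"] by simp
  have iV: "integrable lborel (\<lambda>x::'a. g (norm x))"
  proof -
    have "integrable lborel (\<lambda>x::'a. indicator (ball 0 R) x * g (norm x))"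
      using gb g(3) by (intro ball_indicator_integrable[where B = "g 0"]) (auto simp: abs_of_nonneg)
    moreover have "(\<lambda>x::'a. indicator (ball 0 R) x * g (norm x)) = (\<lambda>x. g (norm x))"
      using supp g(2) by (auto simp: fun_eq_iff split: split_indicator)
    ultimately show ?thesis by simp
  qed
  note id = test_field_integrable(2)[OF \<phi>]
  have iE: "integrable lborel (\<lambda>x. indicator E x * divergence \<phi> x)" if "E \<in> sets borel" for E
    using integrable_mult_indicator[OF _ id, of E] that by simp
  have lev: "(\<integral>x. indicator {x::'a. t < g (norm x)} x * divergence \<phi> x \<partial>lborel) \<le> DIM('a) * (\<integral>x. indicator {x::'a. t < g (norm x)} x \<partial>lborel)"
    if t: "0 \<le> t" for t
  proof -
    let ?S = "{s. 0 \<le> s \<and> t < g s}" and ?E = "{x::'a. t < g (norm x)}"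
    have E: "?E \<in> sets borel" by measurable
    show ?thesis
    proof (cases "?S = {}")
      case True
      then have "?E = {}" by auto
      then show ?thesis by (simp only:) simp
    next
      case False
      have bd: "bdd_above ?S" 
      proof (intro bdd_aboveI[where M = R])
        fix s assume "s \<in> ?S"
        then show "s \<le> R" using g(2)[of s] t by (cases "R \<le> s") auto
      qed
      \<comment> \<open>By monotonicity the superlevel set lies between the open and the closed ball
        of radius \<open>\<rho>\<close>, which differ by a null sphere.\<close>
      define \<rho> where "\<rho> = Sup ?S"
      have sub1: "?E \<subseteq> cball 0 \<rho>" unfolding \<rho>_def using bd by (auto intro!: cSup_upper)
      have sub2: "ball 0 \<rho> \<subseteq> ?E"
      proof
        fix x :: 'a assume "x \<in> ball 0 \<rho>"
        then have "norm x < Sup ?S" by (simp add: \<rho>_def)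
        then obtain s where "s \<in> ?S" "norm x < s" using less_cSup_iff[OF False bd] by blast
        then show "x \<in> ?E" using antimonoD[OF g(1), of "norm x" s] by auto
      qed
      have "negligible (sphere (0::'a) \<rho>)" by (rule negligible_sphere)
      then have null: "AE x::'a in lborel. x \<notin> sphere 0 \<rho>"
        by (intro AE_not_in) (auto simp: negligible_iff_null_sets null_sets_completion_iff)
      then have ae: "AE x::'a in lborel. indicator ?E x = (indicator (ball 0 \<rho>) x :: real)"
      proof eventually_elim
        case (elim x)
        then have "x \<in> ?E \<longleftrightarrow> x \<in> ball 0 \<rho>" using sub1 sub2 by (auto simp: subset_iff)
        then show ?case by (simp add: indicator_def)
      qed
      have [measurable]: "ball (0::'a) \<rho> \<in> sets borel" by simp
      have 1: "(\<integral>x. indicator ?E x * divergence \<phi> x \<partial>lborel) = (\<integral>x. indicator (ball 0 \<rho>) x * divergence \<phi> x \<partial>lborel)"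
        using ae E by (intro integral_cong_AE) (auto elim: eventually_mono)
      have 2: "(\<integral>x. indicator ?E x \<partial>lborel) = measure lborel (ball (0::'a) \<rho>)"
      proof -
        have "(\<integral>x. indicator ?E x \<partial>lborel) = (\<integral>x. indicator (ball (0::'a) \<rho>) x \<partial>lborel :: real)"
          using ae E by (intro integral_cong_AE) auto
        then show ?thesis by simp
      qed
      show ?thesis
      proof (cases "0 < \<rho>")
        case True
        \<comment> \<open>On the sphere the field is bounded by \<open>\<rho>\<close>, so the factor
          n / \<rho> leaves n times the volume of the ball.\<close>
        have "(\<integral>x. indicator (ball 0 \<rho>) x * divergence \<phi> x \<partial>lborel) \<le> real DIM('a) / \<rho> * (\<rho> * measure lborel (ball (0::'a) \<rho>))"
          using n True by (intro divergence_ball_le[OF \<phi> True]) (auto intro: order_trans[OF n])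
        then show ?thesis unfolding 1 2 using True by simp
      next
        case False
        then have "ball (0::'a) \<rho> = {}" by simp
        then show ?thesis unfolding 1 2 by (simp only:) simp
      qed
    qed
  qed
  define D where "D = (\<integral>x. \<bar>divergence \<phi> x\<bar> \<partial>lborel)"
  have D0: "0 \<le> D" by (simp add: D_def)
  \<comment> \<open>The superposition is discretised: a staircase of width \<tau> below
    \<open>g\<close> is a finite combination of indicators of superlevel sets, and the pointwise
    error \<tau> costs \<tau> times the L^1 norm of the divergence.\<close>
  have *: "(\<integral>x. g (norm x) * divergence \<phi> x \<partial>lborel) \<le> real DIM('a) * (\<integral>x. g (norm (x::'a)) \<partial>lborel) + \<tau> * D" if \<tau>: "0 < \<tau>" for \<tau>
  proof -
    obtain N :: nat where N: "g 0 / \<tau> \<le> N" using real_arch_simple by blast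
    define T where "T x = (\<Sum>j<N. \<tau> * indicator {x. Suc j * \<tau> < g (norm x)} x)" for x :: 'a
    have T_eq: "T x = (\<Sum>j<N. \<tau> * of_bool (Suc j * \<tau> < g (norm x)))" for x
      unfolding T_def by (intro sum.cong) (auto simp: indicator_def)
    have "g (norm x) \<le> N * \<tau>" for x :: 'a
    proof -
      have "g 0 \<le> N * \<tau>" using N \<tau> by (simp add: pos_divide_le_eq)
      then show ?thesis using gb[of x] by simp
    qed
    then have Tl: "g (norm x) - \<tau> \<le> T x" for x :: 'a unfolding T_eq using \<tau> by (intro staircase_lower)
    have Tu: "T x \<le> g (norm x)" for x :: 'a unfolding T_eq using \<tau> g(3) by (intro staircase_upper)
    have [measurable]: "T \<in> borel_measurable borel" unfolding T_def[abs_def] by measurable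
    \<comment> \<open>All levels of the staircase are at least \<tau>, so each indicator is
      dominated by the integrable function \<open>g (norm x) / \<tau>\<close>.\<close>
    have iE1: "integrable lborel (\<lambda>x::'a. indicator {x. Suc j * \<tau> < g (norm x)} x :: real)" for j
    proof (rule Bochner_Integration.integrable_bound[OF iV[THEN integrable_mult_right, of "1 / \<tau>"]])
      show "AE x in lborel. norm (indicator {x::'a. Suc j * \<tau> < g (norm x)} x :: real) \<le> norm (1 / \<tau> * g (norm x))"
      proof (intro AE_I2)
        fix x :: 'a
        have "1 \<le> g (norm x) / \<tau>" if "Suc j * \<tau> < g (norm x)"
        proof -
          have "1 * \<tau> \<le> Suc j * \<tau>" using \<tau> by (intro mult_right_mono) auto
          from le_less_trans[OF this that] show ?thesis using \<tau> by (simp add: pos_le_divide_eq)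
        qed
        then show "norm (indicator {x::'a. Suc j * \<tau> < g (norm x)} x :: real) \<le> norm (1 / \<tau> * g (norm x))"
          using \<tau> g(3)[of "norm x"] by (auto split: split_indicator)
      qed
    qed measurable
    have mE: "{x::'a. Suc j * \<tau> < g (norm x)} \<in> sets borel" for j by measurable
    have iTd: "integrable lborel (\<lambda>x. T x * divergence \<phi> x)"
      unfolding T_def sum_distrib_right mult.assoc by (intro Bochner_Integration.integrable_sum integrable_mult_right iE mE)
    have igd: "integrable lborel (\<lambda>x. g (norm x) * divergence \<phi> x)"
    proof (rule Bochner_Integration.integrable_bound[OF id[THEN integrable_mult_right, of "g 0"]])
      show "AE x in lborel. norm (g (norm x) * divergence \<phi> x) \<le> norm (g 0 * divergence \<phi> x)"
        using gb g(3) by (auto simp: abs_mult intro!: mult_right_mono)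
    qed measurable
    have iT: "integrable lborel T" unfolding T_def[abs_def] by (intro Bochner_Integration.integrable_sum integrable_mult_right iE1)
    have "(\<integral>x. g (norm x) * divergence \<phi> x \<partial>lborel) \<le> (\<integral>x. T x * divergence \<phi> x + \<tau> * \<bar>divergence \<phi> x\<bar> \<partial>lborel)"
    proof (rule integral_mono[OF igd])
      show "integrable lborel (\<lambda>x. T x * divergence \<phi> x + \<tau> * \<bar>divergence \<phi> x\<bar>)"
        using iTd id by (intro Bochner_Integration.integrable_add integrable_mult_right integrable_abs)
      fix x
      have "\<bar>g (norm x) - T x\<bar> \<le> \<tau>" using Tl[of x] Tu[of x] \<tau> by (simp add: abs_le_iff)
      then have "\<bar>g (norm x) - T x\<bar> * \<bar>divergence \<phi> x\<bar> \<le> \<tau> * \<bar>divergence \<phi> x\<bar>" by (intro mult_right_mono) auto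
      then have "(g (norm x) - T x) * divergence \<phi> x \<le> \<tau> * \<bar>divergence \<phi> x\<bar>"
        unfolding abs_mult[symmetric] by (rule order_trans[OF abs_ge_self])
      then show "g (norm x) * divergence \<phi> x \<le> T x * divergence \<phi> x + \<tau> * \<bar>divergence \<phi> x\<bar>"
        by (simp add: left_diff_distrib)
    qed
    also have "\<dots> = (\<integral>x. T x * divergence \<phi> x \<partial>lborel) + \<tau> * D"
      unfolding D_def using iTd id by simp
    also have "(\<integral>x. T x * divergence \<phi> x \<partial>lborel) = (\<Sum>j<N. \<tau> * (\<integral>x. indicator {x::'a. Suc j * \<tau> < g (norm x)} x * divergence \<phi> x \<partial>lborel))"
      unfolding T_def sum_distrib_right mult.assoc
      by (subst Bochner_Integration.integral_sum) (auto intro!: integrable_mult_right iE mE)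
    also have "\<dots> \<le> (\<Sum>j<N. \<tau> * (DIM('a) * (\<integral>x. indicator {x::'a. Suc j * \<tau> < g (norm x)} x \<partial>lborel)))"
      using \<tau> by (intro sum_mono mult_left_mono lev) auto
    also have "\<dots> = DIM('a) * (\<integral>x. T x \<partial>lborel)"
    proof -
      have "(\<integral>x. T x \<partial>lborel) = (\<Sum>j<N. \<integral>x. \<tau> * indicator {x::'a. Suc j * \<tau> < g (norm x)} x \<partial>lborel)"
        unfolding T_def by (intro Bochner_Integration.integral_sum integrable_mult_right iE1)
      then show ?thesis by (simp only: integral_mult_right_zero sum_distrib_left mult.left_commute)
    qed
    also have "\<dots> \<le> DIM('a) * (\<integral>x. g (norm (x::'a)) \<partial>lborel)"
      by (intro mult_left_mono integral_mono iT iV Tu) auto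
    finally show ?thesis by simp
  qed
  show ?thesis
  proof (rule field_le_epsilon)
    fix e :: real assume e: "0 < e"
    have "e / (D + 1) * D \<le> e" using e D0 by (simp add: divide_le_eq mult_left_mono)
    moreover have "0 < e / (D + 1)" using e D0 by simp
    ultimately show "(\<integral>x. g (norm x) * divergence \<phi> x \<partial>lborel) \<le> real DIM('a) * (\<integral>x. g (norm (x::'a)) \<partial>lborel) + e"
      using *[of "e / (D + 1)"] by linarith
  qed
qed

text \<open>If \<open>c\<close> exceeded \<open>f s\<close>, monotonicity would keep
  \<open>v\<close> below \<open>c\<close> by a fixed gap on a fixed fraction of every small ball
  around \<open>y\<close>, and the mean oscillation could not tend to 0.\<close>

lemma trace_le_radial_profile:
  fixes v :: "'a::euclidean_space \<Rightarrow> real"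
  assumes R: "0 < R" and f: "antimono_on {0..<R} f" and vf: "AE x in lebesgue. x \<in> ball 0 R \<longrightarrow> v x = f (norm x)"
    and v: "set_integrable lebesgue (ball 0 R) v"
    and y: "norm y = R" and tr: "has_trace_at (ball 0 R) v y c" and s: "0 \<le> s" "s < R"
  shows "c \<le> f s"
proof (rule ccontr)
  assume "\<not> c \<le> f s"
  then have d: "0 < c - f s" by simp
  let ?n = "DIM('a)"
  have "\<forall>\<^sub>F r in at_right 0. (LINT x:ball 0 R \<inter> ball y r|lebesgue. \<bar>v x - c\<bar>) / measure lebesgue (ball y r) < (c - f s) / 2 ^ ?n"
    using tr d unfolding has_trace_at_def by (intro order_tendstoD(2)) auto
  then obtain b where b: "0 < b" "\<And>r. 0 < r \<Longrightarrow> r < b \<Longrightarrow> (LINT x:ball 0 R \<inter> ball y r|lebesgue. \<bar>v x - c\<bar>) / measure lebesgue (ball y r) < (c - f s) / 2 ^ ?n"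
    unfolding eventually_at_right_field by auto
  \<comment> \<open>The bound \<open>R - s\<close> ensures that all points of the small ball below
    have norm at least \<open>s\<close>.\<close>
  define r where "r = min (b / 2) (R - s)"
  have r: "0 < r" "r < b" "r \<le> R - s" using b s by (auto simp: r_def)
  \<comment> \<open>The centre lies on the radius to \<open>y\<close> at depth \<open>r / 2\<close>:
    the ball of radius \<open>r / 2\<close> around it touches the sphere at \<open>y\<close> from
    inside, and its volume is that of \<open>ball y r\<close> divided by
    \<open>2 ^ ?n\<close>.\<close>
  define z where "z = ((R - r / 2) / R) *\<^sub>R y"
  have nz: "norm z = R - r / 2" using R r s y by (simp add: z_def)
  have yz: "dist y z = r / 2"
  proof -
    have "y - z = (1 - (R - r / 2) / R) *\<^sub>R y" unfolding z_def by (simp only: scaleR_left_diff_distrib scaleR_one)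
    also have "1 - (R - r / 2) / R = (r / 2) / R" using R by (simp add: field_simps)
    finally show ?thesis using R r y by (simp add: dist_norm)
  qed
  have sub: "ball z (r / 2) \<subseteq> ball 0 R \<inter> ball y r"
  proof
    fix x assume x: "x \<in> ball z (r / 2)"
    have "norm x \<le> norm z + dist z x" using norm_triangle_ineq[of z "x - z"] by (simp add: dist_norm norm_minus_commute)
    then have "norm x < R" using x nz by simp
    moreover have "dist y x < r" using x yz dist_triangle[of y x z] by simp
    ultimately show "x \<in> ball 0 R \<inter> ball y r" by simp
  qed
  have iV: "set_integrable lebesgue (ball 0 R \<inter> ball y r) (\<lambda>x. \<bar>v x - c\<bar>)"
  proof -
    have "set_integrable lebesgue (ball 0 R \<inter> ball y r) v" by (rule set_integrable_subset[OF v]) auto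
    moreover have "set_integrable lebesgue (ball 0 R \<inter> ball y r) (\<lambda>x. c)"
      unfolding set_integrable_def using emeasure_bounded_finite[OF bounded_ball[of y r]]
      by (intro integrable_scaleR_left integrable_real_indicator)
         (auto intro: le_less_trans[OF emeasure_mono[of _ "ball y r"]])
    ultimately show ?thesis by (intro set_integrable_abs set_integral_diff)
  qed
  have "(c - f s) * measure lebesgue (ball z (r / 2)) = (LINT x|lebesgue. indicator (ball z (r / 2)) x * (c - f s))"
    by simp
  also have "\<dots> \<le> (LINT x:ball 0 R \<inter> ball y r|lebesgue. \<bar>v x - c\<bar>)"
    unfolding set_lebesgue_integral_def
  proof (rule integral_mono_AE)
    show "integrable lebesgue (\<lambda>x. indicator (ball z (r / 2)) x * (c - f s))"
      using emeasure_bounded_finite[OF bounded_ball[of z "r / 2"]]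
      by (intro integrable_mult_left integrable_real_indicator) auto
    show "integrable lebesgue (\<lambda>x. indicator (ball 0 R \<inter> ball y r) x *\<^sub>R \<bar>v x - c\<bar>)"
      using iV unfolding set_integrable_def .
    show "AE x in lebesgue. indicator (ball z (r / 2)) x * (c - f s) \<le> indicator (ball 0 R \<inter> ball y r) x *\<^sub>R \<bar>v x - c\<bar>"
      using vf
    proof eventually_elim
      case (elim x)
      show ?case
      proof (cases "x \<in> ball z (r / 2)")
        case True
        then have x: "x \<in> ball 0 R" "x \<in> ball y r" using sub by auto
        have "norm z \<le> norm x + dist z x" using norm_triangle_ineq[of x "z - x"] by (simp add: dist_norm)
        then have "s \<le> norm x" using True nz r by simp
        then have "f (norm x) \<le> f s" using f x s unfolding monotone_on_def by auto
        then have "c - f s \<le> \<bar>v x - c\<bar>" using elim x d by simp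
        then show ?thesis using True x by simp
      qed simp
    qed
  qed
  finally have "(c - f s) * measure lebesgue (ball z (r / 2)) \<le> (LINT x:ball 0 R \<inter> ball y r|lebesgue. \<bar>v x - c\<bar>)" .
  moreover have "measure lebesgue (ball z (r / 2)) = measure lebesgue (ball y r) / 2 ^ ?n"
    using r by (simp add: content_ball power_divide measure_completion)
  moreover have mp: "0 < measure lebesgue (ball y r)" using r by (simp add: measure_completion)
  ultimately have "(c - f s) / 2 ^ ?n \<le> (LINT x:ball 0 R \<inter> ball y r|lebesgue. \<bar>v x - c\<bar>) / measure lebesgue (ball y r)"
    by (simp add: pos_le_divide_eq)
  then show False using b(2)[OF r(1,2)] by simp
qed

text \<open>The smooth weight \<open>sqrt (\<bar>x\<bar>\<^sup>2 + \<kappa>\<^sup>2) - \<kappa> \<le> \<bar>x\<bar>\<close> replaces \<open>\<bar>x\<bar>\<close>, which is not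
  differentiable at the origin.\<close>

lemma weighted_gradient_le:
  fixes G :: "'a::euclidean_space \<Rightarrow> 'a"
  assumes G: "integrable lborel G"
    and C: "\<And>\<phi>. \<phi> \<in> test_fields (ball 0 R) \<Longrightarrow> (\<And>x. norm (\<phi> x) \<le> norm x) \<Longrightarrow> (\<integral>x. \<phi> x \<bullet> G x \<partial>lborel) \<le> C"
  shows "(\<integral>x. indicator (ball 0 R) x * (norm x * norm (G x)) \<partial>lborel) \<le> C"
proof -
  have [measurable]: "G \<in> borel_measurable borel" using borel_measurable_integrable[OF G] by simp
  have [measurable]: "ball (0::'a) R \<in> sets borel" by simp
  \<comment> \<open>Duality is available for finite measures, hence the restriction of Lebesgue
    measure to the ball.\<close>
  define M where "M = density lborel (\<lambda>x. ennreal (indicator (ball (0::'a) R) x))"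
  have M: "finite_measure M" "sets M = sets borel"
  proof -
    have "emeasure M (space M) = emeasure lborel (ball (0::'a) R)"
      unfolding M_def by (subst emeasure_density) (auto simp: ennreal_indicator)
    then show "finite_measure M"
      using emeasure_bounded_finite[OF bounded_ball[of "0::'a" R]] by (intro finite_measureI) simp
  qed (simp add: M_def)
  define w where "w k x = sqrt ((norm x)\<^sup>2 + (1 / real (Suc k))\<^sup>2) - 1 / real (Suc k)" for k and x :: 'a
  have w: "0 \<le> w k x" "w k x \<le> norm x" for k x
  proof -
    show "0 \<le> w k x" unfolding w_def by (simp add: real_le_rsqrt)
    have "sqrt ((norm x)\<^sup>2 + (1 / real (Suc k))\<^sup>2) \<le> norm x + 1 / real (Suc k)"
      by (intro sqrt_sum_squares_le_sum) auto
    then show "w k x \<le> norm x" unfolding w_def by simp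
  qed
  have [measurable]: "w k \<in> borel_measurable borel" for k unfolding w_def[abs_def] by measurable
  have bnd: "(\<integral>x. indicator (ball 0 R) x * (w k x * norm (G x)) \<partial>lborel) \<le> C" for k
  proof -
    define q where "q = 1 / real (Suc k)"
    have q: "0 < q" by (simp add: q_def)
    have wG: "integrable M (\<lambda>x. w k x *\<^sub>R G x)"
      unfolding M_def
    proof (subst integrable_density)
      show "integrable lborel (\<lambda>x. indicator (ball 0 R) x *\<^sub>R (w k x *\<^sub>R G x))"
      proof (rule Bochner_Integration.integrable_bound[OF integrable_scaleR_right[OF G, of R]])
        show "AE x in lborel. norm (indicator (ball 0 R) x *\<^sub>R (w k x *\<^sub>R G x)) \<le> norm (R *\<^sub>R G x)"
        proof (intro AE_I2)
          fix x
          show "norm (indicator (ball 0 R) x *\<^sub>R (w k x *\<^sub>R G x)) \<le> norm (R *\<^sub>R G x)"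
            using w[of k x] by (auto split: split_indicator intro!: mult_right_mono)
        qed
      qed measurable
    qed auto
    have "(\<integral>x. indicator (ball 0 R) x * norm (w k x *\<^sub>R G x) \<partial>M) \<le> C"
    proof (rule total_variation_le[OF M open_ball wG])
      fix \<phi> :: "'a \<Rightarrow> 'a" assume \<phi>: "\<phi> \<in> test_fields (ball 0 R)" and n: "\<And>x. norm (\<phi> x) \<le> 1"
      have pos: "0 < x \<bullet> x + q\<^sup>2" for x :: 'a using q by (simp add: add_nonneg_pos)
      \<comment> \<open>The weight is shifted from \<open>G\<close> to the test field: the product
        is again a test field and its length is at most |x|.\<close>
      have w\<phi>: "(\<lambda>x. w k x *\<^sub>R \<phi> x) \<in> test_fields (ball 0 R)"
      proof (rule test_fields_mult[OF \<phi>])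
        fix x :: 'a
        have "((\<lambda>x. sqrt (x \<bullet> x + q\<^sup>2) - q) has_derivative (\<lambda>h. (x \<bullet> h) / sqrt (x \<bullet> x + q\<^sup>2))) (at x)"
          using pos[of x] by (auto intro!: derivative_eq_intros simp: inner_commute divide_simps)
        then show "(w k has_derivative (\<lambda>h. (x \<bullet> h) / sqrt (x \<bullet> x + q\<^sup>2))) (at x)"
          unfolding w_def[abs_def] q_def power2_norm_eq_inner .
      next
        fix u :: 'a
        show "continuous_on UNIV (\<lambda>x. (x \<bullet> u) / sqrt (x \<bullet> x + q\<^sup>2))"
          using pos by (intro continuous_intros) (auto simp: less_imp_neq[THEN not_sym])
      qed
      have [measurable]: "\<phi> \<in> borel_measurable borel" by (rule test_field_measurable[OF \<phi>])
      have z: "\<phi> x = 0" if "x \<notin> ball 0 R" for x using test_field_support[OF \<phi>] that by blast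
      have "(\<integral>x. \<phi> x \<bullet> (w k x *\<^sub>R G x) \<partial>M) = (\<integral>x. indicator (ball 0 R) x *\<^sub>R (\<phi> x \<bullet> (w k x *\<^sub>R G x)) \<partial>lborel)"
        unfolding M_def by (rule integral_density) auto
      also have "\<dots> = (\<integral>x. (w k x *\<^sub>R \<phi> x) \<bullet> G x \<partial>lborel)"
        using z by (intro Bochner_Integration.integral_cong refl) (auto split: split_indicator)
      also have "\<dots> \<le> C"
      proof (rule C[OF w\<phi>])
        fix x
        have "norm (w k x *\<^sub>R \<phi> x) \<le> w k x * 1" using w(1)[of k x] n[of x] by (simp add: mult_left_le)
        then show "norm (w k x *\<^sub>R \<phi> x) \<le> norm x" using w(2)[of k x] by simp
      qed
      finally show "(\<integral>x. \<phi> x \<bullet> (w k x *\<^sub>R G x) \<partial>M) \<le> C" .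
    qed
    moreover have "(\<integral>x. indicator (ball 0 R) x * norm (w k x *\<^sub>R G x) \<partial>M) = (\<integral>x. indicator (ball 0 R) x *\<^sub>R (indicator (ball 0 R) x * norm (w k x *\<^sub>R G x)) \<partial>lborel)"
      unfolding M_def by (rule integral_density) auto
    moreover have "\<dots> = (\<integral>x. indicator (ball 0 R) x * (w k x * norm (G x)) \<partial>lborel)"
      using w(1)[of k] by (intro Bochner_Integration.integral_cong refl) (auto split: split_indicator)
    ultimately show ?thesis by simp
  qed
  have "(\<lambda>k. \<integral>x. indicator (ball 0 R) x * (w k x * norm (G x)) \<partial>lborel) \<longlonglongrightarrow> (\<integral>x. indicator (ball 0 R) x * (norm x * norm (G x)) \<partial>lborel)"
  proof (rule integral_dominated_convergence[where w = "\<lambda>x. \<bar>R\<bar> * norm (G x)"])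
    show "integrable lborel (\<lambda>x. \<bar>R\<bar> * norm (G x))" using G by simp
    show "AE x in lborel. (\<lambda>k. indicator (ball 0 R) x * (w k x * norm (G x))) \<longlonglongrightarrow> indicator (ball 0 R) x * (norm x * norm (G x))"
    proof (intro AE_I2 tendsto_mult tendsto_const)
      fix x :: 'a
      have "(\<lambda>k. sqrt ((norm x)\<^sup>2 + (1 / real (Suc k))\<^sup>2) - 1 / real (Suc k)) \<longlonglongrightarrow> sqrt ((norm x)\<^sup>2 + 0\<^sup>2) - 0"
        by (intro tendsto_intros LIMSEQ_divide_real_of_nat_Suc)
      then show "(\<lambda>k. w k x) \<longlonglongrightarrow> norm x" by (simp add: w_def)
    qed
    show "AE x in lborel. norm (indicator (ball 0 R) x * (w k x * norm (G x))) \<le> \<bar>R\<bar> * norm (G x)" for k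
    proof (intro AE_I2)
      fix x
      show "norm (indicator (ball 0 R) x * (w k x * norm (G x))) \<le> \<bar>R\<bar> * norm (G x)"
        using w[of k x] by (auto split: split_indicator simp: abs_mult intro!: mult_right_mono)
    qed
  qed measurable
  then show ?thesis using bnd by (intro LIMSEQ_le_const2) auto
qed

text \<open>Formally the divergence theorem for the field \<open>v x *\<^sub>R x\<close>, since div
  x = n. The boundary value is split off: \<open>v - c\<close>, extended by 0 across the sphere, is
  still radially decreasing, so that \<open>radial_divergence_le\<close> applies to it, and the
  constant \<open>c\<close> accounts for the term with the volume of the ball.\<close>

theorem comparison_function_L1_ge:
  fixes v :: "'a::euclidean_space \<Rightarrow> real"
  assumes R: "0 < R" and rad: "radially_decreasing_on (ball 0 R) v" and W: "v \<in> W11 (ball 0 R)"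
    and tr: "\<And>y. y \<in> frontier (ball 0 R) \<Longrightarrow> has_trace_at (ball 0 R) v y c"
  shows "real DIM('a) * c * measure lebesgue (ball (0::'a) R) + (LINT x:ball 0 R|lebesgue. norm x * norm (weak_grad (ball 0 R) v x))
     \<le> real DIM('a) * L1_norm_on (ball 0 R) v"
    and "set_integrable lebesgue (ball 0 R) (weak_grad (ball 0 R) v)"
proof -
  let ?B = "ball (0::'a) R"
  have [measurable]: "?B \<in> sets borel" by simp
  define G where "G = weak_grad ?B v"
  have vi: "set_integrable lebesgue ?B v" using W by (simp add: W11_def)
  have "has_weak_gradient_on v G ?B"
  proof -
    have "\<exists>G. has_weak_gradient_on v G ?B" using W unfolding W11_def by blast
    then show ?thesis unfolding G_def weak_grad_def by (rule someI_ex)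
  qed
  then have Gi: "set_integrable lebesgue ?B G"
    and Gd: "\<And>\<phi>. \<phi> \<in> test_fields ?B \<Longrightarrow> (LINT x:?B|lebesgue. v x * divergence \<phi> x) = - (LINT x:?B|lebesgue. \<phi> x \<bullet> G x)"
    unfolding has_weak_gradient_on_def has_distr_derivative_on_def by auto
  show "set_integrable lebesgue ?B (weak_grad ?B v)" using Gi unfolding G_def .
  obtain b :: 'a where b: "b \<in> Basis" using nonempty_Basis by blast
  have "s \<in> norm ` ?B" if "0 \<le> s" "s < R" for s
    using that b by (intro image_eqI[of _ _ "s *\<^sub>R b"]) auto
  then have im: "norm ` ?B = {0..<R}" by auto
  obtain f where f: "antimono_on {0..<R} f" and vf: "AE x in lebesgue. x \<in> ?B \<longrightarrow> v x = f (norm x)"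
    using rad unfolding radially_decreasing_on_def im by blast
  have "R *\<^sub>R b \<in> frontier ?B" using R b by (simp add: frontier_ball)
  then have cf: "c \<le> f s" if "0 \<le> s" "s < R" for s
    using trace_le_radial_profile[OF R f vf vi _ tr that, of "R *\<^sub>R b"] R b by simp
  \<comment> \<open>The profile of \<open>v - c\<close> on the whole line: constant to the left of 0
    and equal to 0 from \<open>R\<close> on. The inequality \<open>c \<le> f s\<close> makes the
    jump at \<open>R\<close> a downward one, so \<open>g\<close> is antitone.\<close>
  define g where "g s = (if s < 0 then f 0 else if s < R then f s else c) - c" for s
  have f_mono: "f t \<le> f s" if "0 \<le> s" "s \<le> t" "t < R" for s t using f that unfolding monotone_on_def by auto
  have g: "antimono g" "\<And>s. R \<le> s \<Longrightarrow> g s = 0" "\<And>s. 0 \<le> g s"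
  proof -
    show "antimono g"
    proof (rule antimonoI)
      fix s t :: real assume "s \<le> t"
      then show "g t \<le> g s" unfolding g_def using R cf f_mono[of 0 t] f_mono[of s t] by auto
    qed
    show "R \<le> s \<Longrightarrow> g s = 0" for s using R by (simp add: g_def)
    show "0 \<le> g s" for s using R cf[of 0] cf[of s] by (simp add: g_def)
  qed
  have gm [measurable]: "g \<in> borel_measurable borel"
  proof -
    have "(\<lambda>t. - g t) \<in> borel_measurable borel"
      using g(1) by (intro borel_measurable_mono monoI) (simp add: antimonoD)
    then show ?thesis by simp
  qed
  have ind: "AE x in lebesgue. indicator ?B x * v x = g (norm x) + c * indicator ?B x"
    using vf by eventually_elim (auto simp: g_def split: split_indicator)
  have gi: "integrable lborel (\<lambda>x::'a. g (norm x))"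
  proof -
    have "integrable lborel (\<lambda>x::'a. indicator ?B x * g (norm x))"
      using antimonoD[OF g(1), of 0] g(3) by (intro ball_indicator_integrable[where B = "g 0"]) (auto simp: abs_of_nonneg)
    moreover have "(\<lambda>x::'a. indicator ?B x * g (norm x)) = (\<lambda>x. g (norm x))"
      using g(2) by (auto simp: fun_eq_iff split: split_indicator)
    ultimately show ?thesis by simp
  qed
  have Bi: "integrable lborel (indicator ?B :: 'a \<Rightarrow> real)"
    using emeasure_bounded_finite[OF bounded_ball[of "0::'a" R]] by (intro integrable_real_indicator) auto
  obtain G0 where G0: "G0 \<in> borel_measurable borel" "integrable lborel G0" "AE x in lebesgue. indicator ?B x *\<^sub>R G x = G0 x"
    using integrable_lebesgue_borel_version Gi unfolding set_integrable_def by blast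
  note [measurable] = G0(1)
  \<comment> \<open>The sign comes from the weak formulation: pairing \<open>\<phi>\<close> with
    \<open>- G0\<close> gives the integral of \<open>v\<close> times the divergence of
    \<open>\<phi>\<close>.\<close>
  have "(\<integral>x. indicator ?B x * (norm x * norm (- G0 x)) \<partial>lborel) \<le> real DIM('a) * (\<integral>x. g (norm (x::'a)) \<partial>lborel)"
  proof (rule weighted_gradient_le)
    show "integrable lborel (\<lambda>x. - G0 x)" using G0(2) by simp
    fix \<phi> :: "'a \<Rightarrow> 'a" assume \<phi>: "\<phi> \<in> test_fields ?B" and n: "\<And>x. norm (\<phi> x) \<le> norm x"
    have \<phi>': "\<phi> \<in> test_fields UNIV" using \<phi> test_fields_mono[of ?B UNIV] by blast
    have [measurable]: "\<phi> \<in> borel_measurable borel" by (rule test_field_measurable[OF \<phi>])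
    have dm [measurable]: "divergence \<phi> \<in> borel_measurable borel" by (rule divergence_measurable[OF \<phi>])
    obtain D where D: "0 < D" "\<And>x. \<bar>divergence \<phi> x\<bar> \<le> D" using divergence_bounded[OF \<phi>] by blast
    have i1: "integrable lborel (\<lambda>x. g (norm x) * divergence \<phi> x)"
    proof (rule Bochner_Integration.integrable_bound[OF integrable_mult_right[OF gi, of D]])
      show "AE x in lborel. norm (g (norm x) * divergence \<phi> x) \<le> norm (D * g (norm x))"
        using D g(3) by (auto simp: abs_mult mult.commute[of D] intro!: mult_left_mono order_trans[OF D(2)])
    qed measurable
    have i2: "integrable lborel (\<lambda>x. indicator ?B x * divergence \<phi> x)"
      by (rule ball_indicator_integrable[OF dm D(2)])
    have "(\<integral>x. \<phi> x \<bullet> (- G0 x) \<partial>lborel) = - (\<integral>x. \<phi> x \<bullet> G0 x \<partial>lebesgue)"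
      by (subst integral_completion) auto
    also have "(\<integral>x. \<phi> x \<bullet> G0 x \<partial>lebesgue) = (LINT x:?B|lebesgue. \<phi> x \<bullet> G x)"
      unfolding set_lebesgue_integral_def
    proof (rule integral_cong_AE)
      show "AE x in lebesgue. \<phi> x \<bullet> G0 x = indicator ?B x *\<^sub>R (\<phi> x \<bullet> G x)"
        using G0(3) by eventually_elim (auto split: split_indicator)
      have "(\<lambda>x. indicator ?B x *\<^sub>R G x) \<in> borel_measurable lebesgue"
        using Gi unfolding set_integrable_def by (rule borel_measurable_integrable)
      moreover have "\<phi> \<in> borel_measurable lebesgue" by (intro measurable_completion) measurable
      ultimately have "(\<lambda>x. \<phi> x \<bullet> (indicator ?B x *\<^sub>R G x)) \<in> borel_measurable lebesgue"
        by (intro borel_measurable_inner)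
      then show "(\<lambda>x. indicator ?B x *\<^sub>R (\<phi> x \<bullet> G x)) \<in> borel_measurable lebesgue" by simp
    qed (auto intro!: measurable_completion)
    also have "- \<dots> = (LINT x:?B|lebesgue. v x * divergence \<phi> x)" unfolding Gd[OF \<phi>] by simp
    also have "\<dots> = (\<integral>x. g (norm x) * divergence \<phi> x + c * (indicator ?B x * divergence \<phi> x) \<partial>lebesgue)"
      unfolding set_lebesgue_integral_def
    proof (rule integral_cong_AE)
      show "AE x in lebesgue. indicator ?B x *\<^sub>R (v x * divergence \<phi> x) = g (norm x) * divergence \<phi> x + c * (indicator ?B x * divergence \<phi> x)"
        using ind
      proof eventually_elim
        case (elim x)
        have "indicator ?B x *\<^sub>R (v x * divergence \<phi> x) = (indicator ?B x * v x) * divergence \<phi> x" by simp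
        then show ?case unfolding elim by (simp add: algebra_simps)
      qed
      have "(\<lambda>x. indicator ?B x *\<^sub>R v x) \<in> borel_measurable lebesgue"
        using vi unfolding set_integrable_def by (rule borel_measurable_integrable)
      moreover have "divergence \<phi> \<in> borel_measurable lebesgue" by (intro measurable_completion) measurable
      ultimately have "(\<lambda>x. (indicator ?B x *\<^sub>R v x) * divergence \<phi> x) \<in> borel_measurable lebesgue"
        by (intro borel_measurable_times)
      then show "(\<lambda>x. indicator ?B x *\<^sub>R (v x * divergence \<phi> x)) \<in> borel_measurable lebesgue" by (simp add: mult.assoc)
    qed (auto intro!: measurable_completion)
    also have "\<dots> = (\<integral>x. g (norm x) * divergence \<phi> x + c * (indicator ?B x * divergence \<phi> x) \<partial>lborel)"
      by (subst integral_completion) auto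
    \<comment> \<open>The constant \<open>c\<close> drops out here, because a field with support
      inside the open ball has no flux through the sphere.\<close>
    also have "\<dots> = (\<integral>x. g (norm x) * divergence \<phi> x \<partial>lborel)"
      using i1 i2 divergence_ball_compact_support[OF \<phi> R] by simp
    also have "\<dots> \<le> real DIM('a) * (\<integral>x. g (norm (x::'a)) \<partial>lborel)"
      by (rule radial_divergence_le[OF g \<phi>' n])
    finally show "(\<integral>x. \<phi> x \<bullet> (- G0 x) \<partial>lborel) \<le> real DIM('a) * (\<integral>x. g (norm (x::'a)) \<partial>lborel)" .
  qed
  also have "(\<integral>x. indicator ?B x * (norm x * norm (- G0 x)) \<partial>lborel) = (\<integral>x. indicator ?B x * (norm x * norm (G0 x)) \<partial>lebesgue)"
    by (subst integral_completion) auto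
  also have "\<dots> = (LINT x:?B|lebesgue. norm x * norm (G x))"
    unfolding set_lebesgue_integral_def
  proof (rule integral_cong_AE)
    show "AE x in lebesgue. indicator ?B x * (norm x * norm (G0 x)) = indicator ?B x *\<^sub>R (norm x * norm (G x))"
      using G0(3)
    proof eventually_elim
      case (elim x)
      show ?case unfolding elim[symmetric] by (auto split: split_indicator)
    qed
    have mG: "(\<lambda>x. indicator ?B x *\<^sub>R G x) \<in> borel_measurable lebesgue"
      using Gi unfolding set_integrable_def by (rule borel_measurable_integrable)
    have nx: "(\<lambda>x::'a. norm x) \<in> borel_measurable lebesgue" by (intro measurable_completion) measurable
    have "(\<lambda>x. norm x * norm (indicator ?B x *\<^sub>R G x)) \<in> borel_measurable lebesgue"
      by (rule borel_measurable_times[OF nx measurable_compose[OF mG]]) measurable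
    moreover have "norm x * norm (indicator ?B x *\<^sub>R G x) = indicator ?B x *\<^sub>R (norm x * norm (G x))" for x
      by (auto split: split_indicator)
    ultimately show "(\<lambda>x. indicator ?B x *\<^sub>R (norm x * norm (G x))) \<in> borel_measurable lebesgue" by (simp only:)
  qed (auto intro!: measurable_completion)
  finally have 1: "(LINT x:?B|lebesgue. norm x * norm (G x)) \<le> real DIM('a) * (\<integral>x. g (norm (x::'a)) \<partial>lborel)" .
  have "(\<integral>x. g (norm (x::'a)) \<partial>lborel) + c * measure lebesgue ?B = (\<integral>x. g (norm x) + c * indicator ?B x \<partial>lborel)"
    using gi Bi by (simp add: measure_completion)
  also have "\<dots> = (\<integral>x. g (norm x) + c * indicator ?B x \<partial>lebesgue)"
    by (subst integral_completion) auto
  also have "\<dots> = (LINT x:?B|lebesgue. v x)"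
    unfolding set_lebesgue_integral_def
  proof (rule integral_cong_AE)
    show "AE x in lebesgue. g (norm x) + c * indicator ?B x = indicator ?B x *\<^sub>R v x"
      using ind by eventually_elim simp
    show "(\<lambda>x. g (norm x) + c * indicator ?B x) \<in> borel_measurable lebesgue"
      by (intro measurable_completion) measurable
    show "(\<lambda>x. indicator ?B x *\<^sub>R v x) \<in> borel_measurable lebesgue"
      using vi unfolding set_integrable_def by (rule borel_measurable_integrable)
  qed
  also have "\<dots> \<le> L1_norm_on ?B v"
    unfolding L1_norm_on_def
    by (rule set_integral_mono[OF vi set_integrable_abs[OF vi]]) auto
  finally have 2: "(\<integral>x. g (norm (x::'a)) \<partial>lborel) + c * measure lebesgue ?B \<le> L1_norm_on ?B v" .
  have "real DIM('a) * ((\<integral>x. g (norm (x::'a)) \<partial>lborel) + c * measure lebesgue ?B) \<le> real DIM('a) * L1_norm_on ?B v"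
    using 2 by (intro mult_left_mono) auto
  then show "real DIM('a) * c * measure lebesgue ?B + (LINT x:?B|lebesgue. norm x * norm (weak_grad ?B v x)) \<le> real DIM('a) * L1_norm_on ?B v"
    using 1 unfolding G_def by (simp add: algebra_simps)
qed

section \<open>The Lebesgue decomposition\<close>

lemma integrable_test_field_inner:
  assumes \<phi>: "\<phi> \<in> test_fields U" and M: "finite_measure M" and sets[measurable_cong]: "sets M = sets borel"
    and \<sigma>[measurable]: "\<sigma> \<in> borel_measurable borel" and n: "AE x in M. norm (\<sigma> x) = 1"
  shows "integrable M (\<lambda>x. \<phi> x \<bullet> \<sigma> x)"
proof -
  have [measurable]: "\<phi> \<in> borel_measurable borel" by (rule test_field_measurable[OF \<phi>])
  obtain B where B: "\<And>x. norm (\<phi> x) \<le> B" using test_field_bounded[OF \<phi>] by blast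
  show ?thesis
  proof (rule finite_measure.integrable_const_bound[OF M])
    show "AE x in M. norm (\<phi> x \<bullet> \<sigma> x) \<le> B"
      using n
    proof eventually_elim
      case (elim x)
      have "norm (\<phi> x \<bullet> \<sigma> x) \<le> norm (\<phi> x) * norm (\<sigma> x)" by (simp add: Cauchy_Schwarz_ineq2)
      then show ?case using elim B[of x] by simp
    qed
  qed measurable
qed

text \<open>Exhaustion: the union of null sets whose masses approach the supremum attains it, and a
  null set with mass outside this union would exceed it.\<close>

lemma ex_maximal_null_set:
  fixes M :: "'a::euclidean_space measure"
  assumes M: "finite_measure M" and sets: "sets M = sets borel"
  shows "\<exists>N\<in>null_sets lborel. \<forall>A\<in>null_sets lborel. emeasure M (A - N) = 0"
proof -
  interpret finite_measure M by fact
  let ?Z = "null_sets (lborel :: 'a measure)"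
  have m: "A \<in> sets M" if "A \<in> ?Z" for A using that by (auto simp: sets)
  define c where "c = (SUP A\<in>?Z. measure M A)"
  have bd: "bdd_above (measure M ` ?Z)" by (intro bdd_aboveI2[where M = "measure M (space M)"] bounded_measure)
  have ne: "?Z \<noteq> {}" by auto
  have "\<exists>A\<in>?Z. c - 1 / real (Suc k) < measure M A" for k
    unfolding c_def by (rule less_cSUP_iff[THEN iffD1, OF ne bd]) simp
  then obtain A where A: "\<And>k. A k \<in> ?Z" "\<And>k. c - 1 / real (Suc k) < measure M (A k)" by metis
  define N where "N = (\<Union>k. A k)"
  have N: "N \<in> ?Z" unfolding N_def using A(1) by auto
  have "c \<le> measure M N"
  proof (rule LIMSEQ_le_const2)
    show "(\<lambda>k. c - 1 / real (Suc k)) \<longlonglongrightarrow> c"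
      using tendsto_diff[OF tendsto_const LIMSEQ_divide_real_of_nat_Suc[of 1], of c] by simp
    have "measure M (A k) \<le> measure M N" for k using A(1) m[OF N] by (intro finite_measure_mono) (auto simp: N_def)
    then have "c - 1 / real (Suc k) \<le> measure M N" for k using less_imp_le[OF A(2)] order_trans by blast
    then show "\<exists>K. \<forall>k\<ge>K. c - 1 / real (Suc k) \<le> measure M N" by blast
  qed
  have "emeasure M (B - N) = 0" if B: "B \<in> ?Z" for B
  proof -
    have "measure M (N \<union> B) \<le> c" unfolding c_def using N B by (intro cSUP_upper bd) auto
    moreover have "measure M (N \<union> B) = measure M N + measure M (B - N)"
      using m[OF N] m[OF B] by (subst finite_measure_Union[symmetric]) (auto simp: Un_Diff_cancel)
    ultimately have "measure M (B - N) \<le> 0" using \<open>c \<le> measure M N\<close> by linarith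
    then show ?thesis unfolding emeasure_eq_measure by (simp add: ennreal_neg)
  qed
  then show ?thesis using N by blast
qed

text \<open>Existence gives the choice in \<open>derivative_parts\<close> its meaning. The mass of
  \<open>M\<close> on a maximal Lebesgue null set is the singular part. Off this set
  \<open>M\<close> is absolutely continuous, and its Radon-Nikodym density times the direction
  \<sigma> is the gradient.\<close>

lemma ex_lebesgue_decomposition:
  fixes u :: "'a::euclidean_space \<Rightarrow> real"
  assumes "u \<in> BV"
  shows "\<exists>g S \<sigma>. has_lebesgue_decomposition u g S \<sigma>"
proof -
  obtain M \<sigma> where "has_derivative_measure u M \<sigma>" using assms by (auto simp: BV_def)
  then have sets[measurable_cong]: "sets M = sets borel" and fM: "finite_measure M" and \<sigma>[measurable]: "\<sigma> \<in> borel_measurable borel"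
    and n: "AE x in M. norm (\<sigma> x) = 1" and D: "has_distr_derivative_on u (\<lambda>\<phi>. LINT x|M. \<phi> x \<bullet> \<sigma> x) UNIV"
    unfolding has_derivative_measure_def polar_pair_def by auto
  interpret finite_measure M by fact
  have sp: "space M = UNIV" using sets_eq_imp_space_eq[OF sets] by simp
  obtain N where N: "N \<in> null_sets lborel" "\<And>A. A \<in> null_sets lborel \<Longrightarrow> emeasure M (A - N) = 0"
    using ex_maximal_null_set[OF fM sets] by blast
  have [measurable]: "N \<in> sets borel" using N(1) by auto
  define M1 where "M1 = density M (\<lambda>x. ennreal (indicator (- N) x))"
  define S where "S = density M (\<lambda>x. ennreal (indicator N x))"
  have ed: "emeasure (density M (\<lambda>x. ennreal (indicator E x))) A = emeasure M (E \<inter> A)" if "A \<in> sets borel" "E \<in> sets borel" for A E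
  proof -
    have "emeasure (density M (\<lambda>x. ennreal (indicator E x))) A = (\<integral>\<^sup>+x. ennreal (indicator E x) * indicator A x \<partial>M)"
      using that by (intro emeasure_density) (auto simp: sets)
    also have "\<dots> = (\<integral>\<^sup>+x. indicator (E \<inter> A) x \<partial>M)"
      by (intro nn_integral_cong) (auto split: split_indicator)
    finally have "emeasure (density M (\<lambda>x. ennreal (indicator E x))) A = (\<integral>\<^sup>+x. indicator (E \<inter> A) x \<partial>M)" .
    then show ?thesis using that by (simp add: sets)
  qed
  have fS: "finite_measure S" and sS: "sets S = sets borel"
    by (auto intro!: finite_measureI simp: S_def ed sets sp emeasure_eq_measure)
  have ac: "absolutely_continuous lborel M1"
    unfolding absolutely_continuous_def
  proof
    fix A :: "'a set" assume A: "A \<in> null_sets lborel"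
    then have "emeasure M1 A = emeasure M (- N \<inter> A)" unfolding M1_def by (intro ed) auto
    also have "- N \<inter> A = A - N" by auto
    also have "emeasure M (A - N) = 0" by (rule N(2)[OF A])
    finally show "A \<in> null_sets M1" using A by (intro null_setsI) (auto simp: M1_def sets)
  qed
  have "\<exists>f\<in>borel_measurable lborel. density lborel f = M1"
    by (rule sigma_finite_measure.Radon_Nikodym[OF sigma_finite_lborel ac]) (simp add: M1_def sets)
  then obtain f where f[measurable]: "f \<in> borel_measurable borel" and fd: "density lborel f = M1" by auto
  have fint: "(\<integral>\<^sup>+x. f x \<partial>lborel) < \<infinity>"
  proof -
    have "(\<integral>\<^sup>+x. f x \<partial>lborel) = emeasure (density lborel f) UNIV" by (subst emeasure_density) auto
    also have "\<dots> = emeasure M (- N \<inter> UNIV)" unfolding fd M1_def by (intro ed) auto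
    also have "\<dots> < \<infinity>" by (simp add: emeasure_eq_measure)
    finally show ?thesis .
  qed
  have ffin: "AE x in lborel. f x = ennreal (enn2real (f x))"
    using nn_integral_PInf_AE[of f lborel] fint by (auto elim!: eventually_mono simp: less_top)
  \<comment> \<open>The Radon-Nikodym density has extended values and may be infinite on a null set;
    the real version changes it only there.\<close>
  define f' where "f' x = enn2real (f x)" for x
  have [measurable]: "f' \<in> borel_measurable borel" unfolding f'_def[abs_def] by measurable
  have fd': "density lborel (\<lambda>x. ennreal (f' x)) = M1"
    unfolding fd[symmetric] using ffin by (intro density_cong) (auto simp: f'_def elim: eventually_mono)
  have f'0: "0 \<le> f' x" for x by (simp add: f'_def)
  have if': "integrable lborel f'"
    unfolding integrable_iff_bounded
  proof
    have "(\<integral>\<^sup>+x. ennreal (norm (f' x)) \<partial>lborel) = (\<integral>\<^sup>+x. f x \<partial>lborel)"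
      using ffin by (intro nn_integral_cong_AE) (auto simp: f'_def elim: eventually_mono)
    then show "(\<integral>\<^sup>+x. ennreal (norm (f' x)) \<partial>lborel) < \<infinity>" using fint by simp
  qed measurable
  have n1: "AE x in M1. norm (\<sigma> x) = 1" unfolding M1_def by (subst AE_density) (use n in \<open>auto elim: eventually_mono\<close>)
  have n2: "AE x in S. norm (\<sigma> x) = 1" unfolding S_def by (subst AE_density) (use n in \<open>auto elim: eventually_mono\<close>)
  define g where "g x = f' x *\<^sub>R \<sigma> x" for x
  have [measurable]: "g \<in> borel_measurable borel" unfolding g_def[abs_def] by measurable
  \<comment> \<open>The direction is known to have length 1 only where the density is positive;
    elsewhere \<open>g\<close> vanishes because the density does.\<close>
  have ng: "AE x in lborel. norm (g x) \<le> norm (f' x)"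
  proof -
    have "AE x in lborel. 0 < ennreal (f' x) \<longrightarrow> norm (\<sigma> x) = 1"
      using n1 unfolding fd'[symmetric] by (subst (asm) AE_density) auto
    then show ?thesis
    proof eventually_elim
      case (elim x)
      then show ?case using f'0[of x] by (cases "f' x = 0") (auto simp: g_def ennreal_less_zero_iff)
    qed
  qed
  have ig: "integrable lborel g" by (rule Bochner_Integration.integrable_bound[OF if' _ ng]) simp
  have "has_lebesgue_decomposition u g S \<sigma>"
    unfolding has_lebesgue_decomposition_def
  proof (intro conjI)
    show "integrable lebesgue g" using ig by (subst integrable_completion) auto
    show "polar_pair S \<sigma>" unfolding polar_pair_def using fS sS n2 by simp
    show "\<exists>N\<in>null_sets lborel. emeasure S (- N) = 0"
      using N(1) by (intro bexI[of _ N]) (auto simp: S_def ed)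
    show "has_distr_derivative_on u (\<lambda>\<phi>. (LINT x|lebesgue. \<phi> x \<bullet> g x) + (LINT x|S. \<phi> x \<bullet> \<sigma> x)) UNIV"
      unfolding has_distr_derivative_on_def
    proof
      fix \<phi> :: "'a \<Rightarrow> 'a" assume \<phi>: "\<phi> \<in> test_fields UNIV"
      have [measurable]: "\<phi> \<in> borel_measurable borel" by (rule test_field_measurable[OF \<phi>])
      have i: "integrable M (\<lambda>x. \<phi> x \<bullet> \<sigma> x)" by (rule integrable_test_field_inner[OF \<phi> fM sets \<sigma> n])
      have i1: "integrable M (\<lambda>x. indicator E x *\<^sub>R (\<phi> x \<bullet> \<sigma> x))" if "E \<in> sets borel" for E
        using that by (intro integrable_mult_indicator i) (simp add: sets)
      have "(LINT x|M. \<phi> x \<bullet> \<sigma> x) = (LINT x|M. indicator (- N) x *\<^sub>R (\<phi> x \<bullet> \<sigma> x) + indicator N x *\<^sub>R (\<phi> x \<bullet> \<sigma> x))"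
        by (intro Bochner_Integration.integral_cong refl) (auto split: split_indicator)
      also have "\<dots> = (LINT x|M. indicator (- N) x *\<^sub>R (\<phi> x \<bullet> \<sigma> x)) + (LINT x|M. indicator N x *\<^sub>R (\<phi> x \<bullet> \<sigma> x))"
        by (intro Bochner_Integration.integral_add i1) auto
      also have "(LINT x|M. indicator N x *\<^sub>R (\<phi> x \<bullet> \<sigma> x)) = (LINT x|S. \<phi> x \<bullet> \<sigma> x)"
        unfolding S_def by (intro integral_density[symmetric]) auto
      also have "(LINT x|M. indicator (- N) x *\<^sub>R (\<phi> x \<bullet> \<sigma> x)) = (LINT x|M1. \<phi> x \<bullet> \<sigma> x)"
        unfolding M1_def by (intro integral_density[symmetric]) auto
      also have "\<dots> = (LINT x|lborel. f' x *\<^sub>R (\<phi> x \<bullet> \<sigma> x))"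
        unfolding fd'[symmetric] using f'0 by (intro integral_density) auto
      also have "\<dots> = (LINT x|lebesgue. \<phi> x \<bullet> g x)"
        unfolding g_def by (subst integral_completion) auto
      finally show "(LINT x:UNIV|lebesgue. u x * divergence \<phi> x) = - ((LINT x|lebesgue. \<phi> x \<bullet> g x) + (LINT x|S. \<phi> x \<bullet> \<sigma> x))"
        using D \<phi> unfolding has_distr_derivative_on_def by auto
    qed
  qed
  then show ?thesis by blast
qed

text \<open>The reflected kernel with a constant direction is itself a test field. The gradient of
  the mollified \<open>u\<close> is therefore the mollification of its derivative, and the two parts
  can be estimated separately.\<close>

lemma mollify_grad_decomposition:
  fixes u :: "'a::euclidean_space \<Rightarrow> real"
  assumes d: "0 < \<delta>" and u: "integrable lborel u" and g: "integrable lborel g"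
    and S: "finite_measure S" "sets S = sets borel" "\<sigma> \<in> borel_measurable borel" "AE x in S. norm (\<sigma> x) = 1"
    and D: "\<And>\<phi>. \<phi> \<in> test_fields UNIV \<Longrightarrow> (\<integral>x. u x * divergence \<phi> x \<partial>lborel) = - ((\<integral>x. \<phi> x \<bullet> g x \<partial>lborel) + (\<integral>x. \<phi> x \<bullet> \<sigma> x \<partial>S))"
  shows "mollify_grad \<delta> lborel u x = mollify \<delta> lborel g x + mollify \<delta> S \<sigma> x"
proof (rule euclidean_eqI)
  fix e :: 'a assume e: "e \<in> Basis"
  interpret finite_measure S by fact
  have i\<sigma>: "integrable S \<sigma>"
  proof (rule integrable_const_bound[where B = 1])
    show "AE x in S. norm (\<sigma> x) \<le> 1" using S(4) by eventually_elim simp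
    show "\<sigma> \<in> borel_measurable S" using S(3) by (simp add: measurable_cong_sets[OF S(2) refl])
  qed
  define \<theta> where "\<theta> y = mollifier \<delta> (x - y)" for y
  have \<theta>d: "(\<theta> has_derivative (\<lambda>h. (- mollifier_grad \<delta> (x - y)) \<bullet> h)) (at y)" for y
  proof -
    have "(\<theta> has_derivative (\<lambda>h. mollifier_grad \<delta> (x - y) \<bullet> (0 - h))) (at y)"
      unfolding \<theta>_def
      by (rule has_derivative_compose[OF _ mollifier_has_derivative[OF d]]) (intro derivative_intros)
    then show ?thesis by simp
  qed
  have K: "\<theta> y = 0" if "y \<notin> cball x \<delta>" for y
    using that by (simp add: \<theta>_def dist_norm mollifier_outside[OF d])
  have cont: "continuous_on UNIV (\<lambda>y. - mollifier_grad \<delta> (x - y))"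
    by (intro continuous_intros continuous_on_compose2[OF mollifier_grad_continuous[OF d, of UNIV]]) auto
  have tf1: "(\<lambda>y. \<theta> y *\<^sub>R e) \<in> test_fields UNIV"
    by (rule test_fields_scalar(1)[OF \<theta>d cont compact_cball subset_UNIV K])
  have tf2: "divergence (\<lambda>y. \<theta> y *\<^sub>R e) y = - mollifier_grad \<delta> (x - y) \<bullet> e" for y
    by (rule test_fields_scalar(2)[OF \<theta>d cont compact_cball subset_UNIV K])
  have "(\<integral>y. u y * (- mollifier_grad \<delta> (x - y) \<bullet> e) \<partial>lborel)
      = - ((\<integral>y. (\<theta> y *\<^sub>R e) \<bullet> g y \<partial>lborel) + (\<integral>y. (\<theta> y *\<^sub>R e) \<bullet> \<sigma> y \<partial>S))"
    using D[OF tf1] unfolding tf2 .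
  moreover have "(\<integral>y. u y * (- mollifier_grad \<delta> (x - y) \<bullet> e) \<partial>lborel) = - (mollify_grad \<delta> lborel u x \<bullet> e)"
    unfolding mollify_grad_def
    by (subst integral_inner_left[symmetric]) (auto intro!: integrable_mollify_grad d u)
  moreover have "(\<integral>y. (\<theta> y *\<^sub>R e) \<bullet> g y \<partial>lborel) = mollify \<delta> lborel g x \<bullet> e"
    unfolding mollify_def \<theta>_def
    by (subst integral_inner_left[symmetric]) (auto intro!: integrable_mollify d g simp: inner_commute)
  moreover have "(\<integral>y. (\<theta> y *\<^sub>R e) \<bullet> \<sigma> y \<partial>S) = mollify \<delta> S \<sigma> x \<bullet> e"
    unfolding mollify_def \<theta>_def
    by (subst integral_inner_left[symmetric]) (auto intro!: integrable_mollify d i\<sigma> S simp: inner_commute)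
  ultimately show "mollify_grad \<delta> lborel u x \<bullet> e = (mollify \<delta> lborel g x + mollify \<delta> S \<sigma> x) \<bullet> e"
    by (simp add: inner_add_left)
qed

text \<open>Absolute continuity of the integral along a sequence of sets: \<open>f\<close> is split
  into a part bounded by \<open>N\<close> and a tail of small integral.\<close>

lemma nn_integral_small_sets:
  fixes f :: "'a \<Rightarrow> real"
  assumes f: "integrable M f" and f0: "\<And>x. 0 \<le> f x" and A[measurable]: "\<And>k::nat. A k \<in> sets M" and lim: "(\<lambda>k. emeasure M (A k)) \<longlonglongrightarrow> 0"
  shows "(\<lambda>k. \<integral>\<^sup>+x. indicator (A k) x * ennreal (f x) \<partial>M) \<longlonglongrightarrow> 0"
proof (rule order_tendstoI)
  fix a :: ennreal assume "0 < a"
  then obtain \<epsilon>' where "0 < \<epsilon>'" "\<epsilon>' < a" using dense by blast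
  then obtain \<epsilon> where \<epsilon>: "0 < \<epsilon>" "ennreal \<epsilon> < a" by (cases \<epsilon>') auto
  note [measurable] = borel_measurable_integrable[OF f]
  have "(\<lambda>N. \<integral>\<^sup>+x. ennreal (f x - real N) \<partial>M) \<longlonglongrightarrow> (\<integral>\<^sup>+x. 0 \<partial>M)"
  proof (rule nn_integral_dominated_convergence[where w = "\<lambda>x. ennreal (f x)"])
    show "(\<integral>\<^sup>+x. ennreal (f x) \<partial>M) < \<infinity>" using f f0 by (simp add: integrable_iff_bounded)
    show "AE x in M. (\<lambda>N. ennreal (f x - real N)) \<longlonglongrightarrow> 0"
    proof (intro AE_I2)
      fix x
      obtain N :: nat where N: "f x \<le> N" using real_arch_simple by blast
      have "\<forall>\<^sub>F k in sequentially. ennreal (f x - real k) = 0"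
        using eventually_ge_at_top[of N] by eventually_elim (use N in \<open>auto simp: ennreal_neg\<close>)
      then show "(\<lambda>N. ennreal (f x - real N)) \<longlonglongrightarrow> 0" by (rule tendsto_eventually)
    qed
  qed (auto intro!: ennreal_leI)
  then have "\<forall>\<^sub>F N in sequentially. (\<integral>\<^sup>+x. ennreal (f x - real N) \<partial>M) < ennreal (\<epsilon> / 2)"
    using \<epsilon> by (intro order_tendstoD(2)) auto
  then obtain N where N: "(\<integral>\<^sup>+x. ennreal (f x - real N) \<partial>M) < ennreal (\<epsilon> / 2)" by (auto simp: eventually_sequentially)
  have "\<forall>\<^sub>F k in sequentially. emeasure M (A k) < ennreal (\<epsilon> / (2 * (N + 1)))"
    using \<epsilon> by (intro order_tendstoD(2)[OF lim]) auto
  then show "\<forall>\<^sub>F k in sequentially. (\<integral>\<^sup>+x. indicator (A k) x * ennreal (f x) \<partial>M) < a"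
  proof eventually_elim
    case (elim k)
    have "(\<integral>\<^sup>+x. indicator (A k) x * ennreal (f x) \<partial>M) \<le> (\<integral>\<^sup>+x. ennreal N * indicator (A k) x + ennreal (f x - real N) \<partial>M)"
    proof (intro nn_integral_mono)
      fix x
      have "ennreal (f x) \<le> ennreal (N + max 0 (f x - N))" by (intro ennreal_leI) auto
      also have "\<dots> = ennreal N + ennreal (f x - N)" by (cases "f x \<le> N") (auto simp: ennreal_neg simp flip: ennreal_plus)
      finally show "indicator (A k) x * ennreal (f x) \<le> ennreal N * indicator (A k) x + ennreal (f x - real N)"
        by (auto split: split_indicator)
    qed
    also have "\<dots> = ennreal N * emeasure M (A k) + (\<integral>\<^sup>+x. ennreal (f x - real N) \<partial>M)"
      by (subst nn_integral_add) (auto simp: nn_integral_cmult_indicator)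
    also have "\<dots> \<le> ennreal N * ennreal (\<epsilon> / (2 * (N + 1))) + ennreal (\<epsilon> / 2)"
      using elim N by (intro add_mono mult_left_mono) auto
    also have "\<dots> = ennreal (N * (\<epsilon> / (2 * (N + 1))) + \<epsilon> / 2)"
      using \<epsilon> by (simp flip: ennreal_mult ennreal_plus)
    also have "\<dots> \<le> ennreal \<epsilon>"
    proof (rule ennreal_leI)
      have "N * (\<epsilon> / (2 * (N + 1))) \<le> (N + 1) * (\<epsilon> / (2 * (N + 1)))" using \<epsilon> by (intro mult_right_mono) auto
      also have "\<dots> = \<epsilon> / 2"
      proof -
        have "real N + 1 \<noteq> 0" by (simp add: add_nonneg_eq_0_iff)
        then show ?thesis by (simp add: field_simps)
      qed
      finally show "N * (\<epsilon> / (2 * (N + 1))) + \<epsilon> / 2 \<le> \<epsilon>" by linarith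
    qed
    finally show ?case using \<epsilon>(2) by (rule le_less_trans)
  qed
qed simp

section \<open>The comparison theorem\<close>

lemma power_add_superadditive:
  fixes p q :: real
  assumes "0 \<le> p" "0 \<le> q" "0 < n"
  shows "p ^ n + q ^ n \<le> (p + q) ^ n"
  using assms(3)
proof (induction n rule: nat_induct_non_zero)
  case (Suc n)
  have "p ^ Suc n + q ^ Suc n \<le> (p ^ n + q ^ n) * (p + q)" using assms by (simp add: algebra_simps)
  also have "\<dots> \<le> (p + q) ^ n * (p + q)" using Suc assms by (intro mult_right_mono) auto
  finally show ?case by (simp add: mult.commute)
qed simp

text \<open>The n-th root is subadditive. Lowering a volume by some amount thus lowers the radius by
  at most the radius that belongs to this amount.\<close>

lemma ball_radius_add_le:
  assumes "0 \<le> a" "0 \<le> b"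
  shows "ball_radius TYPE('a::euclidean_space) (a + b) \<le> ball_radius TYPE('a) a + ball_radius TYPE('a) b"
proof -
  let ?w = "unit_ball_vol (real DIM('a))" and ?n = "DIM('a)" and ?r = "ball_radius TYPE('a)"
  have "?w * ?r (a + b) ^ ?n = ?w * (?r a ^ ?n + ?r b ^ ?n)"
    using assms by (simp only: distrib_left ball_radius_power add_nonneg_nonneg)
  then have "?r (a + b) ^ ?n = ?r a ^ ?n + ?r b ^ ?n" by (simp add: less_imp_neq[THEN not_sym])
  also have "\<dots> \<le> (?r a + ?r b) ^ ?n" using assms by (intro power_add_superadditive) auto
  finally show ?thesis using assms by (subst (asm) power_mono_iff) auto
qed

context compact_C11 begin

text \<open>This is the sense in which the radius r(v) is distributed at most like |x|. The points
  of {v \<ge> \<epsilon>} that are not counted on the left have measure at least \<open>a\<close>: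
  with \<open>s\<close> the supremum of \<open>v\<close> over the counted points, they include
  everything above \<open>s\<close>, and the level \<open>s\<close> as well if the supremum is not
  attained.\<close>

lemma upper_level_count:
  assumes \<epsilon>: "0 < \<epsilon>" and a: "0 \<le> a"
  shows "emeasure lborel {x. \<epsilon> \<le> v x \<and> a < m (v x)} \<le> ennreal (measure lborel {x. \<epsilon> \<le> v x} - a)"
proof -
  define E where "E = {x. \<epsilon> \<le> v x}"
  define F where "F = {x. \<epsilon> \<le> v x \<and> a < m (v x)}"
  have [measurable]: "E \<in> sets borel" "F \<in> sets borel" unfolding E_def F_def by measurable
  have EQ: "E \<subseteq> cball 0 Q" using \<epsilon> v_supp by (fastforce simp: E_def not_less[symmetric])
  have fin: "emeasure lborel A < \<infinity>" if "A \<subseteq> E" for A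
    using that EQ by (intro emeasure_bounded_finite bounded_subset[OF bounded_cball[of 0 Q]]) auto
  have fm: "A \<in> fmeasurable lborel" if "A \<subseteq> E" "A \<in> sets borel" for A using fin[OF that(1)] that(2) by (auto simp: fmeasurable_def)
  show ?thesis
  proof (cases "F = {}")
    case True
    then show ?thesis unfolding F_def[symmetric] by simp
  next
    case False
    obtain B where B: "\<And>x. v x \<le> B" using v_bounded by blast
    have bd: "bdd_above (v ` F)" using B by (intro bdd_aboveI2)
    define s where "s = Sup (v ` F)"
    have sF: "v x \<le> s" if "x \<in> F" for x unfolding s_def using that bd by (intro cSup_upper) auto
    have s\<epsilon>: "\<epsilon> \<le> s" using False sF by (force simp: F_def)
    have a_le: "a \<le> measure lborel (E - F)"
    \<comment> \<open>If a counted point has the value \<open>s\<close>, its own condition reads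
      \<open>a < m s\<close>. Otherwise counted points exist above every lower level, and these
      levels are let increase to \<open>s\<close>.\<close>
    proof (cases "\<exists>x\<in>F. v x = s")
      case True
      then have "a < m s" by (auto simp: F_def)
      also have "m s = measure lborel {x. s < v x}" using s\<epsilon> \<epsilon> by (intro m_eq) auto
      also have "\<dots> \<le> measure lborel (E - F)"
      proof (intro measure_mono_fmeasurable fm)
        show "{x. s < v x} \<subseteq> E - F" using s\<epsilon> sF by (force simp: E_def not_less[symmetric])
      qed auto
      finally show ?thesis by simp
    next
      case False
      have lt: "a < m t" if "t < s" for t
      proof -
        have "\<exists>y\<in>v ` F. t < y" using \<open>F \<noteq> {}\<close> that bd unfolding s_def by (subst (asm) less_cSup_iff) auto
        then obtain x where x: "x \<in> F" "t < v x" by blast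
        then show ?thesis using m_antimono[of t "v x"] by (auto simp: F_def)
      qed
      \<comment> \<open>Nonnegative levels increasing to \<open>s\<close>. The sets shrink to {v
        \<ge> s} inside the ball of radius \<open>Q\<close>, whose finite measure gives continuity
        from above.\<close>
      define A where "A k = {x. s - s / real (Suc k) < v x \<and> norm x \<le> Q}" for k
      have "(\<lambda>k. measure lborel (A k)) \<longlonglongrightarrow> measure lborel (\<Inter>k. A k)"
      proof (rule Lim_measure_decseq)
        show "range A \<subseteq> sets lborel" unfolding A_def by auto
        show "decseq A"
        proof (rule decseq_SucI)
          fix k
          have "s / real (Suc (Suc k)) \<le> s / real (Suc k)" using s\<epsilon> \<epsilon> by (intro divide_left_mono) auto
          then show "A (Suc k) \<subseteq> A k" unfolding A_def by auto
        qed
        show "emeasure lborel (A k) \<noteq> \<infinity>" for k unfolding A_def using finite_part by (simp add: less_top)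
      qed
      moreover have "a \<le> measure lborel (A k)" for k
        using lt[of "s - s / real (Suc k)"] s\<epsilon> \<epsilon> unfolding A_def m_def by simp
      ultimately have "a \<le> measure lborel (\<Inter>k. A k)" by (intro LIMSEQ_le_const) auto
      also have "\<dots> \<le> measure lborel (E - F)"
      proof (intro measure_mono_fmeasurable fm)
        show "(\<Inter>k. A k) \<subseteq> E - F"
        proof
          fix x assume x: "x \<in> (\<Inter>k. A k)"
          have "s - 0 \<le> v x"
          proof (rule LIMSEQ_le_const2)
            show "(\<lambda>k. s - s / real (Suc k)) \<longlonglongrightarrow> s - 0" by (intro tendsto_diff tendsto_const LIMSEQ_divide_real_of_nat_Suc)
            have "s - s / real (Suc k) \<le> v x" for k using x by (auto simp: A_def intro: less_imp_le)
            then show "\<exists>N. \<forall>k\<ge>N. s - s / real (Suc k) \<le> v x" by blast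
          qed
          moreover have "x \<notin> F" using calculation False sF[of x] by fastforce
          ultimately show "x \<in> E - F" using s\<epsilon> by (auto simp: E_def)
        qed
        show "(\<Inter>k. A k) \<in> sets lborel" unfolding A_def by measurable
      qed auto
      finally show ?thesis .
    qed
    have "measure lborel E = measure lborel F + measure lborel (E - F)"
    proof -
      have "F \<subseteq> E" by (auto simp: E_def F_def)
      then have "measure lborel (F \<union> (E - F)) = measure lborel F + measure lborel (E - F)"
        using fin[of F] fin[of "E - F"] by (intro measure_Union) (auto simp: less_top)
      then show ?thesis using \<open>F \<subseteq> E\<close> by (simp add: Un_absorb1)
    qed
    then have "measure lborel F \<le> measure lborel E - a" using a_le by linarith
    moreover have "emeasure lborel F = ennreal (measure lborel F)"
      using fin[of F] by (intro emeasure_eq_ennreal_measure) (auto simp: E_def F_def less_top)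
    ultimately show ?thesis unfolding F_def[symmetric] E_def[symmetric] by (simp add: ennreal_leI)
  qed
qed

text \<open>The weight \<open>K\<close> violates the distribution bound of \<open>hardy_littlewood_sharp\<close> only by the mass \<open>\<eta>\<close>
  that the superlevel set has outside \<open>\<Omega>\<close>; lowering it to \<open>K'\<close> restores the bound.\<close>

lemma mollified_inequality:
  fixes G T g :: "'a \<Rightarrow> 'a"
  assumes \<Omega>[measurable]: "\<Omega> \<in> sets borel" and fin: "emeasure lborel \<Omega> < \<infinity>"
    and V: "\<And>x. V x = G x + T x" and [measurable]: "G \<in> borel_measurable borel" "T \<in> borel_measurable borel" "g \<in> borel_measurable borel"
    and \<epsilon>: "0 < \<epsilon>"
    and T: "(\<integral>\<^sup>+x. norm (T x) \<partial>lborel) \<le> ennreal s"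
    and \<beta>: "(\<integral>\<^sup>+x. norm (G x - g x) \<partial>lborel) \<le> ennreal \<beta>"
    and \<eta>: "emeasure lborel ({x. \<epsilon> \<le> v x} - \<Omega>) \<le> ennreal \<eta>"
    and \<gamma>: "(\<integral>\<^sup>+x. indicator ({x. \<epsilon> \<le> v x} - \<Omega>) x * ennreal (norm (g x)) \<partial>lborel) \<le> ennreal \<gamma>"
    and c: "(\<integral>\<^sup>+x. norm (g x) \<partial>lborel) \<le> ennreal c"
    and nn: "0 \<le> s" "0 \<le> \<beta>" "0 \<le> \<eta>" "0 \<le> \<gamma>" "0 \<le> c"
  shows "ennreal DIM('a) * (\<integral>\<^sup>+x. ennreal (v x - 2 * \<epsilon>) \<partial>lborel)
    \<le> (\<integral>\<^sup>+x. indicator (sharp_ball \<Omega>) x * ennreal (norm x) * ennreal (sharp_rearr \<Omega> (\<lambda>x. norm (g x)) x) \<partial>lebesgue)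
      + ennreal (ball_radius TYPE('a) (measure lborel \<Omega> + \<eta>) * (\<gamma> + \<beta> + s) + ball_radius TYPE('a) \<eta> * c)"
proof -
  let ?w = "unit_ball_vol (real DIM('a))" and ?n = "DIM('a)" and ?r = "ball_radius TYPE('a)"
  have wpos: "0 < ?w" by simp
  define m0 where "m0 = measure lborel \<Omega>"
  define E where "E = {x. \<epsilon> \<le> v x}"
  define R where "R = ?r (m0 + \<eta>)"
  have R0: "0 \<le> R" unfolding R_def m0_def using nn by simp
  have [measurable]: "E \<in> sets borel" unfolding E_def by measurable
  have EQ: "E \<subseteq> cball 0 Q" using \<epsilon> v_supp by (fastforce simp: E_def not_less[symmetric])
  have finE: "emeasure lborel E < \<infinity>" by (rule emeasure_bounded_finite[OF bounded_subset[OF bounded_cball EQ]])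
  have mE: "measure lborel E \<le> m0 + \<eta>"
  proof -
    have "emeasure lborel E \<le> emeasure lborel (\<Omega> \<union> (E - \<Omega>))" by (intro emeasure_mono) auto
    also have "\<dots> \<le> emeasure lborel \<Omega> + emeasure lborel (E - \<Omega>)" by (intro emeasure_subadditive) auto
    also have "\<dots> \<le> ennreal m0 + ennreal \<eta>"
      using fin \<eta> unfolding E_def[symmetric] m0_def by (intro add_mono) (auto simp: emeasure_eq_ennreal_measure)
    finally have "ennreal (measure lborel E) \<le> ennreal (m0 + \<eta>)"
      using finE nn by (simp add: emeasure_eq_ennreal_measure m0_def)
    then show ?thesis using nn by (subst (asm) ennreal_le_iff) (auto simp: m0_def)
  qed
  have mv: "m (v x) \<le> m0 + \<eta>" if "x \<in> E" for x
  proof -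
    have "m (v x) = measure lborel {y. v x < v y}" by (intro m_eq v_nonneg)
    also have "\<dots> \<le> measure lborel E"
      using that finE by (intro measure_mono_fmeasurable) (auto simp: E_def fmeasurable_def)
    finally show ?thesis using mE by simp
  qed
  define K where "K x = indicator E x * ?r (m (v x))" for x
  define K' where "K' x = indicator E x * ?r (max 0 (m (v x) - \<eta>))" for x
  have Km [measurable]: "K \<in> borel_measurable borel" "K' \<in> borel_measurable borel"
    unfolding K_def[abs_def] K'_def[abs_def] ball_radius_def by measurable
  have K0: "0 \<le> K x" "0 \<le> K' x" for x by (auto simp: K_def K'_def)
  have KR: "K x \<le> R" for x
    unfolding K_def R_def using mv[of x] R0[unfolded R_def] by (auto intro: ball_radius_mono split: split_indicator)
  have KE: "K x = 0" if "x \<notin> E" for x using that by (simp add: K_def)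
  have KK': "K x \<le> K' x + ?r \<eta>" for x
  proof (cases "x \<in> E")
    case True
    have "?r (m (v x)) \<le> ?r (max 0 (m (v x) - \<eta>) + \<eta>)" by (intro ball_radius_mono) auto
    also have "\<dots> \<le> ?r (max 0 (m (v x) - \<eta>)) + ?r \<eta>" using nn by (intro ball_radius_add_le) auto
    finally show ?thesis using True by (simp add: K_def K'_def)
  qed (use nn in \<open>simp add: K_def K'_def\<close>)
  let ?H = "\<integral>\<^sup>+x. indicator (sharp_ball \<Omega>) x * ennreal (norm x) * ennreal (sharp_rearr \<Omega> (\<lambda>x. norm (g x)) x) \<partial>lebesgue"
  have HL: "(\<integral>\<^sup>+x. indicator \<Omega> x * ennreal (K' x) * ennreal (norm (g x)) \<partial>lborel) \<le> ?H"
  proof (rule hardy_littlewood_sharp[OF \<Omega> fin])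
    fix \<rho> :: real assume \<rho>: "0 \<le> \<rho>"
    have "{x \<in> \<Omega>. \<rho> < K' x} \<subseteq> {x. \<epsilon> \<le> v x \<and> ?w * \<rho> ^ ?n + \<eta> < m (v x)}"
    proof
      fix x assume "x \<in> {x \<in> \<Omega>. \<rho> < K' x}"
      then have x: "\<rho> < K' x" "x \<in> E" using \<rho> by (auto simp: K'_def split: split_indicator_asm)
      then have "?w * \<rho> ^ ?n < ?w * ?r (max 0 (m (v x) - \<eta>)) ^ ?n"
        using \<rho> by (intro mult_strict_left_mono power_strict_mono) (auto simp: K'_def)
      also have "\<dots> = max 0 (m (v x) - \<eta>)" by (intro ball_radius_power) auto
      finally have "?w * \<rho> ^ ?n < max 0 (m (v x) - \<eta>)" .
      moreover have "0 \<le> ?w * \<rho> ^ ?n" using \<rho> by simp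
      ultimately show "x \<in> {x. \<epsilon> \<le> v x \<and> ?w * \<rho> ^ ?n + \<eta> < m (v x)}" using x(2) by (auto simp: E_def)
    qed
    then have "emeasure lborel {x \<in> \<Omega>. \<rho> < K' x} \<le> emeasure lborel {x. \<epsilon> \<le> v x \<and> ?w * \<rho> ^ ?n + \<eta> < m (v x)}"
      by (rule emeasure_mono) measurable
    \<comment> \<open>The excess \<open>\<eta>\<close> cancels: the measure of \<open>E\<close>
      exceeds that of \<Omega> by at most \<open>\<eta>\<close>, and the lowered weight counts only
      points where \<open>m (v x)\<close> passes the threshold by \<open>\<eta>\<close>.\<close>
    also have "\<dots> \<le> ennreal (measure lborel E - (?w * \<rho> ^ ?n + \<eta>))"
      unfolding E_def using \<rho> nn by (intro upper_level_count \<epsilon>) auto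
    also have "\<dots> \<le> ennreal (m0 - ?w * \<rho> ^ ?n)" using mE by (intro ennreal_leI) simp
    finally show "emeasure lborel {x \<in> \<Omega>. \<rho> < K' x} \<le> ennreal (measure lborel \<Omega> - ?w * \<rho> ^ ?n)" unfolding m0_def .
  qed auto
  have "ennreal DIM('a) * (\<integral>\<^sup>+x. ennreal (v x - 2 * \<epsilon>) \<partial>lborel)
     \<le> (\<integral>\<^sup>+x. ennreal (?r (m (v x)) * norm (V x)) * indicator {x. \<epsilon> \<le> v x} x \<partial>lborel)"
    using \<epsilon> by (intro level_set_inequality) auto
  \<comment> \<open>On \<Omega> the weight is \<open>K'\<close> up to the radius belonging to
    \<open>\<eta>\<close>. Outside \<Omega>, and in the terms with \<open>G - g\<close> and with the
    singular part \<open>T\<close>, it is bounded by \<open>R\<close>.\<close>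
  also have "\<dots> \<le> (\<integral>\<^sup>+x. ((indicator \<Omega> x * ennreal (K' x) * ennreal (norm (g x)) + ennreal (?r \<eta>) * ennreal (norm (g x)))
      + ennreal R * (indicator ({x. \<epsilon> \<le> v x} - \<Omega>) x * ennreal (norm (g x))))
      + (ennreal R * ennreal (norm (G x - g x)) + ennreal R * ennreal (norm (T x))) \<partial>lborel)"
  proof (intro nn_integral_mono)
    fix x
    have "norm (V x) \<le> norm (g x) + norm (G x - g x) + norm (T x)"
      using norm_triangle_ineq[of "g x" "G x - g x"] norm_triangle_ineq[of "G x" "T x"] by (simp add: V)
    then have "K x * norm (V x) \<le> K x * (norm (g x) + norm (G x - g x) + norm (T x))"
      using K0 by (intro mult_left_mono)
    also have "\<dots> = K x * norm (g x) + (K x * norm (G x - g x) + K x * norm (T x))" by (simp add: algebra_simps)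
    also have "\<dots> \<le> K x * norm (g x) + (R * norm (G x - g x) + R * norm (T x))"
      using KR by (intro add_mono mult_right_mono order_refl) auto
    also have "K x * norm (g x) \<le> (indicator \<Omega> x * K' x * norm (g x) + ?r \<eta> * norm (g x)) + R * (indicator (E - \<Omega>) x * norm (g x))"
    proof (cases "x \<in> \<Omega>")
      case True
      have "K x * norm (g x) \<le> (K' x + ?r \<eta>) * norm (g x)" by (intro mult_right_mono KK') auto
      then show ?thesis using True by (simp add: algebra_simps)
    next
      case False
      have "0 \<le> ?r \<eta> * norm (g x)" using nn by simp
      moreover have "K x * norm (g x) \<le> R * (indicator (E - \<Omega>) x * norm (g x))"
        using False KR[of x] KE[of x] by (auto intro: mult_right_mono split: split_indicator)
      ultimately show ?thesis using False by simp
    qed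
    finally have le: "K x * norm (V x) \<le> ((indicator \<Omega> x * K' x * norm (g x) + ?r \<eta> * norm (g x)) + R * (indicator (E - \<Omega>) x * norm (g x)))
       + (R * norm (G x - g x) + R * norm (T x))" by simp
    have "ennreal (?r (m (v x)) * norm (V x)) * indicator {x. \<epsilon> \<le> v x} x = ennreal (K x * norm (V x))"
      by (auto simp: K_def E_def split: split_indicator)
    also have "\<dots> \<le> ennreal (((indicator \<Omega> x * K' x * norm (g x) + ?r \<eta> * norm (g x)) + R * (indicator (E - \<Omega>) x * norm (g x)))
       + (R * norm (G x - g x) + R * norm (T x)))" using le by (rule ennreal_leI)
    also have "\<dots> = ((indicator \<Omega> x * ennreal (K' x) * ennreal (norm (g x)) + ennreal (?r \<eta>) * ennreal (norm (g x)))
      + ennreal R * (indicator ({x. \<epsilon> \<le> v x} - \<Omega>) x * ennreal (norm (g x))))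
      + (ennreal R * ennreal (norm (G x - g x)) + ennreal R * ennreal (norm (T x)))"
      unfolding E_def[symmetric] using K0[of x] R0 nn
      by (simp add: ennreal_mult ennreal_indicator)
    finally show "ennreal (?r (m (v x)) * norm (V x)) * indicator {x. \<epsilon> \<le> v x} x \<le> \<dots>" .
  qed
  also have "\<dots> = (((\<integral>\<^sup>+x. indicator \<Omega> x * ennreal (K' x) * ennreal (norm (g x)) \<partial>lborel) + ennreal (?r \<eta>) * (\<integral>\<^sup>+x. norm (g x) \<partial>lborel))
      + ennreal R * (\<integral>\<^sup>+x. indicator ({x. \<epsilon> \<le> v x} - \<Omega>) x * ennreal (norm (g x)) \<partial>lborel))
      + (ennreal R * (\<integral>\<^sup>+x. norm (G x - g x) \<partial>lborel) + ennreal R * (\<integral>\<^sup>+x. norm (T x) \<partial>lborel))"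
    by (simp add: nn_integral_add nn_integral_cmult)
  also have "\<dots> \<le> ((?H + ennreal (?r \<eta>) * ennreal c) + ennreal R * ennreal \<gamma>) + (ennreal R * ennreal \<beta> + ennreal R * ennreal s)"
    using HL T \<beta> \<gamma> c by (intro add_mono mult_left_mono) auto
  also have "\<dots> = ?H + ennreal (R * (\<gamma> + \<beta> + s) + ?r \<eta> * c)"
  proof -
    have "R * (\<gamma> + \<beta> + s) + ?r \<eta> * c = (?r \<eta> * c + R * \<gamma>) + (R * \<beta> + R * s)" by (simp add: distrib_left)
    also have "ennreal \<dots> = (ennreal (?r \<eta>) * ennreal c + ennreal R * ennreal \<gamma>) + (ennreal R * ennreal \<beta> + ennreal R * ennreal s)"
      using nn R0 by (simp add: ennreal_mult)
    finally show ?thesis by (simp only: add.assoc)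
  qed
  finally show ?thesis unfolding R_def m0_def .
qed

end

section \<open>Removal of the mollification\<close>

lemma mollify_compact_C11:
  fixes u :: "'a::euclidean_space \<Rightarrow> real"
  assumes d: "0 < \<delta>" and u: "integrable lborel u" and u0: "\<And>x. 0 \<le> u x" and supp: "\<And>x. norm x > Q \<Longrightarrow> u x = 0"
  shows "\<exists>C L. compact_C11 (mollify \<delta> lborel u) (mollify_grad \<delta> lborel u) C \<delta> L (Q + \<delta>)"
proof -
  have sets: "sets lborel = sets (borel :: 'a measure)" by simp
  obtain C where C: "0 \<le> C" "\<And>x h. norm h \<le> \<delta> \<Longrightarrow>
     \<bar>mollify \<delta> lborel u (x + h) - mollify \<delta> lborel u x - mollify_grad \<delta> lborel u x \<bullet> h\<bar> \<le> C * (norm h)\<^sup>2"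
    using mollify_quad[OF d sets u] by blast
  obtain L where L: "0 \<le> L" "\<And>x y. \<bar>mollify \<delta> lborel u x - mollify \<delta> lborel u y\<bar> \<le> L * norm (x - y)"
    using mollify_lipschitz[OF d sets u] by blast
  have "compact_C11 (mollify \<delta> lborel u) (mollify_grad \<delta> lborel u) C \<delta> L (Q + \<delta>)"
  proof
    show "0 \<le> mollify \<delta> lborel u x" for x
      unfolding mollify_def by (intro integral_nonneg_AE AE_I2) (simp add: mollifier_nonneg[OF d] u0)
    show "norm x > Q + \<delta> \<Longrightarrow> mollify \<delta> lborel u x = 0" for x by (rule mollify_outside[OF d supp])
    show "continuous_on UNIV (mollify_grad \<delta> lborel u)" by (rule mollify_grad_continuous[OF d sets u])
  qed (use C L d in auto)
  then show ?thesis by blast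
qed

text \<open>The order of the two limits matters: for fixed \<epsilon> the mollification scale tends
  to 0, and only then \<epsilon>. The measure of {v \<ge> \<epsilon>} outside \<Omega> is controlled
  by Markov's inequality, whose factor 1 / \<epsilon> blows up if the limits are
  interchanged.\<close>

theorem L1_norm_le_sharp:
  fixes u :: "'a::euclidean_space \<Rightarrow> real" and g \<sigma> :: "'a \<Rightarrow> 'a"
  assumes \<Omega>: "open \<Omega>" "bounded \<Omega>" and u: "integrable lborel u" "\<And>x. 0 \<le> u x" "\<And>x. x \<notin> \<Omega> \<Longrightarrow> u x = 0"
    and g: "integrable lborel g"
    and S: "finite_measure S" "sets S = sets borel" "\<sigma> \<in> borel_measurable borel" "AE x in S. norm (\<sigma> x) = 1"
    and D: "\<And>\<phi>. \<phi> \<in> test_fields UNIV \<Longrightarrow> (\<integral>x. u x * divergence \<phi> x \<partial>lborel) = - ((\<integral>x. \<phi> x \<bullet> g x \<partial>lborel) + (\<integral>x. \<phi> x \<bullet> \<sigma> x \<partial>S))"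
  shows "ennreal DIM('a) * (\<integral>\<^sup>+x. ennreal (u x) \<partial>lborel)
    \<le> (\<integral>\<^sup>+x. indicator (sharp_ball \<Omega>) x * ennreal (norm x) * ennreal (sharp_rearr \<Omega> (\<lambda>x. norm (g x)) x) \<partial>lebesgue)
      + ennreal (ball_radius TYPE('a) (measure lborel \<Omega>) * measure S UNIV)" (is "_ \<le> ?H + ennreal (?R * ?s)")
proof -
  let ?n = "DIM('a)" and ?r = "ball_radius TYPE('a)"
  interpret S: finite_measure S by fact
  have spS: "space S = UNIV" using sets_eq_imp_space_eq[OF S(2)] by simp
  have \<sigma>S: "\<sigma> \<in> borel_measurable S" using S(3) by (simp add: measurable_cong_sets[OF S(2) refl])
  have i\<sigma>: "integrable S \<sigma>"
  proof (rule S.integrable_const_bound[where B = 1])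
    show "AE x in S. norm (\<sigma> x) \<le> 1" using S(4) by eventually_elim simp
  qed (rule \<sigma>S)
  obtain Q where Q: "\<And>x. x \<in> \<Omega> \<Longrightarrow> norm x \<le> Q" using \<Omega>(2) bounded_iff by blast
  have supp: "u x = 0" if "norm x > Q" for x using u(3)[of x] Q[of x] that by fastforce
  have \<Omega>m [measurable]: "\<Omega> \<in> sets borel" using \<Omega>(1) by simp
  have fin: "emeasure lborel \<Omega> < \<infinity>" by (rule emeasure_bounded_finite[OF \<Omega>(2)])
  have [measurable]: "u \<in> borel_measurable borel" "g \<in> borel_measurable borel"
    using borel_measurable_integrable[OF u(1)] borel_measurable_integrable[OF g] by simp_all
  define d where "d k = 1 / real (Suc k)" for k
  have d: "0 < d k" "d \<longlonglongrightarrow> 0" for k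
    using LIMSEQ_divide_real_of_nat_Suc[of 1] by (simp_all add: d_def[abs_def])
  define v where "v k = mollify (d k) lborel u" for k
  define G where "G k = mollify (d k) lborel g" for k
  define T where "T k = mollify (d k) S \<sigma>" for k
  have [measurable]: "v k \<in> borel_measurable borel" "G k \<in> borel_measurable borel" "T k \<in> borel_measurable borel" for k
    unfolding v_def G_def T_def
    by (intro mollify_measurable d lborel.sigma_finite_measure_axioms S.sigma_finite_measure_axioms S(2) \<sigma>S; simp)+
  define a where "a k = (\<integral>\<^sup>+x. ennreal \<bar>v k x - u x\<bar> \<partial>lborel)" for k
  define b where "b k = (\<integral>\<^sup>+x. ennreal (norm (G k x - g x)) \<partial>lborel)" for k
  have alim: "a \<longlonglongrightarrow> 0" unfolding a_def v_def by (rule mollify_L1_convergence_real[OF u(1) d])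
  have blim: "b \<longlonglongrightarrow> 0" unfolding b_def G_def by (rule mollify_L1_convergence[OF g d])
  define c where "c = (\<integral>x. norm (g x) \<partial>lborel)"
  have c: "(\<integral>\<^sup>+x. ennreal (norm (g x)) \<partial>lborel) = ennreal c" "0 \<le> c"
    unfolding c_def using g by (auto intro!: nn_integral_eq_integral)
  have Tb: "(\<integral>\<^sup>+x. ennreal (norm (T k x)) \<partial>lborel) \<le> ennreal ?s" for k
  proof -
    have "(\<integral>\<^sup>+x. ennreal (norm (T k x)) \<partial>lborel) \<le> (\<integral>\<^sup>+x. ennreal (norm (\<sigma> x)) \<partial>S)"
      unfolding T_def by (rule nn_integral_mollify_le[OF d(1) S(2) S.sigma_finite_measure_axioms i\<sigma>])
    also have "\<dots> = (\<integral>\<^sup>+x. 1 \<partial>S)" using S(4) by (intro nn_integral_cong_AE) (auto elim: eventually_mono)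
    also have "\<dots> = ennreal ?s" by (simp add: spS S.emeasure_eq_measure)
    finally show ?thesis .
  qed
  have key: "ennreal ?n * (\<integral>\<^sup>+x. ennreal (u x - 2 * \<epsilon>) \<partial>lborel) \<le> ?H + ennreal (?R * ?s)" if \<epsilon>: "0 < \<epsilon>" for \<epsilon>
  proof -
    \<comment> \<open>Real copies of the extended errors, needed to form the radii of the perturbed
      volumes; they agree with the originals as soon as those are finite.\<close>
    define \<alpha> where "\<alpha> k = enn2real (a k)" for k
    define \<beta> where "\<beta> k = enn2real (b k)" for k
    define F where "F k = {x. \<epsilon> \<le> v k x} - \<Omega>" for k
    have [measurable]: "F k \<in> sets borel" for k unfolding F_def by measurable
    define e where "e k = (\<integral>\<^sup>+x. indicator (F k) x * ennreal (norm (g x)) \<partial>lborel)" for k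
    define \<gamma> where "\<gamma> k = enn2real (e k)" for k
    have ab0: "0 \<le> \<alpha> k" "0 \<le> \<beta> k" "0 \<le> \<gamma> k" for k by (simp_all add: \<alpha>_def \<beta>_def \<gamma>_def)
    have \<alpha>lim: "\<alpha> \<longlonglongrightarrow> 0" unfolding \<alpha>_def using tendsto_enn2real[of a 0] alim by simp
    have \<beta>lim: "\<beta> \<longlonglongrightarrow> 0" unfolding \<beta>_def using tendsto_enn2real[of b 0] blim by simp
    have \<eta>lim: "(\<lambda>k. \<alpha> k / \<epsilon>) \<longlonglongrightarrow> 0" using tendsto_divide[OF \<alpha>lim tendsto_const, of \<epsilon>] \<epsilon> by simp
    have afin: "\<forall>\<^sub>F k in sequentially. a k = ennreal (\<alpha> k)"
    proof -
      have "\<forall>\<^sub>F k in sequentially. a k < 1" using alim by (rule order_tendstoD(2)) simp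
      then show ?thesis by eventually_elim (auto simp: \<alpha>_def less_top[symmetric] dest: less_trans[OF _ ennreal_one_less_top])
    qed
    have bfin: "\<forall>\<^sub>F k in sequentially. b k = ennreal (\<beta> k)"
    proof -
      have "\<forall>\<^sub>F k in sequentially. b k < 1" using blim by (rule order_tendstoD(2)) simp
      then show ?thesis by eventually_elim (auto simp: \<beta>_def less_top[symmetric] dest: less_trans[OF _ ennreal_one_less_top])
    qed
    \<comment> \<open>On \<open>F k\<close> the function \<open>u\<close> vanishes while
      \<open>v k\<close> is at least \<epsilon>, so the L^1 distance pays for this set.\<close>
    have markov: "emeasure lborel (F k) \<le> ennreal (\<alpha> k / \<epsilon>)" if ak: "a k = ennreal (\<alpha> k)" for k
    proof -
      have "ennreal \<epsilon> * emeasure lborel (F k) = (\<integral>\<^sup>+x. ennreal \<epsilon> * indicator (F k) x \<partial>lborel)"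
        by (rule nn_integral_cmult_indicator[symmetric]) simp
      also have "\<dots> \<le> a k"
        unfolding a_def
      proof (intro nn_integral_mono)
        fix x
        show "ennreal \<epsilon> * indicator (F k) x \<le> ennreal \<bar>v k x - u x\<bar>"
          using u(3)[of x] by (auto simp: F_def split: split_indicator intro!: ennreal_leI)
      qed
      finally have "ennreal (1 / \<epsilon>) * (ennreal \<epsilon> * emeasure lborel (F k)) \<le> ennreal (1 / \<epsilon>) * ennreal (\<alpha> k)"
        unfolding ak by (intro mult_left_mono) auto
      moreover have "ennreal (1 / \<epsilon>) * (ennreal \<epsilon> * emeasure lborel (F k)) = emeasure lborel (F k)"
        unfolding mult.assoc[symmetric] using \<epsilon> by (simp flip: ennreal_mult)
      moreover have "ennreal (1 / \<epsilon>) * ennreal (\<alpha> k) = ennreal (\<alpha> k / \<epsilon>)"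
        using \<epsilon> ab0 by (simp flip: ennreal_mult)
      ultimately show ?thesis by simp
    qed
    have Flim: "(\<lambda>k. emeasure lborel (F k)) \<longlonglongrightarrow> 0"
    proof (rule tendsto_sandwich[where f = "\<lambda>_. 0"])
      show "\<forall>\<^sub>F k in sequentially. emeasure lborel (F k) \<le> ennreal (\<alpha> k / \<epsilon>)"
        using afin by eventually_elim (rule markov)
      show "(\<lambda>k. ennreal (\<alpha> k / \<epsilon>)) \<longlonglongrightarrow> 0" using tendsto_ennrealI[OF \<eta>lim] by simp
    qed auto
    have elim: "e \<longlonglongrightarrow> 0"
      unfolding e_def using g by (intro nn_integral_small_sets Flim) auto
    have \<gamma>lim: "\<gamma> \<longlonglongrightarrow> 0" unfolding \<gamma>_def using tendsto_enn2real[of e 0] elim by simp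
    have efin: "e k = ennreal (\<gamma> k)" for k
    proof -
      have "e k \<le> (\<integral>\<^sup>+x. ennreal (norm (g x)) \<partial>lborel)" unfolding e_def by (intro nn_integral_mono) (auto split: split_indicator)
      then have "e k < top" unfolding c using ennreal_less_top le_less_trans by blast
      then show ?thesis by (simp add: \<gamma>_def)
    qed
    \<comment> \<open>Everything except the Hardy-Littlewood term, including the error of replacing
      \<open>v k\<close> by \<open>u\<close>; in the limit only the radius of the ball times the
      singular mass survives.\<close>
    define X where "X k = ?r (measure lborel \<Omega> + \<alpha> k / \<epsilon>) * (\<gamma> k + \<beta> k + ?s) + ?r (\<alpha> k / \<epsilon>) * c + ?n * \<alpha> k" for k
    have "X \<longlonglongrightarrow> ?r (measure lborel \<Omega> + 0) * (0 + 0 + ?s) + ?r 0 * c + real ?n * 0"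
    proof -
      have "0 < unit_ball_vol (real DIM('a))" by simp
      then have w: "unit_ball_vol (real DIM('a)) \<noteq> 0" by (rule less_imp_neq[THEN not_sym])
      have r1: "(\<lambda>k. ?r (measure lborel \<Omega> + \<alpha> k / \<epsilon>)) \<longlonglongrightarrow> ?r (measure lborel \<Omega> + 0)"
        unfolding ball_radius_def by (intro tendsto_real_root tendsto_divide tendsto_add tendsto_const \<eta>lim w)
      have r2: "(\<lambda>k. ?r (\<alpha> k / \<epsilon>)) \<longlonglongrightarrow> ?r 0"
        unfolding ball_radius_def by (intro tendsto_real_root tendsto_divide[OF \<eta>lim tendsto_const w])
      show ?thesis unfolding X_def
        by (intro tendsto_add[OF tendsto_add[OF tendsto_mult[OF r1] tendsto_mult[OF r2 tendsto_const]] tendsto_mult[OF tendsto_const \<alpha>lim]]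
            tendsto_add[OF tendsto_add[OF \<gamma>lim \<beta>lim] tendsto_const])
    qed
    then have Xlim: "X \<longlonglongrightarrow> ?R * ?s" by (simp add: ball_radius_def)
    have ev: "\<forall>\<^sub>F k in sequentially. ennreal ?n * (\<integral>\<^sup>+x. ennreal (u x - 2 * \<epsilon>) \<partial>lborel) \<le> ?H + ennreal (X k)"
      using afin bfin
    proof eventually_elim
      case (elim k)
      obtain C L where "compact_C11 (v k) (mollify_grad (d k) lborel u) C (d k) L (Q + d k)"
        using mollify_compact_C11[OF d(1) u(1,2) supp] unfolding v_def by blast
      then interpret compact_C11 "v k" "mollify_grad (d k) lborel u" C "d k" L "Q + d k" .
      have nn: "0 \<le> ?s" "0 \<le> \<beta> k" "0 \<le> \<alpha> k / \<epsilon>" "0 \<le> \<gamma> k" "0 \<le> c" using ab0 \<epsilon> c(2) by auto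
      have main: "ennreal ?n * (\<integral>\<^sup>+x. ennreal (v k x - 2 * \<epsilon>) \<partial>lborel)
         \<le> ?H + ennreal (?r (measure lborel \<Omega> + \<alpha> k / \<epsilon>) * (\<gamma> k + \<beta> k + ?s) + ?r (\<alpha> k / \<epsilon>) * c)"
      proof (rule mollified_inequality[where G = "G k" and T = "T k"])
        show "mollify_grad (d k) lborel u x = G k x + T k x" for x
          unfolding G_def T_def by (rule mollify_grad_decomposition[OF d(1) u(1) g S D])
        show "(\<integral>\<^sup>+x. ennreal (norm (G k x - g x)) \<partial>lborel) \<le> ennreal (\<beta> k)" using elim(2) by (simp add: b_def)
        show "emeasure lborel ({x. \<epsilon> \<le> v k x} - \<Omega>) \<le> ennreal (\<alpha> k / \<epsilon>)" using markov[OF elim(1)] by (simp add: F_def)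
        show "(\<integral>\<^sup>+x. indicator ({x. \<epsilon> \<le> v k x} - \<Omega>) x * ennreal (norm (g x)) \<partial>lborel) \<le> ennreal (\<gamma> k)"
          using efin[of k] by (simp add: e_def F_def)
      qed (use fin \<epsilon> Tb c nn in auto)
      have "(\<integral>\<^sup>+x. ennreal (u x - 2 * \<epsilon>) \<partial>lborel) \<le> (\<integral>\<^sup>+x. ennreal (v k x - 2 * \<epsilon>) + ennreal \<bar>v k x - u x\<bar> \<partial>lborel)"
      proof (intro nn_integral_mono)
        fix x
        have "ennreal (u x - 2 * \<epsilon>) \<le> ennreal (max 0 (v k x - 2 * \<epsilon>) + \<bar>v k x - u x\<bar>)" by (intro ennreal_leI) linarith
        also have "\<dots> = ennreal (max 0 (v k x - 2 * \<epsilon>)) + ennreal \<bar>v k x - u x\<bar>" by (intro ennreal_plus) auto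
        also have "ennreal (max 0 (v k x - 2 * \<epsilon>)) = ennreal (v k x - 2 * \<epsilon>)" by (simp add: max_def ennreal_neg)
        finally show "ennreal (u x - 2 * \<epsilon>) \<le> ennreal (v k x - 2 * \<epsilon>) + ennreal \<bar>v k x - u x\<bar>" .
      qed
      also have "\<dots> = (\<integral>\<^sup>+x. ennreal (v k x - 2 * \<epsilon>) \<partial>lborel) + ennreal (\<alpha> k)"
        unfolding elim(1)[symmetric] a_def by (rule nn_integral_add) measurable
      finally have "ennreal ?n * (\<integral>\<^sup>+x. ennreal (u x - 2 * \<epsilon>) \<partial>lborel)
          \<le> ennreal ?n * ((\<integral>\<^sup>+x. ennreal (v k x - 2 * \<epsilon>) \<partial>lborel) + ennreal (\<alpha> k))" by (intro mult_left_mono) auto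
      also have "\<dots> = ennreal ?n * (\<integral>\<^sup>+x. ennreal (v k x - 2 * \<epsilon>) \<partial>lborel) + ennreal (?n * \<alpha> k)"
        using ab0 by (simp add: distrib_left ennreal_mult)
      also have "\<dots> \<le> (?H + ennreal (?r (measure lborel \<Omega> + \<alpha> k / \<epsilon>) * (\<gamma> k + \<beta> k + ?s) + ?r (\<alpha> k / \<epsilon>) * c)) + ennreal (?n * \<alpha> k)"
        by (intro add_mono main) simp
      also have "\<dots> = ?H + ennreal (X k)"
      proof -
        have "ennreal (X k) = ennreal (?r (measure lborel \<Omega> + \<alpha> k / \<epsilon>) * (\<gamma> k + \<beta> k + ?s) + ?r (\<alpha> k / \<epsilon>) * c) + ennreal (?n * \<alpha> k)"
          unfolding X_def using nn ab0[of k] by (intro ennreal_plus add_nonneg_nonneg mult_nonneg_nonneg) auto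
        then show ?thesis by (simp only: add.assoc)
      qed
      finally show ?case .
    qed
    have "(\<lambda>k. ?H + ennreal (X k)) \<longlonglongrightarrow> ?H + ennreal (?R * ?s)"
      by (intro tendsto_add tendsto_const tendsto_ennrealI Xlim)
    then show ?thesis by (rule tendsto_lowerbound[OF _ ev]) simp
  qed
  have "(\<lambda>j. \<integral>\<^sup>+x. ennreal (u x - 2 * (1 / real (Suc j))) \<partial>lborel) \<longlonglongrightarrow> (\<integral>\<^sup>+x. ennreal (u x - 2 * 0) \<partial>lborel)"
  proof (rule nn_integral_dominated_convergence[where w = "\<lambda>x. ennreal (u x)"])
    show "(\<integral>\<^sup>+x. ennreal (u x) \<partial>lborel) < \<infinity>" using u(1,2) by (simp add: integrable_iff_bounded)
    show "AE x in lborel. (\<lambda>j. ennreal (u x - 2 * (1 / real (Suc j)))) \<longlonglongrightarrow> ennreal (u x - 2 * 0)"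
      by (intro AE_I2 tendsto_ennrealI tendsto_diff tendsto_mult tendsto_const LIMSEQ_divide_real_of_nat_Suc)
  qed (auto intro!: ennreal_leI)
  then have "(\<lambda>j. ennreal ?n * (\<integral>\<^sup>+x. ennreal (u x - 2 * (1 / real (Suc j))) \<partial>lborel)) \<longlonglongrightarrow> ennreal ?n * (\<integral>\<^sup>+x. ennreal (u x) \<partial>lborel)"
    by (intro ennreal_tendsto_cmult) auto
  moreover have "\<exists>N. \<forall>j\<ge>N. ennreal ?n * (\<integral>\<^sup>+x. ennreal (u x - 2 * (1 / real (Suc j))) \<partial>lborel) \<le> ?H + ennreal (?R * ?s)"
    by (intro exI[of _ 0] allI impI key) simp
  ultimately show ?thesis by (rule LIMSEQ_le_const2)
qed

theorem theorem1p2: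
  fixes \<Omega> :: "'a::euclidean_space set" and u ustar :: "'a \<Rightarrow> real"
  assumes "bounded \<Omega>" and "open \<Omega>" and "finite_perimeter \<Omega>"
    and "u \<in> BV0 \<Omega>" and "AE x in lebesgue. 0 \<le> u x"
    and "is_comparison_function \<Omega> u ustar"
  shows "L1_norm_on \<Omega> u \<le> L1_norm_on (sharp_ball \<Omega>) ustar"
proof (cases "\<Omega> = {}")
  case True
  \<comment> \<open>For empty \<Omega> the symmetrised ball has radius 0, and the statements about
    balls of positive radius do not apply.\<close>
  have "L1_norm_on \<Omega> u = 0" unfolding True L1_norm_on_def set_lebesgue_integral_def by simp
  also have "0 \<le> L1_norm_on (sharp_ball \<Omega>) ustar"
    unfolding L1_norm_on_def set_lebesgue_integral_def by (intro integral_nonneg_AE AE_I2) auto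
  finally show ?thesis .
next
  case False
  let ?n = "DIM('a)"
  define m where "m = measure lborel \<Omega>"
  define R where "R = ball_radius TYPE('a) m"
  have m: "0 < m"
  proof -
    obtain x e where "0 < e" "ball x e \<subseteq> \<Omega>" using False assms(2) open_contains_ball by blast
    then have "0 < measure lborel (ball x e)" by simp
    also have "\<dots> \<le> m" unfolding m_def
      using \<open>ball x e \<subseteq> \<Omega>\<close> assms(2) emeasure_bounded_finite[OF assms(1)]
      by (intro measure_mono_fmeasurable) (auto simp: fmeasurable_def)
    finally show ?thesis .
  qed
  have R: "0 < R" unfolding R_def ball_radius_def using m by simp
  have B: "sharp_ball \<Omega> = ball 0 R"
    unfolding sharp_ball_def R_def m_def ball_radius_def using assms(2) by (simp add: measure_completion)
  have uBV: "u \<in> BV" and uz: "AE x in lebesgue. x \<notin> \<Omega> \<longrightarrow> u x = 0" using assms(4) by (auto simp: BV0_def)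
  define g where "g = abs_cont_grad u"
  define S where "S = sing_variation_measure u"
  \<comment> \<open>Existence resolves the choice: the chosen pair satisfies the decomposition
    together with some direction \<sigma>.\<close>
  have "\<exists>p. case p of (g, S) \<Rightarrow> \<exists>\<sigma>. has_lebesgue_decomposition u g S \<sigma>" using ex_lebesgue_decomposition[OF uBV] by auto
  then have "case derivative_parts u of (g, S) \<Rightarrow> \<exists>\<sigma>. has_lebesgue_decomposition u g S \<sigma>"
    unfolding derivative_parts_def by (rule someI_ex)
  then obtain \<sigma> where "has_lebesgue_decomposition u g S \<sigma>"
    unfolding g_def S_def abs_cont_grad_def sing_variation_measure_def by (auto simp: case_prod_beta)
  then have gi: "integrable lebesgue g" and S: "finite_measure S" "sets S = sets borel" "\<sigma> \<in> borel_measurable borel" "AE x in S. norm (\<sigma> x) = 1"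
    and D: "\<And>\<phi>. \<phi> \<in> test_fields UNIV \<Longrightarrow> (LINT x:UNIV|lebesgue. u x * divergence \<phi> x) = - ((LINT x|lebesgue. \<phi> x \<bullet> g x) + (LINT x|S. \<phi> x \<bullet> \<sigma> x))"
    unfolding has_lebesgue_decomposition_def polar_pair_def has_distr_derivative_on_def by auto
  obtain g0 where g0: "g0 \<in> borel_measurable borel" "integrable lborel g0" "AE x in lebesgue. g x = g0 x"
    using integrable_lebesgue_borel_version[OF gi] .
  have ui: "integrable lebesgue u" using uBV by (simp add: BV_def)
  obtain u' where u': "u' \<in> borel_measurable borel" "integrable lborel u'" "AE x in lebesgue. u x = u' x"
    using integrable_lebesgue_borel_version[OF ui] .
  have \<Omega>m [measurable]: "\<Omega> \<in> sets borel" using assms(2) by simp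
  note [measurable] = u'(1) g0(1)
  \<comment> \<open>A Borel representative that is nonnegative and vanishes outside \<Omega> at
    every point and not just almost everywhere, as the hypotheses of \<open>L1_norm_le_sharp\<close>
    demand.\<close>
  define u0 where "u0 x = indicator \<Omega> x * max 0 (u' x)" for x
  have u0m [measurable]: "u0 \<in> borel_measurable borel" unfolding u0_def[abs_def] by measurable
  have u0ae: "AE x in lebesgue. u x = u0 x"
    using u'(3) uz assms(5) by eventually_elim (auto simp: u0_def split: split_indicator)
  have u0i: "integrable lborel u0"
    by (rule Bochner_Integration.integrable_bound[OF u'(2)]) (auto simp: u0_def split: split_indicator)
  have D0: "(\<integral>x. u0 x * divergence \<phi> x \<partial>lborel) = - ((\<integral>x. \<phi> x \<bullet> g0 x \<partial>lborel) + (\<integral>x. \<phi> x \<bullet> \<sigma> x \<partial>S))"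
    if \<phi>: "\<phi> \<in> test_fields UNIV" for \<phi>
  proof -
    have [measurable]: "\<phi> \<in> borel_measurable borel" by (rule test_field_measurable[OF \<phi>])
    have dm: "divergence \<phi> \<in> borel_measurable lebesgue" using divergence_measurable[OF \<phi>] by (intro measurable_completion) simp
    have \<phi>m: "\<phi> \<in> borel_measurable lebesgue" by (intro measurable_completion) measurable
    have "(\<integral>x. u0 x * divergence \<phi> x \<partial>lborel) = (LINT x:UNIV|lebesgue. u0 x * divergence \<phi> x)"
      by (rule integral_lebesgue_divergence[OF \<phi> u0m, symmetric])
    also have "\<dots> = (LINT x:UNIV|lebesgue. u x * divergence \<phi> x)"
      unfolding set_lebesgue_integral_def
    proof (rule integral_cong_AE)
      show "AE x in lebesgue. indicator UNIV x *\<^sub>R (u0 x * divergence \<phi> x) = indicator UNIV x *\<^sub>R (u x * divergence \<phi> x)"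
        using u0ae by eventually_elim simp
      have "u0 \<in> borel_measurable lebesgue" by (intro measurable_completion) measurable
      from borel_measurable_times[OF this dm] show "(\<lambda>x. indicator UNIV x *\<^sub>R (u0 x * divergence \<phi> x)) \<in> borel_measurable lebesgue" by simp
      from borel_measurable_times[OF borel_measurable_integrable[OF ui] dm]
      show "(\<lambda>x. indicator UNIV x *\<^sub>R (u x * divergence \<phi> x)) \<in> borel_measurable lebesgue" by simp
    qed
    also have "\<dots> = - ((LINT x|lebesgue. \<phi> x \<bullet> g x) + (LINT x|S. \<phi> x \<bullet> \<sigma> x))" by (rule D[OF \<phi>])
    also have "(LINT x|lebesgue. \<phi> x \<bullet> g x) = (LINT x|lebesgue. \<phi> x \<bullet> g0 x)"
    proof (rule integral_cong_AE)
      show "AE x in lebesgue. \<phi> x \<bullet> g x = \<phi> x \<bullet> g0 x" using g0(3) by eventually_elim simp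
      show "(\<lambda>x. \<phi> x \<bullet> g x) \<in> borel_measurable lebesgue" by (rule borel_measurable_inner[OF \<phi>m borel_measurable_integrable[OF gi]])
      show "(\<lambda>x. \<phi> x \<bullet> g0 x) \<in> borel_measurable lebesgue" by (intro measurable_completion) measurable
    qed
    also have "\<dots> = (\<integral>x. \<phi> x \<bullet> g0 x \<partial>lborel)" by (rule integral_completion) measurable
    finally show ?thesis .
  qed
  have main: "ennreal ?n * (\<integral>\<^sup>+x. ennreal (u0 x) \<partial>lborel)
    \<le> (\<integral>\<^sup>+x. indicator (sharp_ball \<Omega>) x * ennreal (norm x) * ennreal (sharp_rearr \<Omega> (\<lambda>x. norm (g0 x)) x) \<partial>lebesgue)
      + ennreal (R * measure S UNIV)"
    unfolding R_def m_def
    by (rule L1_norm_le_sharp[OF assms(2,1) u0i _ _ g0(2) S D0]) (auto simp: u0_def)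
  \<comment> \<open>A rearrangement sees a function only through the measures of its superlevel
    sets, so the Borel version and \<open>abs_cont_grad u\<close> give the same one.\<close>
  have sr: "sharp_rearr \<Omega> (\<lambda>x. norm (g0 x)) = sharp_rearr \<Omega> (\<lambda>z. norm (abs_cont_grad u z))"
  proof -
    have "distribution_fun \<Omega> (\<lambda>x. norm (g0 x)) t = distribution_fun \<Omega> (\<lambda>z. norm (g z)) t" for t
      unfolding distribution_fun_def
    proof (rule measure_eq_AE)
      show "AE x in lebesgue. (x \<in> {x \<in> \<Omega>. t < \<bar>norm (g0 x)\<bar>}) = (x \<in> {x \<in> \<Omega>. t < \<bar>norm (g x)\<bar>})"
        using g0(3) by eventually_elim simp
      have \<Omega>L [measurable]: "\<Omega> \<in> sets lebesgue" by simp
      note [measurable] = borel_measurable_integrable[OF gi]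
      have "{x \<in> space lebesgue. x \<in> \<Omega> \<and> t < \<bar>norm (g x)\<bar>} \<in> sets lebesgue" by measurable
      then show "{x \<in> \<Omega>. t < \<bar>norm (g x)\<bar>} \<in> sets lebesgue" by simp
      have "{x \<in> \<Omega>. t < \<bar>norm (g0 x)\<bar>} \<in> sets borel" by measurable
      then show "{x \<in> \<Omega>. t < \<bar>norm (g0 x)\<bar>} \<in> sets lebesgue" by simp
    qed
    then show ?thesis unfolding sharp_rearr_def incr_rearr_def decr_rearr_def g_def by simp
  qed
  define c where "c = measure S UNIV / Per (ball (0::'a) R)"
  have cmp: "radially_decreasing_on (ball 0 R) ustar" "ustar \<in> W11 (ball 0 R)"
    "AE x in lebesgue. x \<in> ball 0 R \<longrightarrow> norm (weak_grad (ball 0 R) ustar x) = sharp_rearr \<Omega> (\<lambda>x. norm (g0 x)) x"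
    "\<And>y. y \<in> frontier (ball 0 R) \<Longrightarrow> has_trace_at (ball 0 R) ustar y c"
    using assms(6) unfolding is_comparison_function_def B sr c_def S_def by auto
  let ?W = "weak_grad (ball 0 R) ustar" and ?I = "LINT x:ball 0 R|lebesgue. norm x * norm (weak_grad (ball 0 R) ustar x)"
  note ge = comparison_function_L1_ge[OF R cmp(1,2,4)]
  have Wm: "(\<lambda>x. indicator (ball 0 R) x *\<^sub>R ?W x) \<in> borel_measurable lebesgue"
    using ge(2) unfolding set_integrable_def by (rule borel_measurable_integrable)
  \<comment> \<open>Integrability comes first: a Lebesgue integral with the default value 0 could
    not be identified with the nonnegative integral.\<close>
  have Wi: "integrable lebesgue (\<lambda>x. indicator (ball 0 R) x *\<^sub>R (norm x * norm (?W x)))"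
  proof (rule Bochner_Integration.integrable_bound)
    show "integrable lebesgue (\<lambda>x. R *\<^sub>R (indicator (ball 0 R) x *\<^sub>R ?W x))"
      using ge(2) unfolding set_integrable_def by (rule integrable_scaleR_right)
    have nx: "(\<lambda>x::'a. norm x) \<in> borel_measurable lebesgue" by (intro measurable_completion) measurable
    have "(\<lambda>x. norm x * norm (indicator (ball 0 R) x *\<^sub>R ?W x)) \<in> borel_measurable lebesgue"
      by (rule borel_measurable_times[OF nx measurable_compose[OF Wm]]) measurable
    moreover have "norm x * norm (indicator (ball 0 R) x *\<^sub>R ?W x) = indicator (ball 0 R) x *\<^sub>R (norm x * norm (?W x))" for x
      by (auto split: split_indicator)
    ultimately show "(\<lambda>x. indicator (ball 0 R) x *\<^sub>R (norm x * norm (?W x))) \<in> borel_measurable lebesgue" by (simp only:)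
    show "AE x in lebesgue. norm (indicator (ball 0 R) x *\<^sub>R (norm x * norm (?W x))) \<le> norm (R *\<^sub>R (indicator (ball 0 R) x *\<^sub>R ?W x))"
      by (intro AE_I2) (auto split: split_indicator intro!: mult_right_mono)
  qed
  \<comment> \<open>The gradient equation of the comparison problem turns the Hardy-Littlewood bound
    into the weighted gradient integral of \<open>ustar\<close>.\<close>
  have H: "(\<integral>\<^sup>+x. indicator (sharp_ball \<Omega>) x * ennreal (norm x) * ennreal (sharp_rearr \<Omega> (\<lambda>x. norm (g0 x)) x) \<partial>lebesgue) = ennreal ?I"
  proof -
    have "(\<integral>\<^sup>+x. indicator (sharp_ball \<Omega>) x * ennreal (norm x) * ennreal (sharp_rearr \<Omega> (\<lambda>x. norm (g0 x)) x) \<partial>lebesgue)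
       = (\<integral>\<^sup>+x. ennreal (indicator (ball 0 R) x *\<^sub>R (norm x * norm (?W x))) \<partial>lebesgue)"
    proof (rule nn_integral_cong_AE)
      show "AE x in lebesgue. indicator (sharp_ball \<Omega>) x * ennreal (norm x) * ennreal (sharp_rearr \<Omega> (\<lambda>x. norm (g0 x)) x)
          = ennreal (indicator (ball 0 R) x *\<^sub>R (norm x * norm (?W x)))"
        using cmp(3) unfolding B
      proof eventually_elim
        case (elim x)
        show ?case
        proof (cases "x \<in> ball 0 R")
          case True
          then have "sharp_rearr \<Omega> (\<lambda>x. norm (g0 x)) x = norm (?W x)" using elim by simp
          then show ?thesis using True by (simp add: ennreal_mult)
        qed simp
      qed
    qed
    also have "\<dots> = ennreal ?I"
      unfolding set_lebesgue_integral_def by (rule nn_integral_eq_integral[OF Wi]) (auto split: split_indicator)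
    finally show ?thesis .
  qed
  have I0: "0 \<le> ?I" unfolding set_lebesgue_integral_def by (intro integral_nonneg_AE AE_I2) auto
  have L1u: "L1_norm_on \<Omega> u = (\<integral>x. u0 x \<partial>lborel)"
  proof -
    have "L1_norm_on \<Omega> u = (\<integral>x. u0 x \<partial>lebesgue)"
      unfolding L1_norm_on_def set_lebesgue_integral_def
    proof (rule integral_cong_AE)
      show "AE x in lebesgue. indicator \<Omega> x *\<^sub>R \<bar>u x\<bar> = u0 x"
        using u0ae by eventually_elim (auto simp: u0_def split: split_indicator)
      have "indicator \<Omega> \<in> borel_measurable lebesgue" by (intro borel_measurable_indicator) simp
      then show "(\<lambda>x. indicator \<Omega> x *\<^sub>R \<bar>u x\<bar>) \<in> borel_measurable lebesgue"
        by (intro borel_measurable_scaleR borel_measurable_abs borel_measurable_integrable[OF ui])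
      show "u0 \<in> borel_measurable lebesgue" by (intro measurable_completion) measurable
    qed
    also have "\<dots> = (\<integral>x. u0 x \<partial>lborel)" by (rule integral_completion) measurable
    finally show ?thesis .
  qed
  have u0nn: "0 \<le> (\<integral>x. u0 x \<partial>lborel)" by (intro integral_nonneg_AE AE_I2) (simp add: u0_def)
  have "(\<integral>\<^sup>+x. ennreal (u0 x) \<partial>lborel) = ennreal (\<integral>x. u0 x \<partial>lborel)"
    by (rule nn_integral_eq_integral[OF u0i]) (simp add: u0_def)
  then have "ennreal (?n * (\<integral>x. u0 x \<partial>lborel)) \<le> ennreal (?I + R * measure S UNIV)"
    using main u0nn I0 R unfolding H by (simp add: ennreal_mult)
  then have 1: "?n * L1_norm_on \<Omega> u \<le> ?I + R * measure S UNIV"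
    unfolding L1u using I0 R by (subst (asm) ennreal_le_iff) auto
  have Pb: "Per (ball (0::'a) R) \<le> ?n / R * measure lborel (ball (0::'a) R)" "0 < Per (ball (0::'a) R)"
    using perimeter_ball[OF R, where 'a='a] by auto
  \<comment> \<open>The perimeter stands in the denominator of \<open>c\<close>, so the upper bound
    for it bounds the boundary contribution from below.\<close>
  have "R * measure S UNIV \<le> ?n * c * measure lebesgue (ball (0::'a) R)"
  proof -
    have "R * Per (ball (0::'a) R) \<le> ?n * measure lborel (ball (0::'a) R)" using Pb(1) R by (simp add: field_simps)
    then have "R * Per (ball (0::'a) R) * measure S UNIV \<le> ?n * measure lborel (ball (0::'a) R) * measure S UNIV"
      by (intro mult_right_mono) auto
    then show ?thesis using Pb(2) by (simp add: c_def measure_completion pos_le_divide_eq mult_ac)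
  qed
  then have "?n * L1_norm_on \<Omega> u \<le> ?n * L1_norm_on (sharp_ball \<Omega>) ustar"
    using 1 ge(1) unfolding B by linarith
  then show ?thesis by (rule mult_left_le_imp_le) simp
qed

end
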